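(* Let $j:\mathcal J\hookrightarrow\mathcal C$ be a small and eleutheric subcategory of arities in a cocomplete $\mathcal V$-category $\mathcal C$. Then the forgetful functor $\mathrm{End}_{\mathcal J}(\mathcal C)\to\mathrm{Sig}_{\mathcal J}(\mathcal C)$, $H\mapsto (HJ)_{J\in\mathrm{ob}\,\mathcal J}$, is monadic.
   Context: $\mathcal V=(\mathcal V_0,\otimes,I)$ is a symmetric monoidal closed category with $\mathcal V_0$ locally small and having all small limits and colimits. $\mathcal V$-categories may be large; $\mathcal C_0$ is the underlying ordinary category of $\mathcal C$. A weight is a $\mathcal V$-functor $W:\mathcal B^{op}\to\mathcal V$; $W*D$ is the $W$-weighted colimit of $D:\mathcal B\to\mathcal C$. $\mathcal C$ is cocomplete if it has all small weighted colimits; for a class $\Phi$ of weights, $\mathcal C$ is $\Phi$-cocomplete if it has all $W*D$ with $W\in\Phi$. A subcategory of arities in $\mathcal C$ is a $\mathcal V$-category $\mathcal J$ with a fully faithful dense $\mathcal V$-functor $j:\mathcal J\hookrightarrow\mathcal C$; it is small if $\mathcal J$ is small. $\Phi_{\mathcal J}$ is the class of weights $\mathcal C(j-,C):\mathcal J^{op}\to\mathcal V$ ($C\in\mathcal C$). $\mathcal J$ is eleutheric if $\mathcal C$ is $\Phi_{\mathcal J}$-cocomplete and $\mathcal C(J,-):\mathcal C\to\mathcal V$ preserves $\Phi_{\mathcal J}$-colimits for every $J\in\mathcal J$. A $\mathcal V$-endofunctor of $\mathcal C$ is $\mathcal J$-ary if it preserves $\Phi_{\mathcal J}$-colimits. $\mathrm{End}_{\mathcal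 J}(\mathcal C)$ is the ordinary category of $\mathcal J$-ary $\mathcal V$-endofunctors on $\mathcal C$ and $\mathcal V$-natural transformations. A $\mathcal J$-signature in $\mathcal C$ is a family $\Sigma=(\Sigma J)_{J\in\mathrm{ob}\,\mathcal J}$ of objects of $\mathcal C$; $\mathrm{Sig}_{\mathcal J}(\mathcal C)$ is the category of $\mathcal J$-signatures, whose morphisms are families of morphisms of $\mathcal C_0$ indexed by $\mathrm{ob}\,\mathcal J$. *)

theory Defs
  imports "HOL-Library.FuncSet" "HOL-Library.Equipollence"
begin

section \<open>Smallness\<close>

text \<open>
  Smallness is cardinality below that of a fixed set \<open>U\<close> which plays the role of a
  Grothendieck universe: \<open>|U|\<close> is an infinite, regular, strong limit cardinal, i.e.\ sets of
  cardinality below \<open>|U|\<close> are closed under power sets and small unions.  The cardinal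
  \<open>\<omega>\<close> is not excluded, so that the hypothesis is satisfiable in every model of HOL.
\<close>

definition universe :: "'u set \<Rightarrow> bool" where
  "universe U \<longleftrightarrow> infinite U \<and>
     (\<forall>X. X \<subseteq> U \<and> X \<prec> U \<longrightarrow> Pow X \<prec> U) \<and>
     (\<forall>\<X>. \<X> \<prec> U \<and> (\<forall>X\<in>\<X>. X \<subseteq> U \<and> X \<prec> U) \<longrightarrow> \<Union>\<X> \<prec> U)"

definition small :: "'u set \<Rightarrow> 'a set \<Rightarrow> bool" where
  "small U X \<longleftrightarrow> X \<prec> U"


section \<open>Ordinary categories\<close>

record ('o, 'm) cat =
  Ob :: "'o set"
  Arr :: "'m set"
  Dom :: "'m \<Rightarrow> 'o"
  Cod :: "'m \<Rightarrow> 'o"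
  Idt :: "'o \<Rightarrow> 'm"
  Cmp :: "'m \<Rightarrow> 'm \<Rightarrow> 'm" (infixr "\<cdot>\<index>" 70)

definition Hom :: "('o, 'm, 'x) cat_scheme \<Rightarrow> 'o \<Rightarrow> 'o \<Rightarrow> 'm set" where
  "Hom C a b = {f \<in> Arr C. Dom C f = a \<and> Cod C f = b}"

locale category =
  fixes C :: "('o, 'm, 'x) cat_scheme" (structure)
  assumes dom_ob: "f \<in> Arr C \<Longrightarrow> Dom C f \<in> Ob C"
    and cod_ob: "f \<in> Arr C \<Longrightarrow> Cod C f \<in> Ob C"
    and idt_hom: "a \<in> Ob C \<Longrightarrow> Idt C a \<in> Hom C a a"
    and cmp_hom: "f \<in> Hom C a b \<Longrightarrow> g \<in> Hom C b c \<Longrightarrow> g \<cdot> f \<in> Hom C a c"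
    and idt_left: "f \<in> Hom C a b \<Longrightarrow> Idt C b \<cdot> f = f"
    and idt_right: "f \<in> Hom C a b \<Longrightarrow> f \<cdot> Idt C a = f"
    and cmp_assoc: "f \<in> Hom C a b \<Longrightarrow> g \<in> Hom C b c \<Longrightarrow> h \<in> Hom C c d \<Longrightarrow>
      (h \<cdot> g) \<cdot> f = h \<cdot> (g \<cdot> f)"

definition is_inverse :: "('o, 'm, 'x) cat_scheme \<Rightarrow> 'm \<Rightarrow> 'm \<Rightarrow> bool" where
  "is_inverse C f g \<longleftrightarrow> f \<in> Hom C (Dom C f) (Cod C f) \<and> g \<in> Hom C (Cod C f) (Dom C f) \<and>
     g \<cdot>\<^bsub>C\<^esub> f = Idt C (Dom C f) \<and> f \<cdot>\<^bsub>C\<^esub> g = Idt C (Cod C f)"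

definition is_iso :: "('o, 'm, 'x) cat_scheme \<Rightarrow> 'm \<Rightarrow> bool" where
  "is_iso C f \<longleftrightarrow> (\<exists>g. is_inverse C f g)"

definition inverse_arr :: "('o, 'm, 'x) cat_scheme \<Rightarrow> 'm \<Rightarrow> 'm" where
  "inverse_arr C f = (THE g. is_inverse C f g)"

record ('o, 'm, 'p, 'n) func =
  fo :: "'o \<Rightarrow> 'p"
  fa :: "'m \<Rightarrow> 'n"

definition is_functor ::
  "('o, 'm, 'x) cat_scheme \<Rightarrow> ('p, 'n, 'y) cat_scheme \<Rightarrow> ('o, 'm, 'p, 'n) func \<Rightarrow> bool" where
  "is_functor A B F \<longleftrightarrow> category A \<and> category B \<and>
     (\<forall>a\<in>Ob A. fo F a \<in> Ob B) \<and>
     (\<forall>f\<in>Arr A. fa F f \<in> Hom B (fo F (Dom A f)) (fo F (Cod A f))) \<and>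
     (\<forall>a\<in>Ob A. fa F (Idt A a) = Idt B (fo F a)) \<and>
     (\<forall>f\<in>Arr A. \<forall>g\<in>Arr A. Dom A g = Cod A f \<longrightarrow> fa F (g \<cdot>\<^bsub>A\<^esub> f) = fa F g \<cdot>\<^bsub>B\<^esub> fa F f)"

definition id_func :: "('o, 'm, 'o, 'm) func" where
  "id_func = \<lparr>fo = (\<lambda>a. a), fa = (\<lambda>f. f)\<rparr>"

definition comp_func ::
  "('p, 'n, 'q, 'k) func \<Rightarrow> ('o, 'm, 'p, 'n) func \<Rightarrow> ('o, 'm, 'q, 'k) func" where
  "comp_func G F = \<lparr>fo = fo G \<circ> fo F, fa = fa G \<circ> fa F\<rparr>"

definition is_nat_trans ::
  "('o, 'm, 'x) cat_scheme \<Rightarrow> ('p, 'n, 'y) cat_scheme \<Rightarrow>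
   ('o, 'm, 'p, 'n) func \<Rightarrow> ('o, 'm, 'p, 'n) func \<Rightarrow> ('o \<Rightarrow> 'n) \<Rightarrow> bool" where
  "is_nat_trans A B F G \<tau> \<longleftrightarrow> is_functor A B F \<and> is_functor A B G \<and>
     (\<forall>a\<in>Ob A. \<tau> a \<in> Hom B (fo F a) (fo G a)) \<and>
     (\<forall>f\<in>Arr A. \<tau> (Cod A f) \<cdot>\<^bsub>B\<^esub> fa F f = fa G f \<cdot>\<^bsub>B\<^esub> \<tau> (Dom A f))"

definition is_nat_iso ::
  "('o, 'm, 'x) cat_scheme \<Rightarrow> ('p, 'n, 'y) cat_scheme \<Rightarrow>
   ('o, 'm, 'p, 'n) func \<Rightarrow> ('o, 'm, 'p, 'n) func \<Rightarrow> ('o \<Rightarrow> 'n) \<Rightarrow> bool" where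
  "is_nat_iso A B F G \<tau> \<longleftrightarrow> is_nat_trans A B F G \<tau> \<and> (\<forall>a\<in>Ob A. is_iso B (\<tau> a))"

definition is_equivalence ::
  "('o, 'm, 'x) cat_scheme \<Rightarrow> ('p, 'n, 'y) cat_scheme \<Rightarrow> ('o, 'm, 'p, 'n) func \<Rightarrow> bool" where
  "is_equivalence A B F \<longleftrightarrow> is_functor A B F \<and>
     (\<exists>G \<sigma> \<tau>. is_functor B A G \<and>
        is_nat_iso A A id_func (comp_func G F) \<sigma> \<and> is_nat_iso B B (comp_func F G) id_func \<tau>)"

definition is_cone ::
  "('i, 'k, 'x) cat_scheme \<Rightarrow> ('o, 'm, 'y) cat_scheme \<Rightarrow> ('i, 'k, 'o, 'm) func \<Rightarrow>
   'o \<Rightarrow> ('i \<Rightarrow> 'm) \<Rightarrow> bool" where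
  "is_cone S C D l p \<longleftrightarrow> l \<in> Ob C \<and> (\<forall>i\<in>Ob S. p i \<in> Hom C l (fo D i)) \<and>
     (\<forall>k\<in>Arr S. fa D k \<cdot>\<^bsub>C\<^esub> p (Dom S k) = p (Cod S k))"

definition is_limit ::
  "('i, 'k, 'x) cat_scheme \<Rightarrow> ('o, 'm, 'y) cat_scheme \<Rightarrow> ('i, 'k, 'o, 'm) func \<Rightarrow>
   'o \<Rightarrow> ('i \<Rightarrow> 'm) \<Rightarrow> bool" where
  "is_limit S C D l p \<longleftrightarrow> is_cone S C D l p \<and>
     (\<forall>x q. is_cone S C D x q \<longrightarrow> (\<exists>!u. u \<in> Hom C x l \<and> (\<forall>i\<in>Ob S. p i \<cdot>\<^bsub>C\<^esub> u = q i)))"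

definition is_cocone ::
  "('i, 'k, 'x) cat_scheme \<Rightarrow> ('o, 'm, 'y) cat_scheme \<Rightarrow> ('i, 'k, 'o, 'm) func \<Rightarrow>
   'o \<Rightarrow> ('i \<Rightarrow> 'm) \<Rightarrow> bool" where
  "is_cocone S C D l p \<longleftrightarrow> l \<in> Ob C \<and> (\<forall>i\<in>Ob S. p i \<in> Hom C (fo D i) l) \<and>
     (\<forall>k\<in>Arr S. p (Cod S k) \<cdot>\<^bsub>C\<^esub> fa D k = p (Dom S k))"

definition is_colimit ::
  "('i, 'k, 'x) cat_scheme \<Rightarrow> ('o, 'm, 'y) cat_scheme \<Rightarrow> ('i, 'k, 'o, 'm) func \<Rightarrow>
   'o \<Rightarrow> ('i \<Rightarrow> 'm) \<Rightarrow> bool" where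
  "is_colimit S C D l p \<longleftrightarrow> is_cocone S C D l p \<and>
     (\<forall>x q. is_cocone S C D x q \<longrightarrow> (\<exists>!u. u \<in> Hom C l x \<and> (\<forall>i\<in>Ob S. u \<cdot>\<^bsub>C\<^esub> p i = q i)))"

text \<open>
  Up to isomorphism, the objects and arrows of a small category are elements of \<open>U\<close>, so it
  suffices to let the small shapes range over the type \<open>'u\<close>.
\<close>

definition has_small_limits :: "'u set \<Rightarrow> ('o, 'm, 'x) cat_scheme \<Rightarrow> bool" where
  "has_small_limits U C \<longleftrightarrow>
     (\<forall>(S :: ('u, 'u) cat) D. small U (Ob S) \<and> small U (Arr S) \<and> is_functor S C D \<longrightarrow>
        (\<exists>l p. is_limit S C D l p))"

definition has_small_colimits :: "'u set \<Rightarrow> ('o, 'm, 'x) cat_scheme \<Rightarrow> bool" where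
  "has_small_colimits U C \<longleftrightarrow>
     (\<forall>(S :: ('u, 'u) cat) D. small U (Ob S) \<and> small U (Arr S) \<and> is_functor S C D \<longrightarrow>
        (\<exists>l p. is_colimit S C D l p))"

definition locally_small :: "'u set \<Rightarrow> ('o, 'm, 'x) cat_scheme \<Rightarrow> bool" where
  "locally_small U C \<longleftrightarrow> (\<forall>a\<in>Ob C. \<forall>b\<in>Ob C. small U (Hom C a b))"

text \<open>The category of \<open>S\<close>-indexed families of objects and of arrows of \<open>C\<close>.\<close>

definition family_cat :: "'s set \<Rightarrow> ('o, 'm, 'x) cat_scheme \<Rightarrow> ('s \<Rightarrow> 'o, 's \<Rightarrow> 'm) cat" where
  "family_cat S C = \<lparr>
     Ob = (S \<rightarrow>\<^sub>E Ob C),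
     Arr = (S \<rightarrow>\<^sub>E Arr C),
     Dom = (\<lambda>f. \<lambda>s\<in>S. Dom C (f s)),
     Cod = (\<lambda>f. \<lambda>s\<in>S. Cod C (f s)),
     Idt = (\<lambda>a. \<lambda>s\<in>S. Idt C (a s)),
     Cmp = (\<lambda>g f. \<lambda>s\<in>S. g s \<cdot>\<^bsub>C\<^esub> f s)\<rparr>"


section \<open>Monadic functors\<close>

definition is_adjunction ::
  "('o, 'm, 'x) cat_scheme \<Rightarrow> ('p, 'n, 'y) cat_scheme \<Rightarrow> ('p, 'n, 'o, 'm) func \<Rightarrow>
   ('o, 'm, 'p, 'n) func \<Rightarrow> ('p \<Rightarrow> 'n) \<Rightarrow> ('o \<Rightarrow> 'm) \<Rightarrow> bool" where
  "is_adjunction A B F G \<eta> \<epsilon> \<longleftrightarrow> is_functor B A F \<and> is_functor A B G \<and>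
     is_nat_trans B B id_func (comp_func G F) \<eta> \<and>
     is_nat_trans A A (comp_func F G) id_func \<epsilon> \<and>
     (\<forall>b\<in>Ob B. \<epsilon> (fo F b) \<cdot>\<^bsub>A\<^esub> fa F (\<eta> b) = Idt A (fo F b)) \<and>
     (\<forall>a\<in>Ob A. fa G (\<epsilon> a) \<cdot>\<^bsub>B\<^esub> \<eta> (fo G a) = Idt B (fo G a))"

text \<open>
  The Eilenberg--Moore category of a monad \<open>(T, \<eta>, \<mu>)\<close> on \<open>B\<close>.  A homomorphism of algebras is
  recorded together with its source and target algebras.
\<close>

definition is_algebra ::
  "('p, 'n, 'y) cat_scheme \<Rightarrow> ('p, 'n, 'p, 'n) func \<Rightarrow> ('p \<Rightarrow> 'n) \<Rightarrow> ('p \<Rightarrow> 'n) \<Rightarrow>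
   'p \<times> 'n \<Rightarrow> bool" where
  "is_algebra B T \<eta> \<mu> = (\<lambda>(b, h). b \<in> Ob B \<and> h \<in> Hom B (fo T b) b \<and>
     h \<cdot>\<^bsub>B\<^esub> \<eta> b = Idt B b \<and> h \<cdot>\<^bsub>B\<^esub> \<mu> b = h \<cdot>\<^bsub>B\<^esub> fa T h)"

definition algebra_cat ::
  "('p, 'n, 'y) cat_scheme \<Rightarrow> ('p, 'n, 'p, 'n) func \<Rightarrow> ('p \<Rightarrow> 'n) \<Rightarrow> ('p \<Rightarrow> 'n) \<Rightarrow>
   ('p \<times> 'n, ('p \<times> 'n) \<times> 'n \<times> ('p \<times> 'n)) cat" where
  "algebra_cat B T \<eta> \<mu> = \<lparr>
     Ob = {x. is_algebra B T \<eta> \<mu> x},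
     Arr = {(x, f, y). is_algebra B T \<eta> \<mu> x \<and> is_algebra B T \<eta> \<mu> y \<and>
              f \<in> Hom B (fst x) (fst y) \<and> f \<cdot>\<^bsub>B\<^esub> snd x = snd y \<cdot>\<^bsub>B\<^esub> fa T f},
     Dom = (\<lambda>(x, f, y). x),
     Cod = (\<lambda>(x, f, y). y),
     Idt = (\<lambda>x. (x, Idt B (fst x), x)),
     Cmp = (\<lambda>(y, g, z) (x, f, y'). (x, g \<cdot>\<^bsub>B\<^esub> f, z))\<rparr>"

definition comparison_func ::
  "('o, 'm, 'x) cat_scheme \<Rightarrow> ('o, 'm, 'p, 'n) func \<Rightarrow> ('o \<Rightarrow> 'm) \<Rightarrow>
   ('o, 'm, 'p \<times> 'n, ('p \<times> 'n) \<times> 'n \<times> ('p \<times> 'n)) func" where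
  "comparison_func A G \<epsilon> = (let k = (\<lambda>a. (fo G a, fa G (\<epsilon> a))) in
     \<lparr>fo = k, fa = (\<lambda>f. (k (Dom A f), fa G f, k (Cod A f)))\<rparr>)"

definition is_monadic ::
  "('o, 'm, 'x) cat_scheme \<Rightarrow> ('p, 'n, 'y) cat_scheme \<Rightarrow> ('o, 'm, 'p, 'n) func \<Rightarrow> bool" where
  "is_monadic A B G \<longleftrightarrow> is_functor A B G \<and>
     (\<exists>F \<eta> \<epsilon>. is_adjunction A B F G \<eta> \<epsilon> \<and>
        is_equivalence A (algebra_cat B (comp_func G F) \<eta> (\<lambda>b. fa G (\<epsilon> (fo F b))))
          (comparison_func A G \<epsilon>))"


section \<open>Symmetric monoidal closed categories\<close>

text \<open>
  \<open>\<otimes>\<close> and \<open>\<odot>\<close> are the tensor product on objects and on arrows; \<open>assc a b c\<close> is the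
  isomorphism from \<open>(a \<otimes> b) \<otimes> c\<close> to \<open>a \<otimes> (b \<otimes> c)\<close>, and \<open>ev a b\<close> is the evaluation from
  \<open>ihom a b \<otimes> a\<close> to \<open>b\<close>.
\<close>

record ('o, 'm) smcc = "('o, 'm) cat" +
  tens_ob :: "'o \<Rightarrow> 'o \<Rightarrow> 'o" (infixr "\<otimes>\<index>" 75)
  tens_arr :: "'m \<Rightarrow> 'm \<Rightarrow> 'm" (infixr "\<odot>\<index>" 75)
  unit_ob :: "'o"
  assc :: "'o \<Rightarrow> 'o \<Rightarrow> 'o \<Rightarrow> 'm"
  lunit :: "'o \<Rightarrow> 'm"
  runit :: "'o \<Rightarrow> 'm"
  symm :: "'o \<Rightarrow> 'o \<Rightarrow> 'm"
  ihom :: "'o \<Rightarrow> 'o \<Rightarrow> 'o"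
  ev :: "'o \<Rightarrow> 'o \<Rightarrow> 'm"

locale symmetric_monoidal_closed = category V
  for V :: "('o, 'm) smcc" (structure) +
  assumes tens_ob: "a \<in> Ob V \<Longrightarrow> b \<in> Ob V \<Longrightarrow> a \<otimes> b \<in> Ob V"
    and tens_arr: "f \<in> Hom V a b \<Longrightarrow> g \<in> Hom V c d \<Longrightarrow> f \<odot> g \<in> Hom V (a \<otimes> c) (b \<otimes> d)"
    and tens_idt: "a \<in> Ob V \<Longrightarrow> b \<in> Ob V \<Longrightarrow> Idt V a \<odot> Idt V b = Idt V (a \<otimes> b)"
    and tens_cmp: "f \<in> Hom V a b \<Longrightarrow> g \<in> Hom V b c \<Longrightarrow> f' \<in> Hom V a' b' \<Longrightarrow> g' \<in> Hom V b' c' \<Longrightarrow>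
      (g \<cdot> f) \<odot> (g' \<cdot> f') = (g \<odot> g') \<cdot> (f \<odot> f')"
    and unit_ob: "unit_ob V \<in> Ob V"
    and assc_hom: "a \<in> Ob V \<Longrightarrow> b \<in> Ob V \<Longrightarrow> c \<in> Ob V \<Longrightarrow>
      assc V a b c \<in> Hom V ((a \<otimes> b) \<otimes> c) (a \<otimes> (b \<otimes> c))"
    and assc_iso: "a \<in> Ob V \<Longrightarrow> b \<in> Ob V \<Longrightarrow> c \<in> Ob V \<Longrightarrow> is_iso V (assc V a b c)"
    and assc_natural: "f \<in> Hom V a a' \<Longrightarrow> g \<in> Hom V b b' \<Longrightarrow> h \<in> Hom V c c' \<Longrightarrow>
      assc V a' b' c' \<cdot> ((f \<odot> g) \<odot> h) = (f \<odot> (g \<odot> h)) \<cdot> assc V a b c"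
    and lunit_hom: "a \<in> Ob V \<Longrightarrow> lunit V a \<in> Hom V (unit_ob V \<otimes> a) a"
    and lunit_iso: "a \<in> Ob V \<Longrightarrow> is_iso V (lunit V a)"
    and lunit_natural: "f \<in> Hom V a b \<Longrightarrow>
      lunit V b \<cdot> (Idt V (unit_ob V) \<odot> f) = f \<cdot> lunit V a"
    and runit_hom: "a \<in> Ob V \<Longrightarrow> runit V a \<in> Hom V (a \<otimes> unit_ob V) a"
    and runit_iso: "a \<in> Ob V \<Longrightarrow> is_iso V (runit V a)"
    and runit_natural: "f \<in> Hom V a b \<Longrightarrow>
      runit V b \<cdot> (f \<odot> Idt V (unit_ob V)) = f \<cdot> runit V a"
    and symm_hom: "a \<in> Ob V \<Longrightarrow> b \<in> Ob V \<Longrightarrow> symm V a b \<in> Hom V (a \<otimes> b) (b \<otimes> a)"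
    and symm_natural: "f \<in> Hom V a a' \<Longrightarrow> g \<in> Hom V b b' \<Longrightarrow>
      symm V a' b' \<cdot> (f \<odot> g) = (g \<odot> f) \<cdot> symm V a b"
    and symm_symm: "a \<in> Ob V \<Longrightarrow> b \<in> Ob V \<Longrightarrow> symm V b a \<cdot> symm V a b = Idt V (a \<otimes> b)"
    and pentagon: "a \<in> Ob V \<Longrightarrow> b \<in> Ob V \<Longrightarrow> c \<in> Ob V \<Longrightarrow> d \<in> Ob V \<Longrightarrow>
      assc V a b (c \<otimes> d) \<cdot> assc V (a \<otimes> b) c d =
      (Idt V a \<odot> assc V b c d) \<cdot> assc V a (b \<otimes> c) d \<cdot> (assc V a b c \<odot> Idt V d)"
    and triangle: "a \<in> Ob V \<Longrightarrow> b \<in> Ob V \<Longrightarrow>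
      (Idt V a \<odot> lunit V b) \<cdot> assc V a (unit_ob V) b = runit V a \<odot> Idt V b"
    and hexagon: "a \<in> Ob V \<Longrightarrow> b \<in> Ob V \<Longrightarrow> c \<in> Ob V \<Longrightarrow>
      assc V b c a \<cdot> symm V a (b \<otimes> c) \<cdot> assc V a b c =
      (Idt V b \<odot> symm V a c) \<cdot> assc V b a c \<cdot> (symm V a b \<odot> Idt V c)"
    and ihom_ob: "a \<in> Ob V \<Longrightarrow> b \<in> Ob V \<Longrightarrow> ihom V a b \<in> Ob V"
    and ev_hom: "a \<in> Ob V \<Longrightarrow> b \<in> Ob V \<Longrightarrow> ev V a b \<in> Hom V (ihom V a b \<otimes> a) b"
    and ev_universal: "x \<in> Ob V \<Longrightarrow> a \<in> Ob V \<Longrightarrow> b \<in> Ob V \<Longrightarrow> f \<in> Hom V (x \<otimes> a) b \<Longrightarrow>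
      \<exists>!g. g \<in> Hom V x (ihom V a b) \<and> ev V a b \<cdot> (g \<odot> Idt V a) = f"

definition curry_arr :: "('o, 'm) smcc \<Rightarrow> 'o \<Rightarrow> 'o \<Rightarrow> 'o \<Rightarrow> 'm \<Rightarrow> 'm" where
  "curry_arr V x a b f =
     (THE g. g \<in> Hom V x (ihom V a b) \<and> ev V a b \<cdot>\<^bsub>V\<^esub> (g \<odot>\<^bsub>V\<^esub> Idt V a) = f)"

text \<open>The arrow from the unit object to \<open>ihom a b\<close> corresponding to \<open>f\<close> from \<open>a\<close> to \<open>b\<close>.\<close>

definition name_arr :: "('o, 'm) smcc \<Rightarrow> 'o \<Rightarrow> 'o \<Rightarrow> 'm \<Rightarrow> 'm" where
  "name_arr V a b f = curry_arr V (unit_ob V) a b (f \<cdot>\<^bsub>V\<^esub> lunit V a)"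


section \<open>Enriched categories, functors and natural transformations\<close>

record ('c, 'o, 'm) vcat =
  VOb :: "'c set"
  VHom :: "'c \<Rightarrow> 'c \<Rightarrow> 'o"
  VCmp :: "'c \<Rightarrow> 'c \<Rightarrow> 'c \<Rightarrow> 'm"
  VIdt :: "'c \<Rightarrow> 'm"

locale vcategory = symmetric_monoidal_closed V
  for V :: "('o, 'm) smcc" (structure) +
  fixes C :: "('c, 'o, 'm) vcat"
  assumes vhom_ob: "a \<in> VOb C \<Longrightarrow> b \<in> VOb C \<Longrightarrow> VHom C a b \<in> Ob V"
    and vcmp_hom: "a \<in> VOb C \<Longrightarrow> b \<in> VOb C \<Longrightarrow> c \<in> VOb C \<Longrightarrow>
      VCmp C a b c \<in> Hom V (VHom C b c \<otimes> VHom C a b) (VHom C a c)"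
    and vidt_hom: "a \<in> VOb C \<Longrightarrow> VIdt C a \<in> Hom V (unit_ob V) (VHom C a a)"
    and vcmp_assoc: "a \<in> VOb C \<Longrightarrow> b \<in> VOb C \<Longrightarrow> c \<in> VOb C \<Longrightarrow> d \<in> VOb C \<Longrightarrow>
      VCmp C a b d \<cdot> (VCmp C b c d \<odot> Idt V (VHom C a b)) =
      VCmp C a c d \<cdot> (Idt V (VHom C c d) \<odot> VCmp C a b c) \<cdot>
        assc V (VHom C c d) (VHom C b c) (VHom C a b)"
    and vidt_left: "a \<in> VOb C \<Longrightarrow> b \<in> VOb C \<Longrightarrow>
      VCmp C a b b \<cdot> (VIdt C b \<odot> Idt V (VHom C a b)) = lunit V (VHom C a b)"
    and vidt_right: "a \<in> VOb C \<Longrightarrow> b \<in> VOb C \<Longrightarrow>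
      VCmp C a a b \<cdot> (Idt V (VHom C a b) \<odot> VIdt C a) = runit V (VHom C a b)"

record ('a, 'b, 'm) vfun =
  vfo :: "'a \<Rightarrow> 'b"
  vfa :: "'a \<Rightarrow> 'a \<Rightarrow> 'm"

definition is_vfunctor ::
  "('o, 'm) smcc \<Rightarrow> ('a, 'o, 'm) vcat \<Rightarrow> ('b, 'o, 'm) vcat \<Rightarrow> ('a, 'b, 'm) vfun \<Rightarrow> bool" where
  "is_vfunctor V A B F \<longleftrightarrow> vcategory V A \<and> vcategory V B \<and>
     (\<forall>a\<in>VOb A. vfo F a \<in> VOb B) \<and>
     (\<forall>a\<in>VOb A. \<forall>b\<in>VOb A. vfa F a b \<in> Hom V (VHom A a b) (VHom B (vfo F a) (vfo F b))) \<and>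
     (\<forall>a\<in>VOb A. vfa F a a \<cdot>\<^bsub>V\<^esub> VIdt A a = VIdt B (vfo F a)) \<and>
     (\<forall>a\<in>VOb A. \<forall>b\<in>VOb A. \<forall>c\<in>VOb A.
        vfa F a c \<cdot>\<^bsub>V\<^esub> VCmp A a b c =
        VCmp B (vfo F a) (vfo F b) (vfo F c) \<cdot>\<^bsub>V\<^esub> (vfa F b c \<odot>\<^bsub>V\<^esub> vfa F a b))"

definition comp_vfun ::
  "('o, 'm) smcc \<Rightarrow> ('b, 'c, 'm) vfun \<Rightarrow> ('a, 'b, 'm) vfun \<Rightarrow> ('a, 'c, 'm) vfun" where
  "comp_vfun V G F = \<lparr>vfo = vfo G \<circ> vfo F,
     vfa = (\<lambda>a b. vfa G (vfo F a) (vfo F b) \<cdot>\<^bsub>V\<^esub> vfa F a b)\<rparr>"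

definition fully_faithful ::
  "('o, 'm) smcc \<Rightarrow> ('a, 'o, 'm) vcat \<Rightarrow> ('a, 'b, 'm) vfun \<Rightarrow> bool" where
  "fully_faithful V A F \<longleftrightarrow> (\<forall>a\<in>VOb A. \<forall>b\<in>VOb A. is_iso V (vfa F a b))"

definition op_vcat :: "('o, 'm) smcc \<Rightarrow> ('c, 'o, 'm) vcat \<Rightarrow> ('c, 'o, 'm) vcat" where
  "op_vcat V C = \<lparr>VOb = VOb C, VHom = (\<lambda>a b. VHom C b a),
     VCmp = (\<lambda>a b c. VCmp C c b a \<cdot>\<^bsub>V\<^esub> symm V (VHom C c b) (VHom C b a)),
     VIdt = VIdt C\<rparr>"

definition op_vfun :: "('a, 'b, 'm) vfun \<Rightarrow> ('a, 'b, 'm) vfun" where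
  "op_vfun F = \<lparr>vfo = vfo F, vfa = (\<lambda>a b. vfa F b a)\<rparr>"

text \<open>\<open>V\<close> as a category enriched over itself.\<close>

definition self_vcat :: "('o, 'm) smcc \<Rightarrow> ('o, 'o, 'm) vcat" where
  "self_vcat V = \<lparr>VOb = Ob V, VHom = ihom V,
     VCmp = (\<lambda>a b c. curry_arr V (ihom V b c \<otimes>\<^bsub>V\<^esub> ihom V a b) a c
       (ev V b c \<cdot>\<^bsub>V\<^esub> (Idt V (ihom V b c) \<odot>\<^bsub>V\<^esub> ev V a b) \<cdot>\<^bsub>V\<^esub> assc V (ihom V b c) (ihom V a b) a)),
     VIdt = (\<lambda>a. curry_arr V (unit_ob V) a a (lunit V a))\<rparr>"

text \<open>The representable functor \<open>C(a,-)\<close> from \<open>C\<close> to \<open>V\<close>.\<close>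

definition rep_vfun :: "('o, 'm) smcc \<Rightarrow> ('c, 'o, 'm) vcat \<Rightarrow> 'c \<Rightarrow> ('c, 'o, 'm) vfun" where
  "rep_vfun V C a = \<lparr>vfo = VHom C a,
     vfa = (\<lambda>b c. curry_arr V (VHom C b c) (VHom C a b) (VHom C a c) (VCmp C a b c))\<rparr>"

text \<open>The functor \<open>C(D-,x)\<close> from the opposite of the domain of \<open>D\<close> to \<open>V\<close>.\<close>

definition corep_vfun ::
  "('o, 'm) smcc \<Rightarrow> ('c, 'o, 'm) vcat \<Rightarrow> ('b, 'c, 'm) vfun \<Rightarrow> 'c \<Rightarrow> ('b, 'o, 'm) vfun" where
  "corep_vfun V C D x = comp_vfun V (rep_vfun V (op_vcat V C) x) (op_vfun D)"

text \<open>
  Composition in the underlying ordinary category \<open>C\<^sub>0\<close>, for arrows from the unit object to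
  the hom objects of \<open>C\<close>.
\<close>

definition und_cmp ::
  "('o, 'm) smcc \<Rightarrow> ('c, 'o, 'm) vcat \<Rightarrow> 'c \<Rightarrow> 'c \<Rightarrow> 'c \<Rightarrow> 'm \<Rightarrow> 'm \<Rightarrow> 'm" where
  "und_cmp V C a b c g f =
     VCmp C a b c \<cdot>\<^bsub>V\<^esub> (g \<odot>\<^bsub>V\<^esub> f) \<cdot>\<^bsub>V\<^esub> inverse_arr V (lunit V (unit_ob V))"

definition underlying_cat ::
  "('o, 'm) smcc \<Rightarrow> ('c, 'o, 'm) vcat \<Rightarrow> ('c, 'c \<times> 'm \<times> 'c) cat" where
  "underlying_cat V C = \<lparr>
     Ob = VOb C,
     Arr = {(a, f, b). a \<in> VOb C \<and> b \<in> VOb C \<and> f \<in> Hom V (unit_ob V) (VHom C a b)},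
     Dom = (\<lambda>(a, f, b). a),
     Cod = (\<lambda>(a, f, b). b),
     Idt = (\<lambda>a. (a, VIdt C a, a)),
     Cmp = (\<lambda>(b, g, c) (a, f, b'). (a, und_cmp V C a b c g f, c))\<rparr>"

definition is_vnat_trans ::
  "('o, 'm) smcc \<Rightarrow> ('a, 'o, 'm) vcat \<Rightarrow> ('b, 'o, 'm) vcat \<Rightarrow>
   ('a, 'b, 'm) vfun \<Rightarrow> ('a, 'b, 'm) vfun \<Rightarrow> ('a \<Rightarrow> 'm) \<Rightarrow> bool" where
  "is_vnat_trans V A B F G \<alpha> \<longleftrightarrow> is_vfunctor V A B F \<and> is_vfunctor V A B G \<and>
     (\<forall>a\<in>VOb A. \<alpha> a \<in> Hom V (unit_ob V) (VHom B (vfo F a) (vfo G a))) \<and>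
     (\<forall>a\<in>VOb A. \<forall>b\<in>VOb A.
        VCmp B (vfo F a) (vfo F b) (vfo G b) \<cdot>\<^bsub>V\<^esub> (\<alpha> b \<odot>\<^bsub>V\<^esub> vfa F a b) \<cdot>\<^bsub>V\<^esub>
          inverse_arr V (lunit V (VHom A a b)) =
        VCmp B (vfo F a) (vfo G a) (vfo G b) \<cdot>\<^bsub>V\<^esub> (vfa G a b \<odot>\<^bsub>V\<^esub> \<alpha> a) \<cdot>\<^bsub>V\<^esub>
          inverse_arr V (runit V (VHom A a b)))"

text \<open>
  The hom object \<open>[A,B](F,G)\<close> of the enriched functor category is the end over \<open>a\<close> of
  \<open>B(F a, G a)\<close>, i.e.\ the universal object \<open>e\<close> with a \<open>V\<close>-natural family of arrows
  \<open>\<pi> a\<close> from \<open>e\<close> to \<open>B(F a, G a)\<close>.  Such an end need not exist if \<open>A\<close> is large.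
\<close>

definition is_vnat_family ::
  "('o, 'm) smcc \<Rightarrow> ('a, 'o, 'm) vcat \<Rightarrow> ('b, 'o, 'm) vcat \<Rightarrow>
   ('a, 'b, 'm) vfun \<Rightarrow> ('a, 'b, 'm) vfun \<Rightarrow> 'o \<Rightarrow> ('a \<Rightarrow> 'm) \<Rightarrow> bool" where
  "is_vnat_family V A B F G t \<alpha> \<longleftrightarrow> t \<in> Ob V \<and>
     (\<forall>a\<in>VOb A. \<alpha> a \<in> Hom V t (VHom B (vfo F a) (vfo G a))) \<and>
     (\<forall>a\<in>VOb A. \<forall>b\<in>VOb A.
        VCmp B (vfo F a) (vfo F b) (vfo G b) \<cdot>\<^bsub>V\<^esub> (\<alpha> b \<odot>\<^bsub>V\<^esub> vfa F a b) =
        VCmp B (vfo F a) (vfo G a) (vfo G b) \<cdot>\<^bsub>V\<^esub> (vfa G a b \<odot>\<^bsub>V\<^esub> \<alpha> a) \<cdot>\<^bsub>V\<^esub>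
          symm V t (VHom A a b))"

definition is_functor_hom ::
  "('o, 'm) smcc \<Rightarrow> ('a, 'o, 'm) vcat \<Rightarrow> ('b, 'o, 'm) vcat \<Rightarrow>
   ('a, 'b, 'm) vfun \<Rightarrow> ('a, 'b, 'm) vfun \<Rightarrow> 'o \<Rightarrow> ('a \<Rightarrow> 'm) \<Rightarrow> bool" where
  "is_functor_hom V A B F G e \<pi> \<longleftrightarrow> is_vfunctor V A B F \<and> is_vfunctor V A B G \<and>
     is_vnat_family V A B F G e \<pi> \<and>
     (\<forall>t \<alpha>. is_vnat_family V A B F G t \<alpha> \<longrightarrow>
        (\<exists>!u. u \<in> Hom V t e \<and> (\<forall>a\<in>VOb A. \<pi> a \<cdot>\<^bsub>V\<^esub> u = \<alpha> a)))"


section \<open>Weighted colimits\<close>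

text \<open>
  A weight is a pair \<open>(B, W)\<close> with \<open>W\<close> a \<open>V\<close>-functor from the opposite of \<open>B\<close> to \<open>V\<close>.
  An object \<open>l\<close> with unit \<open>\<kappa>\<close> from \<open>W\<close> to \<open>C(D-,l)\<close> is the \<open>W\<close>-weighted colimit of \<open>D\<close> if
  the arrows from \<open>C(l,x)\<close> to \<open>[W b, C(D b,x)]\<close> induced by \<open>\<kappa>\<close>, namely the action of \<open>C(D b,-)\<close>
  followed by precomposition with \<open>\<kappa> b\<close>, present \<open>C(l,x)\<close> as the hom object from \<open>W\<close> to
  \<open>C(D-,x)\<close> in the category of \<open>V\<close>-functors from the opposite of \<open>B\<close> to \<open>V\<close>.
\<close>

definition is_weight :: "('o, 'm) smcc \<Rightarrow> ('b, 'o, 'm) vcat \<Rightarrow> ('b, 'o, 'm) vfun \<Rightarrow> bool" where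
  "is_weight V B W \<longleftrightarrow> vcategory V B \<and> is_vfunctor V (op_vcat V B) (self_vcat V) W"

definition is_wcolimit ::
  "('o, 'm) smcc \<Rightarrow> ('b, 'o, 'm) vcat \<Rightarrow> ('c, 'o, 'm) vcat \<Rightarrow> ('b, 'o, 'm) vfun \<Rightarrow>
   ('b, 'c, 'm) vfun \<Rightarrow> 'c \<Rightarrow> ('b \<Rightarrow> 'm) \<Rightarrow> bool" where
  "is_wcolimit V B C W D l \<kappa> \<longleftrightarrow> is_weight V B W \<and> is_vfunctor V B C D \<and> l \<in> VOb C \<and>
     is_vnat_trans V (op_vcat V B) (self_vcat V) W (corep_vfun V C D l) \<kappa> \<and>
     (\<forall>x\<in>VOb C. is_functor_hom V (op_vcat V B) (self_vcat V) W (corep_vfun V C D x) (VHom C l x)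
        (\<lambda>b. VCmp (self_vcat V) (vfo W b) (VHom C (vfo D b) l) (VHom C (vfo D b) x) \<cdot>\<^bsub>V\<^esub>
           (vfa (rep_vfun V C (vfo D b)) l x \<odot>\<^bsub>V\<^esub> \<kappa> b) \<cdot>\<^bsub>V\<^esub>
           inverse_arr V (runit V (VHom C l x))))"

definition has_wcolimits ::
  "('o, 'm) smcc \<Rightarrow> (('b, 'o, 'm) vcat \<times> ('b, 'o, 'm) vfun) set \<Rightarrow> ('c, 'o, 'm) vcat \<Rightarrow> bool" where
  "has_wcolimits V \<Phi> C \<longleftrightarrow>
     (\<forall>(B, W)\<in>\<Phi>. \<forall>D. is_vfunctor V B C D \<longrightarrow> (\<exists>l \<kappa>. is_wcolimit V B C W D l \<kappa>))"

text \<open>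
  The unit of the image under \<open>F\<close> of a weighted colimit has components the composites of
  \<open>\<kappa> b\<close> from \<open>W b\<close> to \<open>C(D b,l)\<close> and \<open>F\<close> from \<open>C(D b,l)\<close> to \<open>E(F D b,F l)\<close>.
\<close>

definition preserves_wcolimits ::
  "('o, 'm) smcc \<Rightarrow> (('b, 'o, 'm) vcat \<times> ('b, 'o, 'm) vfun) set \<Rightarrow>
   ('c, 'o, 'm) vcat \<Rightarrow> ('e, 'o, 'm) vcat \<Rightarrow> ('c, 'e, 'm) vfun \<Rightarrow> bool" where
  "preserves_wcolimits V \<Phi> C E F \<longleftrightarrow>
     (\<forall>(B, W)\<in>\<Phi>. \<forall>D l \<kappa>. is_wcolimit V B C W D l \<kappa> \<longrightarrow>
        is_wcolimit V B E W (comp_vfun V F D) (vfo F l)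
          (\<lambda>b. let x = VHom C (vfo D b) l; y = VHom E (vfo F (vfo D b)) (vfo F l) in
             und_cmp V (self_vcat V) (vfo W b) x y (name_arr V x y (vfa F (vfo D b) l)) (\<kappa> b)))"

text \<open>Again, the objects of a small \<open>V\<close>-category can be taken in the type \<open>'u\<close>.\<close>

definition small_weights ::
  "'u set \<Rightarrow> ('o, 'm) smcc \<Rightarrow> (('u, 'o, 'm) vcat \<times> ('u, 'o, 'm) vfun) set" where
  "small_weights U V = {(B, W). small U (VOb B) \<and> is_weight V B W}"

definition cocomplete :: "'u set \<Rightarrow> ('o, 'm) smcc \<Rightarrow> ('c, 'o, 'm) vcat \<Rightarrow> bool" where
  "cocomplete U V C \<longleftrightarrow> has_wcolimits V (small_weights U V) C"


section \<open>Subcategories of arities\<close>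

text \<open>
  \<open>j\<close> is dense if the \<open>V\<close>-functor sending \<open>x\<close> to \<open>C(j-,x)\<close> is fully faithful, i.e.\ if
  its action on hom objects, with components the actions of the \<open>C(j k,-)\<close>, presents every
  \<open>C(x,y)\<close> as the hom object from \<open>C(j-,x)\<close> to \<open>C(j-,y)\<close>.
\<close>

definition is_dense ::
  "('o, 'm) smcc \<Rightarrow> ('j, 'o, 'm) vcat \<Rightarrow> ('c, 'o, 'm) vcat \<Rightarrow> ('j, 'c, 'm) vfun \<Rightarrow> bool" where
  "is_dense V J C j \<longleftrightarrow>
     (\<forall>x\<in>VOb C. \<forall>y\<in>VOb C.
        is_functor_hom V (op_vcat V J) (self_vcat V) (corep_vfun V C j x) (corep_vfun V C j y)
          (VHom C x y) (\<lambda>k. vfa (rep_vfun V C (vfo j k)) x y))"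

definition subcategory_of_arities ::
  "('o, 'm) smcc \<Rightarrow> ('j, 'o, 'm) vcat \<Rightarrow> ('c, 'o, 'm) vcat \<Rightarrow> ('j, 'c, 'm) vfun \<Rightarrow> bool" where
  "subcategory_of_arities V J C j \<longleftrightarrow>
     is_vfunctor V J C j \<and> fully_faithful V J j \<and> is_dense V J C j"

definition arity_weights ::
  "('o, 'm) smcc \<Rightarrow> ('j, 'o, 'm) vcat \<Rightarrow> ('c, 'o, 'm) vcat \<Rightarrow> ('j, 'c, 'm) vfun \<Rightarrow>
   (('j, 'o, 'm) vcat \<times> ('j, 'o, 'm) vfun) set" where
  "arity_weights V J C j = {(J, corep_vfun V C j x) |x. x \<in> VOb C}"

definition eleutheric ::
  "('o, 'm) smcc \<Rightarrow> ('j, 'o, 'm) vcat \<Rightarrow> ('c, 'o, 'm) vcat \<Rightarrow> ('j, 'c, 'm) vfun \<Rightarrow> bool" where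
  "eleutheric V J C j \<longleftrightarrow> has_wcolimits V (arity_weights V J C j) C \<and>
     (\<forall>k\<in>VOb J. preserves_wcolimits V (arity_weights V J C j) C (self_vcat V)
        (rep_vfun V C (vfo j k)))"

definition is_ary ::
  "('o, 'm) smcc \<Rightarrow> ('j, 'o, 'm) vcat \<Rightarrow> ('c, 'o, 'm) vcat \<Rightarrow> ('j, 'c, 'm) vfun \<Rightarrow>
   ('c, 'c, 'm) vfun \<Rightarrow> bool" where
  "is_ary V J C j H \<longleftrightarrow> is_vfunctor V C C H \<and>
     preserves_wcolimits V (arity_weights V J C j) C C H"

text \<open>
  The functions making up an endofunctor or a transformation are required to be undefined
  away from the objects of \<open>C\<close>, so that equality in HOL is equality of \<open>V\<close>-functors and of
  \<open>V\<close>-natural transformations.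
\<close>

definition ary_endofunctors ::
  "('o, 'm) smcc \<Rightarrow> ('j, 'o, 'm) vcat \<Rightarrow> ('c, 'o, 'm) vcat \<Rightarrow> ('j, 'c, 'm) vfun \<Rightarrow>
   ('c, 'c, 'm) vfun set" where
  "ary_endofunctors V J C j = {H. is_ary V J C j H \<and> vfo H \<in> extensional (VOb C) \<and>
     case_prod (vfa H) \<in> extensional (VOb C \<times> VOb C)}"

definition end_cat ::
  "('o, 'm) smcc \<Rightarrow> ('j, 'o, 'm) vcat \<Rightarrow> ('c, 'o, 'm) vcat \<Rightarrow> ('j, 'c, 'm) vfun \<Rightarrow>
   (('c, 'c, 'm) vfun, ('c, 'c, 'm) vfun \<times> ('c \<Rightarrow> 'm) \<times> ('c, 'c, 'm) vfun) cat" where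
  "end_cat V J C j = \<lparr>
     Ob = ary_endofunctors V J C j,
     Arr = {(F, \<alpha>, G). F \<in> ary_endofunctors V J C j \<and> G \<in> ary_endofunctors V J C j \<and>
              is_vnat_trans V C C F G \<alpha> \<and> \<alpha> \<in> extensional (VOb C)},
     Dom = (\<lambda>(F, \<alpha>, G). F),
     Cod = (\<lambda>(F, \<alpha>, G). G),
     Idt = (\<lambda>F. (F, \<lambda>c\<in>VOb C. VIdt C (vfo F c), F)),
     Cmp = (\<lambda>(G, \<beta>, H) (F, \<alpha>, G').
       (F, \<lambda>c\<in>VOb C. und_cmp V C (vfo F c) (vfo G c) (vfo H c) (\<beta> c) (\<alpha> c), H))\<rparr>"

definition sig_cat ::
  "('o, 'm) smcc \<Rightarrow> ('j, 'o, 'm) vcat \<Rightarrow> ('c, 'o, 'm) vcat \<Rightarrow>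
   ('j \<Rightarrow> 'c, 'j \<Rightarrow> 'c \<times> 'm \<times> 'c) cat" where
  "sig_cat V J C = family_cat (VOb J) (underlying_cat V C)"

definition forgetful ::
  "('j, 'o, 'm) vcat \<Rightarrow> ('j, 'c, 'm) vfun \<Rightarrow>
   (('c, 'c, 'm) vfun, ('c, 'c, 'm) vfun \<times> ('c \<Rightarrow> 'm) \<times> ('c, 'c, 'm) vfun,
    'j \<Rightarrow> 'c, 'j \<Rightarrow> 'c \<times> 'm \<times> 'c) func" where
  "forgetful J j = \<lparr>
     fo = (\<lambda>H. \<lambda>k\<in>VOb J. vfo H (vfo j k)),
     fa = (\<lambda>(F, \<alpha>, G). \<lambda>k\<in>VOb J. (vfo F (vfo j k), \<alpha> (vfo j k), vfo G (vfo j k)))\<rparr>"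

end

theory Submission
  imports Defs
begin

text \<open>
  Restriction along \<open>j\<close> identifies \<open>J\<close>-ary endofunctors with \<open>V\<close>-functors from \<open>J\<close> to \<open>C\<close>: by density
  every object \<open>c\<close> is the colimit of \<open>j\<close> weighted by \<open>C(j-,c)\<close>, so a \<open>J\<close>-ary endofunctor is the pointwise
  left Kan extension of its restriction, and by eleuthericity every such Kan extension is \<open>J\<close>-ary.
  The free \<open>J\<close>-ary endofunctor on a signature \<open>X\<close> is the left Kan extension of \<open>X\<close> along
  the functor to \<open>C\<close> from the discrete category on the objects of \<open>J\<close>, so that its value at \<open>c\<close> is the
  coproduct of the copowers \<open>C(j k,c) \<otimes> X k\<close>.  An algebra structure on \<open>X\<close> for the induced monad therefore
  consists of arrows from \<open>J(l,k)\<close> to \<open>C(X l,X k)\<close>, and the algebra laws say precisely that these make \<open>X\<close>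
  a \<open>V\<close>-functor on \<open>J\<close>.  Hence the comparison functor is an equivalence, and no coequalizers are needed.
\<close>

section \<open>Monoidal coherence\<close>

text \<open>Two obstacles shape the proof. Composites in an enriched category carry associators and
  unitors, so arrows of \<open>V\<close> into hom objects are treated as generalised elements whose
  grade is a list of objects; concatenation of lists makes their composition strictly associative,
  and \<open>V\<close>-naturality becomes an equation between composites. Moreover \<open>C\<close>
  may be large, so the hom objects of \<open>[C,C]\<close> need not exist; colimits are therefore
  used through their universal property for elements of every grade, and never through a functor
  category. That a Kan extension \<open>H\<close> along \<open>i\<close> preserves the required
  colimits is an interchange of colimits: \<open>H c\<close> is a colimit weighted by
  \<open>C(i-,c)\<close>, and \<open>C(i b,-)\<close> preserves the colimits in question because
  \<open>i b\<close> is an arity. The argument does not depend on the domain of \<open>i\<close>, so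
  it covers both \<open>j\<close> and the discrete category that yields free endofunctors. Freeness
  is kept in a pointwise form because an algebra structure is a mere family of arrows, one for each
  arity, and is not a transformation to which a universal property of endofunctors would
  apply.\<close>

lemma Hom_iff: "f \<in> Hom C a b \<longleftrightarrow> f \<in> Arr C \<and> Dom C f = a \<and> Cod C f = b"
  by (auto simp: Hom_def)

section \<open>Inverses and isomorphisms in an ordinary category\<close>

context category
begin

lemma idt_arr [simp]: "a \<in> Ob C \<Longrightarrow> Idt C a \<in> Arr C"
  and dom_idt [simp]: "a \<in> Ob C \<Longrightarrow> Dom C (Idt C a) = a"
  and cod_idt [simp]: "a \<in> Ob C \<Longrightarrow> Cod C (Idt C a) = a"
  using idt_hom by (auto simp: Hom_iff)

lemma cmp_arr [simp]: "f \<in> Arr C \<Longrightarrow> g \<in> Arr C \<Longrightarrow> Dom C g = Cod C f \<Longrightarrow> g \<cdot> f \<in> Arr C"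
  and dom_cmp [simp]: "f \<in> Arr C \<Longrightarrow> g \<in> Arr C \<Longrightarrow> Dom C g = Cod C f \<Longrightarrow> Dom C (g \<cdot> f) = Dom C f"
  and cod_cmp [simp]: "f \<in> Arr C \<Longrightarrow> g \<in> Arr C \<Longrightarrow> Dom C g = Cod C f \<Longrightarrow> Cod C (g \<cdot> f) = Cod C g"
  using cmp_hom[of f "Dom C f" "Cod C f" g "Cod C g"] by (auto simp: Hom_iff)

lemma cmp_assoc' [simp]:
  "f \<in> Arr C \<Longrightarrow> g \<in> Arr C \<Longrightarrow> h \<in> Arr C \<Longrightarrow> Dom C g = Cod C f \<Longrightarrow> Dom C h = Cod C g \<Longrightarrow>
   (h \<cdot> g) \<cdot> f = h \<cdot> (g \<cdot> f)"
  by (rule cmp_assoc[of _ "Dom C f" "Cod C f" _ "Cod C g" _ "Cod C h"]) (auto simp: Hom_iff)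

lemma idt_left' [simp]: "f \<in> Arr C \<Longrightarrow> Cod C f = b \<Longrightarrow> Idt C b \<cdot> f = f"
  and idt_right' [simp]: "f \<in> Arr C \<Longrightarrow> Dom C f = a \<Longrightarrow> f \<cdot> Idt C a = f"
  using idt_left idt_right by (auto simp: Hom_iff)

lemma dom_ob' [simp]: "f \<in> Arr C \<Longrightarrow> Dom C f \<in> Ob C"
  and cod_ob' [simp]: "f \<in> Arr C \<Longrightarrow> Cod C f \<in> Ob C"
  using dom_ob cod_ob by auto

lemma is_inverse_unique: "is_inverse C f g \<Longrightarrow> is_inverse C f h \<Longrightarrow> g = h"
  unfolding is_inverse_def by (metis (no_types, lifting) cmp_assoc idt_left idt_right)

lemma inverse_arr_eq: "is_inverse C f g \<Longrightarrow> inverse_arr C f = g"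
  unfolding inverse_arr_def using is_inverse_unique by blast

lemma is_isoI: "f \<in> Hom C a b \<Longrightarrow> g \<in> Hom C b a \<Longrightarrow> g \<cdot> f = Idt C a \<Longrightarrow> f \<cdot> g = Idt C b \<Longrightarrow> is_iso C f"
  unfolding is_iso_def is_inverse_def by (auto simp: Hom_iff)

lemma iso_inverse: "is_iso C f \<Longrightarrow> is_inverse C f (inverse_arr C f)"
  unfolding is_iso_def using inverse_arr_eq by auto

lemma iso_arr: "is_iso C f \<Longrightarrow> f \<in> Arr C"
  by (auto simp: is_iso_def is_inverse_def Hom_iff)

lemma inv_arr [simp]: "is_iso C f \<Longrightarrow> inverse_arr C f \<in> Arr C"
  and dom_inv [simp]: "is_iso C f \<Longrightarrow> Dom C (inverse_arr C f) = Cod C f"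
  and cod_inv [simp]: "is_iso C f \<Longrightarrow> Cod C (inverse_arr C f) = Dom C f"
  and inv_cmp [simp]: "is_iso C f \<Longrightarrow> inverse_arr C f \<cdot> f = Idt C (Dom C f)"
  and cmp_inv [simp]: "is_iso C f \<Longrightarrow> f \<cdot> inverse_arr C f = Idt C (Cod C f)"
  using iso_inverse by (auto simp: is_inverse_def Hom_iff)

lemma inv_cmp_cancel [simp]: "is_iso C f \<Longrightarrow> h \<in> Arr C \<Longrightarrow> Cod C h = Dom C f \<Longrightarrow>
    inverse_arr C f \<cdot> (f \<cdot> h) = h"
  and cmp_inv_cancel [simp]: "is_iso C f \<Longrightarrow> h \<in> Arr C \<Longrightarrow> Cod C h = Cod C f \<Longrightarrow>
    f \<cdot> (inverse_arr C f \<cdot> h) = h"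
  using iso_arr[of f] by (simp_all add: cmp_assoc'[symmetric] del: cmp_assoc')

lemma inv_iso [simp]: "is_iso C f \<Longrightarrow> is_iso C (inverse_arr C f)"
  using iso_arr[of f] by (intro is_isoI[of _ "Cod C f" "Dom C f" f]) (auto simp: Hom_iff)

lemma iso_epi: "is_iso C f \<Longrightarrow> g \<in> Arr C \<Longrightarrow> h \<in> Arr C \<Longrightarrow> Dom C g = Cod C f \<Longrightarrow> Dom C h = Cod C f \<Longrightarrow>
   g \<cdot> f = h \<cdot> f \<Longrightarrow> g = h"
proof -
  assume a: "is_iso C f" "g \<in> Arr C" "h \<in> Arr C" "Dom C g = Cod C f" "Dom C h = Cod C f" "g \<cdot> f = h \<cdot> f"
  then have "(g \<cdot> f) \<cdot> inverse_arr C f = (h \<cdot> f) \<cdot> inverse_arr C f" by simp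
  then show "g = h" using a(1-5) iso_arr[of f] by simp
qed

lemma iso_mono: "is_iso C f \<Longrightarrow> g \<in> Arr C \<Longrightarrow> h \<in> Arr C \<Longrightarrow> Cod C g = Dom C f \<Longrightarrow> Cod C h = Dom C f \<Longrightarrow>
   f \<cdot> g = f \<cdot> h \<Longrightarrow> g = h"
  by (metis inv_cmp_cancel)

lemma iso_cmp: "is_iso C f \<Longrightarrow> is_iso C g \<Longrightarrow> Dom C g = Cod C f \<Longrightarrow> is_iso C (g \<cdot> f)"
  using iso_arr[of f] iso_arr[of g]
  by (intro is_isoI[of _ "Dom C f" "Cod C g" "inverse_arr C f \<cdot> inverse_arr C g"]) (auto simp: Hom_iff)

end

section \<open>Naturality rules and the coherence of unitors and symmetry\<close>

context symmetric_monoidal_closed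
begin

abbreviation unt ("\<I>") where "\<I> \<equiv> unit_ob V"
abbreviation idV ("\<iota>") where "\<iota> \<equiv> Idt V"
abbreviation invV where "invV \<equiv> inverse_arr V"

lemmas [simp] = tens_ob unit_ob ihom_ob assc_iso lunit_iso runit_iso

lemma tens_arr' [simp]: "f \<in> Arr V \<Longrightarrow> g \<in> Arr V \<Longrightarrow> f \<odot> g \<in> Arr V"
  and dom_tens [simp]: "f \<in> Arr V \<Longrightarrow> g \<in> Arr V \<Longrightarrow> Dom V (f \<odot> g) = Dom V f \<otimes> Dom V g"
  and cod_tens [simp]: "f \<in> Arr V \<Longrightarrow> g \<in> Arr V \<Longrightarrow> Cod V (f \<odot> g) = Cod V f \<otimes> Cod V g"
  using tens_arr[of f "Dom V f" "Cod V f" g "Dom V g" "Cod V g"] by (auto simp: Hom_iff)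

lemma tens_idt' [simp]: "a \<in> Ob V \<Longrightarrow> b \<in> Ob V \<Longrightarrow> \<iota> a \<odot> \<iota> b = \<iota> (a \<otimes> b)"
  by (rule tens_idt)

lemma assc_arr [simp]: "a \<in> Ob V \<Longrightarrow> b \<in> Ob V \<Longrightarrow> c \<in> Ob V \<Longrightarrow> assc V a b c \<in> Arr V"
  and dom_assc [simp]: "a \<in> Ob V \<Longrightarrow> b \<in> Ob V \<Longrightarrow> c \<in> Ob V \<Longrightarrow> Dom V (assc V a b c) = (a \<otimes> b) \<otimes> c"
  and cod_assc [simp]: "a \<in> Ob V \<Longrightarrow> b \<in> Ob V \<Longrightarrow> c \<in> Ob V \<Longrightarrow> Cod V (assc V a b c) = a \<otimes> (b \<otimes> c)"
  and lunit_arr [simp]: "a \<in> Ob V \<Longrightarrow> lunit V a \<in> Arr V"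
  and dom_lunit [simp]: "a \<in> Ob V \<Longrightarrow> Dom V (lunit V a) = \<I> \<otimes> a"
  and cod_lunit [simp]: "a \<in> Ob V \<Longrightarrow> Cod V (lunit V a) = a"
  and runit_arr [simp]: "a \<in> Ob V \<Longrightarrow> runit V a \<in> Arr V"
  and dom_runit [simp]: "a \<in> Ob V \<Longrightarrow> Dom V (runit V a) = a \<otimes> \<I>"
  and cod_runit [simp]: "a \<in> Ob V \<Longrightarrow> Cod V (runit V a) = a"
  and symm_arr [simp]: "a \<in> Ob V \<Longrightarrow> b \<in> Ob V \<Longrightarrow> symm V a b \<in> Arr V"
  and dom_symm [simp]: "a \<in> Ob V \<Longrightarrow> b \<in> Ob V \<Longrightarrow> Dom V (symm V a b) = a \<otimes> b"
  and cod_symm [simp]: "a \<in> Ob V \<Longrightarrow> b \<in> Ob V \<Longrightarrow> Cod V (symm V a b) = b \<otimes> a"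
  and ev_arr [simp]: "a \<in> Ob V \<Longrightarrow> b \<in> Ob V \<Longrightarrow> ev V a b \<in> Arr V"
  and dom_ev [simp]: "a \<in> Ob V \<Longrightarrow> b \<in> Ob V \<Longrightarrow> Dom V (ev V a b) = ihom V a b \<otimes> a"
  and cod_ev [simp]: "a \<in> Ob V \<Longrightarrow> b \<in> Ob V \<Longrightarrow> Cod V (ev V a b) = b"
  using assc_hom lunit_hom runit_hom symm_hom ev_hom by (auto simp: Hom_iff)

text \<open>The simplifier associates composites to the right and merges adjacent tensor products.\<close>

lemma tens_merge [simp]: "f \<in> Arr V \<Longrightarrow> g \<in> Arr V \<Longrightarrow> f' \<in> Arr V \<Longrightarrow> g' \<in> Arr V \<Longrightarrow>
    Dom V g = Cod V f \<Longrightarrow> Dom V g' = Cod V f' \<Longrightarrow> (g \<odot> g') \<cdot> (f \<odot> f') = (g \<cdot> f) \<odot> (g' \<cdot> f')"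
  using tens_cmp[of f "Dom V f" "Cod V f" g "Cod V g" f' "Dom V f'" "Cod V f'" g' "Cod V g'"]
  by (auto simp: Hom_iff)

lemma tens_merge' [simp]: "f \<in> Arr V \<Longrightarrow> g \<in> Arr V \<Longrightarrow> f' \<in> Arr V \<Longrightarrow> g' \<in> Arr V \<Longrightarrow> h \<in> Arr V \<Longrightarrow>
    Dom V g = Cod V f \<Longrightarrow> Dom V g' = Cod V f' \<Longrightarrow> Cod V h = Dom V f \<otimes> Dom V f' \<Longrightarrow>
    (g \<odot> g') \<cdot> ((f \<odot> f') \<cdot> h) = ((g \<cdot> f) \<odot> (g' \<cdot> f')) \<cdot> h"
  by (simp add: cmp_assoc'[symmetric] del: cmp_assoc')

lemma tens_iso [simp]: "is_iso V f \<Longrightarrow> is_iso V g \<Longrightarrow> is_iso V (f \<odot> g)"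
  using iso_arr[of f] iso_arr[of g]
  by (intro is_isoI[of _ "Dom V f \<otimes> Dom V g" "Cod V f \<otimes> Cod V g" "invV f \<odot> invV g"])
     (auto simp: Hom_iff)

lemma idt_iso [simp]: "a \<in> Ob V \<Longrightarrow> is_iso V (\<iota> a)"
  by (rule is_isoI[of _ a a "\<iota> a"]) (auto simp: Hom_iff)

lemma symm_iso [simp]: "a \<in> Ob V \<Longrightarrow> b \<in> Ob V \<Longrightarrow> is_iso V (symm V a b)"
  by (rule is_isoI[of _ "a \<otimes> b" "b \<otimes> a" "symm V b a"]) (auto simp: Hom_iff symm_symm)

lemma assc_nat: "f \<in> Arr V \<Longrightarrow> g \<in> Arr V \<Longrightarrow> h \<in> Arr V \<Longrightarrow> a = Cod V f \<Longrightarrow> b = Cod V g \<Longrightarrow> c = Cod V h \<Longrightarrow>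
    assc V a b c \<cdot> ((f \<odot> g) \<odot> h) = (f \<odot> (g \<odot> h)) \<cdot> assc V (Dom V f) (Dom V g) (Dom V h)"
  using assc_natural by (auto simp: Hom_iff)

lemma lunit_nat: "f \<in> Arr V \<Longrightarrow> b = Cod V f \<Longrightarrow> lunit V b \<cdot> (\<iota> \<I> \<odot> f) = f \<cdot> lunit V (Dom V f)"
  and runit_nat: "f \<in> Arr V \<Longrightarrow> b = Cod V f \<Longrightarrow> runit V b \<cdot> (f \<odot> \<iota> \<I>) = f \<cdot> runit V (Dom V f)"
  and symm_nat: "f \<in> Arr V \<Longrightarrow> g \<in> Arr V \<Longrightarrow> a = Cod V f \<Longrightarrow> b = Cod V g \<Longrightarrow>
    symm V a b \<cdot> (f \<odot> g) = (g \<odot> f) \<cdot> symm V (Dom V f) (Dom V g)"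
  using lunit_natural runit_natural symm_natural by (auto simp: Hom_iff)

lemma inv_nat:
  assumes "p \<in> Arr V" "q \<in> Arr V" "is_iso V p" "is_iso V q" "f \<in> Arr V" "g \<in> Arr V" "q \<cdot> g = f \<cdot> p"
    "Cod V g = Dom V q" "Dom V g = Dom V p" "Dom V f = Cod V p" "Cod V f = Cod V q"
  shows "invV q \<cdot> f = g \<cdot> invV p"
proof -
  have "f = (f \<cdot> p) \<cdot> invV p" using assms(1-6,8-) by simp
  also have "\<dots> = q \<cdot> (g \<cdot> invV p)" using assms(1-6,8-) unfolding assms(7)[symmetric] by simp
  finally have "invV q \<cdot> f = invV q \<cdot> (q \<cdot> (g \<cdot> invV p))" by simp
  also have "\<dots> = g \<cdot> invV p" using assms(1-6,8-) by simp
  finally show ?thesis .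
qed

lemma assc_inv_nat: "f \<in> Arr V \<Longrightarrow> g \<in> Arr V \<Longrightarrow> h \<in> Arr V \<Longrightarrow> a = Cod V f \<Longrightarrow> b = Cod V g \<Longrightarrow> c = Cod V h \<Longrightarrow>
    invV (assc V a b c) \<cdot> (f \<odot> (g \<odot> h)) =
    ((f \<odot> g) \<odot> h) \<cdot> invV (assc V (Dom V f) (Dom V g) (Dom V h))"
  by (rule inv_nat) (auto simp: assc_nat)

lemma lunit_inv_nat: "f \<in> Arr V \<Longrightarrow> b = Cod V f \<Longrightarrow>
    invV (lunit V b) \<cdot> f = (\<iota> \<I> \<odot> f) \<cdot> invV (lunit V (Dom V f))"
  by (rule inv_nat) (auto simp: lunit_nat)

lemma runit_inv_nat: "f \<in> Arr V \<Longrightarrow> b = Cod V f \<Longrightarrow>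
    invV (runit V b) \<cdot> f = (f \<odot> \<iota> \<I>) \<cdot> invV (runit V (Dom V f))"
  by (rule inv_nat) (auto simp: runit_nat)

text \<open>The left unitor is a natural isomorphism from \<open>\<I> \<otimes> -\<close> to the
  identity. Hence an equation between structure isomorphisms may be proved after tensoring with
  \<open>\<I>\<close>, where pentagon and triangle become applicable.\<close>

lemma tens_unit_left_faithful: "f \<in> Arr V \<Longrightarrow> g \<in> Arr V \<Longrightarrow> Dom V f = Dom V g \<Longrightarrow> Cod V f = Cod V g \<Longrightarrow>
    \<iota> \<I> \<odot> f = \<iota> \<I> \<odot> g \<Longrightarrow> f = g"
proof -
  assume a: "f \<in> Arr V" "g \<in> Arr V" "Dom V f = Dom V g" "Cod V f = Cod V g" "\<iota> \<I> \<odot> f = \<iota> \<I> \<odot> g"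
  have "f \<cdot> lunit V (Dom V g) = lunit V (Cod V g) \<cdot> (\<iota> \<I> \<odot> f)" using a(1-4) by (simp add: lunit_nat)
  also have "\<dots> = g \<cdot> lunit V (Dom V g)" unfolding a(5) using a(1-4) by (simp add: lunit_nat)
  finally show "f = g" by (rule iso_epi[rotated -1]) (simp_all add: a(1-4))
qed

lemma tens_unit_right_faithful: "f \<in> Arr V \<Longrightarrow> g \<in> Arr V \<Longrightarrow> Dom V f = Dom V g \<Longrightarrow> Cod V f = Cod V g \<Longrightarrow>
    f \<odot> \<iota> \<I> = g \<odot> \<iota> \<I> \<Longrightarrow> f = g"
proof -
  assume a: "f \<in> Arr V" "g \<in> Arr V" "Dom V f = Dom V g" "Cod V f = Cod V g" "f \<odot> \<iota> \<I> = g \<odot> \<iota> \<I>"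
  have "f \<cdot> runit V (Dom V g) = runit V (Cod V g) \<cdot> (f \<odot> \<iota> \<I>)" using a(1-4) by (simp add: runit_nat)
  also have "\<dots> = g \<cdot> runit V (Dom V g)" unfolding a(5) using a(1-4) by (simp add: runit_nat)
  finally show "f = g" by (rule iso_epi[rotated -1]) (simp_all add: a(1-4))
qed

text \<open>Kelly's argument: tensored with \<open>\<I>\<close> on the left, the equation follows
  from the pentagon at \<open>\<I>, \<I>, a, b\<close>, the triangle and naturality of the
  associator.\<close>

lemma lunit_tens:
  assumes [simp]: "a \<in> Ob V" "b \<in> Ob V"
  shows "lunit V (a \<otimes> b) \<cdot> assc V \<I> a b = lunit V a \<odot> \<iota> b"
proof (rule tens_unit_left_faithful)
  \<comment> \<open>An isomorphism common to both sides, cancelled at the end.\<close>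
  let ?X = "assc V \<I> (\<I> \<otimes> a) b \<cdot> (assc V \<I> \<I> a \<odot> \<iota> b)"
  have "(\<iota> \<I> \<odot> (lunit V (a \<otimes> b) \<cdot> assc V \<I> a b)) \<cdot> ?X =
      (\<iota> \<I> \<odot> lunit V (a \<otimes> b)) \<cdot> ((\<iota> \<I> \<odot> assc V \<I> a b) \<cdot> ?X)" by simp
  also have "\<dots> = (\<iota> \<I> \<odot> lunit V (a \<otimes> b)) \<cdot> (assc V \<I> \<I> (a \<otimes> b) \<cdot> assc V (\<I> \<otimes> \<I>) a b)"
    using pentagon[of \<I> \<I> a b] by simp
  also have "\<dots> = ((\<iota> \<I> \<odot> lunit V (a \<otimes> b)) \<cdot> assc V \<I> \<I> (a \<otimes> b)) \<cdot> assc V (\<I> \<otimes> \<I>) a b" by simp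
  also have "\<dots> = (runit V \<I> \<odot> (\<iota> a \<odot> \<iota> b)) \<cdot> assc V (\<I> \<otimes> \<I>) a b"
    using triangle[of \<I> "a \<otimes> b"] by simp
  also have "\<dots> = assc V \<I> a b \<cdot> ((runit V \<I> \<odot> \<iota> a) \<odot> \<iota> b)"
    by (subst assc_nat) auto
  also have "\<dots> = assc V \<I> a b \<cdot> (((\<iota> \<I> \<odot> lunit V a) \<odot> \<iota> b) \<cdot> (assc V \<I> \<I> a \<odot> \<iota> b))"
    using triangle[of \<I> a] by simp
  also have "\<dots> = (assc V \<I> a b \<cdot> ((\<iota> \<I> \<odot> lunit V a) \<odot> \<iota> b)) \<cdot> (assc V \<I> \<I> a \<odot> \<iota> b)" by simp
  also have "\<dots> = (\<iota> \<I> \<odot> (lunit V a \<odot> \<iota> b)) \<cdot> ?X"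
    by (subst assc_nat) auto
  finally show "\<iota> \<I> \<odot> (lunit V (a \<otimes> b) \<cdot> assc V \<I> a b) = \<iota> \<I> \<odot> (lunit V a \<odot> \<iota> b)"
    by (rule iso_epi[of ?X, rotated -1]) (auto intro: iso_cmp)
qed auto

text \<open>The mirror image of the preceding argument: tensor with \<open>\<I>\<close> on the right
  and use the pentagon at \<open>a, b, \<I>, \<I>\<close>.\<close>

lemma runit_tens:
  assumes [simp]: "a \<in> Ob V" "b \<in> Ob V"
  shows "runit V (a \<otimes> b) = (\<iota> a \<odot> runit V b) \<cdot> assc V a b \<I>"
proof (rule tens_unit_right_faithful)
  have "assc V a b \<I> \<cdot> (runit V (a \<otimes> b) \<odot> \<iota> \<I>) =
      (assc V a b \<I> \<cdot> ((\<iota> a \<odot> \<iota> b) \<odot> lunit V \<I>)) \<cdot> assc V (a \<otimes> b) \<I> \<I>"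
    using triangle[of "a \<otimes> b" \<I>] by simp
  also have "\<dots> = (\<iota> a \<odot> (\<iota> b \<odot> lunit V \<I>)) \<cdot> (assc V a b (\<I> \<otimes> \<I>) \<cdot> assc V (a \<otimes> b) \<I> \<I>)"
    by (subst assc_nat) auto
  also have "\<dots> = (\<iota> a \<odot> ((\<iota> b \<odot> lunit V \<I>) \<cdot> assc V b \<I> \<I>)) \<cdot> assc V a (b \<otimes> \<I>) \<I> \<cdot> (assc V a b \<I> \<odot> \<iota> \<I>)"
    by (subst pentagon) auto
  also have "\<dots> = ((\<iota> a \<odot> (runit V b \<odot> \<iota> \<I>)) \<cdot> assc V a (b \<otimes> \<I>) \<I>) \<cdot> (assc V a b \<I> \<odot> \<iota> \<I>)"
    by (subst triangle) auto
  also have "\<dots> = (assc V a b \<I> \<cdot> ((\<iota> a \<odot> runit V b) \<odot> \<iota> \<I>)) \<cdot> (assc V a b \<I> \<odot> \<iota> \<I>)"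
    by (subst assc_nat) auto
  also have "\<dots> = assc V a b \<I> \<cdot> (((\<iota> a \<odot> runit V b) \<cdot> assc V a b \<I>) \<odot> \<iota> \<I>)" by simp
  finally show "runit V (a \<otimes> b) \<odot> \<iota> \<I> = ((\<iota> a \<odot> runit V b) \<cdot> assc V a b \<I>) \<odot> \<iota> \<I>"
    by (rule iso_mono[rotated -1]) auto
qed auto

text \<open>Naturality of the left unitor at itself identifies
  \<open>lunit V (\<I> \<otimes> \<I>)\<close> with
  \<open>\<iota> \<I> \<odot> lunit V \<I>\<close>; after that \<open>lunit_tens\<close> and the
  triangle express both unitors, tensored with \<open>\<I>\<close>, by the same composite.\<close>

lemma runit_unit: "runit V \<I> = lunit V \<I>"
proof (rule tens_unit_right_faithful)
  have "lunit V \<I> \<cdot> lunit V (\<I> \<otimes> \<I>) = lunit V \<I> \<cdot> (\<iota> \<I> \<odot> lunit V \<I>)" by (subst lunit_nat) auto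
  then have "lunit V (\<I> \<otimes> \<I>) = \<iota> \<I> \<odot> lunit V \<I>" by (rule iso_mono[rotated -1]) auto
  then show "runit V \<I> \<odot> \<iota> \<I> = lunit V \<I> \<odot> \<iota> \<I>"
    using lunit_tens[of \<I> \<I>] triangle[of \<I> \<I>] by simp
qed auto

text \<open>No axiom relates the symmetry to the unitors directly. The relation is forced by the
  hexagon at \<open>a, \<I>, \<I>\<close>, in which one occurrence of \<open>symm V a \<I>\<close>
  can be cancelled.\<close>

lemma lunit_symm:
  assumes [simp]: "a \<in> Ob V"
  shows "lunit V a \<cdot> symm V a \<I> = runit V a"
proof (rule tens_unit_right_faithful)
  have "symm V a \<I> \<cdot> (runit V a \<odot> \<iota> \<I>) = symm V a \<I> \<cdot> ((\<iota> a \<odot> lunit V \<I>) \<cdot> assc V a \<I> \<I>)"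
    by (simp add: triangle)
  also have "\<dots> = (symm V a \<I> \<cdot> (\<iota> a \<odot> lunit V \<I>)) \<cdot> assc V a \<I> \<I>" by simp
  also have "\<dots> = (lunit V \<I> \<odot> \<iota> a) \<cdot> (symm V a (\<I> \<otimes> \<I>) \<cdot> assc V a \<I> \<I>)" by (subst symm_nat) auto
  also have "\<dots> = lunit V (\<I> \<otimes> a) \<cdot> (assc V \<I> \<I> a \<cdot> symm V a (\<I> \<otimes> \<I>) \<cdot> assc V a \<I> \<I>)"
    by (subst lunit_tens[symmetric]) auto
  also have "\<dots> = (lunit V (\<I> \<otimes> a) \<cdot> (\<iota> \<I> \<odot> symm V a \<I>)) \<cdot> assc V \<I> a \<I> \<cdot> (symm V a \<I> \<odot> \<iota> \<I>)"
    by (subst hexagon) auto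
  also have "\<dots> = symm V a \<I> \<cdot> ((lunit V (a \<otimes> \<I>) \<cdot> assc V \<I> a \<I>) \<cdot> (symm V a \<I> \<odot> \<iota> \<I>))"
    by (subst lunit_nat) auto
  also have "\<dots> = symm V a \<I> \<cdot> ((lunit V a \<cdot> symm V a \<I>) \<odot> \<iota> \<I>)" by (subst lunit_tens) auto
  finally have "runit V a \<odot> \<iota> \<I> = (lunit V a \<cdot> symm V a \<I>) \<odot> \<iota> \<I>"
    by (rule iso_mono[rotated -1]) auto
  then show "(lunit V a \<cdot> symm V a \<I>) \<odot> \<iota> \<I> = runit V a \<odot> \<iota> \<I>" ..
qed auto

lemma runit_symm:
  assumes [simp]: "a \<in> Ob V"
  shows "runit V a \<cdot> symm V \<I> a = lunit V a"
  using arg_cong[OF lunit_symm[of a], of "\<lambda>h. h \<cdot> symm V \<I> a"] by (simp add: symm_symm)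

text \<open>The hexagon axiom describes the symmetry with a tensor product in the second place;
  inverting it gives the other hexagon, since each symmetry is inverse to the opposite one.\<close>

lemma symm_tens:
  assumes [simp]: "x \<in> Ob V" "y \<in> Ob V" "z \<in> Ob V"
  shows "symm V (x \<otimes> y) z =
    assc V z x y \<cdot> (symm V x z \<odot> \<iota> y) \<cdot> invV (assc V x z y) \<cdot> (\<iota> x \<odot> symm V y z) \<cdot> assc V x y z"
proof (rule iso_mono[of "assc V x y z \<cdot> symm V z (x \<otimes> y)"])
  have "(assc V x y z \<cdot> symm V z (x \<otimes> y)) \<cdot> assc V z x y \<cdot> (symm V x z \<odot> \<iota> y) \<cdot> invV (assc V x z y)
      \<cdot> (\<iota> x \<odot> symm V y z) \<cdot> assc V x y z =
    (assc V x y z \<cdot> symm V z (x \<otimes> y) \<cdot> assc V z x y) \<cdot> (symm V x z \<odot> \<iota> y) \<cdot> invV (assc V x z y)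
      \<cdot> (\<iota> x \<odot> symm V y z) \<cdot> assc V x y z" by simp
  also have "\<dots> = assc V x y z" by (subst hexagon) (auto simp: symm_symm)
  finally show "(assc V x y z \<cdot> symm V z (x \<otimes> y)) \<cdot> symm V (x \<otimes> y) z =
     (assc V x y z \<cdot> symm V z (x \<otimes> y)) \<cdot> assc V z x y \<cdot> (symm V x z \<odot> \<iota> y) \<cdot> invV (assc V x z y)
      \<cdot> (\<iota> x \<odot> symm V y z) \<cdot> assc V x y z" by (simp add: symm_symm)
qed (auto intro: iso_cmp)

text \<open>Both sides reverse the order of three factors. This is the identity behind associativity
  of composition in the opposite of an enriched category.\<close>

lemma symm_hexagon:
  assumes [simp]: "x \<in> Ob V" "y \<in> Ob V" "z \<in> Ob V"
  shows "(\<iota> z \<odot> symm V x y) \<cdot> symm V (x \<otimes> y) z =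
    assc V z y x \<cdot> (symm V y z \<odot> \<iota> x) \<cdot> symm V x (y \<otimes> z) \<cdot> assc V x y z"
proof -
  have "invV (assc V y z x) \<cdot> (assc V y z x \<cdot> symm V x (y \<otimes> z) \<cdot> assc V x y z) =
     invV (assc V y z x) \<cdot> ((\<iota> y \<odot> symm V x z) \<cdot> assc V y x z \<cdot> (symm V x y \<odot> \<iota> z))"
    by (subst hexagon) auto
  then have h: "symm V x (y \<otimes> z) \<cdot> assc V x y z =
     invV (assc V y z x) \<cdot> ((\<iota> y \<odot> symm V x z) \<cdot> assc V y x z \<cdot> (symm V x y \<odot> \<iota> z))" by simp
  have "(\<iota> z \<odot> symm V x y) \<cdot> symm V (x \<otimes> y) z = symm V (y \<otimes> x) z \<cdot> (symm V x y \<odot> \<iota> z)"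
    by (subst symm_nat) auto
  also have "\<dots> = assc V z y x \<cdot> (symm V y z \<odot> \<iota> x) \<cdot> invV (assc V y z x) \<cdot> (\<iota> y \<odot> symm V x z) \<cdot>
     assc V y x z \<cdot> (symm V x y \<odot> \<iota> z)" by (simp add: symm_tens)
  finally show ?thesis by (simp add: h)
qed

section \<open>Strictification of the tensor product\<close>

text \<open>Bracketed to the right and closed by the unit, so \<open>\<T> [x]\<close> is
  \<open>x \<otimes> \<I>\<close> and not \<open>x\<close>. This is the origin of most right unitors
  in later formulas.\<close>

fun tensor_list ("\<T>") where
  "\<T> [] = \<I>"
| "\<T> (x # xs) = x \<otimes> \<T> xs"

text \<open>The coherence isomorphism from \<open>\<T> (xs @ ys)\<close> to
  \<open>\<T> xs \<otimes> \<T> ys\<close>. It points into the tensor product because it is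
  precomposed to \<open>g \<odot> f\<close> whenever two graded arrows are composed.\<close>

fun psi where
  "psi [] ys = invV (lunit V (\<T> ys))"
| "psi (x # xs) ys = invV (assc V x (\<T> xs) (\<T> ys)) \<cdot> (\<iota> x \<odot> psi xs ys)"

fun lwhisker where
  "lwhisker [] u = u"
| "lwhisker (t # ts) u = \<iota> t \<odot> lwhisker ts u"

text \<open>A right-bracketed tensor product cannot be extended on the right by recursion, so
  \<open>u \<odot> \<iota> (\<T> ys)\<close> is conjugated with \<open>psi\<close>. The lists are
  arguments because \<open>psi\<close> depends on them and not only on their tensor
  products.\<close>

definition rwhisker where
  "rwhisker xs xs' ys u = invV (psi xs' ys) \<cdot> (u \<odot> \<iota> (\<T> ys)) \<cdot> psi xs ys"

lemma tensor_list [simp]: "set xs \<subseteq> Ob V \<Longrightarrow> \<T> xs \<in> Ob V"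
  by (induction xs) auto

lemma psi_arr_aux: "set xs \<subseteq> Ob V \<Longrightarrow> set ys \<subseteq> Ob V \<Longrightarrow>
   psi xs ys \<in> Arr V \<and> Dom V (psi xs ys) = \<T> (xs @ ys) \<and> Cod V (psi xs ys) = \<T> xs \<otimes> \<T> ys \<and> is_iso V (psi xs ys)"
  by (induction xs) (auto intro!: iso_cmp)

lemma psi_arr [simp]: "set xs \<subseteq> Ob V \<Longrightarrow> set ys \<subseteq> Ob V \<Longrightarrow> psi xs ys \<in> Arr V"
  and dom_psi [simp]: "set xs \<subseteq> Ob V \<Longrightarrow> set ys \<subseteq> Ob V \<Longrightarrow> Dom V (psi xs ys) = \<T> (xs @ ys)"
  and cod_psi [simp]: "set xs \<subseteq> Ob V \<Longrightarrow> set ys \<subseteq> Ob V \<Longrightarrow> Cod V (psi xs ys) = \<T> xs \<otimes> \<T> ys"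
  and psi_iso [simp]: "set xs \<subseteq> Ob V \<Longrightarrow> set ys \<subseteq> Ob V \<Longrightarrow> is_iso V (psi xs ys)"
  using psi_arr_aux by auto

lemma psi_Nil_right: "set xs \<subseteq> Ob V \<Longrightarrow> psi xs [] = invV (runit V (\<T> xs))"
proof (induction xs)
  case Nil
  then show ?case by (simp add: runit_unit)
next
  case (Cons x xs)
  have "invV ((\<iota> x \<odot> runit V (\<T> xs)) \<cdot> assc V x (\<T> xs) \<I>) = invV (assc V x (\<T> xs) \<I>) \<cdot> (\<iota> x \<odot> invV (runit V (\<T> xs)))"
    using Cons.prems by (intro inverse_arr_eq) (auto simp: is_inverse_def Hom_iff)
  then show ?case using Cons by (simp add: runit_tens)
qed

text \<open>The coherence statement that makes composition of graded arrows strictly associative.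
  For the empty list it is \<open>lunit_tens\<close> with naturality of the unitor; the induction
  step is the pentagon at the head of \<open>xs\<close>.\<close>

lemma psi_assoc: "set xs \<subseteq> Ob V \<Longrightarrow> set ys \<subseteq> Ob V \<Longrightarrow> set zs \<subseteq> Ob V \<Longrightarrow>
  assc V (\<T> xs) (\<T> ys) (\<T> zs) \<cdot> (psi xs ys \<odot> \<iota> (\<T> zs)) \<cdot> psi (xs @ ys) zs = (\<iota> (\<T> xs) \<odot> psi ys zs) \<cdot> psi xs (ys @ zs)"
proof (induction xs)
  case Nil
  have 1: "assc V \<I> (\<T> ys) (\<T> zs) \<cdot> (invV (lunit V (\<T> ys)) \<odot> \<iota> (\<T> zs)) = invV (lunit V (\<T> ys \<otimes> \<T> zs))"
    (is "?L = ?R")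
  proof (rule iso_mono)
    show "lunit V (\<T> ys \<otimes> \<T> zs) \<cdot> ?L = lunit V (\<T> ys \<otimes> \<T> zs) \<cdot> ?R"
      using Nil lunit_tens[of "\<T> ys" "\<T> zs"] cmp_assoc'[of "invV (lunit V (\<T> ys)) \<odot> \<iota> (\<T> zs)" "assc V \<I> (\<T> ys) (\<T> zs)" "lunit V (\<T> ys \<otimes> \<T> zs)"]
      by (simp del: cmp_assoc')
  qed (use Nil in auto)
  have "assc V \<I> (\<T> ys) (\<T> zs) \<cdot> (invV (lunit V (\<T> ys)) \<odot> \<iota> (\<T> zs)) \<cdot> psi ys zs =
    (assc V \<I> (\<T> ys) (\<T> zs) \<cdot> (invV (lunit V (\<T> ys)) \<odot> \<iota> (\<T> zs))) \<cdot> psi ys zs" using Nil by simp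
  also have "\<dots> = (\<iota> \<I> \<odot> psi ys zs) \<cdot> invV (lunit V (\<T> (ys @ zs)))" using Nil unfolding 1
    by (subst lunit_inv_nat) auto
  finally show ?case by simp
next
  case (Cons x xs)
  let ?X = "\<T> xs" and ?Y = "\<T> ys" and ?Z = "\<T> zs"
  have [simp]: "x \<in> Ob V" "?X \<in> Ob V" "?Y \<in> Ob V" "?Z \<in> Ob V" "set xs \<subseteq> Ob V" "set ys \<subseteq> Ob V" "set zs \<subseteq> Ob V"
    using Cons.prems by auto
  let ?A = "(\<iota> x \<odot> assc V ?X ?Y ?Z) \<cdot> assc V x (?X \<otimes> ?Y) ?Z"
  \<comment> \<open>The pentagon with two of its associators moved across.\<close>
  have P: "assc V (x \<otimes> ?X) ?Y ?Z \<cdot> (invV (assc V x ?X ?Y) \<odot> \<iota> ?Z) = invV (assc V x ?X (?Y \<otimes> ?Z)) \<cdot> ?A"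
    (is "?L = ?R")
  proof (rule iso_mono)
    have "assc V x ?X (?Y \<otimes> ?Z) \<cdot> ?L = (assc V x ?X (?Y \<otimes> ?Z) \<cdot> assc V (x \<otimes> ?X) ?Y ?Z) \<cdot> (invV (assc V x ?X ?Y) \<odot> \<iota> ?Z)"
      by simp
    also have "\<dots> = ?A" by (subst pentagon) auto
    finally show "assc V x ?X (?Y \<otimes> ?Z) \<cdot> ?L = assc V x ?X (?Y \<otimes> ?Z) \<cdot> ?R" by simp
  qed auto
  have "assc V (x \<otimes> ?X) ?Y ?Z \<cdot> (psi (x # xs) ys \<odot> \<iota> ?Z) \<cdot> psi ((x # xs) @ ys) zs =
    (assc V (x \<otimes> ?X) ?Y ?Z \<cdot> (invV (assc V x ?X ?Y) \<odot> \<iota> ?Z)) \<cdot> (((\<iota> x \<odot> psi xs ys) \<odot> \<iota> ?Z) \<cdot>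
     invV (assc V x (\<T> (xs @ ys)) ?Z)) \<cdot> (\<iota> x \<odot> psi (xs @ ys) zs)" by simp
  also have "((\<iota> x \<odot> psi xs ys) \<odot> \<iota> ?Z) \<cdot> invV (assc V x (\<T> (xs @ ys)) ?Z) =
    invV (assc V x (?X \<otimes> ?Y) ?Z) \<cdot> (\<iota> x \<odot> (psi xs ys \<odot> \<iota> ?Z))" by (subst assc_inv_nat) auto
  also note P
  also have "(invV (assc V x ?X (?Y \<otimes> ?Z)) \<cdot> ?A) \<cdot> (invV (assc V x (?X \<otimes> ?Y) ?Z) \<cdot> (\<iota> x \<odot> (psi xs ys \<odot> \<iota> ?Z))) \<cdot> (\<iota> x \<odot> psi (xs @ ys) zs) =
    invV (assc V x ?X (?Y \<otimes> ?Z)) \<cdot> (\<iota> x \<odot> (assc V ?X ?Y ?Z \<cdot> (psi xs ys \<odot> \<iota> ?Z) \<cdot> psi (xs @ ys) zs))" by simp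
  also have "\<dots> = invV (assc V x ?X (?Y \<otimes> ?Z)) \<cdot> ((\<iota> x \<odot> (\<iota> ?X \<odot> psi ys zs)) \<cdot> (\<iota> x \<odot> psi xs (ys @ zs)))"
    by (subst Cons.IH) auto
  also have "\<dots> = (invV (assc V x ?X (?Y \<otimes> ?Z)) \<cdot> (\<iota> x \<odot> (\<iota> ?X \<odot> psi ys zs))) \<cdot> (\<iota> x \<odot> psi xs (ys @ zs))"
    by (simp del: tens_merge tens_merge')
  also have "\<dots> = (\<iota> (\<T> (x # xs)) \<odot> psi ys zs) \<cdot> psi (x # xs) (ys @ zs)" by (subst assc_inv_nat) auto
  finally show ?case by simp
qed

lemma lwhisker_arr_aux: "u \<in> Arr V \<Longrightarrow> Dom V u = \<T> xs \<Longrightarrow> Cod V u = \<T> ys \<Longrightarrow> set ts \<subseteq> Ob V \<Longrightarrow>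
   lwhisker ts u \<in> Arr V \<and> Dom V (lwhisker ts u) = \<T> (ts @ xs) \<and> Cod V (lwhisker ts u) = \<T> (ts @ ys)"
  by (induction ts) auto

lemma lwhisker_hom: "u \<in> Hom V (\<T> xs) (\<T> ys) \<Longrightarrow> set ts \<subseteq> Ob V \<Longrightarrow> lwhisker ts u \<in> Hom V (\<T> (ts @ xs)) (\<T> (ts @ ys))"
  using lwhisker_arr_aux by (auto simp: Hom_iff)

lemma rwhisker_hom: "u \<in> Hom V (\<T> xs) (\<T> xs') \<Longrightarrow> set xs \<subseteq> Ob V \<Longrightarrow> set xs' \<subseteq> Ob V \<Longrightarrow> set ys \<subseteq> Ob V \<Longrightarrow>
   rwhisker xs xs' ys u \<in> Hom V (\<T> (xs @ ys)) (\<T> (xs' @ ys))"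
  by (auto simp: rwhisker_def Hom_iff)

lemma lwhisker_append: "lwhisker (ts @ ts') u = lwhisker ts (lwhisker ts' u)"
  by (induction ts) auto

lemma psi_lwhisker: "u \<in> Hom V (\<T> xs) (\<T> ys) \<Longrightarrow> set ts \<subseteq> Ob V \<Longrightarrow> set xs \<subseteq> Ob V \<Longrightarrow> set ys \<subseteq> Ob V \<Longrightarrow>
   psi ts ys \<cdot> lwhisker ts u = (\<iota> (\<T> ts) \<odot> u) \<cdot> psi ts xs"
proof (induction ts)
  case Nil
  then show ?case using lunit_inv_nat[of u "\<T> ys"] by (auto simp: Hom_iff)
next
  case (Cons t ts)
  note [simp] = Cons.prems
  have u[simp]: "u \<in> Arr V" "Dom V u = \<T> xs" "Cod V u = \<T> ys" using Cons.prems by (auto simp: Hom_iff)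
  have t[simp]: "t \<in> Ob V" "set ts \<subseteq> Ob V" using Cons.prems by auto
  have [simp]: "lwhisker ts u \<in> Arr V" "Dom V (lwhisker ts u) = \<T> (ts @ xs)" "Cod V (lwhisker ts u) = \<T> (ts @ ys)"
    using lwhisker_arr_aux[of u xs ys ts] by auto
  have "psi (t # ts) ys \<cdot> lwhisker (t # ts) u = invV (assc V t (\<T> ts) (\<T> ys)) \<cdot> (\<iota> t \<odot> (psi ts ys \<cdot> lwhisker ts u))"
    by simp
  also have "\<dots> = invV (assc V t (\<T> ts) (\<T> ys)) \<cdot> (\<iota> t \<odot> (\<iota> (\<T> ts) \<odot> u)) \<cdot> (\<iota> t \<odot> psi ts xs)"
    using Cons.IH by simp
  also have "\<dots> = (invV (assc V t (\<T> ts) (\<T> ys)) \<cdot> (\<iota> t \<odot> (\<iota> (\<T> ts) \<odot> u))) \<cdot> (\<iota> t \<odot> psi ts xs)"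
    by (simp del: tens_merge tens_merge')
  also have "\<dots> = (\<iota> (\<T> (t # ts)) \<odot> u) \<cdot> psi (t # ts) xs" by (subst assc_inv_nat) auto
  finally show ?case .
qed

lemma psi_rwhisker: "u \<in> Hom V (\<T> xs) (\<T> xs') \<Longrightarrow> set xs \<subseteq> Ob V \<Longrightarrow> set xs' \<subseteq> Ob V \<Longrightarrow> set ys \<subseteq> Ob V \<Longrightarrow>
   psi xs' ys \<cdot> rwhisker xs xs' ys u = (u \<odot> \<iota> (\<T> ys)) \<cdot> psi xs ys"
  by (auto simp: rwhisker_def Hom_iff)

text \<open>Since \<open>psi xs' ys\<close> is invertible, the naturality square pins down the
  whiskered arrow; the rules below only exhibit an arrow that makes the square commute.\<close>

lemma rwhisker_unique:
  assumes "u \<in> Hom V (\<T> xs) (\<T> xs')" "set xs \<subseteq> Ob V" "set xs' \<subseteq> Ob V" "set ys \<subseteq> Ob V"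
    "v \<in> Hom V (\<T> (xs @ ys)) (\<T> (xs' @ ys))" "psi xs' ys \<cdot> v = (u \<odot> \<iota> (\<T> ys)) \<cdot> psi xs ys"
  shows "rwhisker xs xs' ys u = v"
proof -
  have "psi xs' ys \<cdot> rwhisker xs xs' ys u = psi xs' ys \<cdot> v" unfolding assms(6) by (rule psi_rwhisker[OF assms(1-4)])
  then show ?thesis
    by (rule iso_mono[rotated -1]) (use rwhisker_hom[OF assms(1-4)] assms(2-5) in \<open>simp_all add: Hom_iff\<close>)
qed

lemma rwhisker_Nil: "u \<in> Hom V (\<T> xs) (\<T> xs') \<Longrightarrow> set xs \<subseteq> Ob V \<Longrightarrow> set xs' \<subseteq> Ob V \<Longrightarrow> rwhisker xs xs' [] u = u"
  by (rule rwhisker_unique) (auto simp: Hom_iff psi_Nil_right runit_inv_nat)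

lemma rwhisker_lwhisker:
  assumes u: "u \<in> Hom V (\<T> xs) (\<T> xs')" and [simp]: "set xs \<subseteq> Ob V" "set xs' \<subseteq> Ob V" "set ys \<subseteq> Ob V" "set ts \<subseteq> Ob V"
  shows "rwhisker (ts @ xs) (ts @ xs') ys (lwhisker ts u) = lwhisker ts (rwhisker xs xs' ys u)"
  using assms(5)
proof (induction ts)
  case (Cons t ts)
  have t[simp]: "t \<in> Ob V" "set ts \<subseteq> Ob V" using Cons.prems by auto
  have l: "lwhisker ts u \<in> Hom V (\<T> (ts @ xs)) (\<T> (ts @ xs'))" using u by (simp add: lwhisker_hom)
  then have [simp]: "lwhisker ts u \<in> Arr V" "Dom V (lwhisker ts u) = \<T> (ts @ xs)" "Cod V (lwhisker ts u) = \<T> (ts @ xs')"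
    by (auto simp: Hom_iff)
  have r: "rwhisker (ts @ xs) (ts @ xs') ys (lwhisker ts u) \<in> Hom V (\<T> (ts @ xs @ ys)) (\<T> (ts @ xs' @ ys))"
    using rwhisker_hom[OF l] by simp
  then have [simp]: "rwhisker (ts @ xs) (ts @ xs') ys (lwhisker ts u) \<in> Arr V"
    "Dom V (rwhisker (ts @ xs) (ts @ xs') ys (lwhisker ts u)) = \<T> (ts @ xs @ ys)"
    "Cod V (rwhisker (ts @ xs) (ts @ xs') ys (lwhisker ts u)) = \<T> (ts @ xs' @ ys)"
    by (auto simp: Hom_iff)
  have "rwhisker (t # ts @ xs) (t # ts @ xs') ys (\<iota> t \<odot> lwhisker ts u) = \<iota> t \<odot> rwhisker (ts @ xs) (ts @ xs') ys (lwhisker ts u)"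
  proof (rule rwhisker_unique)
    have "psi (t # ts @ xs') ys \<cdot> (\<iota> t \<odot> rwhisker (ts @ xs) (ts @ xs') ys (lwhisker ts u)) =
      invV (assc V t (\<T> (ts @ xs')) (\<T> ys)) \<cdot> (\<iota> t \<odot> (psi (ts @ xs') ys \<cdot> rwhisker (ts @ xs) (ts @ xs') ys (lwhisker ts u)))"
      by simp
    also have "\<dots> = invV (assc V t (\<T> (ts @ xs')) (\<T> ys)) \<cdot> (\<iota> t \<odot> (lwhisker ts u \<odot> \<iota> (\<T> ys))) \<cdot> (\<iota> t \<odot> psi (ts @ xs) ys)"
      using psi_rwhisker[OF l, of ys] by simp
    also have "\<dots> = (invV (assc V t (\<T> (ts @ xs')) (\<T> ys)) \<cdot> (\<iota> t \<odot> (lwhisker ts u \<odot> \<iota> (\<T> ys)))) \<cdot> (\<iota> t \<odot> psi (ts @ xs) ys)"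
      by (simp del: tens_merge tens_merge')
    also have "\<dots> = ((\<iota> t \<odot> lwhisker ts u) \<odot> \<iota> (\<T> ys)) \<cdot> psi (t # ts @ xs) ys" by (subst assc_inv_nat) auto
    finally show "psi (t # ts @ xs') ys \<cdot> (\<iota> t \<odot> rwhisker (ts @ xs) (ts @ xs') ys (lwhisker ts u)) =
      ((\<iota> t \<odot> lwhisker ts u) \<odot> \<iota> (\<T> ys)) \<cdot> psi (t # ts @ xs) ys" .
  qed (auto simp: Hom_iff)
  then show ?case using Cons.IH by simp
qed simp

lemma rwhisker_rwhisker:
  assumes u: "u \<in> Hom V (\<T> xs) (\<T> xs')" and [simp]: "set xs \<subseteq> Ob V" "set xs' \<subseteq> Ob V" "set ys \<subseteq> Ob V" "set zs \<subseteq> Ob V"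
  shows "rwhisker (xs @ ys) (xs' @ ys) zs (rwhisker xs xs' ys u) = rwhisker xs xs' (ys @ zs) u"
proof (rule sym, rule rwhisker_unique[OF u])
  let ?r = "rwhisker xs xs' ys u" and ?s = "rwhisker (xs @ ys) (xs' @ ys) zs (rwhisker xs xs' ys u)"
  have r: "?r \<in> Hom V (\<T> (xs @ ys)) (\<T> (xs' @ ys))" using rwhisker_hom[OF u] by simp
  have s: "?s \<in> Hom V (\<T> (xs @ ys @ zs)) (\<T> (xs' @ ys @ zs))" using rwhisker_hom[OF r, of zs] by simp
  then show "?s \<in> Hom V (\<T> (xs @ ys @ zs)) (\<T> (xs' @ ys @ zs))" .
  have [simp]: "u \<in> Arr V" "Dom V u = \<T> xs" "Cod V u = \<T> xs'" using u by (auto simp: Hom_iff)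
  have [simp]: "?r \<in> Arr V" "Dom V ?r = \<T> (xs @ ys)" "Cod V ?r = \<T> (xs' @ ys)" using r by (auto simp: Hom_iff)
  have [simp]: "?s \<in> Arr V" "Dom V ?s = \<T> (xs @ ys @ zs)" "Cod V ?s = \<T> (xs' @ ys @ zs)" using s by (auto simp: Hom_iff)
  have "(\<iota> (\<T> xs') \<odot> psi ys zs) \<cdot> psi xs' (ys @ zs) \<cdot> ?s =
     ((\<iota> (\<T> xs') \<odot> psi ys zs) \<cdot> psi xs' (ys @ zs)) \<cdot> ?s" by simp
  also have "\<dots> = assc V (\<T> xs') (\<T> ys) (\<T> zs) \<cdot> (psi xs' ys \<odot> \<iota> (\<T> zs)) \<cdot> (psi (xs' @ ys) zs \<cdot> ?s)"
    by (subst psi_assoc[symmetric]) auto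
  also have "\<dots> = assc V (\<T> xs') (\<T> ys) (\<T> zs) \<cdot> ((psi xs' ys \<cdot> ?r) \<odot> \<iota> (\<T> zs)) \<cdot> psi (xs @ ys) zs"
    using psi_rwhisker[OF r, of zs] by simp
  also have "\<dots> = assc V (\<T> xs') (\<T> ys) (\<T> zs) \<cdot> ((u \<odot> \<iota> (\<T> ys)) \<odot> \<iota> (\<T> zs)) \<cdot> (psi xs ys \<odot> \<iota> (\<T> zs)) \<cdot> psi (xs @ ys) zs"
    using psi_rwhisker[OF u, of ys] by simp
  also have "\<dots> = (assc V (\<T> xs') (\<T> ys) (\<T> zs) \<cdot> ((u \<odot> \<iota> (\<T> ys)) \<odot> \<iota> (\<T> zs))) \<cdot> (psi xs ys \<odot> \<iota> (\<T> zs)) \<cdot> psi (xs @ ys) zs"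
    by (simp del: tens_merge tens_merge')
  also have "\<dots> = (u \<odot> (\<iota> (\<T> ys) \<odot> \<iota> (\<T> zs))) \<cdot> assc V (\<T> xs) (\<T> ys) (\<T> zs) \<cdot> (psi xs ys \<odot> \<iota> (\<T> zs)) \<cdot> psi (xs @ ys) zs"
    by (subst assc_nat) auto
  also have "\<dots> = (u \<odot> (\<iota> (\<T> ys) \<odot> \<iota> (\<T> zs))) \<cdot> (\<iota> (\<T> xs) \<odot> psi ys zs) \<cdot> psi xs (ys @ zs)"
    by (subst psi_assoc) auto
  also have "\<dots> = (\<iota> (\<T> xs') \<odot> psi ys zs) \<cdot> (u \<odot> \<iota> (\<T> (ys @ zs))) \<cdot> psi xs (ys @ zs)" by simp
  finally show "psi xs' (ys @ zs) \<cdot> ?s = (u \<odot> \<iota> (\<T> (ys @ zs))) \<cdot> psi xs (ys @ zs)"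
    by (rule iso_mono[rotated -1]) auto
qed simp_all

end

section \<open>Currying and the basic enriched categories\<close>

context symmetric_monoidal_closed
begin

text \<open>Transposition along the tensor-hom adjunction, inverse to \<open>curry_arr\<close>.
  Equations between arrows into an internal hom are proved by transposing both sides and appealing
  to \<open>unc_inj\<close>.\<close>

definition unc where
  "unc a b f = ev V a b \<cdot> (f \<odot> \<iota> a)"

lemma unc_arr [simp]: "a \<in> Ob V \<Longrightarrow> b \<in> Ob V \<Longrightarrow> f \<in> Arr V \<Longrightarrow> Cod V f = ihom V a b \<Longrightarrow> unc a b f \<in> Arr V"
  and dom_unc [simp]: "a \<in> Ob V \<Longrightarrow> b \<in> Ob V \<Longrightarrow> f \<in> Arr V \<Longrightarrow> Cod V f = ihom V a b \<Longrightarrow> Dom V (unc a b f) = Dom V f \<otimes> a"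
  and cod_unc [simp]: "a \<in> Ob V \<Longrightarrow> b \<in> Ob V \<Longrightarrow> f \<in> Arr V \<Longrightarrow> Cod V f = ihom V a b \<Longrightarrow> Cod V (unc a b f) = b"
  by (simp_all add: unc_def)

lemma curry_props:
  assumes "x \<in> Ob V" "a \<in> Ob V" "b \<in> Ob V" "f \<in> Arr V" "Dom V f = x \<otimes> a" "Cod V f = b"
  shows "curry_arr V x a b f \<in> Hom V x (ihom V a b) \<and> unc a b (curry_arr V x a b f) = f"
  unfolding curry_arr_def unc_def
  by (rule theI') (rule ev_universal, use assms in \<open>auto simp: Hom_iff\<close>)

lemma curry_arr' [simp]: "x \<in> Ob V \<Longrightarrow> a \<in> Ob V \<Longrightarrow> b \<in> Ob V \<Longrightarrow> f \<in> Arr V \<Longrightarrow> Dom V f = x \<otimes> a \<Longrightarrow> Cod V f = b \<Longrightarrow>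
    curry_arr V x a b f \<in> Arr V"
  and dom_curry [simp]: "x \<in> Ob V \<Longrightarrow> a \<in> Ob V \<Longrightarrow> b \<in> Ob V \<Longrightarrow> f \<in> Arr V \<Longrightarrow> Dom V f = x \<otimes> a \<Longrightarrow> Cod V f = b \<Longrightarrow>
    Dom V (curry_arr V x a b f) = x"
  and cod_curry [simp]: "x \<in> Ob V \<Longrightarrow> a \<in> Ob V \<Longrightarrow> b \<in> Ob V \<Longrightarrow> f \<in> Arr V \<Longrightarrow> Dom V f = x \<otimes> a \<Longrightarrow> Cod V f = b \<Longrightarrow>
    Cod V (curry_arr V x a b f) = ihom V a b"
  and unc_curry [simp]: "x \<in> Ob V \<Longrightarrow> a \<in> Ob V \<Longrightarrow> b \<in> Ob V \<Longrightarrow> f \<in> Arr V \<Longrightarrow> Dom V f = x \<otimes> a \<Longrightarrow> Cod V f = b \<Longrightarrow>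
    unc a b (curry_arr V x a b f) = f"
  using curry_props by (auto simp: Hom_iff)

lemma unc_inj:
  assumes "unc a b f = unc a b g" "a \<in> Ob V" "b \<in> Ob V" "f \<in> Arr V" "g \<in> Arr V" "Dom V f = Dom V g"
    "Cod V f = ihom V a b" "Cod V g = ihom V a b"
  shows "f = g"
proof -
  have "\<exists>!h. h \<in> Hom V (Dom V f) (ihom V a b) \<and> ev V a b \<cdot> (h \<odot> \<iota> a) = unc a b f"
    by (rule ev_universal) (use assms in \<open>simp_all add: Hom_iff\<close>)
  moreover have "f \<in> Hom V (Dom V f) (ihom V a b)" "g \<in> Hom V (Dom V f) (ihom V a b)"
    using assms(2-) by (simp_all add: Hom_iff)
  ultimately show ?thesis using assms(1) unfolding unc_def by metis
qed

lemma unc_cmp: "a \<in> Ob V \<Longrightarrow> b \<in> Ob V \<Longrightarrow> f \<in> Arr V \<Longrightarrow> Cod V f = ihom V a b \<Longrightarrow> u \<in> Arr V \<Longrightarrow> Dom V f = Cod V u \<Longrightarrow>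
    unc a b (f \<cdot> u) = unc a b f \<cdot> (u \<odot> \<iota> a)"
  by (simp add: unc_def)

lemma unc_idt [simp]: "a \<in> Ob V \<Longrightarrow> b \<in> Ob V \<Longrightarrow> unc a b (\<iota> (ihom V a b)) = ev V a b"
  by (simp add: unc_def)

section \<open>\<open>V\<close> as a category enriched over itself\<close>

lemma self_simps [simp]: "VOb (self_vcat V) = Ob V" "VHom (self_vcat V) = ihom V"
  by (simp_all add: self_vcat_def)

lemma self_cmp_arr [simp]: "a \<in> Ob V \<Longrightarrow> b \<in> Ob V \<Longrightarrow> c \<in> Ob V \<Longrightarrow> VCmp (self_vcat V) a b c \<in> Arr V"
  and self_cmp_dom [simp]: "a \<in> Ob V \<Longrightarrow> b \<in> Ob V \<Longrightarrow> c \<in> Ob V \<Longrightarrow> Dom V (VCmp (self_vcat V) a b c) = ihom V b c \<otimes> ihom V a b"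
  and self_cmp_cod [simp]: "a \<in> Ob V \<Longrightarrow> b \<in> Ob V \<Longrightarrow> c \<in> Ob V \<Longrightarrow> Cod V (VCmp (self_vcat V) a b c) = ihom V a c"
  and self_idt_arr [simp]: "a \<in> Ob V \<Longrightarrow> VIdt (self_vcat V) a \<in> Arr V"
  and self_idt_dom [simp]: "a \<in> Ob V \<Longrightarrow> Dom V (VIdt (self_vcat V) a) = \<I>"
  and self_idt_cod [simp]: "a \<in> Ob V \<Longrightarrow> Cod V (VIdt (self_vcat V) a) = ihom V a a"
  and unc_self_cmp: "a \<in> Ob V \<Longrightarrow> b \<in> Ob V \<Longrightarrow> c \<in> Ob V \<Longrightarrow> unc a c (VCmp (self_vcat V) a b c) =
    ev V b c \<cdot> (\<iota> (ihom V b c) \<odot> ev V a b) \<cdot> assc V (ihom V b c) (ihom V a b) a"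
  and unc_self_idt: "a \<in> Ob V \<Longrightarrow> unc a a (VIdt (self_vcat V) a) = lunit V a"
  by (simp_all add: self_vcat_def)

text \<open>Composition in \<open>self_vcat V\<close> is defined as a transpose, so its own
  transpose is an iterated evaluation; calculations with the self-enrichment thereby lose their
  \<open>curry_arr\<close>.\<close>

lemma unc_scmp:
  assumes [simp]: "a \<in> Ob V" "b \<in> Ob V" "c \<in> Ob V" "f \<in> Arr V" "g \<in> Arr V" "Cod V f = ihom V b c" "Cod V g = ihom V a b"
  shows "unc a c (VCmp (self_vcat V) a b c \<cdot> (f \<odot> g)) = unc b c f \<cdot> (\<iota> (Dom V f) \<odot> unc a b g) \<cdot> assc V (Dom V f) (Dom V g) a"
proof -
  have "unc a c (VCmp (self_vcat V) a b c \<cdot> (f \<odot> g)) =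
     ev V b c \<cdot> (\<iota> (ihom V b c) \<odot> ev V a b) \<cdot> (assc V (ihom V b c) (ihom V a b) a \<cdot> ((f \<odot> g) \<odot> \<iota> a))"
    by (simp add: unc_cmp unc_self_cmp)
  also have "\<dots> = ev V b c \<cdot> (\<iota> (ihom V b c) \<odot> ev V a b) \<cdot> ((f \<odot> (g \<odot> \<iota> a)) \<cdot> assc V (Dom V f) (Dom V g) a)"
    by (subst assc_nat) auto
  finally show ?thesis by (simp add: unc_def)
qed

text \<open>After transposition, associativity is the pentagon, the left unit law is
  \<open>lunit_tens\<close> and the right unit law is the triangle.\<close>

lemma vcategory_self: "vcategory V (self_vcat V)"
proof (intro vcategory.intro vcategory_axioms.intro, rule symmetric_monoidal_closed_axioms)
  let ?S = "self_vcat V"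
  fix a b c d assume "a \<in> VOb ?S" "b \<in> VOb ?S" "c \<in> VOb ?S" "d \<in> VOb ?S"
  then have [simp]: "a \<in> Ob V" "b \<in> Ob V" "c \<in> Ob V" "d \<in> Ob V" by auto
  let ?f = "ihom V c d" and ?g = "ihom V b c" and ?h = "ihom V a b"
  have "unc a d (VCmp ?S a b d \<cdot> (VCmp ?S b c d \<odot> \<iota> ?h)) =
    ev V c d \<cdot> (\<iota> ?f \<odot> ev V b c) \<cdot> (assc V ?f ?g b \<cdot> ((\<iota> ?f \<odot> \<iota> ?g) \<odot> ev V a b)) \<cdot> assc V (?f \<otimes> ?g) ?h a"
    by (simp add: unc_scmp unc_self_cmp)
  also have "\<dots> = ev V c d \<cdot> (\<iota> ?f \<odot> (ev V b c \<cdot> (\<iota> ?g \<odot> ev V a b))) \<cdot> (assc V ?f ?g (?h \<otimes> a) \<cdot> assc V (?f \<otimes> ?g) ?h a)"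
    by (subst assc_nat) auto
  also have "\<dots> = unc a d (VCmp ?S a c d \<cdot> (\<iota> ?f \<odot> VCmp ?S a b c)) \<cdot> (assc V ?f ?g ?h \<odot> \<iota> a)"
    by (subst pentagon) (auto simp: unc_scmp unc_self_cmp)
  also have "\<dots> = unc a d (VCmp ?S a c d \<cdot> (\<iota> ?f \<odot> VCmp ?S a b c) \<cdot> assc V ?f ?g ?h)"
    by (subst unc_cmp[symmetric]) auto
  finally show "VCmp ?S a b d \<cdot> (VCmp ?S b c d \<odot> \<iota> (VHom ?S a b)) =
     VCmp ?S a c d \<cdot> (\<iota> (VHom ?S c d) \<odot> VCmp ?S a b c) \<cdot> assc V (VHom ?S c d) (VHom ?S b c) (VHom ?S a b)"
    unfolding self_simps by (rule unc_inj) auto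
next
  let ?S = "self_vcat V"
  fix a b assume "a \<in> VOb ?S" "b \<in> VOb ?S"
  then have [simp]: "a \<in> Ob V" "b \<in> Ob V" by auto
  have "unc a b (VCmp ?S a b b \<cdot> (VIdt ?S b \<odot> \<iota> (ihom V a b))) = (lunit V b \<cdot> (\<iota> \<I> \<odot> ev V a b)) \<cdot> assc V \<I> (ihom V a b) a"
    by (simp add: unc_scmp unc_self_idt)
  also have "\<dots> = ev V a b \<cdot> (lunit V (ihom V a b \<otimes> a) \<cdot> assc V \<I> (ihom V a b) a)"
    by (subst lunit_nat) auto
  also have "\<dots> = unc a b (lunit V (ihom V a b))" by (subst lunit_tens) (auto simp: unc_def)
  finally show "VCmp ?S a b b \<cdot> (VIdt ?S b \<odot> \<iota> (VHom ?S a b)) = lunit V (VHom ?S a b)"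
    unfolding self_simps by (rule unc_inj) auto
  have "unc a b (VCmp ?S a a b \<cdot> (\<iota> (ihom V a b) \<odot> VIdt ?S a)) = ev V a b \<cdot> ((\<iota> (ihom V a b) \<odot> lunit V a) \<cdot> assc V (ihom V a b) \<I> a)"
    by (simp add: unc_scmp unc_self_idt)
  also have "\<dots> = unc a b (runit V (ihom V a b))" by (subst triangle) (auto simp: unc_def)
  finally show "VCmp ?S a a b \<cdot> (\<iota> (VHom ?S a b) \<odot> VIdt ?S a) = runit V (VHom ?S a b)"
    unfolding self_simps by (rule unc_inj) auto
qed (auto simp: Hom_iff)

lemma vcat_simps:
  assumes "vcategory V E"
  shows "a \<in> VOb E \<Longrightarrow> b \<in> VOb E \<Longrightarrow> VHom E a b \<in> Ob V"
    and "a \<in> VOb E \<Longrightarrow> b \<in> VOb E \<Longrightarrow> c \<in> VOb E \<Longrightarrow> VCmp E a b c \<in> Arr V"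
    and "a \<in> VOb E \<Longrightarrow> b \<in> VOb E \<Longrightarrow> c \<in> VOb E \<Longrightarrow> Dom V (VCmp E a b c) = VHom E b c \<otimes> VHom E a b"
    and "a \<in> VOb E \<Longrightarrow> b \<in> VOb E \<Longrightarrow> c \<in> VOb E \<Longrightarrow> Cod V (VCmp E a b c) = VHom E a c"
    and "a \<in> VOb E \<Longrightarrow> VIdt E a \<in> Arr V"
    and "a \<in> VOb E \<Longrightarrow> Dom V (VIdt E a) = \<I>"
    and "a \<in> VOb E \<Longrightarrow> Cod V (VIdt E a) = VHom E a a"
  using vcategory.vhom_ob[OF assms] vcategory.vcmp_hom[OF assms] vcategory.vidt_hom[OF assms]
  by (auto simp: Hom_iff)

section \<open>Opposite enriched categories\<close>

lemma op_simps [simp]: "VOb (op_vcat V E) = VOb E" "VHom (op_vcat V E) a b = VHom E b a"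
  "VIdt (op_vcat V E) = VIdt E" "VCmp (op_vcat V E) a b c = VCmp E c b a \<cdot> symm V (VHom E c b) (VHom E b a)"
  by (simp_all add: op_vcat_def)

lemma vcategory_op:
  assumes "vcategory V E"
  shows "vcategory V (op_vcat V E)"
proof (intro vcategory.intro vcategory_axioms.intro, rule symmetric_monoidal_closed_axioms)
  note [simp] = vcat_simps[OF assms]
  fix a b c d assume "a \<in> VOb (op_vcat V E)" "b \<in> VOb (op_vcat V E)" "c \<in> VOb (op_vcat V E)" "d \<in> VOb (op_vcat V E)"
  then have [simp]: "a \<in> VOb E" "b \<in> VOb E" "c \<in> VOb E" "d \<in> VOb E" by auto
  let ?x = "VHom E d c" and ?y = "VHom E c b" and ?z = "VHom E b a"
  have "(VCmp E d b a \<cdot> symm V (VHom E d b) ?z) \<cdot> ((VCmp E d c b \<cdot> symm V ?x ?y) \<odot> \<iota> ?z) =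
     VCmp E d b a \<cdot> (symm V (VHom E d b) ?z \<cdot> ((VCmp E d c b \<cdot> symm V ?x ?y) \<odot> \<iota> ?z))" by simp
  also have "\<dots> = VCmp E d b a \<cdot> (\<iota> ?z \<odot> VCmp E d c b) \<cdot> ((\<iota> ?z \<odot> symm V ?x ?y) \<cdot> symm V (?x \<otimes> ?y) ?z)"
    by (subst symm_nat) auto
  also have "\<dots> = (VCmp E d b a \<cdot> (\<iota> ?z \<odot> VCmp E d c b) \<cdot> assc V ?z ?y ?x) \<cdot> (symm V ?y ?z \<odot> \<iota> ?x) \<cdot> symm V ?x (?y \<otimes> ?z) \<cdot> assc V ?x ?y ?z"
    by (subst symm_hexagon) auto
  also have "\<dots> = (VCmp E d c a \<cdot> (VCmp E c b a \<odot> \<iota> ?x)) \<cdot> (symm V ?y ?z \<odot> \<iota> ?x) \<cdot> symm V ?x (?y \<otimes> ?z) \<cdot> assc V ?x ?y ?z"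
    by (subst vcategory.vcmp_assoc[OF assms]) auto
  also have "\<dots> = VCmp E d c a \<cdot> (((VCmp E c b a \<cdot> symm V ?y ?z) \<odot> \<iota> ?x) \<cdot> symm V ?x (?y \<otimes> ?z)) \<cdot> assc V ?x ?y ?z"
    by simp
  also have "\<dots> = VCmp E d c a \<cdot> (symm V ?x (VHom E c a) \<cdot> (\<iota> ?x \<odot> (VCmp E c b a \<cdot> symm V ?y ?z))) \<cdot> assc V ?x ?y ?z"
    by (subst symm_nat) auto
  finally show "VCmp (op_vcat V E) a b d \<cdot> (VCmp (op_vcat V E) b c d \<odot> \<iota> (VHom (op_vcat V E) a b)) =
     VCmp (op_vcat V E) a c d \<cdot> (\<iota> (VHom (op_vcat V E) c d) \<odot> VCmp (op_vcat V E) a b c) \<cdot>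
     assc V (VHom (op_vcat V E) c d) (VHom (op_vcat V E) b c) (VHom (op_vcat V E) a b)"
    by simp
next
  note [simp] = vcat_simps[OF assms]
  fix a b assume "a \<in> VOb (op_vcat V E)" "b \<in> VOb (op_vcat V E)"
  then have [simp]: "a \<in> VOb E" "b \<in> VOb E" by auto
  have "(VCmp E b b a \<cdot> symm V (VHom E b b) (VHom E b a)) \<cdot> (VIdt E b \<odot> \<iota> (VHom E b a)) =
     VCmp E b b a \<cdot> (symm V (VHom E b b) (VHom E b a) \<cdot> (VIdt E b \<odot> \<iota> (VHom E b a)))" by simp
  also have "\<dots> = (VCmp E b b a \<cdot> (\<iota> (VHom E b a) \<odot> VIdt E b)) \<cdot> symm V \<I> (VHom E b a)"
    by (subst symm_nat) auto
  also have "\<dots> = lunit V (VHom E b a)" by (subst vcategory.vidt_right[OF assms]) (auto simp: runit_symm)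
  finally show "VCmp (op_vcat V E) a b b \<cdot> (VIdt (op_vcat V E) b \<odot> \<iota> (VHom (op_vcat V E) a b)) = lunit V (VHom (op_vcat V E) a b)"
    by simp
  have "(VCmp E b a a \<cdot> symm V (VHom E b a) (VHom E a a)) \<cdot> (\<iota> (VHom E b a) \<odot> VIdt E a) =
     VCmp E b a a \<cdot> (symm V (VHom E b a) (VHom E a a) \<cdot> (\<iota> (VHom E b a) \<odot> VIdt E a))" by simp
  also have "\<dots> = (VCmp E b a a \<cdot> (VIdt E a \<odot> \<iota> (VHom E b a))) \<cdot> symm V (VHom E b a) \<I>"
    by (subst symm_nat) auto
  also have "\<dots> = runit V (VHom E b a)" by (subst vcategory.vidt_left[OF assms]) (auto simp: lunit_symm)
  finally show "VCmp (op_vcat V E) a a b \<cdot> (\<iota> (VHom (op_vcat V E) a b) \<odot> VIdt (op_vcat V E) a) = runit V (VHom (op_vcat V E) a b)"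
    by simp
qed (auto simp: Hom_iff vcat_simps[OF assms])

section \<open>Enriched functors, their composites and opposites\<close>

lemma vfun_cat:
  assumes "is_vfunctor V A B F"
  shows "vcategory V A" "vcategory V B"
  using assms by (auto simp: is_vfunctor_def)

lemma vfun_simps:
  assumes "is_vfunctor V A B F"
  shows "a \<in> VOb A \<Longrightarrow> vfo F a \<in> VOb B"
    and "a \<in> VOb A \<Longrightarrow> b \<in> VOb A \<Longrightarrow> vfa F a b \<in> Arr V"
    and "a \<in> VOb A \<Longrightarrow> b \<in> VOb A \<Longrightarrow> Dom V (vfa F a b) = VHom A a b"
    and "a \<in> VOb A \<Longrightarrow> b \<in> VOb A \<Longrightarrow> Cod V (vfa F a b) = VHom B (vfo F a) (vfo F b)"
  using assms by (auto simp: is_vfunctor_def Hom_iff)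

lemma vfun_idt: "is_vfunctor V A B F \<Longrightarrow> a \<in> VOb A \<Longrightarrow> vfa F a a \<cdot> VIdt A a = VIdt B (vfo F a)"
  and vfun_cmp: "is_vfunctor V A B F \<Longrightarrow> a \<in> VOb A \<Longrightarrow> b \<in> VOb A \<Longrightarrow> c \<in> VOb A \<Longrightarrow>
     vfa F a c \<cdot> VCmp A a b c = VCmp B (vfo F a) (vfo F b) (vfo F c) \<cdot> (vfa F b c \<odot> vfa F a b)"
  by (auto simp: is_vfunctor_def)

lemma comp_vfun_simps [simp]: "vfo (comp_vfun V G F) a = vfo G (vfo F a)"
  "vfa (comp_vfun V G F) a b = vfa G (vfo F a) (vfo F b) \<cdot> vfa F a b"
  by (simp_all add: comp_vfun_def)

lemma op_vfun_simps [simp]: "vfo (op_vfun F) = vfo F" "vfa (op_vfun F) a b = vfa F b a"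
  by (simp_all add: op_vfun_def)

lemma is_vfunctor_comp:
  assumes F: "is_vfunctor V A B F" and G: "is_vfunctor V B E G"
  shows "is_vfunctor V A E (comp_vfun V G F)"
proof -
  note [simp] = vcat_simps[OF vfun_cat(1)[OF F]] vcat_simps[OF vfun_cat(2)[OF F]] vcat_simps[OF vfun_cat(2)[OF G]]
    vfun_simps[OF F] vfun_simps[OF G]
  have "(vfa G (vfo F a) (vfo F c) \<cdot> vfa F a c) \<cdot> VCmp A a b c =
     VCmp E (vfo G (vfo F a)) (vfo G (vfo F b)) (vfo G (vfo F c)) \<cdot>
     ((vfa G (vfo F b) (vfo F c) \<cdot> vfa F b c) \<odot> (vfa G (vfo F a) (vfo F b) \<cdot> vfa F a b))"
    if [simp]: "a \<in> VOb A" "b \<in> VOb A" "c \<in> VOb A" for a b c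
  proof -
    have "(vfa G (vfo F a) (vfo F c) \<cdot> vfa F a c) \<cdot> VCmp A a b c =
      (vfa G (vfo F a) (vfo F c) \<cdot> VCmp B (vfo F a) (vfo F b) (vfo F c)) \<cdot> (vfa F b c \<odot> vfa F a b)"
      by (simp add: vfun_cmp[OF F])
    then show ?thesis by (simp add: vfun_cmp[OF G])
  qed
  then show ?thesis using vfun_cat(1)[OF F] vfun_cat(2)[OF G]
    by (auto simp: is_vfunctor_def[of _ A E] Hom_iff vfun_idt[OF F] vfun_idt[OF G])
qed

lemma is_vfunctor_op:
  assumes F: "is_vfunctor V A B F"
  shows "is_vfunctor V (op_vcat V A) (op_vcat V B) (op_vfun F)"
proof -
  note [simp] = vcat_simps[OF vfun_cat(1)[OF F]] vcat_simps[OF vfun_cat(2)[OF F]] vfun_simps[OF F]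
  have "vfa F c a \<cdot> (VCmp A c b a \<cdot> symm V (VHom A c b) (VHom A b a)) =
     (VCmp B (vfo F c) (vfo F b) (vfo F a) \<cdot> symm V (VHom B (vfo F c) (vfo F b)) (VHom B (vfo F b) (vfo F a))) \<cdot>
       (vfa F c b \<odot> vfa F b a)"
    if [simp]: "a \<in> VOb A" "b \<in> VOb A" "c \<in> VOb A" for a b c
  proof -
    have "vfa F c a \<cdot> (VCmp A c b a \<cdot> symm V (VHom A c b) (VHom A b a)) =
      (vfa F c a \<cdot> VCmp A c b a) \<cdot> symm V (VHom A c b) (VHom A b a)" by simp
    also have "\<dots> = VCmp B (vfo F c) (vfo F b) (vfo F a) \<cdot> ((vfa F b a \<odot> vfa F c b) \<cdot> symm V (VHom A c b) (VHom A b a))"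
      by (subst vfun_cmp[OF F]) auto
    also have "\<dots> = VCmp B (vfo F c) (vfo F b) (vfo F a) \<cdot> (symm V (VHom B (vfo F c) (vfo F b)) (VHom B (vfo F b) (vfo F a)) \<cdot>
       (vfa F c b \<odot> vfa F b a))"
      by (subst symm_nat) auto
    finally show ?thesis by simp
  qed
  then show ?thesis using vfun_cat[OF F]
    by (auto simp: is_vfunctor_def[of _ "op_vcat V A"] Hom_iff vfun_idt[OF F] vcategory_op)
qed

section \<open>Representable functors\<close>

lemma rep_simps:
  assumes "vcategory V E" "a \<in> VOb E"
  shows "vfo (rep_vfun V E a) b = VHom E a b"
    and "b \<in> VOb E \<Longrightarrow> c \<in> VOb E \<Longrightarrow> vfa (rep_vfun V E a) b c \<in> Arr V"
    and "b \<in> VOb E \<Longrightarrow> c \<in> VOb E \<Longrightarrow> Dom V (vfa (rep_vfun V E a) b c) = VHom E b c"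
    and "b \<in> VOb E \<Longrightarrow> c \<in> VOb E \<Longrightarrow> Cod V (vfa (rep_vfun V E a) b c) = ihom V (VHom E a b) (VHom E a c)"
    and "b \<in> VOb E \<Longrightarrow> c \<in> VOb E \<Longrightarrow> unc (VHom E a b) (VHom E a c) (vfa (rep_vfun V E a) b c) = VCmp E a b c"
  using assms by (simp_all add: rep_vfun_def vcat_simps)

text \<open>Transposed, preservation of composition is associativity in \<open>E\<close> and
  preservation of identities is the left unit law.\<close>

lemma is_vfunctor_rep:
  assumes E: "vcategory V E" and [simp]: "a \<in> VOb E"
  shows "is_vfunctor V E (self_vcat V) (rep_vfun V E a)"
proof -
  note [simp] = vcat_simps[OF E] rep_simps[OF E \<open>a \<in> VOb E\<close>]
  let ?S = "self_vcat V" and ?R = "rep_vfun V E a"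
  have 1: "vfa ?R b b \<cdot> VIdt E b = VIdt ?S (VHom E a b)" if [simp]: "b \<in> VOb E" for b
    by (rule unc_inj[of "VHom E a b" "VHom E a b"]) (simp_all add: unc_cmp unc_self_idt vcategory.vidt_left[OF E])
  have 2: "vfa ?R b d \<cdot> VCmp E b c d = VCmp ?S (VHom E a b) (VHom E a c) (VHom E a d) \<cdot> (vfa ?R c d \<odot> vfa ?R b c)"
    if [simp]: "b \<in> VOb E" "c \<in> VOb E" "d \<in> VOb E" for b c d
  proof (rule unc_inj)
    have "unc (VHom E a b) (VHom E a d) (vfa ?R b d \<cdot> VCmp E b c d) = VCmp E a b d \<cdot> (VCmp E b c d \<odot> \<iota> (VHom E a b))"
      by (simp add: unc_cmp)
    then show "unc (VHom E a b) (VHom E a d) (vfa ?R b d \<cdot> VCmp E b c d) = unc (VHom E a b) (VHom E a d)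
       (VCmp ?S (VHom E a b) (VHom E a c) (VHom E a d) \<cdot> (vfa ?R c d \<odot> vfa ?R b c))"
      by (simp add: unc_scmp vcategory.vcmp_assoc[OF E])
  qed auto
  show ?thesis using 1 2 E vcategory_self by (auto simp: is_vfunctor_def Hom_iff)
qed

lemma is_vfunctor_corep:
  assumes D: "is_vfunctor V B E D" and x: "x \<in> VOb E"
  shows "is_vfunctor V (op_vcat V B) (self_vcat V) (corep_vfun V E D x)"
  unfolding corep_vfun_def
  by (rule is_vfunctor_comp[OF is_vfunctor_op[OF D] is_vfunctor_rep])
    (use x vfun_cat[OF D] in \<open>auto intro: vcategory_op\<close>)

text \<open>The symmetry in the last clause is that of \<open>op_vcat\<close>: it moves the arrow to
  be precomposed behind the element of \<open>E(D a,x)\<close>.\<close>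

lemma corep_simps:
  assumes D: "is_vfunctor V B E D" and x: "x \<in> VOb E"
  shows "vfo (corep_vfun V E D x) b = VHom E (vfo D b) x"
    and "a \<in> VOb B \<Longrightarrow> b \<in> VOb B \<Longrightarrow> vfa (corep_vfun V E D x) a b \<in> Arr V"
    and "a \<in> VOb B \<Longrightarrow> b \<in> VOb B \<Longrightarrow> Dom V (vfa (corep_vfun V E D x) a b) = VHom B b a"
    and "a \<in> VOb B \<Longrightarrow> b \<in> VOb B \<Longrightarrow> Cod V (vfa (corep_vfun V E D x) a b) = ihom V (VHom E (vfo D a) x) (VHom E (vfo D b) x)"
    and "a \<in> VOb B \<Longrightarrow> b \<in> VOb B \<Longrightarrow> unc (VHom E (vfo D a) x) (VHom E (vfo D b) x) (vfa (corep_vfun V E D x) a b) =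
      VCmp E (vfo D b) (vfo D a) x \<cdot> symm V (VHom E (vfo D b) (vfo D a)) (VHom E (vfo D a) x) \<cdot> (vfa D b a \<odot> \<iota> (VHom E (vfo D a) x))"
proof -
  note [simp] = vfun_simps[OF D] vcat_simps[OF vfun_cat(2)[OF D]] x
    rep_simps[OF vcategory_op[OF vfun_cat(2)[OF D]], unfolded op_simps]
  show 1: "vfo (corep_vfun V E D x) b = VHom E (vfo D b) x" by (simp add: corep_vfun_def)
  assume [simp]: "a \<in> VOb B" "b \<in> VOb B"
  show "unc (VHom E (vfo D a) x) (VHom E (vfo D b) x) (vfa (corep_vfun V E D x) a b) =
      VCmp E (vfo D b) (vfo D a) x \<cdot> symm V (VHom E (vfo D b) (vfo D a)) (VHom E (vfo D a) x) \<cdot> (vfa D b a \<odot> \<iota> (VHom E (vfo D a) x))"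
    by (simp add: corep_vfun_def unc_cmp)
qed (use vfun_simps[OF is_vfunctor_corep[OF assms]] in \<open>auto simp: corep_vfun_def rep_vfun_def\<close>)

end

section \<open>Graded arrows\<close>

context symmetric_monoidal_closed
begin

text \<open>
  An arrow of \<open>gr E\<close> from \<open>a\<close> to \<open>b\<close> of grade \<open>[x\<^sub>1, \<dots>, x\<^sub>n]\<close> is an arrow of \<open>V\<close> from
  \<open>x\<^sub>1 \<otimes> \<dots> \<otimes> x\<^sub>n\<close> to \<open>E(a,b)\<close>.  Grades are concatenated by composition, which is strictly
  associative, so that the coherence isomorphisms of \<open>V\<close> disappear from all later calculations.
\<close>

definition gr :: "('c, 'o, 'm) vcat \<Rightarrow> ('c, 'c \<times> 'o list \<times> 'm \<times> 'c) cat" where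
  "gr E = \<lparr>
     Ob = VOb E,
     Arr = {(a, xs, f, b). a \<in> VOb E \<and> b \<in> VOb E \<and> set xs \<subseteq> Ob V \<and> f \<in> Hom V (\<T> xs) (VHom E a b)},
     Dom = (\<lambda>(a, xs, f, b). a),
     Cod = (\<lambda>(a, xs, f, b). b),
     Idt = (\<lambda>a. (a, [], VIdt E a, a)),
     Cmp = (\<lambda>(b, ys, g, c) (a, xs, f, b'). (a, ys @ xs, VCmp E a b c \<cdot> (g \<odot> f) \<cdot> psi ys xs, c))\<rparr>"

lemmas HomV_iff = Hom_iff[where C = V]

abbreviation gcomp ("(_ \<star>\<^bsub>_\<^esub>/ _)" [71, 0, 70] 70) where
  "q \<star>\<^bsub>E\<^esub> p \<equiv> Cmp (gr E) q p"

abbreviation GHom where "GHom E a b \<equiv> Hom (gr E) a b"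

definition grd :: "'c \<times> 'o list \<times> 'm \<times> 'c \<Rightarrow> 'o list" where
  "grd p = fst (snd p)"

definition el :: "'c \<times> 'o list \<times> 'm \<times> 'c \<Rightarrow> 'm" where
  "el p = fst (snd (snd p))"

text \<open>Restriction of a generalised element along \<open>u\<close>; the arrows between two
  fixed objects of \<open>gr E\<close> form a presheaf in the grade.\<close>

definition reix :: "'o list \<Rightarrow> 'm \<Rightarrow> 'c \<times> 'o list \<times> 'm \<times> 'c \<Rightarrow> 'c \<times> 'o list \<times> 'm \<times> 'c" where
  "reix xs u p = (fst p, xs, el p \<cdot> u, snd (snd (snd p)))"

text \<open>The identity of \<open>VHom E a b\<close> regarded as a generalised element. Its grade
  is a one-element list, whose tensor product carries an extra unit, hence the unitor.\<close>

definition univ :: "('c, 'o, 'm) vcat \<Rightarrow> 'c \<Rightarrow> 'c \<Rightarrow> 'c \<times> 'o list \<times> 'm \<times> 'c" where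
  "univ E a b = (a, [VHom E a b], runit V (VHom E a b), b)"

definition gf :: "('a, 'b, 'm) vfun \<Rightarrow> 'a \<times> 'o list \<times> 'm \<times> 'a \<Rightarrow> 'b \<times> 'o list \<times> 'm \<times> 'b" where
  "gf H p = (vfo H (fst p), grd p, vfa H (fst p) (snd (snd (snd p))) \<cdot> el p, vfo H (snd (snd (snd p))))"

lemma gr_simps [simp]: "Ob (gr E) = VOb E" "Dom (gr E) (a, xs, f, b) = a" "Cod (gr E) (a, xs, f, b) = b"
  "Idt (gr E) a = (a, [], VIdt E a, a)"
  "(b, ys, g, c) \<star>\<^bsub>E\<^esub> (a, xs, f, b') = (a, ys @ xs, VCmp E a b c \<cdot> (g \<odot> f) \<cdot> psi ys xs, c)"
  "(a, xs, f, b) \<in> Arr (gr E) \<longleftrightarrow> a \<in> VOb E \<and> b \<in> VOb E \<and> set xs \<subseteq> Ob V \<and> f \<in> Hom V (\<T> xs) (VHom E a b)"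
  by (simp_all add: gr_def)

lemma tuple_simps [simp]: "grd (a, xs, f, b) = xs" "el (a, xs, f, b) = f"
  "reix ys u (a, xs, f, b) = (a, ys, f \<cdot> u, b)"
  "gf H (a, xs, f, b) = (vfo H a, xs, vfa H a b \<cdot> f, vfo H b)"
  by (simp_all add: grd_def el_def reix_def gf_def)

lemma GHom_iff: "(a, xs, f, b) \<in> GHom E a' b' \<longleftrightarrow>
   a = a' \<and> b = b' \<and> a \<in> VOb E \<and> b \<in> VOb E \<and> set xs \<subseteq> Ob V \<and> f \<in> Arr V \<and> Dom V f = \<T> xs \<and> Cod V f = VHom E a b"
  by (auto simp: Hom_iff)

lemma GHom_E:
  assumes "p \<in> GHom E a b"
  obtains xs f where "p = (a, xs, f, b)" "a \<in> VOb E" "b \<in> VOb E" "set xs \<subseteq> Ob V" "f \<in> Arr V"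
    "Dom V f = \<T> xs" "Cod V f = VHom E a b"
  using assms by (cases p) (auto simp: GHom_iff)

lemma GHom_ob: "p \<in> GHom E a b \<Longrightarrow> a \<in> VOb E" "p \<in> GHom E a b \<Longrightarrow> b \<in> VOb E"
  by (auto elim!: GHom_E)

lemma grd_cmp [simp]: "grd (q \<star>\<^bsub>E\<^esub> p) = grd q @ grd p"
  by (cases q; cases p) simp

lemma grd_reix [simp]: "grd (reix xs u p) = xs"
  by (simp add: reix_def)

lemma grd_gf [simp]: "grd (gf H p) = grd p"
  by (simp add: gf_def)

lemma grd_univ [simp]: "grd (univ E a b) = [VHom E a b]"
  by (simp add: univ_def)

lemma grd_ob: "p \<in> GHom E a b \<Longrightarrow> set (grd p) \<subseteq> Ob V"
  by (auto elim!: GHom_E)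

lemma GHom_eqI: "p \<in> GHom E a b \<Longrightarrow> q \<in> GHom E a b \<Longrightarrow> grd p = grd q \<Longrightarrow> el p = el q \<Longrightarrow> p = q"
  by (auto elim!: GHom_E)

text \<open>Concatenation of grades absorbs the coherence: the unit laws use \<open>psi\<close> at
  an empty list, which is an inverse unitor, and associativity is \<open>psi_assoc\<close> combined
  with associativity in \<open>E\<close>.\<close>

lemma category_gr:
  assumes E: "vcategory V E"
  shows "category (gr E)"
proof
  note [simp] = vcat_simps[OF E]
  fix p q r a b c d
  show "Dom (gr E) p \<in> Ob (gr E)" "Cod (gr E) p \<in> Ob (gr E)" if "p \<in> Arr (gr E)"
    using that by (cases p; simp)+
  show "Idt (gr E) a \<in> GHom E a a" if "a \<in> Ob (gr E)" using that by (simp add: GHom_iff)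
  show "q \<star>\<^bsub>E\<^esub> p \<in> GHom E a c" if "p \<in> GHom E a b" "q \<in> GHom E b c"
    using that by (auto elim!: GHom_E simp: GHom_iff)
  show "Idt (gr E) b \<star>\<^bsub>E\<^esub> p = p" if "p \<in> GHom E a b"
    using that
  proof (rule GHom_E)
    fix xs f assume [simp]: "p = (a, xs, f, b)" "a \<in> VOb E" "b \<in> VOb E" "set xs \<subseteq> Ob V" "f \<in> Arr V" "Dom V f = \<T> xs" "Cod V f = VHom E a b"
    have "VCmp E a b b \<cdot> (VIdt E b \<odot> f) \<cdot> invV (lunit V (\<T> xs)) =
      (VCmp E a b b \<cdot> (VIdt E b \<odot> \<iota> (VHom E a b))) \<cdot> (\<iota> \<I> \<odot> f) \<cdot> invV (lunit V (\<T> xs))" by simp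
    also have "\<dots> = (lunit V (VHom E a b) \<cdot> (\<iota> \<I> \<odot> f)) \<cdot> invV (lunit V (\<T> xs))"
      by (subst vcategory.vidt_left[OF E]) simp_all
    also have "\<dots> = f" by (subst lunit_nat) auto
    finally show ?thesis by simp
  qed
  show "p \<star>\<^bsub>E\<^esub> Idt (gr E) a = p" if "p \<in> GHom E a b"
    using that
  proof (rule GHom_E)
    fix xs f assume [simp]: "p = (a, xs, f, b)" "a \<in> VOb E" "b \<in> VOb E" "set xs \<subseteq> Ob V" "f \<in> Arr V" "Dom V f = \<T> xs" "Cod V f = VHom E a b"
    have "VCmp E a a b \<cdot> (f \<odot> VIdt E a) \<cdot> invV (runit V (\<T> xs)) =
      (VCmp E a a b \<cdot> (\<iota> (VHom E a b) \<odot> VIdt E a)) \<cdot> (f \<odot> \<iota> \<I>) \<cdot> invV (runit V (\<T> xs))" by simp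
    also have "\<dots> = (runit V (VHom E a b) \<cdot> (f \<odot> \<iota> \<I>)) \<cdot> invV (runit V (\<T> xs))"
      by (subst vcategory.vidt_right[OF E]) simp_all
    also have "\<dots> = f" by (subst runit_nat) auto
    finally show ?thesis by (simp add: psi_Nil_right)
  qed
  show "(r \<star>\<^bsub>E\<^esub> q) \<star>\<^bsub>E\<^esub> p = r \<star>\<^bsub>E\<^esub> (q \<star>\<^bsub>E\<^esub> p)" if p: "p \<in> GHom E a b" and q: "q \<in> GHom E b c" and r: "r \<in> GHom E c d"
  proof (rule GHom_E[OF p], rule GHom_E[OF q], rule GHom_E[OF r])
    fix xs f ys g zs h
    assume [simp]: "p = (a, xs, f, b)" "a \<in> VOb E" "b \<in> VOb E" "set xs \<subseteq> Ob V" "f \<in> Arr V" "Dom V f = \<T> xs" "Cod V f = VHom E a b"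
      "q = (b, ys, g, c)" "c \<in> VOb E" "set ys \<subseteq> Ob V" "g \<in> Arr V" "Dom V g = \<T> ys" "Cod V g = VHom E b c"
      "r = (c, zs, h, d)" "d \<in> VOb E" "set zs \<subseteq> Ob V" "h \<in> Arr V" "Dom V h = \<T> zs" "Cod V h = VHom E c d"
    have "VCmp E a b d \<cdot> ((VCmp E b c d \<cdot> (h \<odot> g) \<cdot> psi zs ys) \<odot> f) \<cdot> psi (zs @ ys) xs =
      (VCmp E a b d \<cdot> (VCmp E b c d \<odot> \<iota> (VHom E a b))) \<cdot> ((h \<odot> g) \<odot> f) \<cdot> (psi zs ys \<odot> \<iota> (\<T> xs)) \<cdot> psi (zs @ ys) xs"
      by simp
    also have "\<dots> = VCmp E a c d \<cdot> (\<iota> (VHom E c d) \<odot> VCmp E a b c) \<cdot>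
      (assc V (VHom E c d) (VHom E b c) (VHom E a b) \<cdot> ((h \<odot> g) \<odot> f)) \<cdot> (psi zs ys \<odot> \<iota> (\<T> xs)) \<cdot> psi (zs @ ys) xs"
      by (subst vcategory.vcmp_assoc[OF E]) (auto simp del: tens_merge tens_merge')
    also have "\<dots> = VCmp E a c d \<cdot> (\<iota> (VHom E c d) \<odot> VCmp E a b c) \<cdot> (h \<odot> (g \<odot> f)) \<cdot>
      (assc V (\<T> zs) (\<T> ys) (\<T> xs) \<cdot> (psi zs ys \<odot> \<iota> (\<T> xs)) \<cdot> psi (zs @ ys) xs)"
      by (subst assc_nat) (auto simp del: tens_merge tens_merge')
    also have "\<dots> = VCmp E a c d \<cdot> (\<iota> (VHom E c d) \<odot> VCmp E a b c) \<cdot> (h \<odot> (g \<odot> f)) \<cdot>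
      (\<iota> (\<T> zs) \<odot> psi ys xs) \<cdot> psi zs (ys @ xs)"
      by (subst psi_assoc) auto
    finally show "(r \<star>\<^bsub>E\<^esub> q) \<star>\<^bsub>E\<^esub> p = r \<star>\<^bsub>E\<^esub> (q \<star>\<^bsub>E\<^esub> p)" by simp
  qed
qed

lemma gcmp_hom: "vcategory V E \<Longrightarrow> p \<in> GHom E a b \<Longrightarrow> q \<in> GHom E b c \<Longrightarrow> q \<star>\<^bsub>E\<^esub> p \<in> GHom E a c"
  by (rule category.cmp_hom[OF category_gr])

lemma gcmp_assoc: "vcategory V E \<Longrightarrow> p \<in> GHom E a b \<Longrightarrow> q \<in> GHom E b c \<Longrightarrow> r \<in> GHom E c d \<Longrightarrow>
    (r \<star>\<^bsub>E\<^esub> q) \<star>\<^bsub>E\<^esub> p = r \<star>\<^bsub>E\<^esub> (q \<star>\<^bsub>E\<^esub> p)"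
  by (rule category.cmp_assoc[OF category_gr])

abbreviation gid where "gid E a \<equiv> (a, [], VIdt E a, a)"

lemma gid_hom: "vcategory V E \<Longrightarrow> a \<in> VOb E \<Longrightarrow> gid E a \<in> GHom E a a"
  using category.idt_hom[OF category_gr] by simp

lemma gid_left: "vcategory V E \<Longrightarrow> p \<in> GHom E a b \<Longrightarrow> gid E b \<star>\<^bsub>E\<^esub> p = p"
  using category.idt_left[OF category_gr] by fastforce

lemma gid_right: "vcategory V E \<Longrightarrow> p \<in> GHom E a b \<Longrightarrow> p \<star>\<^bsub>E\<^esub> gid E a = p"
  using category.idt_right[OF category_gr] by fastforce

lemma reix_hom: "p \<in> GHom E a b \<Longrightarrow> set xs \<subseteq> Ob V \<Longrightarrow> u \<in> Hom V (\<T> xs) (\<T> (grd p)) \<Longrightarrow> reix xs u p \<in> GHom E a b"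
  by (auto elim!: GHom_E simp: GHom_iff HomV_iff)

text \<open>Naturality of \<open>psi\<close> in its second list. Together with the companion rule
  for the first list it makes composition with a fixed arrow, on either side, an operator in the
  sense defined below.\<close>

lemma cmp_reix:
  assumes E: "vcategory V E" and p: "p \<in> GHom E a b" and q: "q \<in> GHom E b c"
    and xs: "set xs \<subseteq> Ob V" and u: "u \<in> Hom V (\<T> xs) (\<T> (grd p))"
  shows "q \<star>\<^bsub>E\<^esub> reix xs u p = reix (grd q @ xs) (lwhisker (grd q) u) (q \<star>\<^bsub>E\<^esub> p)"
proof (rule GHom_E[OF p], rule GHom_E[OF q])
  note [simp] = vcat_simps[OF E] xs
  fix xs' f ys g
  assume [simp]: "p = (a, xs', f, b)" "a \<in> VOb E" "b \<in> VOb E" "set xs' \<subseteq> Ob V" "f \<in> Arr V" "Dom V f = \<T> xs'" "Cod V f = VHom E a b"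
      "q = (b, ys, g, c)" "c \<in> VOb E" "set ys \<subseteq> Ob V" "g \<in> Arr V" "Dom V g = \<T> ys" "Cod V g = VHom E b c"
  have u': "u \<in> Hom V (\<T> xs) (\<T> xs')" using u by simp
  have [simp]: "u \<in> Arr V" "Dom V u = \<T> xs" "Cod V u = \<T> xs'" using u by (auto simp: Hom_iff)
  have [simp]: "lwhisker ys u \<in> Arr V" "Dom V (lwhisker ys u) = \<T> (ys @ xs)" "Cod V (lwhisker ys u) = \<T> (ys @ xs')"
    using lwhisker_arr_aux[of u xs xs' ys] by auto
  have "(VCmp E a b c \<cdot> (g \<odot> f) \<cdot> psi ys xs') \<cdot> lwhisker ys u = VCmp E a b c \<cdot> (g \<odot> f) \<cdot> (psi ys xs' \<cdot> lwhisker ys u)" by simp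
  also have "\<dots> = VCmp E a b c \<cdot> (g \<odot> (f \<cdot> u)) \<cdot> psi ys xs" using psi_lwhisker[OF u' _ xs] by simp
  finally show ?thesis by simp
qed

lemma reix_cmp:
  assumes E: "vcategory V E" and p: "p \<in> GHom E a b" and q: "q \<in> GHom E b c"
    and xs: "set xs \<subseteq> Ob V" and u: "u \<in> Hom V (\<T> xs) (\<T> (grd q))"
  shows "reix xs u q \<star>\<^bsub>E\<^esub> p = reix (xs @ grd p) (rwhisker xs (grd q) (grd p) u) (q \<star>\<^bsub>E\<^esub> p)"
proof (rule GHom_E[OF p], rule GHom_E[OF q])
  note [simp] = vcat_simps[OF E] xs
  fix xs' f ys g
  assume [simp]: "p = (a, xs', f, b)" "a \<in> VOb E" "b \<in> VOb E" "set xs' \<subseteq> Ob V" "f \<in> Arr V" "Dom V f = \<T> xs'" "Cod V f = VHom E a b"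
      "q = (b, ys, g, c)" "c \<in> VOb E" "set ys \<subseteq> Ob V" "g \<in> Arr V" "Dom V g = \<T> ys" "Cod V g = VHom E b c"
  have u': "u \<in> Hom V (\<T> xs) (\<T> ys)" using u by simp
  have [simp]: "u \<in> Arr V" "Dom V u = \<T> xs" "Cod V u = \<T> ys" using u by (auto simp: Hom_iff)
  have [simp]: "rwhisker xs ys xs' u \<in> Arr V" "Dom V (rwhisker xs ys xs' u) = \<T> (xs @ xs')" "Cod V (rwhisker xs ys xs' u) = \<T> (ys @ xs')"
    using rwhisker_hom[OF u', of xs'] by (auto simp: Hom_iff)
  have "(VCmp E a b c \<cdot> (g \<odot> f) \<cdot> psi ys xs') \<cdot> rwhisker xs ys xs' u = VCmp E a b c \<cdot> (g \<odot> f) \<cdot> (psi ys xs' \<cdot> rwhisker xs ys xs' u)" by simp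
  also have "\<dots> = VCmp E a b c \<cdot> ((g \<cdot> u) \<odot> f) \<cdot> psi xs xs'" using u' by (subst psi_rwhisker) simp_all
  finally show ?thesis by simp
qed

lemma univ_hom: "vcategory V E \<Longrightarrow> a \<in> VOb E \<Longrightarrow> b \<in> VOb E \<Longrightarrow> univ E a b \<in> GHom E a b"
  by (auto simp: univ_def GHom_iff vcat_simps)

text \<open>The Yoneda lemma for a hom object: an arrow of any grade is a restriction of the
  universal one along its own underlying arrow, up to the unitor.\<close>

lemma univ_rep:
  assumes E: "vcategory V E" and p: "p \<in> GHom E a b"
  shows "invV (runit V (VHom E a b)) \<cdot> el p \<in> Hom V (\<T> (grd p)) (\<T> (grd (univ E a b)))"
    "p = reix (grd p) (invV (runit V (VHom E a b)) \<cdot> el p) (univ E a b)"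
  using p vcat_simps[OF E] by (auto elim!: GHom_E simp: HomV_iff univ_def)


subsection \<open>Operators on graded arrows\<close>

text \<open>
  By Yoneda, an operator amounts to an arrow of \<open>V\<close> from \<open>ts \<otimes> E(a,b) \<otimes> ys\<close> to \<open>E'(d,e)\<close>, namely
  its value at the universal element of \<open>E(a,b)\<close>.
\<close>

definition oper :: "('a, 'o, 'm) vcat \<Rightarrow> 'a \<Rightarrow> 'a \<Rightarrow> ('b, 'o, 'm) vcat \<Rightarrow> 'b \<Rightarrow> 'b \<Rightarrow> 'o list \<Rightarrow> 'o list \<Rightarrow>
    ('a \<times> 'o list \<times> 'm \<times> 'a \<Rightarrow> 'b \<times> 'o list \<times> 'm \<times> 'b) \<Rightarrow> bool" where
  "oper E a b E' d e ts ys A \<longleftrightarrow> set ts \<subseteq> Ob V \<and> set ys \<subseteq> Ob V \<and>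
     (\<forall>p\<in>GHom E a b. A p \<in> GHom E' d e \<and> grd (A p) = ts @ grd p @ ys) \<and>
     (\<forall>p\<in>GHom E a b. \<forall>xs u. set xs \<subseteq> Ob V \<longrightarrow> u \<in> Hom V (\<T> xs) (\<T> (grd p)) \<longrightarrow>
        A (reix xs u p) = reix (ts @ xs @ ys) (lwhisker ts (rwhisker xs (grd p) ys u)) (A p))"

lemma operD:
  assumes "oper E a b E' d e ts ys A"
  shows "set ts \<subseteq> Ob V" "set ys \<subseteq> Ob V" "p \<in> GHom E a b \<Longrightarrow> A p \<in> GHom E' d e"
    "p \<in> GHom E a b \<Longrightarrow> grd (A p) = ts @ grd p @ ys"
    "p \<in> GHom E a b \<Longrightarrow> set xs \<subseteq> Ob V \<Longrightarrow> u \<in> Hom V (\<T> xs) (\<T> (grd p)) \<Longrightarrow>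
      A (reix xs u p) = reix (ts @ xs @ ys) (lwhisker ts (rwhisker xs (grd p) ys u)) (A p)"
  using assms by (auto simp: oper_def)

text \<open>Every argument is a restriction of the universal element and operators commute with
  restriction, so an identity between operators needs checking at one argument only.\<close>

lemma oper_eqI:
  assumes E: "vcategory V E" and A: "oper E a b E' d e ts ys A" and B: "oper E a b E' d e ts ys B"
    and eq: "A (univ E a b) = B (univ E a b)" and p: "p \<in> GHom E a b"
  shows "A p = B p"
proof -
  note u = univ_rep[OF E p] and un = univ_hom[OF E GHom_ob[OF p]]
  have "A (reix (grd p) (invV (runit V (VHom E a b)) \<cdot> el p) (univ E a b)) = B (reix (grd p) (invV (runit V (VHom E a b)) \<cdot> el p) (univ E a b))"
    using operD(5)[OF A un grd_ob[OF p] u(1)] operD(5)[OF B un grd_ob[OF p] u(1)] eq by simp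
  then show ?thesis using u(2) by simp
qed

lemma oper_cong:
  assumes A: "oper E a b E' d e ts ys A" and eq: "\<And>p. p \<in> GHom E a b \<Longrightarrow> B p = A p"
  shows "oper E a b E' d e ts ys B"
proof -
  have "B (reix xs u p) = A (reix xs u p)" if "p \<in> GHom E a b" "set xs \<subseteq> Ob V" "u \<in> Hom V (\<T> xs) (\<T> (grd p))" for xs u p
    using reix_hom[OF that] eq by auto
  then show ?thesis using A eq unfolding oper_def by auto
qed

text \<open>The outer operator sees the whole grade \<open>ts @ grd p @ ys\<close>, so its own
  grades are added on the outside. That the restrictions agree is the interchange of left and right
  whiskering.\<close>

lemma oper_comp:
  assumes A: "oper E a b E' d e ts ys A" and B: "oper E' d e E'' d' e' ts' ys' B"
    and "ts'' = ts' @ ts" "ys'' = ys @ ys'"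
  shows "oper E a b E'' d' e' ts'' ys'' (\<lambda>p. B (A p))"
  unfolding oper_def
proof (intro conjI ballI allI impI)
  fix p assume p: "p \<in> GHom E a b"
  show "B (A p) \<in> GHom E'' d' e'" "grd (B (A p)) = ts'' @ grd p @ ys''"
    using operD(3,4)[OF A p] operD(3,4)[OF B] assms(3,4) by auto
  fix xs u assume xs: "set xs \<subseteq> Ob V" and u: "u \<in> Hom V (\<T> xs) (\<T> (grd p))"
  note Ap = operD(3,4)[OF A p]
  note [simp] = operD(1,2)[OF A] operD(1,2)[OF B] grd_ob[OF p] xs
  have r: "rwhisker xs (grd p) ys u \<in> Hom V (\<T> (xs @ ys)) (\<T> (grd p @ ys))" using rwhisker_hom[OF u] by simp
  have l: "lwhisker ts (rwhisker xs (grd p) ys u) \<in> Hom V (\<T> (ts @ xs @ ys)) (\<T> (ts @ grd p @ ys))" using lwhisker_hom[OF r] by simp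
  have "B (A (reix xs u p)) = B (reix (ts @ xs @ ys) (lwhisker ts (rwhisker xs (grd p) ys u)) (A p))"
    using operD(5)[OF A p xs u] by simp
  also have "\<dots> = reix (ts' @ (ts @ xs @ ys) @ ys') (lwhisker ts' (rwhisker (ts @ xs @ ys) (ts @ grd p @ ys) ys' (lwhisker ts (rwhisker xs (grd p) ys u)))) (B (A p))"
    using operD(5)[OF B Ap(1), of "ts @ xs @ ys"] l Ap(2) by simp
  also have "rwhisker (ts @ xs @ ys) (ts @ grd p @ ys) ys' (lwhisker ts (rwhisker xs (grd p) ys u)) = lwhisker ts (rwhisker xs (grd p) (ys @ ys') u)"
    using rwhisker_lwhisker[OF r, of ys' ts] rwhisker_rwhisker[OF u, of ys ys'] by simp
  finally show "B (A (reix xs u p)) = reix (ts'' @ xs @ ys'') (lwhisker ts'' (rwhisker xs (grd p) ys'' u)) (B (A p))"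
    using assms(3,4) by (simp add: lwhisker_append)
qed (use assms operD(1,2)[OF A] operD(1,2)[OF B] in auto)

lemma oper_lcmp: "vcategory V E \<Longrightarrow> q \<in> GHom E b c \<Longrightarrow> oper E a b E a c (grd q) [] (\<lambda>p. q \<star>\<^bsub>E\<^esub> p)"
  unfolding oper_def by (auto simp: rwhisker_Nil grd_ob cmp_reix intro: gcmp_hom)

lemma oper_rcmp: "vcategory V E \<Longrightarrow> q \<in> GHom E a b \<Longrightarrow> oper E b c E a c [] (grd q) (\<lambda>p. p \<star>\<^bsub>E\<^esub> q)"
  unfolding oper_def by (auto simp: grd_ob reix_cmp intro: gcmp_hom)

lemma oper_post: "vcategory V E' \<Longrightarrow> q \<in> GHom E' e f \<Longrightarrow> oper E a b E' d e ts ys A \<Longrightarrow> ts' = grd q @ ts \<Longrightarrow>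
   oper E a b E' d f ts' ys (\<lambda>p. q \<star>\<^bsub>E'\<^esub> A p)"
  by (rule oper_comp[OF _ oper_lcmp]) auto

lemma oper_pre: "vcategory V E' \<Longrightarrow> q \<in> GHom E' c d \<Longrightarrow> oper E a b E' d e ts ys A \<Longrightarrow> ys' = ys @ grd q \<Longrightarrow>
   oper E a b E' c e ts ys' (\<lambda>p. A p \<star>\<^bsub>E'\<^esub> q)"
  by (rule oper_comp[OF _ oper_rcmp]) auto


subsection \<open>Functors and transformations on graded arrows\<close>

lemma gf_hom: "is_vfunctor V A B H \<Longrightarrow> p \<in> GHom A a b \<Longrightarrow> gf H p \<in> GHom B (vfo H a) (vfo H b)"
  by (auto elim!: GHom_E simp: GHom_iff vfun_simps)

lemma gf_idt: "is_vfunctor V A B H \<Longrightarrow> a \<in> VOb A \<Longrightarrow> gf H (gid A a) = gid B (vfo H a)"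
  by (simp add: vfun_idt)

lemma gf_cmp:
  assumes H: "is_vfunctor V A B H" and p: "p \<in> GHom A a b" and q: "q \<in> GHom A b c"
  shows "gf H (q \<star>\<^bsub>A\<^esub> p) = gf H q \<star>\<^bsub>B\<^esub> gf H p"
proof (rule GHom_E[OF p], rule GHom_E[OF q])
  note [simp] = vcat_simps[OF vfun_cat(1)[OF H]] vcat_simps[OF vfun_cat(2)[OF H]] vfun_simps[OF H]
  fix xs f ys g
  assume [simp]: "p = (a, xs, f, b)" "a \<in> VOb A" "b \<in> VOb A" "set xs \<subseteq> Ob V" "f \<in> Arr V" "Dom V f = \<T> xs" "Cod V f = VHom A a b"
      "q = (b, ys, g, c)" "c \<in> VOb A" "set ys \<subseteq> Ob V" "g \<in> Arr V" "Dom V g = \<T> ys" "Cod V g = VHom A b c"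
  have "vfa H a c \<cdot> VCmp A a b c \<cdot> (g \<odot> f) \<cdot> psi ys xs = (vfa H a c \<cdot> VCmp A a b c) \<cdot> (g \<odot> f) \<cdot> psi ys xs"
    by simp
  also have "\<dots> = VCmp B (vfo H a) (vfo H b) (vfo H c) \<cdot> ((vfa H b c \<cdot> g) \<odot> (vfa H a b \<cdot> f)) \<cdot> psi ys xs"
    by (subst vfun_cmp[OF H]) auto
  finally show ?thesis by simp
qed

lemma gf_comp:
  assumes H: "is_vfunctor V A B H" and G: "is_vfunctor V B E G" and p: "p \<in> GHom A a b"
  shows "gf (comp_vfun V G H) p = gf G (gf H p)"
  using p vfun_simps[OF H] vfun_simps[OF G] by (auto elim!: GHom_E)

lemma oper_gf:
  assumes H: "is_vfunctor V A B H"
  shows "oper A a b B (vfo H a) (vfo H b) [] [] (gf H)"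
  unfolding oper_def
proof (intro conjI ballI allI impI)
  fix p xs u assume p: "p \<in> GHom A a b" and xs: "set xs \<subseteq> Ob V" and u: "u \<in> Hom V (\<T> xs) (\<T> (grd p))"
  have "gf H (reix xs u p) = reix xs u (gf H p)"
    using p u vfun_simps[OF H] by (auto elim!: GHom_E simp: HomV_iff)
  then show "gf H (reix xs u p) = reix ([] @ xs @ []) (lwhisker [] (rwhisker xs (grd p) [] u)) (gf H p)"
    using u xs grd_ob[OF p] by (simp add: rwhisker_Nil)
qed (use gf_hom[OF H] in auto)

text \<open>A \<open>V\<close>-functor recovered from an action \<open>k\<close> on generalised
  elements: its effect on a hom object is read off at the universal element, with the unitor
  removed. Both components are restricted to the objects of \<open>A\<close> so that the result can
  be a member of \<open>ary_endofunctors\<close>.\<close>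

definition mk_vfun :: "('a, 'o, 'm) vcat \<Rightarrow> ('a \<Rightarrow> 'b) \<Rightarrow>
    ('a \<Rightarrow> 'a \<Rightarrow> 'a \<times> 'o list \<times> 'm \<times> 'a \<Rightarrow> 'b \<times> 'o list \<times> 'm \<times> 'b) \<Rightarrow> ('a, 'b, 'm) vfun" where
  "mk_vfun A h k = \<lparr>vfo = restrict h (VOb A),
     vfa = (\<lambda>a b. restrict (\<lambda>(a, b). el (k a b (univ A a b)) \<cdot> invV (runit V (VHom A a b))) (VOb A \<times> VOb A) (a, b))\<rparr>"

lemma mk_vfun:
  assumes A: "vcategory V A" and B: "vcategory V B"
    and h: "\<And>a. a \<in> VOb A \<Longrightarrow> h a \<in> VOb B"
    and k: "\<And>a b. a \<in> VOb A \<Longrightarrow> b \<in> VOb A \<Longrightarrow> oper A a b B (h a) (h b) [] [] (k a b)"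
    and idt: "\<And>a. a \<in> VOb A \<Longrightarrow> k a a (gid A a) = gid B (h a)"
    and cmp: "\<And>a b c p q. p \<in> GHom A a b \<Longrightarrow> q \<in> GHom A b c \<Longrightarrow> k a c (q \<star>\<^bsub>A\<^esub> p) = k b c q \<star>\<^bsub>B\<^esub> k a b p"
  shows "is_vfunctor V A B (mk_vfun A h k)"
    and "p \<in> GHom A a b \<Longrightarrow> gf (mk_vfun A h k) p = k a b p"
proof -
  let ?F = "mk_vfun A h k"
  note [simp] = vcat_simps[OF A] vcat_simps[OF B] h
  have o [simp]: "vfo ?F a = h a" if "a \<in> VOb A" for a using that by (simp add: mk_vfun_def)
  have ku: "k a b (univ A a b) \<in> GHom B (h a) (h b)" "grd (k a b (univ A a b)) = [VHom A a b]" if "a \<in> VOb A" "b \<in> VOb A" for a b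
    using operD(3,4)[OF k[OF that] univ_hom[OF A that]] by simp_all
  have a [simp]: "vfa ?F a b \<in> Arr V" "Dom V (vfa ?F a b) = VHom A a b" "Cod V (vfa ?F a b) = VHom B (h a) (h b)"
     "k a b (univ A a b) = (h a, [VHom A a b], vfa ?F a b \<cdot> runit V (VHom A a b), h b)"
    if "a \<in> VOb A" "b \<in> VOb A" for a b
    using ku[OF that] that by (auto simp: mk_vfun_def elim!: GHom_E)
  show gf: "gf ?F p = k a b p" if p: "p \<in> GHom A a b" for p a b
  proof -
    have [simp]: "a \<in> VOb A" "b \<in> VOb A" using GHom_ob[OF p] by auto
    show ?thesis
    proof (rule oper_eqI[OF A _ k _ p])
      show "oper A a b B (h a) (h b) [] [] (gf ?F)"
        unfolding oper_def
      proof (intro conjI ballI allI impI)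
        fix p xs u assume p: "p \<in> GHom A a b" and xs: "set xs \<subseteq> Ob V" and u: "u \<in> Hom V (\<T> xs) (\<T> (grd p))"
        have "gf ?F (reix xs u p) = reix xs u (gf ?F p)"
          using p u by (auto elim!: GHom_E simp: HomV_iff)
        then show "gf ?F (reix xs u p) = reix ([] @ xs @ []) (lwhisker [] (rwhisker xs (grd p) [] u)) (gf ?F p)"
          using u xs grd_ob[OF p] by (simp add: rwhisker_Nil)
      qed (auto elim!: GHom_E simp: GHom_iff)
      show "gf ?F (univ A a b) = k a b (univ A a b)" by (simp add: a(4)) (simp add: univ_def)
    qed auto
  qed
  have 1: "vfa ?F a a \<cdot> VIdt A a = VIdt B (h a)" if "a \<in> VOb A" for a
    using gf[OF gid_hom[OF A that]] idt[OF that] by simp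
  have 2: "vfa ?F a c \<cdot> VCmp A a b c = VCmp B (h a) (h b) (h c) \<cdot> (vfa ?F b c \<odot> vfa ?F a b)"
    if [simp]: "a \<in> VOb A" "b \<in> VOb A" "c \<in> VOb A" for a b c
  proof -
    let ?p = "univ A a b" and ?q = "univ A b c"
    \<comment> \<open>The composite of the two universal elements is the composition arrow
      precomposed with the isomorphism \<open>?r\<close>, so the equation for these elements gives
      the one for hom objects by cancellation.\<close>
    let ?r = "(runit V (VHom A b c) \<odot> runit V (VHom A a b)) \<cdot> psi [VHom A b c] [VHom A a b]"
    have [simp]: "is_iso V ?r" by (intro iso_cmp psi_iso) auto
    have pq: "?p \<in> GHom A a b" "?q \<in> GHom A b c" "?q \<star>\<^bsub>A\<^esub> ?p \<in> GHom A a c"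
      using univ_hom[OF A] gcmp_hom[OF A univ_hom[OF A] univ_hom[OF A]] by simp_all
    have "gf ?F (?q \<star>\<^bsub>A\<^esub> ?p) = gf ?F ?q \<star>\<^bsub>B\<^esub> gf ?F ?p"
      using gf[OF pq(1)] gf[OF pq(2)] gf[OF pq(3)] cmp[OF pq(1,2)] by simp
    then have "(vfa ?F a c \<cdot> VCmp A a b c) \<cdot> ?r = (VCmp B (h a) (h b) (h c) \<cdot> (vfa ?F b c \<odot> vfa ?F a b)) \<cdot> ?r"
      by (simp add: univ_def del: psi.simps)
    then show ?thesis by (rule iso_epi[rotated -1]) (simp_all del: psi.simps)
  qed
  show "is_vfunctor V A B ?F" using 1 2 A B by (auto simp: is_vfunctor_def Hom_iff)
qed

lemma mk_vfun_ext: "vfo (mk_vfun A h k) \<in> extensional (VOb A)"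
  "case_prod (vfa (mk_vfun A h k)) \<in> extensional (VOb A \<times> VOb A)"
  by (auto simp: mk_vfun_def extensional_def)

text \<open>\<open>V\<close>-naturality becomes the usual naturality square, required for arrows of
  every grade; the square at the universal element returns the equation between arrows out of the
  hom object.\<close>

lemma vnat_trans_iff:
  assumes F: "is_vfunctor V A B F" and G: "is_vfunctor V A B G"
  shows "is_vnat_trans V A B F G \<alpha> \<longleftrightarrow>
    (\<forall>a\<in>VOb A. (vfo F a, [], \<alpha> a, vfo G a) \<in> GHom B (vfo F a) (vfo G a)) \<and>
    (\<forall>a b p. p \<in> GHom A a b \<longrightarrow>
       (vfo F b, [], \<alpha> b, vfo G b) \<star>\<^bsub>B\<^esub> gf F p = gf G p \<star>\<^bsub>B\<^esub> (vfo F a, [], \<alpha> a, vfo G a))"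
    (is "_ \<longleftrightarrow> ?T \<and> ?N")
proof -
  note [simp] = vcat_simps[OF vfun_cat(1)[OF F]] vcat_simps[OF vfun_cat(2)[OF F]] vfun_simps[OF F] vfun_simps[OF G]
  have T: "(\<forall>a\<in>VOb A. \<alpha> a \<in> Hom V \<I> (VHom B (vfo F a) (vfo G a))) \<longleftrightarrow> ?T"
    by (auto simp: GHom_iff HomV_iff)
  let ?L = "\<lambda>a b. VCmp B (vfo F a) (vfo F b) (vfo G b) \<cdot> (\<alpha> b \<odot> vfa F a b) \<cdot> invV (lunit V (VHom A a b))"
  let ?R = "\<lambda>a b. VCmp B (vfo F a) (vfo G a) (vfo G b) \<cdot> (vfa G a b \<odot> \<alpha> a) \<cdot> invV (runit V (VHom A a b))"
  have "(\<forall>a\<in>VOb A. \<forall>b\<in>VOb A. ?L a b = ?R a b) \<longleftrightarrow> ?N" if "?T"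
  proof -
    have [simp]: "\<alpha> a \<in> Arr V" "Dom V (\<alpha> a) = \<I>" "Cod V (\<alpha> a) = VHom B (vfo F a) (vfo G a)" if "a \<in> VOb A" for a
      using that \<open>?T\<close> by (auto simp: GHom_iff)
    have eq: "(vfo F b, [], \<alpha> b, vfo G b) \<star>\<^bsub>B\<^esub> gf F (a, xs, f, b) = (vfo F a, xs, ?L a b \<cdot> f, vfo G b)"
      "gf G (a, xs, f, b) \<star>\<^bsub>B\<^esub> (vfo F a, [], \<alpha> a, vfo G a) = (vfo F a, xs, ?R a b \<cdot> f, vfo G b)"
      if "(a, xs, f, b) \<in> GHom A a b" for a xs f b
    proof -
      have [simp]: "a \<in> VOb A" "b \<in> VOb A" "set xs \<subseteq> Ob V" "f \<in> Arr V" "Dom V f = \<T> xs" "Cod V f = VHom A a b"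
        using that by (auto simp: GHom_iff)
      show "(vfo F b, [], \<alpha> b, vfo G b) \<star>\<^bsub>B\<^esub> gf F (a, xs, f, b) = (vfo F a, xs, ?L a b \<cdot> f, vfo G b)"
        by (simp add: lunit_inv_nat)
      show "gf G (a, xs, f, b) \<star>\<^bsub>B\<^esub> (vfo F a, [], \<alpha> a, vfo G a) = (vfo F a, xs, ?R a b \<cdot> f, vfo G b)"
        by (simp add: runit_inv_nat psi_Nil_right)
    qed
    show ?thesis
    proof
      assume L: "\<forall>a\<in>VOb A. \<forall>b\<in>VOb A. ?L a b = ?R a b"
      show ?N
      proof (intro allI impI)
        fix a b p assume p: "p \<in> GHom A a b"
        then obtain xs f where [simp]: "p = (a, xs, f, b)" and "a \<in> VOb A" "b \<in> VOb A" by (auto elim!: GHom_E)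
        then show "(vfo F b, [], \<alpha> b, vfo G b) \<star>\<^bsub>B\<^esub> gf F p = gf G p \<star>\<^bsub>B\<^esub> (vfo F a, [], \<alpha> a, vfo G a)"
          using L eq[of a xs f b] p by (simp del: tuple_simps gr_simps)
      qed
    next
      assume N: ?N
      show "\<forall>a\<in>VOb A. \<forall>b\<in>VOb A. ?L a b = ?R a b"
      proof (intro ballI)
        fix a b assume [simp]: "a \<in> VOb A" "b \<in> VOb A"
        have u: "(a, [VHom A a b], runit V (VHom A a b), b) \<in> GHom A a b" by (simp add: GHom_iff)
        have "?L a b \<cdot> runit V (VHom A a b) = ?R a b \<cdot> runit V (VHom A a b)"
          using N[rule_format, OF u] unfolding eq[OF u] by simp
        then show "?L a b = ?R a b" by (rule iso_epi[rotated -1]) simp_all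
      qed
    qed
  qed
  then show ?thesis using F G T unfolding is_vnat_trans_def by blast
qed

end

section \<open>Weighted colimits in terms of graded arrows\<close>

context symmetric_monoidal_closed
begin

text \<open>Stands for a \<open>V\<close>-natural family of arrows from
  \<open>\<T> ts \<otimes> C(i b,c)\<close> to \<open>E(D b,x)\<close>, that is, for an element of
  grade \<open>ts\<close> of the hom object from \<open>C(i-,c)\<close> to \<open>E(D-,x)\<close>,
  whether or not that hom object exists.\<close>

definition graded_family :: "('b, 'o, 'm) vcat \<Rightarrow> ('c, 'o, 'm) vcat \<Rightarrow> ('b, 'c, 'm) vfun \<Rightarrow> 'c \<Rightarrow>
    ('e, 'o, 'm) vcat \<Rightarrow> ('b, 'e, 'm) vfun \<Rightarrow> 'e \<Rightarrow> 'o list \<Rightarrow>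
    ('b \<Rightarrow> 'c \<times> 'o list \<times> 'm \<times> 'c \<Rightarrow> 'e \<times> 'o list \<times> 'm \<times> 'e) \<Rightarrow> bool" where
  "graded_family B C i c E D x ts A \<longleftrightarrow> set ts \<subseteq> Ob V \<and> (\<forall>b\<in>VOb B. oper C (vfo i b) c E (vfo D b) x ts [] (A b)) \<and>
     (\<forall>b b' p q. p \<in> GHom C (vfo i b) c \<longrightarrow> q \<in> GHom B b' b \<longrightarrow>
        A b' (p \<star>\<^bsub>C\<^esub> gf i q) = A b p \<star>\<^bsub>E\<^esub> gf D q)"

text \<open>\<open>l\<close> is the colimit of \<open>D\<close> weighted by \<open>C(i-,c)\<close>, with unit \<open>K b\<close> from \<open>C(i b,c)\<close> to \<open>E(D b,l)\<close>.\<close>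

definition gcolim :: "('b, 'o, 'm) vcat \<Rightarrow> ('c, 'o, 'm) vcat \<Rightarrow> ('b, 'c, 'm) vfun \<Rightarrow> 'c \<Rightarrow>
    ('e, 'o, 'm) vcat \<Rightarrow> ('b, 'e, 'm) vfun \<Rightarrow> 'e \<Rightarrow>
    ('b \<Rightarrow> 'c \<times> 'o list \<times> 'm \<times> 'c \<Rightarrow> 'e \<times> 'o list \<times> 'm \<times> 'e) \<Rightarrow> bool" where
  "gcolim B C i c E D l K \<longleftrightarrow> l \<in> VOb E \<and> graded_family B C i c E D l [] K \<and>
     (\<forall>x\<in>VOb E. \<forall>ts A. graded_family B C i c E D x ts A \<longrightarrow>
        (\<exists>!u. u \<in> GHom E l x \<and> grd u = ts \<and> (\<forall>b\<in>VOb B. \<forall>p\<in>GHom C (vfo i b) c. u \<star>\<^bsub>E\<^esub> K b p = A b p)))"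

text \<open>The same notion in terms of arrows of \<open>V\<close>, with one object \<open>t\<close>
  in place of a list. It lies half way between \<open>is_vnat_family\<close>, whose components are
  transposed, and \<open>graded_family\<close>, whose components are operators.\<close>

definition natural_family :: "('b, 'o, 'm) vcat \<Rightarrow> ('c, 'o, 'm) vcat \<Rightarrow> ('b, 'c, 'm) vfun \<Rightarrow> 'c \<Rightarrow>
    ('e, 'o, 'm) vcat \<Rightarrow> ('b, 'e, 'm) vfun \<Rightarrow> 'e \<Rightarrow> 'o \<Rightarrow> ('b \<Rightarrow> 'm) \<Rightarrow> bool" where
  "natural_family B C i c E D x t a \<longleftrightarrow> t \<in> Ob V \<and>
     (\<forall>b\<in>VOb B. a b \<in> Hom V (t \<otimes> VHom C (vfo i b) c) (VHom E (vfo D b) x)) \<and>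
     (\<forall>b\<in>VOb B. \<forall>b'\<in>VOb B.
        a b' \<cdot> (\<iota> t \<odot> (VCmp C (vfo i b') (vfo i b) c \<cdot> (\<iota> (VHom C (vfo i b) c) \<odot> vfa i b' b))) =
        VCmp E (vfo D b') (vfo D b) x \<cdot> (a b \<odot> vfa D b' b) \<cdot> invV (assc V t (VHom C (vfo i b) c) (VHom B b' b)))"

lemma natural_family_cong: "natural_family B C i c E D x t a \<Longrightarrow> (\<And>b. b \<in> VOb B \<Longrightarrow> a' b = a b) \<Longrightarrow> natural_family B C i c E D x t a'"
  by (simp add: natural_family_def)

lemma graded_familyD:
  assumes "graded_family B C i c E D x ts A"
  shows "set ts \<subseteq> Ob V" "b \<in> VOb B \<Longrightarrow> oper C (vfo i b) c E (vfo D b) x ts [] (A b)"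
    "p \<in> GHom C (vfo i b) c \<Longrightarrow> q \<in> GHom B b' b \<Longrightarrow> A b' (p \<star>\<^bsub>C\<^esub> gf i q) = A b p \<star>\<^bsub>E\<^esub> gf D q"
    "b \<in> VOb B \<Longrightarrow> p \<in> GHom C (vfo i b) c \<Longrightarrow> A b p \<in> GHom E (vfo D b) x"
    "b \<in> VOb B \<Longrightarrow> p \<in> GHom C (vfo i b) c \<Longrightarrow> grd (A b p) = ts @ grd p"
proof -
  show "set ts \<subseteq> Ob V" and o: "\<And>b. b \<in> VOb B \<Longrightarrow> oper C (vfo i b) c E (vfo D b) x ts [] (A b)"
    using assms by (simp_all add: graded_family_def)
  show "p \<in> GHom C (vfo i b) c \<Longrightarrow> q \<in> GHom B b' b \<Longrightarrow> A b' (p \<star>\<^bsub>C\<^esub> gf i q) = A b p \<star>\<^bsub>E\<^esub> gf D q"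
    using assms unfolding graded_family_def by blast
  show "b \<in> VOb B \<Longrightarrow> p \<in> GHom C (vfo i b) c \<Longrightarrow> A b p \<in> GHom E (vfo D b) x"
    "b \<in> VOb B \<Longrightarrow> p \<in> GHom C (vfo i b) c \<Longrightarrow> grd (A b p) = ts @ grd p"
    using operD(3,4)[OF o] by simp_all
qed

lemma graded_familyI:
  assumes "set ts \<subseteq> Ob V" "\<And>b. b \<in> VOb B \<Longrightarrow> oper C (vfo i b) c E (vfo D b) x ts [] (A b)"
    "\<And>b b' p q. p \<in> GHom C (vfo i b) c \<Longrightarrow> q \<in> GHom B b' b \<Longrightarrow> A b' (p \<star>\<^bsub>C\<^esub> gf i q) = A b p \<star>\<^bsub>E\<^esub> gf D q"
  shows "graded_family B C i c E D x ts A"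
  using assms unfolding graded_family_def by blast

lemma graded_family_cong:
  assumes A: "graded_family B C i c E D x ts A" and eq: "\<And>b p. b \<in> VOb B \<Longrightarrow> p \<in> GHom C (vfo i b) c \<Longrightarrow> A' b p = A b p"
    and i: "is_vfunctor V B C i"
  shows "graded_family B C i c E D x ts A'"
proof (rule graded_familyI)
  show "set ts \<subseteq> Ob V" by (rule graded_familyD(1)[OF A])
  show "oper C (vfo i b) c E (vfo D b) x ts [] (A' b)" if "b \<in> VOb B" for b
    by (rule oper_cong[OF graded_familyD(2)[OF A that]]) (rule eq[OF that])
  fix b b' p q assume p: "p \<in> GHom C (vfo i b) c" and q: "q \<in> GHom B b' b"
  have "p \<star>\<^bsub>C\<^esub> gf i q \<in> GHom C (vfo i b') c" by (rule gcmp_hom[OF vfun_cat(2)[OF i] gf_hom[OF i q] p])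
  then show "A' b' (p \<star>\<^bsub>C\<^esub> gf i q) = A' b p \<star>\<^bsub>E\<^esub> gf D q"
    using graded_familyD(3)[OF A p q] eq p GHom_ob[OF q] by metis
qed

text \<open>The family is transposed. Symmetries then come from the opposite category on both sides
  and from \<open>is_vnat_family\<close> itself; the hexagon combines them into a single isomorphism
  common to the two sides.\<close>

lemma vnat_family_iff:
  assumes i: "is_vfunctor V B C i" and c: "c \<in> VOb C" and D: "is_vfunctor V B E D" and x: "x \<in> VOb E"
  shows "is_vnat_family V (op_vcat V B) (self_vcat V) (corep_vfun V C i c) (corep_vfun V E D x) t \<alpha> \<longleftrightarrow>
    (\<forall>b\<in>VOb B. \<alpha> b \<in> Hom V t (ihom V (VHom C (vfo i b) c) (VHom E (vfo D b) x))) \<and>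
    natural_family B C i c E D x t (\<lambda>b. unc (VHom C (vfo i b) c) (VHom E (vfo D b) x) (\<alpha> b))"
proof -
  note [simp] = vcat_simps[OF vfun_cat(1)[OF i]] vcat_simps[OF vfun_cat(2)[OF i]] vcat_simps[OF vfun_cat(2)[OF D]]
    vfun_simps[OF i] vfun_simps[OF D] corep_simps(1-4)[OF i c] corep_simps(1-4)[OF D x] c x
  let ?S = "self_vcat V" and ?F = "corep_vfun V C i c" and ?G = "corep_vfun V E D x"
  let ?W = "\<lambda>b. VHom C (vfo i b) c" and ?X = "\<lambda>b. VHom E (vfo D b) x"
  let ?a = "\<lambda>b. unc (?W b) (?X b) (\<alpha> b)"
  have "(VCmp ?S (?W a) (?W b) (?X b) \<cdot> (\<alpha> b \<odot> vfa ?F a b) =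
        VCmp ?S (?W a) (?X a) (?X b) \<cdot> (vfa ?G a b \<odot> \<alpha> a) \<cdot> symm V t (VHom B b a)) \<longleftrightarrow>
        ?a b \<cdot> (\<iota> t \<odot> (VCmp C (vfo i b) (vfo i a) c \<cdot> (\<iota> (?W a) \<odot> vfa i b a))) =
        VCmp E (vfo D b) (vfo D a) x \<cdot> (?a a \<odot> vfa D b a) \<cdot> invV (assc V t (?W a) (VHom B b a))"
      (is "?L = ?R \<longleftrightarrow> ?L' = ?R'")
    if [simp]: "a \<in> VOb B" "b \<in> VOb B" "t \<in> Ob V" and
      "\<And>b. b \<in> VOb B \<Longrightarrow> \<alpha> b \<in> Hom V t (ihom V (?W b) (?X b))" for a b
  proof -
    have [simp]: "\<alpha> b \<in> Arr V" "Dom V (\<alpha> b) = t" "Cod V (\<alpha> b) = ihom V (?W b) (?X b)"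
      "\<alpha> a \<in> Arr V" "Dom V (\<alpha> a) = t" "Cod V (\<alpha> a) = ihom V (?W a) (?X a)"
      using that by (auto simp: Hom_iff)
    let ?B = "VHom B b a"
    \<comment> \<open>Moves the hom object of \<open>B\<close> from between \<open>t\<close> and the
      weight to the end. It is invertible, so it can be cancelled in the transposed
      equation.\<close>
    let ?Z = "(\<iota> t \<odot> symm V ?B (?W a)) \<cdot> assc V t ?B (?W a)"
    have [simp]: "is_iso V ?Z" by (rule iso_cmp) auto
    have L: "unc (?W a) (?X b) ?L = ?L' \<cdot> ?Z"
    proof -
      have "unc (?W a) (?X b) ?L = ?a b \<cdot> (\<iota> t \<odot> (VCmp C (vfo i b) (vfo i a) c \<cdot>
          (symm V (VHom C (vfo i b) (vfo i a)) (?W a) \<cdot> (vfa i b a \<odot> \<iota> (?W a))))) \<cdot> assc V t ?B (?W a)"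
        by (simp add: unc_scmp corep_simps(5)[OF i c])
      also have "\<dots> = ?L' \<cdot> ?Z" by (subst symm_nat) auto
      finally show ?thesis .
    qed
    have R: "unc (?W a) (?X b) ?R = ?R' \<cdot> ?Z"
    proof -
      have h: "invV (assc V t (?W a) ?B) \<cdot> ?Z = symm V ?B (t \<otimes> ?W a) \<cdot> assc V ?B t (?W a) \<cdot> (symm V t ?B \<odot> \<iota> (?W a))"
      proof -
        have "(assc V t (?W a) ?B \<cdot> symm V ?B (t \<otimes> ?W a) \<cdot> assc V ?B t (?W a)) \<cdot> (symm V t ?B \<odot> \<iota> (?W a)) = ?Z"
          by (subst hexagon) (auto simp: symm_symm)
        from arg_cong[OF this, of "\<lambda>h. invV (assc V t (?W a) ?B) \<cdot> h"] show ?thesis by simp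
      qed
      have "unc (?W a) (?X b) ?R = unc (?W a) (?X b) ((VCmp ?S (?W a) (?X a) (?X b) \<cdot> (vfa ?G a b \<odot> \<alpha> a)) \<cdot> symm V t ?B)" by simp
      also have "\<dots> = unc (?W a) (?X b) (VCmp ?S (?W a) (?X a) (?X b) \<cdot> (vfa ?G a b \<odot> \<alpha> a)) \<cdot> (symm V t ?B \<odot> \<iota> (?W a))"
        by (rule unc_cmp) auto
      also have "\<dots> = VCmp E (vfo D b) (vfo D a) x \<cdot> (symm V (VHom E (vfo D b) (vfo D a)) (?X a) \<cdot> (vfa D b a \<odot> ?a a)) \<cdot>
          assc V ?B t (?W a) \<cdot> (symm V t ?B \<odot> \<iota> (?W a))"
        by (simp add: unc_scmp corep_simps(5)[OF D x])
      also have "\<dots> = VCmp E (vfo D b) (vfo D a) x \<cdot> (?a a \<odot> vfa D b a) \<cdot> (symm V ?B (t \<otimes> ?W a) \<cdot> assc V ?B t (?W a) \<cdot> (symm V t ?B \<odot> \<iota> (?W a)))"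
        by (subst symm_nat) auto
      finally show ?thesis unfolding h[symmetric] by simp
    qed
    show ?thesis
    proof
      assume "?L = ?R"
      then have "?L' \<cdot> ?Z = ?R' \<cdot> ?Z" using L R by metis
      then show "?L' = ?R'" by (rule iso_epi[rotated -1]) auto
    next
      assume "?L' = ?R'"
      then have "unc (?W a) (?X b) ?L = unc (?W a) (?X b) ?R" using L R by metis
      then show "?L = ?R" by (rule unc_inj) auto
    qed
  qed
  note key = this
  have ty: "(\<forall>b\<in>VOb B. ?a b \<in> Hom V (t \<otimes> ?W b) (?X b))"
    if "\<forall>b\<in>VOb B. \<alpha> b \<in> Hom V t (ihom V (?W b) (?X b))"
    using that by (auto simp: Hom_iff)
  show ?thesis
  proof
    assume L: "is_vnat_family V (op_vcat V B) (self_vcat V) (corep_vfun V C i c) (corep_vfun V E D x) t \<alpha>"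
    then have t: "t \<in> Ob V" and \<alpha>: "\<forall>b\<in>VOb B. \<alpha> b \<in> Hom V t (ihom V (?W b) (?X b))" by (auto simp: is_vnat_family_def)
    show "(\<forall>b\<in>VOb B. \<alpha> b \<in> Hom V t (ihom V (?W b) (?X b))) \<and> natural_family B C i c E D x t ?a"
      unfolding natural_family_def using L ty[OF \<alpha>] key[OF _ _ t \<alpha>[rule_format]] t \<alpha> by (simp add: is_vnat_family_def)
  next
    assume R: "(\<forall>b\<in>VOb B. \<alpha> b \<in> Hom V t (ihom V (?W b) (?X b))) \<and> natural_family B C i c E D x t ?a"
    then have t: "t \<in> Ob V" and \<alpha>: "\<forall>b\<in>VOb B. \<alpha> b \<in> Hom V t (ihom V (?W b) (?X b))" by (auto simp: natural_family_def)
    show "is_vnat_family V (op_vcat V B) (self_vcat V) (corep_vfun V C i c) (corep_vfun V E D x) t \<alpha>"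
      unfolding is_vnat_family_def using R key[OF _ _ t \<alpha>[rule_format]] t \<alpha> by (simp add: natural_family_def)
  qed
qed

text \<open>A transformation is a family indexed by the unit object. One definition uses inverse
  unitors and the other a symmetry; they differ by composition with \<open>lunit\<close>, through
  \<open>runit_symm\<close>.\<close>

lemma vnat_trans_family:
  assumes "is_vfunctor V A B F" "is_vfunctor V A B G"
  shows "is_vnat_trans V A B F G \<alpha> \<longleftrightarrow> is_vnat_family V A B F G \<I> \<alpha>"
proof -
  note [simp] = vcat_simps[OF vfun_cat(1)[OF assms(1)]] vcat_simps[OF vfun_cat(2)[OF assms(1)]] vfun_simps[OF assms(1)] vfun_simps[OF assms(2)]
  have "VCmp B (vfo F a) (vfo F b) (vfo G b) \<cdot> (\<alpha> b \<odot> vfa F a b) \<cdot> invV (lunit V (VHom A a b)) =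
        VCmp B (vfo F a) (vfo G a) (vfo G b) \<cdot> (vfa G a b \<odot> \<alpha> a) \<cdot> invV (runit V (VHom A a b)) \<longleftrightarrow>
        VCmp B (vfo F a) (vfo F b) (vfo G b) \<cdot> (\<alpha> b \<odot> vfa F a b) =
        VCmp B (vfo F a) (vfo G a) (vfo G b) \<cdot> (vfa G a b \<odot> \<alpha> a) \<cdot> symm V \<I> (VHom A a b)" (is "?L = ?R \<longleftrightarrow> ?L' = ?R'")
    if [simp]: "a \<in> VOb A" "b \<in> VOb A" and
      "\<And>b. b \<in> VOb A \<Longrightarrow> \<alpha> b \<in> Hom V \<I> (VHom B (vfo F b) (vfo G b))" for a b
  proof -
    have [simp]: "\<alpha> b \<in> Arr V" "Dom V (\<alpha> b) = \<I>" "Cod V (\<alpha> b) = VHom B (vfo F b) (vfo G b)"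
      "\<alpha> a \<in> Arr V" "Dom V (\<alpha> a) = \<I>" "Cod V (\<alpha> a) = VHom B (vfo F a) (vfo G a)"
      using that by (auto simp: Hom_iff)
    have 1: "?L \<cdot> lunit V (VHom A a b) = ?L'" by simp
    have "invV (runit V (VHom A a b)) \<cdot> (runit V (VHom A a b) \<cdot> symm V \<I> (VHom A a b)) = symm V \<I> (VHom A a b)" by simp
    then have 2: "?R \<cdot> lunit V (VHom A a b) = ?R'" by (simp add: runit_symm)
    show ?thesis
    proof
      assume "?L = ?R" then show "?L' = ?R'" using 1 2 by simp
    next
      assume "?L' = ?R'"
      then have "?L \<cdot> lunit V (VHom A a b) = ?R \<cdot> lunit V (VHom A a b)" unfolding 1 2 .
      then show "?L = ?R" by (rule iso_epi[rotated -1]) auto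
    qed
  qed
  then show ?thesis using assms unfolding is_vnat_trans_def is_vnat_family_def by auto
qed

text \<open>Used to pass between an object \<open>t\<close> and \<open>\<T> [t]\<close>, which
  differ by a right unitor.\<close>

lemma natural_family_pull:
  assumes "natural_family B C i c E D x t a" and v: "v \<in> Hom V s t" and s: "s \<in> Ob V"
    and i: "is_vfunctor V B C i" and c: "c \<in> VOb C" and D: "is_vfunctor V B E D" and x: "x \<in> VOb E"
  shows "natural_family B C i c E D x s (\<lambda>b. a b \<cdot> (v \<odot> \<iota> (VHom C (vfo i b) c)))"
proof -
  note [simp] = vcat_simps[OF vfun_cat(1)[OF i]] vcat_simps[OF vfun_cat(2)[OF i]] vcat_simps[OF vfun_cat(2)[OF D]]
    vfun_simps[OF i] vfun_simps[OF D] c x s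
  have [simp]: "v \<in> Arr V" "Dom V v = s" "Cod V v = t" "t \<in> Ob V" using v assms(1) by (auto simp: Hom_iff natural_family_def)
  have [simp]: "a b \<in> Arr V" "Dom V (a b) = t \<otimes> VHom C (vfo i b) c" "Cod V (a b) = VHom E (vfo D b) x" if "b \<in> VOb B" for b
    using assms(1) that by (auto simp: Hom_iff natural_family_def)
  have "(a b' \<cdot> (v \<odot> \<iota> (VHom C (vfo i b') c))) \<cdot> (\<iota> s \<odot> (VCmp C (vfo i b') (vfo i b) c \<cdot> (\<iota> (VHom C (vfo i b) c) \<odot> vfa i b' b))) =
        VCmp E (vfo D b') (vfo D b) x \<cdot> ((a b \<cdot> (v \<odot> \<iota> (VHom C (vfo i b) c))) \<odot> vfa D b' b) \<cdot> invV (assc V s (VHom C (vfo i b) c) (VHom B b' b))"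
    if [simp]: "b \<in> VOb B" "b' \<in> VOb B" for b b'
  proof -
    have "(a b' \<cdot> (v \<odot> \<iota> (VHom C (vfo i b') c))) \<cdot> (\<iota> s \<odot> (VCmp C (vfo i b') (vfo i b) c \<cdot> (\<iota> (VHom C (vfo i b) c) \<odot> vfa i b' b))) =
      (a b' \<cdot> (\<iota> t \<odot> (VCmp C (vfo i b') (vfo i b) c \<cdot> (\<iota> (VHom C (vfo i b) c) \<odot> vfa i b' b)))) \<cdot>
      (v \<odot> (\<iota> (VHom C (vfo i b) c) \<odot> \<iota> (VHom B b' b)))" by simp
    also have "\<dots> = VCmp E (vfo D b') (vfo D b) x \<cdot> (a b \<odot> vfa D b' b) \<cdot> (invV (assc V t (VHom C (vfo i b) c) (VHom B b' b)) \<cdot>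
      (v \<odot> (\<iota> (VHom C (vfo i b) c) \<odot> \<iota> (VHom B b' b))))"
      using assms(1) by (subst (1) natural_family_def[THEN iffD1, THEN conjunct2, THEN conjunct2, rule_format]) auto
    also have "\<dots> = VCmp E (vfo D b') (vfo D b) x \<cdot> (a b \<odot> vfa D b' b) \<cdot> (((v \<odot> \<iota> (VHom C (vfo i b) c)) \<odot> \<iota> (VHom B b' b)) \<cdot>
      invV (assc V s (VHom C (vfo i b) c) (VHom B b' b)))"
      by (subst assc_inv_nat) auto
    finally show ?thesis by simp
  qed
  then show ?thesis by (auto simp: natural_family_def Hom_iff)
qed

section \<open>Operators and the arrows of \<open>V\<close> that represent them\<close>

definition raw_oper :: "'d \<Rightarrow> 'd \<Rightarrow> 'o list \<Rightarrow> 'm \<Rightarrow> 'a \<times> 'o list \<times> 'm \<times> 'a \<Rightarrow> 'd \<times> 'o list \<times> 'm \<times> 'd" where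
  "raw_oper d e ts a p = (d, ts @ grd p, a \<cdot> (\<iota> (\<T> ts) \<odot> el p) \<cdot> psi ts (grd p), e)"

lemma oper_raw_oper:
  assumes C: "vcategory V C" and E: "vcategory V E" and ab: "a \<in> VOb C" "b \<in> VOb C" "d \<in> VOb E" "e \<in> VOb E" "set ts \<subseteq> Ob V"
    and r: "r \<in> Hom V (\<T> ts \<otimes> VHom C a b) (VHom E d e)"
  shows "oper C a b E d e ts [] (raw_oper d e ts r)"
  unfolding oper_def
proof (intro conjI ballI allI impI)
  note [simp] = vcat_simps[OF C] vcat_simps[OF E] ab
  have [simp]: "r \<in> Arr V" "Dom V r = \<T> ts \<otimes> VHom C a b" "Cod V r = VHom E d e" using r by (auto simp: Hom_iff)
  fix p assume p: "p \<in> GHom C a b"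
  show "raw_oper d e ts r p \<in> GHom E d e" "grd (raw_oper d e ts r p) = ts @ grd p @ []"
    using p by (auto elim!: GHom_E simp: raw_oper_def GHom_iff)
  fix xs u assume xs: "set xs \<subseteq> Ob V" and u: "u \<in> Hom V (\<T> xs) (\<T> (grd p))"
  from p show "raw_oper d e ts r (reix xs u p) = reix (ts @ xs @ []) (lwhisker ts (rwhisker xs (grd p) [] u)) (raw_oper d e ts r p)"
  proof (rule GHom_E)
    fix ys f assume [simp]: "p = (a, ys, f, b)" "set ys \<subseteq> Ob V" "f \<in> Arr V" "Dom V f = \<T> ys" "Cod V f = VHom C a b"
    have u': "u \<in> Hom V (\<T> xs) (\<T> ys)" using u by simp
    have [simp]: "u \<in> Arr V" "Dom V u = \<T> xs" "Cod V u = \<T> ys" using u by (auto simp: Hom_iff)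
    have [simp]: "lwhisker ts u \<in> Arr V" "Dom V (lwhisker ts u) = \<T> (ts @ xs)" "Cod V (lwhisker ts u) = \<T> (ts @ ys)"
      using lwhisker_arr_aux[of u xs ys ts] by auto
    have "(r \<cdot> (\<iota> (\<T> ts) \<odot> f) \<cdot> psi ts ys) \<cdot> lwhisker ts u = r \<cdot> (\<iota> (\<T> ts) \<odot> f) \<cdot> (psi ts ys \<cdot> lwhisker ts u)"
      by simp
    also have "\<dots> = r \<cdot> (\<iota> (\<T> ts) \<odot> (f \<cdot> u)) \<cdot> psi ts xs" using psi_lwhisker[OF u' _ xs, of ts] xs by simp
    finally show ?thesis using xs u' by (simp add: raw_oper_def rwhisker_Nil)
  qed
qed (use ab in auto)

text \<open>At the universal element the representing arrow is merely precomposed with an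
  isomorphism.\<close>

lemma raw_oper_inj:
  assumes C: "vcategory V C" and ab: "a \<in> VOb C" "b \<in> VOb C" "set ts \<subseteq> Ob V"
    and r: "r \<in> Hom V (\<T> ts \<otimes> VHom C a b) y" and r': "r' \<in> Hom V (\<T> ts \<otimes> VHom C a b) y"
    and eq: "raw_oper d e ts r (univ C a b) = raw_oper d e ts r' (univ C a b)"
  shows "r = r'"
proof -
  note [simp] = vcat_simps[OF C] ab
  have [simp]: "r \<in> Arr V" "Dom V r = \<T> ts \<otimes> VHom C a b" "Cod V r = y" "r' \<in> Arr V" "Dom V r' = \<T> ts \<otimes> VHom C a b" "Cod V r' = y"
    using r r' by (auto simp: Hom_iff)
  have "r \<cdot> ((\<iota> (\<T> ts) \<odot> runit V (VHom C a b)) \<cdot> psi ts [VHom C a b]) = r' \<cdot> ((\<iota> (\<T> ts) \<odot> runit V (VHom C a b)) \<cdot> psi ts [VHom C a b])"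
    using eq by (simp add: raw_oper_def univ_def)
  then show ?thesis by (rule iso_epi[rotated -1]) (auto intro!: iso_cmp)
qed

text \<open>The representing arrow is the value at the universal element, with the comparison
  \<open>psi ts [VHom C a b]\<close> and the unitor undone.\<close>

lemma raw_oper_ex:
  assumes C: "vcategory V C" and E: "vcategory V E" and ab: "a \<in> VOb C" "b \<in> VOb C" "d \<in> VOb E" "e \<in> VOb E"
    and A: "oper C a b E d e ts [] A"
  shows "\<exists>r. r \<in> Hom V (\<T> ts \<otimes> VHom C a b) (VHom E d e) \<and> (\<forall>p\<in>GHom C a b. A p = raw_oper d e ts r p)"
proof -
  note [simp] = vcat_simps[OF C] vcat_simps[OF E] ab operD(1)[OF A]
  let ?r = "el (A (univ C a b)) \<cdot> invV (psi ts [VHom C a b]) \<cdot> (\<iota> (\<T> ts) \<odot> invV (runit V (VHom C a b)))"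
  obtain f where f: "A (univ C a b) = (d, ts @ [VHom C a b], f, e)" and
     [simp]: "f \<in> Arr V" "Dom V f = \<T> (ts @ [VHom C a b])" "Cod V f = VHom E d e"
    using operD(3,4)[OF A univ_hom[OF C ab(1,2)]] by (auto elim!: GHom_E)
  have r: "?r \<in> Hom V (\<T> ts \<otimes> VHom C a b) (VHom E d e)" by (simp add: f Hom_iff)
  have "A p = raw_oper d e ts ?r p" if "p \<in> GHom C a b" for p
    by (rule oper_eqI[OF C A oper_raw_oper[OF C E ab operD(1)[OF A] r] _ that]) (simp add: raw_oper_def univ_def f[unfolded univ_def])
  then show ?thesis using r by blast
qed

text \<open>At \<open>p\<close> and \<open>q\<close>, the two sides of the graded condition are the
  two sides of the raw condition precomposed with the same arrow \<open>?Z p q\<close>; for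
  universal \<open>p\<close> and \<open>q\<close> this arrow is invertible.\<close>

lemma graded_family_raw_oper:
  assumes i: "is_vfunctor V B C i" and c: "c \<in> VOb C" and D: "is_vfunctor V B E D" and x: "x \<in> VOb E" and ts: "set ts \<subseteq> Ob V"
    and a: "\<And>b. b \<in> VOb B \<Longrightarrow> a b \<in> Hom V (\<T> ts \<otimes> VHom C (vfo i b) c) (VHom E (vfo D b) x)"
  shows "graded_family B C i c E D x ts (\<lambda>b. raw_oper (vfo D b) x ts (a b)) \<longleftrightarrow> natural_family B C i c E D x (\<T> ts) a"
proof -
  note B = vfun_cat(1)[OF i] and C = vfun_cat(2)[OF i] and E = vfun_cat(2)[OF D]
  note [simp] = vcat_simps[OF B] vcat_simps[OF C] vcat_simps[OF E] vfun_simps[OF i] vfun_simps[OF D] c x ts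
  have [simp]: "a b \<in> Arr V" "Dom V (a b) = \<T> ts \<otimes> VHom C (vfo i b) c" "Cod V (a b) = VHom E (vfo D b) x" if "b \<in> VOb B" for b
    using a[OF that] by (auto simp: Hom_iff)
  let ?A = "\<lambda>b. raw_oper (vfo D b) x ts (a b)"
  let ?L = "\<lambda>b b'. a b' \<cdot> (\<iota> (\<T> ts) \<odot> (VCmp C (vfo i b') (vfo i b) c \<cdot> (\<iota> (VHom C (vfo i b) c) \<odot> vfa i b' b)))"
  let ?R = "\<lambda>b b'. VCmp E (vfo D b') (vfo D b) x \<cdot> (a b \<odot> vfa D b' b) \<cdot> invV (assc V (\<T> ts) (VHom C (vfo i b) c) (VHom B b' b))"
  let ?Z = "\<lambda>p q. (\<iota> (\<T> ts) \<odot> (el p \<odot> el q)) \<cdot> (\<iota> (\<T> ts) \<odot> psi (grd p) (grd q)) \<cdot> psi ts (grd p @ grd q)"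
  have eq: "?A b' (p \<star>\<^bsub>C\<^esub> gf i q) = (vfo D b', ts @ grd p @ grd q, ?L b b' \<cdot> ?Z p q, x)"
    "?A b p \<star>\<^bsub>E\<^esub> gf D q = (vfo D b', ts @ grd p @ grd q, ?R b b' \<cdot> ?Z p q, x)"
    if p: "p \<in> GHom C (vfo i b) c" and q: "q \<in> GHom B b' b" for b b' p q
  proof -
    obtain xs f where [simp]: "p = (vfo i b, xs, f, c)" "set xs \<subseteq> Ob V" "f \<in> Arr V" "Dom V f = \<T> xs" "Cod V f = VHom C (vfo i b) c"
      using p by (auto elim!: GHom_E)
    obtain ys g where [simp]: "q = (b', ys, g, b)" "b \<in> VOb B" "b' \<in> VOb B" "set ys \<subseteq> Ob V" "g \<in> Arr V" "Dom V g = \<T> ys" "Cod V g = VHom B b' b"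
      using q by (auto elim!: GHom_E)
    show "?A b' (p \<star>\<^bsub>C\<^esub> gf i q) = (vfo D b', ts @ grd p @ grd q, ?L b b' \<cdot> ?Z p q, x)"
      by (simp add: raw_oper_def)
    have "VCmp E (vfo D b') (vfo D b) x \<cdot> ((a b \<cdot> (\<iota> (\<T> ts) \<odot> f) \<cdot> psi ts xs) \<odot> (vfa D b' b \<cdot> g)) \<cdot> psi (ts @ xs) ys =
      VCmp E (vfo D b') (vfo D b) x \<cdot> (a b \<odot> vfa D b' b) \<cdot> invV (assc V (\<T> ts) (VHom C (vfo i b) c) (VHom B b' b)) \<cdot>
      (assc V (\<T> ts) (VHom C (vfo i b) c) (VHom B b' b) \<cdot> ((\<iota> (\<T> ts) \<odot> f) \<odot> g)) \<cdot> (psi ts xs \<odot> \<iota> (\<T> ys)) \<cdot> psi (ts @ xs) ys"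
      by simp
    also have "\<dots> = VCmp E (vfo D b') (vfo D b) x \<cdot> (a b \<odot> vfa D b' b) \<cdot> invV (assc V (\<T> ts) (VHom C (vfo i b) c) (VHom B b' b)) \<cdot>
      (\<iota> (\<T> ts) \<odot> (f \<odot> g)) \<cdot> (assc V (\<T> ts) (\<T> xs) (\<T> ys) \<cdot> (psi ts xs \<odot> \<iota> (\<T> ys)) \<cdot> psi (ts @ xs) ys)"
      by (subst assc_nat) auto
    also have "\<dots> = ?R b b' \<cdot> ?Z p q" by (subst psi_assoc) auto
    finally show "?A b p \<star>\<^bsub>E\<^esub> gf D q = (vfo D b', ts @ grd p @ grd q, ?R b b' \<cdot> ?Z p q, x)"
      by (simp add: raw_oper_def)
  qed
  show ?thesis
  proof
    assume G: "graded_family B C i c E D x ts ?A"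
    have "?L b b' = ?R b b'" if [simp]: "b \<in> VOb B" "b' \<in> VOb B" for b b'
    proof -
      have p: "univ C (vfo i b) c \<in> GHom C (vfo i b) c" and q: "univ B b' b \<in> GHom B b' b" using univ_hom[OF C] univ_hom[OF B] by auto
      have "?L b b' \<cdot> ?Z (univ C (vfo i b) c) (univ B b' b) = ?R b b' \<cdot> ?Z (univ C (vfo i b) c) (univ B b' b)"
        using graded_familyD(3)[OF G p q] unfolding eq[OF p q] prod.inject by (simp only:)
      moreover have "is_iso V (?Z (univ C (vfo i b) c) (univ B b' b))"
        by (intro iso_cmp tens_iso psi_iso idt_iso) (auto simp: univ_def simp del: psi.simps)
      ultimately show ?thesis by (rule iso_epi[rotated -1]) (auto simp: univ_def simp del: psi.simps)
    qed
    then show "natural_family B C i c E D x (\<T> ts) a" using a by (simp add: natural_family_def)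
  next
    assume R: "natural_family B C i c E D x (\<T> ts) a"
    show "graded_family B C i c E D x ts ?A"
    proof (rule graded_familyI[OF ts])
      fix b assume "b \<in> VOb B" then show "oper C (vfo i b) c E (vfo D b) x ts [] (?A b)"
        by (intro oper_raw_oper C E) (use a in auto)
    next
      fix b b' p q assume p: "p \<in> GHom C (vfo i b) c" and q: "q \<in> GHom B b' b"
      have "?L b b' = ?R b b'" using R GHom_ob[OF q] by (simp add: natural_family_def)
      then show "?A b' (p \<star>\<^bsub>C\<^esub> gf i q) = ?A b p \<star>\<^bsub>E\<^esub> gf D q" unfolding eq[OF p q] by (simp only:)
    qed
  qed
qed

text \<open>The arrow from \<open>a\<close> to \<open>b\<close> that an element \<open>f\<close> of
  the internal hom names; it undoes \<open>name_arr\<close>.\<close>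

definition den :: "'o \<Rightarrow> 'o \<Rightarrow> 'm \<Rightarrow> 'm" where
  "den a b f = unc a b f \<cdot> invV (lunit V a)"

lemma den_arr [simp]: "a \<in> Ob V \<Longrightarrow> b \<in> Ob V \<Longrightarrow> f \<in> Arr V \<Longrightarrow> Dom V f = \<I> \<Longrightarrow> Cod V f = ihom V a b \<Longrightarrow> den a b f \<in> Arr V"
  and dom_den [simp]: "a \<in> Ob V \<Longrightarrow> b \<in> Ob V \<Longrightarrow> f \<in> Arr V \<Longrightarrow> Dom V f = \<I> \<Longrightarrow> Cod V f = ihom V a b \<Longrightarrow> Dom V (den a b f) = a"
  and cod_den [simp]: "a \<in> Ob V \<Longrightarrow> b \<in> Ob V \<Longrightarrow> f \<in> Arr V \<Longrightarrow> Dom V f = \<I> \<Longrightarrow> Cod V f = ihom V a b \<Longrightarrow> Cod V (den a b f) = b"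
  and unc_den: "a \<in> Ob V \<Longrightarrow> b \<in> Ob V \<Longrightarrow> f \<in> Arr V \<Longrightarrow> Dom V f = \<I> \<Longrightarrow> Cod V f = ihom V a b \<Longrightarrow> unc a b f = den a b f \<cdot> lunit V a"
  by (simp_all add: den_def)

definition graded_unit :: "('c, 'o, 'm) vcat \<Rightarrow> ('b, 'c, 'm) vfun \<Rightarrow> 'c \<Rightarrow> ('e, 'o, 'm) vcat \<Rightarrow> ('b, 'e, 'm) vfun \<Rightarrow> 'e \<Rightarrow> ('b \<Rightarrow> 'm) \<Rightarrow>
    'b \<Rightarrow> 'c \<times> 'o list \<times> 'm \<times> 'c \<Rightarrow> 'e \<times> 'o list \<times> 'm \<times> 'e" where
  "graded_unit C i c E D l \<kappa> b p = (vfo D b, grd p, den (VHom C (vfo i b) c) (VHom E (vfo D b) l) (\<kappa> b) \<cdot> el p, l)"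

text \<open>A family tested on an object \<open>t\<close> is, up to a unitor, a family of grade
  \<open>[t]\<close>, and a family of grade \<open>ts\<close> is one tested on the object
  \<open>\<T> ts\<close>. So the end in the definition of a weighted colimit and a condition
  quantified over all lists have the same content.\<close>

theorem wcolimit_iff_gcolim:
  assumes i: "is_vfunctor V B C i" and c: "c \<in> VOb C" and D: "is_vfunctor V B E D" and l: "l \<in> VOb E"
    and \<kappa>: "\<And>b. b \<in> VOb B \<Longrightarrow> \<kappa> b \<in> Hom V \<I> (ihom V (VHom C (vfo i b) c) (VHom E (vfo D b) l))"
  shows "is_wcolimit V B E (corep_vfun V C i c) D l \<kappa> \<longleftrightarrow> gcolim B C i c E D l (graded_unit C i c E D l \<kappa>)"
proof -
  note B = vfun_cat(1)[OF i] and C = vfun_cat(2)[OF i] and E = vfun_cat(2)[OF D]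
  note [simp] = vcat_simps[OF B] vcat_simps[OF C] vcat_simps[OF E] vfun_simps[OF i] vfun_simps[OF D] c l
  let ?W = "\<lambda>b. VHom C (vfo i b) c" and ?F = "corep_vfun V C i c" and ?S = "self_vcat V"
  let ?k = "\<lambda>b. den (?W b) (VHom E (vfo D b) l) (\<kappa> b)"
  let ?K = "graded_unit C i c E D l \<kappa>"
  let ?\<pi> = "\<lambda>x b. VCmp ?S (vfo ?F b) (VHom E (vfo D b) l) (VHom E (vfo D b) x) \<cdot>
           (vfa (rep_vfun V E (vfo D b)) l x \<odot> \<kappa> b) \<cdot> invV (runit V (VHom E l x))"
  have \<kappa>' [simp]: "\<kappa> b \<in> Arr V" "Dom V (\<kappa> b) = \<I>" "Cod V (\<kappa> b) = ihom V (?W b) (VHom E (vfo D b) l)" if "b \<in> VOb B" for b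
    using \<kappa>[OF that] by (auto simp: Hom_iff)
  have K0: "graded_family B C i c E D l [] ?K \<longleftrightarrow> is_vnat_trans V (op_vcat V B) ?S ?F (corep_vfun V E D l) \<kappa>"
  proof -
    \<comment> \<open>The unitor that separates \<open>den\<close> from \<open>unc\<close> is
      cancelled by \<open>psi [] (grd p)\<close>.\<close>
    have e: "raw_oper (vfo D b) l [] (unc (?W b) (VHom E (vfo D b) l) (\<kappa> b)) p = ?K b p" if "b \<in> VOb B" "p \<in> GHom C (vfo i b) c" for b p
      using that by (auto elim!: GHom_E simp: raw_oper_def graded_unit_def den_def lunit_inv_nat)
    have "graded_family B C i c E D l [] ?K \<longleftrightarrow> graded_family B C i c E D l [] (\<lambda>b. raw_oper (vfo D b) l [] (unc (?W b) (VHom E (vfo D b) l) (\<kappa> b)))"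
      using graded_family_cong[where A = ?K and A' = "\<lambda>b. raw_oper (vfo D b) l [] (unc (?W b) (VHom E (vfo D b) l) (\<kappa> b))", OF _ e i]
        graded_family_cong[where A' = ?K and A = "\<lambda>b. raw_oper (vfo D b) l [] (unc (?W b) (VHom E (vfo D b) l) (\<kappa> b))", OF _ e[symmetric] i]
      by blast
    also have "\<dots> \<longleftrightarrow> natural_family B C i c E D l (\<T> []) (\<lambda>b. unc (?W b) (VHom E (vfo D b) l) (\<kappa> b))"
      by (rule graded_family_raw_oper[OF i c D l]) (auto simp: Hom_iff)
    also have "\<dots> \<longleftrightarrow> is_vnat_family V (op_vcat V B) ?S ?F (corep_vfun V E D l) \<I> \<kappa>"
      unfolding vnat_family_iff[OF i c D l] using \<kappa> by simp
    also have "\<dots> \<longleftrightarrow> is_vnat_trans V (op_vcat V B) ?S ?F (corep_vfun V E D l) \<kappa>"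
      by (rule vnat_trans_family[symmetric]) (auto intro: is_vfunctor_corep[OF i] is_vfunctor_corep[OF D])
    finally show ?thesis .
  qed
  \<comment> \<open>Transposition turns the structure map of \<open>is_wcolimit\<close> into
    composition with the arrow named by \<open>\<kappa> b\<close>; the triangle axiom removes the
    unit object.\<close>
  have \<pi>: "unc (?W b) (VHom E (vfo D b) x) (?\<pi> x b \<cdot> u) = VCmp E (vfo D b) l x \<cdot> (u \<odot> ?k b)"
      "?\<pi> x b \<in> Hom V (VHom E l x) (ihom V (?W b) (VHom E (vfo D b) x))"
    if [simp]: "b \<in> VOb B" "x \<in> VOb E" "u \<in> Arr V" "Cod V u = VHom E l x" for x b u
  proof -
    let ?r = "vfa (rep_vfun V E (vfo D b)) l x" and ?P = "VHom E l x" and ?X = "VHom E (vfo D b) x" and ?L = "VHom E (vfo D b) l"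
    have [simp]: "?r \<in> Arr V" "Dom V ?r = ?P" "Cod V ?r = ihom V ?L ?X" "unc ?L ?X ?r = VCmp E (vfo D b) l x"
      using rep_simps[OF E, of "vfo D b"] by simp_all
    have [simp]: "vfo ?F b = ?W b" by (rule corep_simps(1)[OF i c])
    show "?\<pi> x b \<in> Hom V (VHom E l x) (ihom V (?W b) (VHom E (vfo D b) x))" by (simp add: Hom_iff)
    have "unc (?W b) ?X (?\<pi> x b \<cdot> u) = unc (?W b) ?X ((VCmp ?S (?W b) ?L ?X \<cdot> (?r \<odot> \<kappa> b)) \<cdot> (invV (runit V ?P) \<cdot> u))"
      by simp
    also have "\<dots> = unc (?W b) ?X (VCmp ?S (?W b) ?L ?X \<cdot> (?r \<odot> \<kappa> b)) \<cdot> ((invV (runit V ?P) \<cdot> u) \<odot> \<iota> (?W b))"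
      by (rule unc_cmp) auto
    also have "\<dots> = VCmp E (vfo D b) l x \<cdot> (\<iota> ?P \<odot> ?k b) \<cdot> ((\<iota> ?P \<odot> lunit V (?W b)) \<cdot> assc V ?P \<I> (?W b)) \<cdot>
        ((invV (runit V ?P) \<cdot> u) \<odot> \<iota> (?W b))"
      by (simp add: unc_scmp unc_den)
    also have "\<dots> = VCmp E (vfo D b) l x \<cdot> (u \<odot> ?k b)" by (subst triangle) auto
    finally show "unc (?W b) ?X (?\<pi> x b \<cdot> u) = VCmp E (vfo D b) l x \<cdot> (u \<odot> ?k b)" .
  qed
  have uK: "(l, ts, u, x) \<star>\<^bsub>E\<^esub> ?K b p = raw_oper (vfo D b) x ts (VCmp E (vfo D b) l x \<cdot> (u \<odot> ?k b)) p"
    if "b \<in> VOb B" "p \<in> GHom C (vfo i b) c" "(l, ts, u, x) \<in> GHom E l x" for b p ts u x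
    using that by (auto elim!: GHom_E simp: raw_oper_def graded_unit_def)
  \<comment> \<open>A graded arrow from \<open>l\<close> to \<open>x\<close> of grade
    \<open>ts\<close> is an arrow \<open>u\<close> of \<open>V\<close> with fixed labels, so unique
    existence can be transported between the two formulations.\<close>
  have Ex: "(\<exists>!u. u \<in> GHom E l x \<and> grd u = ts \<and> (\<forall>b\<in>VOb B. \<forall>p\<in>GHom C (vfo i b) c. u \<star>\<^bsub>E\<^esub> ?K b p = raw_oper (vfo D b) x ts (a b) p)) \<longleftrightarrow>
      (\<exists>!u. u \<in> Hom V (\<T> ts) (VHom E l x) \<and> (\<forall>b\<in>VOb B. VCmp E (vfo D b) l x \<cdot> (u \<odot> ?k b) = a b))" (is "?P \<longleftrightarrow> ?Q")
    if x: "x \<in> VOb E" and ts: "set ts \<subseteq> Ob V" and a: "\<And>b. b \<in> VOb B \<Longrightarrow> a b \<in> Hom V (\<T> ts \<otimes> ?W b) (VHom E (vfo D b) x)" for x ts a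
  proof -
    have 1: "(\<forall>p\<in>GHom C (vfo i b) c. (l, ts, u, x) \<star>\<^bsub>E\<^esub> ?K b p = raw_oper (vfo D b) x ts (a b) p) \<longleftrightarrow> VCmp E (vfo D b) l x \<cdot> (u \<odot> ?k b) = a b"
      if u: "u \<in> Hom V (\<T> ts) (VHom E l x)" and b: "b \<in> VOb B" for u b
    proof
      have g: "(l, ts, u, x) \<in> GHom E l x" using u x ts by (auto simp: GHom_iff HomV_iff)
      have ty: "VCmp E (vfo D b) l x \<cdot> (u \<odot> ?k b) \<in> Hom V (\<T> ts \<otimes> ?W b) (VHom E (vfo D b) x)" using u x b by (auto simp: Hom_iff)
      show "VCmp E (vfo D b) l x \<cdot> (u \<odot> ?k b) = a b" if *: "\<forall>p\<in>GHom C (vfo i b) c. (l, ts, u, x) \<star>\<^bsub>E\<^esub> ?K b p = raw_oper (vfo D b) x ts (a b) p"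
      proof (rule raw_oper_inj[OF C _ c ts ty a[OF b]])
        have "univ C (vfo i b) c \<in> GHom C (vfo i b) c" using b by (intro univ_hom[OF C]) auto
        then show "raw_oper (vfo D b) x ts (VCmp E (vfo D b) l x \<cdot> (u \<odot> ?k b)) (univ C (vfo i b) c) = raw_oper (vfo D b) x ts (a b) (univ C (vfo i b) c)"
          using * uK[OF b _ g] by metis
      qed (use b in auto)
      show "\<forall>p\<in>GHom C (vfo i b) c. (l, ts, u, x) \<star>\<^bsub>E\<^esub> ?K b p = raw_oper (vfo D b) x ts (a b) p" if "VCmp E (vfo D b) l x \<cdot> (u \<odot> ?k b) = a b"
        using that uK[OF b _ g] by metis
    qed
    have 2: "u \<in> GHom E l x \<and> grd u = ts \<longleftrightarrow> (\<exists>f. u = (l, ts, f, x) \<and> f \<in> Hom V (\<T> ts) (VHom E l x))" for u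
      using x ts by (cases u) (auto simp: GHom_iff HomV_iff)
    have 3: "u \<in> GHom E l x \<and> grd u = ts \<and> (\<forall>b\<in>VOb B. \<forall>p\<in>GHom C (vfo i b) c. u \<star>\<^bsub>E\<^esub> ?K b p = raw_oper (vfo D b) x ts (a b) p) \<longleftrightarrow>
      (\<exists>f. u = (l, ts, f, x) \<and> f \<in> Hom V (\<T> ts) (VHom E l x) \<and> (\<forall>b\<in>VOb B. VCmp E (vfo D b) l x \<cdot> (f \<odot> ?k b) = a b))"
      (is "_ \<longleftrightarrow> (\<exists>f. ?N f)") for u
    proof
      assume L: "u \<in> GHom E l x \<and> grd u = ts \<and> (\<forall>b\<in>VOb B. \<forall>p\<in>GHom C (vfo i b) c. u \<star>\<^bsub>E\<^esub> ?K b p = raw_oper (vfo D b) x ts (a b) p)"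
      then obtain f where f: "u = (l, ts, f, x)" "f \<in> Hom V (\<T> ts) (VHom E l x)" using 2[of u] by blast
      then have "?N f" using L 1[OF f(2)] by simp
      then show "\<exists>f. ?N f" by blast
    next
      assume "\<exists>f. ?N f"
      then obtain f where f: "?N f" by blast
      then show "u \<in> GHom E l x \<and> grd u = ts \<and> (\<forall>b\<in>VOb B. \<forall>p\<in>GHom C (vfo i b) c. u \<star>\<^bsub>E\<^esub> ?K b p = raw_oper (vfo D b) x ts (a b) p)"
        using 1[of f] 2[of u] by simp
    qed
    show ?thesis unfolding 3 by blast
  qed
  have H: "is_functor_hom V (op_vcat V B) ?S ?F (corep_vfun V E D x) (VHom E l x) (?\<pi> x) \<longleftrightarrow>
     (\<forall>ts A. graded_family B C i c E D x ts A \<longrightarrow>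
        (\<exists>!u. u \<in> GHom E l x \<and> grd u = ts \<and> (\<forall>b\<in>VOb B. \<forall>p\<in>GHom C (vfo i b) c. u \<star>\<^bsub>E\<^esub> ?K b p = A b p)))"
    if x [simp]: "x \<in> VOb E" and K: "graded_family B C i c E D l [] ?K" for x
  proof -
    \<comment> \<open>The structure maps form a natural family because composing the universal
      element of \<open>E(l,x)\<close> with the unit gives a graded family; the grade
      \<open>[VHom E l x]\<close> is afterwards replaced by the object itself.\<close>
    have fam: "is_vnat_family V (op_vcat V B) ?S ?F (corep_vfun V E D x) (VHom E l x) (?\<pi> x)"
    proof -
      let ?u = "univ E l x" and ?P = "VHom E l x"
      have u: "?u \<in> GHom E l x" by (rule univ_hom[OF E]) auto
      have "graded_family B C i c E D x [?P] (\<lambda>b p. ?u \<star>\<^bsub>E\<^esub> ?K b p)"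
      proof (rule graded_familyI)
        show "set [?P] \<subseteq> Ob V" by simp
      next
        fix b assume b: "b \<in> VOb B"
        show "oper C (vfo i b) c E (vfo D b) x [?P] [] (\<lambda>p. ?u \<star>\<^bsub>E\<^esub> ?K b p)"
          by (rule oper_post[OF E u graded_familyD(2)[OF K b]]) simp
      next
        fix b b' p q assume p: "p \<in> GHom C (vfo i b) c" and q: "q \<in> GHom B b' b"
        show "?u \<star>\<^bsub>E\<^esub> ?K b' (p \<star>\<^bsub>C\<^esub> gf i q) = (?u \<star>\<^bsub>E\<^esub> ?K b p) \<star>\<^bsub>E\<^esub> gf D q"
          unfolding graded_familyD(3)[OF K p q]
          by (rule gcmp_assoc[OF E gf_hom[OF D q] graded_familyD(4)[OF K GHom_ob(2)[OF q] p] u, symmetric])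
      qed
      then have "graded_family B C i c E D x [?P] (\<lambda>b. raw_oper (vfo D b) x [?P] (VCmp E (vfo D b) l x \<cdot> (runit V ?P \<odot> ?k b)))"
        by (rule graded_family_cong[OF _ _ i]) (use uK u in \<open>auto simp: univ_def\<close>)
      then have "natural_family B C i c E D x (\<T> [?P]) (\<lambda>b. VCmp E (vfo D b) l x \<cdot> (runit V ?P \<odot> ?k b))"
        by (subst (asm) graded_family_raw_oper[OF i c D x]) (auto simp: Hom_iff)
      then have R: "natural_family B C i c E D x ?P (\<lambda>b. (VCmp E (vfo D b) l x \<cdot> (runit V ?P \<odot> ?k b)) \<cdot> (invV (runit V ?P) \<odot> \<iota> (?W b)))"
        by (rule natural_family_pull[OF _ _ _ i c D x]) (auto simp: Hom_iff)
      have eq: "(VCmp E (vfo D b) l x \<cdot> (runit V ?P \<odot> ?k b)) \<cdot> (invV (runit V ?P) \<odot> \<iota> (?W b)) = unc (?W b) (VHom E (vfo D b) x) (?\<pi> x b)"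
        if b: "b \<in> VOb B" for b
        using b \<pi>(1)[OF b x, of "\<iota> ?P"] \<pi>(2)[OF b x, of "\<iota> ?P"] by (auto simp: Hom_iff)
      have "natural_family B C i c E D x ?P (\<lambda>b. unc (?W b) (VHom E (vfo D b) x) (?\<pi> x b))"
        by (rule natural_family_cong[OF R]) (rule eq[symmetric])
      then show ?thesis unfolding vnat_family_iff[OF i c D x] using \<pi>(2)[OF _ x, of _ "\<iota> ?P"] by auto
    qed
    have hom: "is_functor_hom V (op_vcat V B) ?S ?F (corep_vfun V E D x) (VHom E l x) (?\<pi> x) \<longleftrightarrow>
      (\<forall>t \<alpha>. is_vnat_family V (op_vcat V B) ?S ?F (corep_vfun V E D x) t \<alpha> \<longrightarrow>
        (\<exists>!u. u \<in> Hom V t (VHom E l x) \<and> (\<forall>a\<in>VOb B. ?\<pi> x a \<cdot> u = \<alpha> a)))"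
      unfolding is_functor_hom_def using fam is_vfunctor_corep[OF i c] is_vfunctor_corep[OF D x] by simp
    have step: "(\<exists>!u. u \<in> Hom V t (VHom E l x) \<and> (\<forall>b\<in>VOb B. ?\<pi> x b \<cdot> u = \<alpha> b)) \<longleftrightarrow>
       (\<exists>!u. u \<in> Hom V t (VHom E l x) \<and> (\<forall>b\<in>VOb B. VCmp E (vfo D b) l x \<cdot> (u \<odot> ?k b) = unc (?W b) (VHom E (vfo D b) x) (\<alpha> b)))"
      if \<alpha>: "\<forall>b\<in>VOb B. \<alpha> b \<in> Hom V t (ihom V (?W b) (VHom E (vfo D b) x))" for t \<alpha>
    proof -
      have "?\<pi> x b \<cdot> u = \<alpha> b \<longleftrightarrow> VCmp E (vfo D b) l x \<cdot> (u \<odot> ?k b) = unc (?W b) (VHom E (vfo D b) x) (\<alpha> b)"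
        if u: "u \<in> Hom V t (VHom E l x)" and b: "b \<in> VOb B" for u b
      proof -
        have [simp]: "u \<in> Arr V" "Dom V u = t" "Cod V u = VHom E l x" using u by (auto simp: Hom_iff)
        have "?\<pi> x b \<cdot> u = \<alpha> b \<longleftrightarrow> unc (?W b) (VHom E (vfo D b) x) (?\<pi> x b \<cdot> u) = unc (?W b) (VHom E (vfo D b) x) (\<alpha> b)"
          using unc_inj[of "?W b" "VHom E (vfo D b) x" "?\<pi> x b \<cdot> u" "\<alpha> b"] \<alpha> b \<pi>(2)[OF b x, of u] by (auto simp: Hom_iff)
        then show ?thesis using \<pi>(1)[OF b x, of u] by simp
      qed
      then have "(u \<in> Hom V t (VHom E l x) \<and> (\<forall>b\<in>VOb B. ?\<pi> x b \<cdot> u = \<alpha> b)) \<longleftrightarrow>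
        (u \<in> Hom V t (VHom E l x) \<and> (\<forall>b\<in>VOb B. VCmp E (vfo D b) l x \<cdot> (u \<odot> ?k b) = unc (?W b) (VHom E (vfo D b) x) (\<alpha> b)))" for u
        by blast
      then show ?thesis by presburger
    qed
    show ?thesis unfolding hom
    proof (intro iffI allI impI)
      fix ts A
      assume L: "\<forall>t \<alpha>. is_vnat_family V (op_vcat V B) ?S ?F (corep_vfun V E D x) t \<alpha> \<longrightarrow>
        (\<exists>!u. u \<in> Hom V t (VHom E l x) \<and> (\<forall>a\<in>VOb B. ?\<pi> x a \<cdot> u = \<alpha> a))" and A: "graded_family B C i c E D x ts A"
      show "\<exists>!u. u \<in> GHom E l x \<and> grd u = ts \<and> (\<forall>b\<in>VOb B. \<forall>p\<in>GHom C (vfo i b) c. u \<star>\<^bsub>E\<^esub> ?K b p = A b p)"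
      proof -
        have "\<forall>b\<in>VOb B. \<exists>r. r \<in> Hom V (\<T> ts \<otimes> ?W b) (VHom E (vfo D b) x) \<and> (\<forall>p\<in>GHom C (vfo i b) c. A b p = raw_oper (vfo D b) x ts r p)"
          using graded_familyD(2)[OF A] by (auto intro!: raw_oper_ex[OF C E])
        then obtain a where a: "\<And>b. b \<in> VOb B \<Longrightarrow> a b \<in> Hom V (\<T> ts \<otimes> ?W b) (VHom E (vfo D b) x)"
          and Aa: "\<And>b p. b \<in> VOb B \<Longrightarrow> p\<in>GHom C (vfo i b) c \<Longrightarrow> A b p = raw_oper (vfo D b) x ts (a b) p"
          by metis
        have ts: "set ts \<subseteq> Ob V" by (rule graded_familyD(1)[OF A])
        have "graded_family B C i c E D x ts (\<lambda>b. raw_oper (vfo D b) x ts (a b))" by (rule graded_family_cong[OF A _ i]) (simp add: Aa)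
        then have R: "natural_family B C i c E D x (\<T> ts) a" using graded_family_raw_oper[OF i c D x ts a] by simp
        let ?\<alpha> = "\<lambda>b. curry_arr V (\<T> ts) (?W b) (VHom E (vfo D b) x) (a b)"
        have \<alpha>: "\<forall>b\<in>VOb B. ?\<alpha> b \<in> Hom V (\<T> ts) (ihom V (?W b) (VHom E (vfo D b) x))"
          and u\<alpha>: "\<And>b. b \<in> VOb B \<Longrightarrow> unc (?W b) (VHom E (vfo D b) x) (?\<alpha> b) = a b"
          using a ts by (auto simp: Hom_iff)
        have "is_vnat_family V (op_vcat V B) ?S ?F (corep_vfun V E D x) (\<T> ts) ?\<alpha>"
          unfolding vnat_family_iff[OF i c D x] using \<alpha> R u\<alpha> by (simp add: natural_family_def)
        then have "\<exists>!u. u \<in> Hom V (\<T> ts) (VHom E l x) \<and> (\<forall>b\<in>VOb B. VCmp E (vfo D b) l x \<cdot> (u \<odot> ?k b) = a b)"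
          using L step[OF \<alpha>] u\<alpha> by simp
        then show ?thesis using Ex[OF x ts a] Aa by simp
      qed
    next
      fix t \<alpha>
      assume G: "\<forall>ts A. graded_family B C i c E D x ts A \<longrightarrow>
        (\<exists>!u. u \<in> GHom E l x \<and> grd u = ts \<and> (\<forall>b\<in>VOb B. \<forall>p\<in>GHom C (vfo i b) c. u \<star>\<^bsub>E\<^esub> ?K b p = A b p))"
        and F: "is_vnat_family V (op_vcat V B) ?S ?F (corep_vfun V E D x) t \<alpha>"
      then have \<alpha>: "\<forall>b\<in>VOb B. \<alpha> b \<in> Hom V t (ihom V (?W b) (VHom E (vfo D b) x))"
        and R: "natural_family B C i c E D x t (\<lambda>b. unc (?W b) (VHom E (vfo D b) x) (\<alpha> b))"
        unfolding vnat_family_iff[OF i c D x] by auto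
      have [simp]: "t \<in> Ob V" using R by (simp add: natural_family_def)
      let ?a = "\<lambda>b. unc (?W b) (VHom E (vfo D b) x) (\<alpha> b)"
      \<comment> \<open>The object \<open>t\<close> is tested through the grade \<open>[t]\<close>,
        whose tensor product is \<open>t \<otimes> \<I>\<close>.\<close>
      let ?a' = "\<lambda>b. ?a b \<cdot> (runit V t \<odot> \<iota> (?W b))"
      have a: "?a b \<in> Arr V" "Dom V (?a b) = t \<otimes> ?W b" "Cod V (?a b) = VHom E (vfo D b) x" if "b \<in> VOb B" for b
        using \<alpha> that by (auto simp: Hom_iff)
      have R': "natural_family B C i c E D x (\<T> [t]) ?a'" by (rule natural_family_pull[OF R _ _ i c D x]) (auto simp: Hom_iff)
      have ta: "?a' b \<in> Hom V (\<T> [t] \<otimes> ?W b) (VHom E (vfo D b) x)" if "b \<in> VOb B" for b using a[OF that] that by (auto simp: Hom_iff)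
      have "graded_family B C i c E D x [t] (\<lambda>b. raw_oper (vfo D b) x [t] (?a' b))"
        using graded_family_raw_oper[OF i c D x _ ta] R' by simp
      then have "\<exists>!u. u \<in> GHom E l x \<and> grd u = [t] \<and> (\<forall>b\<in>VOb B. \<forall>p\<in>GHom C (vfo i b) c. u \<star>\<^bsub>E\<^esub> ?K b p = raw_oper (vfo D b) x [t] (?a' b) p)"
        using G by simp
      then have ex: "\<exists>!u. u \<in> Hom V (t \<otimes> \<I>) (VHom E l x) \<and> (\<forall>b\<in>VOb B. VCmp E (vfo D b) l x \<cdot> (u \<odot> ?k b) = ?a' b)"
        using Ex[OF x _ ta] by simp
      show "\<exists>!u. u \<in> Hom V t (VHom E l x) \<and> (\<forall>b\<in>VOb B. ?\<pi> x b \<cdot> u = \<alpha> b)"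
        unfolding step[OF \<alpha>]
      proof -
        obtain u where u: "u \<in> Hom V (t \<otimes> \<I>) (VHom E l x)" "\<And>b. b\<in>VOb B \<Longrightarrow> VCmp E (vfo D b) l x \<cdot> (u \<odot> ?k b) = ?a' b"
          using ex by blast
        have [simp]: "u \<in> Arr V" "Dom V u = t \<otimes> \<I>" "Cod V u = VHom E l x" using u(1) by (auto simp: Hom_iff)
        show "\<exists>!u. u \<in> Hom V t (VHom E l x) \<and> (\<forall>b\<in>VOb B. VCmp E (vfo D b) l x \<cdot> (u \<odot> ?k b) = ?a b)"
        proof (rule ex1I[of _ "u \<cdot> invV (runit V t)"], intro conjI ballI)
          show "u \<cdot> invV (runit V t) \<in> Hom V t (VHom E l x)" by (simp add: Hom_iff)
          fix b assume b: "b \<in> VOb B"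
          have "VCmp E (vfo D b) l x \<cdot> ((u \<cdot> invV (runit V t)) \<odot> ?k b) = (VCmp E (vfo D b) l x \<cdot> (u \<odot> ?k b)) \<cdot> (invV (runit V t) \<odot> \<iota> (?W b))"
            using b by simp
          also have "\<dots> = ?a b" unfolding u(2)[OF b] using a[OF b] b by simp
          finally show "VCmp E (vfo D b) l x \<cdot> ((u \<cdot> invV (runit V t)) \<odot> ?k b) = ?a b" .
        next
          fix v assume v: "v \<in> Hom V t (VHom E l x) \<and> (\<forall>b\<in>VOb B. VCmp E (vfo D b) l x \<cdot> (v \<odot> ?k b) = ?a b)"
          then have [simp]: "v \<in> Arr V" "Dom V v = t" "Cod V v = VHom E l x" by (auto simp: Hom_iff)
          have "v \<cdot> runit V t \<in> Hom V (t \<otimes> \<I>) (VHom E l x)" by (simp add: Hom_iff)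
          moreover have "VCmp E (vfo D b) l x \<cdot> ((v \<cdot> runit V t) \<odot> ?k b) = ?a' b" if b: "b \<in> VOb B" for b
          proof -
            have "VCmp E (vfo D b) l x \<cdot> ((v \<cdot> runit V t) \<odot> ?k b) = (VCmp E (vfo D b) l x \<cdot> (v \<odot> ?k b)) \<cdot> (runit V t \<odot> \<iota> (?W b))"
              using b by simp
            then show ?thesis using v b by metis
          qed
          ultimately have "v \<cdot> runit V t = u" using ex u by blast
          then show "v = u \<cdot> invV (runit V t)" by auto
        qed
      qed
    qed
  qed
  have w: "is_weight V B ?F" using is_vfunctor_corep[OF i c] B by (simp add: is_weight_def)
  show ?thesis
  proof (cases "graded_family B C i c E D l [] ?K")
    case True
    have "(\<forall>x\<in>VOb E. is_functor_hom V (op_vcat V B) ?S ?F (corep_vfun V E D x) (VHom E l x) (?\<pi> x)) \<longleftrightarrow>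
      (\<forall>x\<in>VOb E. \<forall>ts A. graded_family B C i c E D x ts A \<longrightarrow>
        (\<exists>!u. u \<in> GHom E l x \<and> grd u = ts \<and> (\<forall>b\<in>VOb B. \<forall>p\<in>GHom C (vfo i b) c. u \<star>\<^bsub>E\<^esub> ?K b p = A b p)))"
      by (rule ball_cong[OF refl]) (rule H[OF _ True])
    then show ?thesis unfolding is_wcolimit_def gcolim_def using w D l K0 True by meson
  next
    case False
    then show ?thesis unfolding is_wcolimit_def gcolim_def using K0 by meson
  qed
qed

end

section \<open>Preservation of weighted colimits\<close>

context symmetric_monoidal_closed
begin

lemma gcolimD:
  assumes "gcolim B C i c E D l K"
  shows "l \<in> VOb E" "graded_family B C i c E D l [] K"
    "x \<in> VOb E \<Longrightarrow> graded_family B C i c E D x ts A \<Longrightarrow>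
      \<exists>u. u \<in> GHom E l x \<and> grd u = ts \<and> (\<forall>b\<in>VOb B. \<forall>p\<in>GHom C (vfo i b) c. u \<star>\<^bsub>E\<^esub> K b p = A b p)"
  using assms unfolding gcolim_def by blast+

lemma graded_family_post:
  assumes D: "is_vfunctor V B E D" and A: "graded_family B C i c E D l ts A" and u: "u \<in> GHom E l x"
  shows "graded_family B C i c E D x (grd u @ ts) (\<lambda>b p. u \<star>\<^bsub>E\<^esub> A b p)"
proof (rule graded_familyI)
  note E = vfun_cat(2)[OF D]
  show "set (grd u @ ts) \<subseteq> Ob V" using grd_ob[OF u] graded_familyD(1)[OF A] by simp
  show "oper C (vfo i b) c E (vfo D b) x (grd u @ ts) [] (\<lambda>p. u \<star>\<^bsub>E\<^esub> A b p)" if "b \<in> VOb B" for b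
    by (rule oper_post[OF E u graded_familyD(2)[OF A that]]) simp
  fix b b' p q assume p: "p \<in> GHom C (vfo i b) c" and q: "q \<in> GHom B b' b"
  show "u \<star>\<^bsub>E\<^esub> A b' (p \<star>\<^bsub>C\<^esub> gf i q) = (u \<star>\<^bsub>E\<^esub> A b p) \<star>\<^bsub>E\<^esub> gf D q"
    unfolding graded_familyD(3)[OF A p q]
    by (rule gcmp_assoc[OF E gf_hom[OF D q] graded_familyD(4)[OF A GHom_ob(2)[OF q] p] u, symmetric])
qed

text \<open>The composites of \<open>u\<close> with the unit form a graded family, and both
  \<open>u\<close> and \<open>v\<close> solve the extension problem for it.\<close>

lemma gcolim_unique:
  assumes G: "gcolim B C i c E D l K" and D: "is_vfunctor V B E D"
    and u: "u \<in> GHom E l x" and v: "v \<in> GHom E l x" and g: "grd u = grd v"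
    and eq: "\<And>b p. b \<in> VOb B \<Longrightarrow> p \<in> GHom C (vfo i b) c \<Longrightarrow> u \<star>\<^bsub>E\<^esub> K b p = v \<star>\<^bsub>E\<^esub> K b p"
  shows "u = v"
proof -
  have "graded_family B C i c E D x (grd u) (\<lambda>b p. u \<star>\<^bsub>E\<^esub> K b p)"
    using graded_family_post[OF D gcolimD(2)[OF G] u] by simp
  then have "\<exists>!w. w \<in> GHom E l x \<and> grd w = grd u \<and> (\<forall>b\<in>VOb B. \<forall>p\<in>GHom C (vfo i b) c. w \<star>\<^bsub>E\<^esub> K b p = u \<star>\<^bsub>E\<^esub> K b p)"
    using G GHom_ob[OF u] unfolding gcolim_def by blast
  then show ?thesis using u v g eq by metis
qed

text \<open>Units of colimits are total functions of which only the values on the relevant homs are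
  constrained, so they may be exchanged for functions that agree there.\<close>

lemma gcolim_cong:
  assumes G: "gcolim B C i c E D l K" and eq: "\<And>b p. b \<in> VOb B \<Longrightarrow> p \<in> GHom C (vfo i b) c \<Longrightarrow> K' b p = K b p"
    and i: "is_vfunctor V B C i"
  shows "gcolim B C i c E D l K'"
proof -
  have "graded_family B C i c E D l [] K'" by (rule graded_family_cong[OF gcolimD(2)[OF G] eq i])
  moreover have "(\<forall>b\<in>VOb B. \<forall>p\<in>GHom C (vfo i b) c. u \<star>\<^bsub>E\<^esub> K' b p = A b p) \<longleftrightarrow> (\<forall>b\<in>VOb B. \<forall>p\<in>GHom C (vfo i b) c. u \<star>\<^bsub>E\<^esub> K b p = A b p)" for u A
    using eq by (metis (no_types))
  ultimately show ?thesis using G unfolding gcolim_def by presburger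
qed

text \<open>The unit of a \<open>gcolim\<close> is an abstract operator. To apply a hypothesis about
  \<open>is_wcolimit\<close> it has to come from elements \<open>\<kappa> b\<close> of internal
  homs, which arise by currying the representing arrows.\<close>

lemma graded_unit_ex:
  assumes i: "is_vfunctor V B C i" and c: "c \<in> VOb C" and D: "is_vfunctor V B E D" and l: "l \<in> VOb E"
    and K: "graded_family B C i c E D l [] K"
  shows "\<exists>\<kappa>. (\<forall>b\<in>VOb B. \<kappa> b \<in> Hom V \<I> (ihom V (VHom C (vfo i b) c) (VHom E (vfo D b) l))) \<and>
     (\<forall>b\<in>VOb B. \<forall>p\<in>GHom C (vfo i b) c. K b p = graded_unit C i c E D l \<kappa> b p)"
proof -
  note B = vfun_cat(1)[OF i] and C = vfun_cat(2)[OF i] and E = vfun_cat(2)[OF D]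
  note [simp] = vcat_simps[OF C] vcat_simps[OF E] vfun_simps[OF i] vfun_simps[OF D] c l
  have "\<exists>k. k \<in> Hom V \<I> (ihom V (VHom C (vfo i b) c) (VHom E (vfo D b) l)) \<and>
     (\<forall>p\<in>GHom C (vfo i b) c. K b p = (vfo D b, grd p, den (VHom C (vfo i b) c) (VHom E (vfo D b) l) k \<cdot> el p, l))"
    if b [simp]: "b \<in> VOb B" for b
  proof -
    let ?W = "VHom C (vfo i b) c" and ?X = "VHom E (vfo D b) l"
    obtain r where r: "r \<in> Hom V (\<I> \<otimes> ?W) ?X" and Kr: "\<And>p. p \<in> GHom C (vfo i b) c \<Longrightarrow> K b p = raw_oper (vfo D b) l [] r p"
      using raw_oper_ex[OF C E _ _ _ _ graded_familyD(2)[OF K b]] by auto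
    have [simp]: "r \<in> Arr V" "Dom V r = \<I> \<otimes> ?W" "Cod V r = ?X" using r by (auto simp: Hom_iff)
    have "K b p = (vfo D b, grd p, den ?W ?X (curry_arr V \<I> ?W ?X r) \<cdot> el p, l)" if "p \<in> GHom C (vfo i b) c" for p
      unfolding Kr[OF that] using that by (auto elim!: GHom_E simp: raw_oper_def den_def lunit_inv_nat)
    moreover have "curry_arr V \<I> ?W ?X r \<in> Hom V \<I> (ihom V ?W ?X)" by (auto simp: Hom_iff)
    ultimately show ?thesis by blast
  qed
  then show ?thesis unfolding graded_unit_def by metis
qed

lemma den_name [simp]:
  assumes "x \<in> Ob V" "y \<in> Ob V" "g \<in> Hom V x y"
  shows "name_arr V x y g \<in> Hom V \<I> (ihom V x y)" "unc x y (name_arr V x y g) = g \<cdot> lunit V x"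
  using assms by (auto simp: name_arr_def Hom_iff)

text \<open>Evaluates the unit that \<open>preserves_wcolimits\<close> prescribes for the image of a
  colimit: composing names amounts to composing the named arrows.\<close>

lemma den_und_cmp:
  assumes w [simp]: "w \<in> Ob V" "x \<in> Ob V" "y \<in> Ob V" and g: "g \<in> Hom V x y" and k: "k \<in> Hom V \<I> (ihom V w x)"
  shows "und_cmp V (self_vcat V) w x y (name_arr V x y g) k \<in> Hom V \<I> (ihom V w y)"
    and "den w y (und_cmp V (self_vcat V) w x y (name_arr V x y g) k) = g \<cdot> den w x k"
proof -
  have [simp]: "g \<in> Arr V" "Dom V g = x" "Cod V g = y" "k \<in> Arr V" "Dom V k = \<I>" "Cod V k = ihom V w x"
    using g k by (auto simp: Hom_iff)
  let ?n = "name_arr V x y g"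
  have [simp]: "?n \<in> Arr V" "Dom V ?n = \<I>" "Cod V ?n = ihom V x y" "unc x y ?n = g \<cdot> lunit V x"
    using den_name[OF w(2,3) g] by (auto simp: Hom_iff)
  let ?u = "und_cmp V (self_vcat V) w x y ?n k"
  show "?u \<in> Hom V \<I> (ihom V w y)" by (simp add: und_cmp_def Hom_iff)
  have "unc w y ?u = unc w y ((VCmp (self_vcat V) w x y \<cdot> (?n \<odot> k)) \<cdot> invV (lunit V \<I>))" by (simp add: und_cmp_def)
  also have "\<dots> = unc w y (VCmp (self_vcat V) w x y \<cdot> (?n \<odot> k)) \<cdot> (invV (lunit V \<I>) \<odot> \<iota> w)"
    by (rule unc_cmp) auto
  also have "\<dots> = g \<cdot> (lunit V x \<cdot> (\<iota> \<I> \<odot> unc w x k)) \<cdot> assc V \<I> \<I> w \<cdot> (invV (lunit V \<I>) \<odot> \<iota> w)"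
    by (simp add: unc_scmp)
  also have "\<dots> = g \<cdot> unc w x k \<cdot> (lunit V (\<I> \<otimes> w) \<cdot> assc V \<I> \<I> w) \<cdot> (invV (lunit V \<I>) \<odot> \<iota> w)"
    by (subst lunit_nat) auto
  also have "\<dots> = g \<cdot> unc w x k" by (subst lunit_tens) auto
  finally show "den w y ?u = g \<cdot> den w x k" by (simp add: den_def)
qed

lemma gcolim_has:
  assumes H: "has_wcolimits V \<Phi> E" and m: "(B, corep_vfun V C i c) \<in> \<Phi>"
    and i: "is_vfunctor V B C i" and c: "c \<in> VOb C" and D: "is_vfunctor V B E D"
  shows "\<exists>l K. gcolim B C i c E D l K"
proof -
  obtain l \<kappa> where w: "is_wcolimit V B E (corep_vfun V C i c) D l \<kappa>"
    using H m D unfolding has_wcolimits_def by fast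
  then have l: "l \<in> VOb E" and n: "is_vnat_trans V (op_vcat V B) (self_vcat V) (corep_vfun V C i c) (corep_vfun V E D l) \<kappa>"
    by (auto simp: is_wcolimit_def)
  have "\<kappa> b \<in> Hom V \<I> (ihom V (VHom C (vfo i b) c) (VHom E (vfo D b) l))" if "b \<in> VOb B" for b
    using n that by (simp add: is_vnat_trans_def corep_simps(1)[OF i c] corep_simps(1)[OF D l])
  then show ?thesis using wcolimit_iff_gcolim[OF i c D l] w by blast
qed

text \<open>The prescribed unit names the composite of the given unit with the action of
  \<open>F\<close>, so on generalised elements it is \<open>gf F\<close> applied to the old unit.
  Units that are abstract operators are covered by \<open>graded_unit_ex\<close>.\<close>

lemma preserves_iff_gcolim:
  assumes j: "is_vfunctor V J C j" and F: "is_vfunctor V C E F"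
  shows "preserves_wcolimits V (arity_weights V J C j) C E F \<longleftrightarrow>
    (\<forall>z\<in>VOb C. \<forall>D l K. is_vfunctor V J C D \<longrightarrow> gcolim J C j z C D l K \<longrightarrow>
       gcolim J C j z E (comp_vfun V F D) (vfo F l) (\<lambda>b p. gf F (K b p)))" (is "_ \<longleftrightarrow> ?R")
proof -
  note C = vfun_cat(2)[OF j] and E = vfun_cat(2)[OF F]
  note [simp] = vcat_simps[OF C] vcat_simps[OF E] vfun_simps[OF j] vfun_simps[OF F]
  let ?k' = "\<lambda>z D l \<kappa> b. let x = VHom C (vfo D b) l; y = VHom E (vfo F (vfo D b)) (vfo F l) in
             und_cmp V (self_vcat V) (vfo (corep_vfun V C j z) b) x y (name_arr V x y (vfa F (vfo D b) l)) (\<kappa> b)"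
  have key: "is_wcolimit V J E (corep_vfun V C j z) (comp_vfun V F D) (vfo F l) (?k' z D l \<kappa>) \<longleftrightarrow>
      gcolim J C j z E (comp_vfun V F D) (vfo F l) (\<lambda>b p. gf F (graded_unit C j z C D l \<kappa> b p))"
    if z [simp]: "z \<in> VOb C" and D: "is_vfunctor V J C D" and l [simp]: "l \<in> VOb C"
      and \<kappa>: "\<And>b. b \<in> VOb J \<Longrightarrow> \<kappa> b \<in> Hom V \<I> (ihom V (VHom C (vfo j b) z) (VHom C (vfo D b) l))" for z D l \<kappa>
  proof -
    note [simp] = vfun_simps[OF D]
    have k': "?k' z D l \<kappa> b \<in> Hom V \<I> (ihom V (VHom C (vfo j b) z) (VHom E (vfo F (vfo D b)) (vfo F l)))"
      "den (VHom C (vfo j b) z) (VHom E (vfo F (vfo D b)) (vfo F l)) (?k' z D l \<kappa> b) = vfa F (vfo D b) l \<cdot> den (VHom C (vfo j b) z) (VHom C (vfo D b) l) (\<kappa> b)"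
      if [simp]: "b \<in> VOb J" for b
    proof -
      have "vfa F (vfo D b) l \<in> Hom V (VHom C (vfo D b) l) (VHom E (vfo F (vfo D b)) (vfo F l))" by (simp add: Hom_iff)
      note d = den_und_cmp[OF _ _ _ this \<kappa>[OF that]]
      show "?k' z D l \<kappa> b \<in> Hom V \<I> (ihom V (VHom C (vfo j b) z) (VHom E (vfo F (vfo D b)) (vfo F l)))"
        "den (VHom C (vfo j b) z) (VHom E (vfo F (vfo D b)) (vfo F l)) (?k' z D l \<kappa> b) = vfa F (vfo D b) l \<cdot> den (VHom C (vfo j b) z) (VHom C (vfo D b) l) (\<kappa> b)"
        unfolding Let_def corep_simps(1)[OF j z] by (rule d; simp)+
    qed
    have e: "graded_unit C j z E (comp_vfun V F D) (vfo F l) (?k' z D l \<kappa>) b p = gf F (graded_unit C j z C D l \<kappa> b p)"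
      if b [simp]: "b \<in> VOb J" and p: "p \<in> GHom C (vfo j b) z" for b p
    proof -
      have [simp]: "\<kappa> b \<in> Arr V" "Dom V (\<kappa> b) = \<I>" "Cod V (\<kappa> b) = ihom V (VHom C (vfo j b) z) (VHom C (vfo D b) l)"
        using \<kappa>[OF b] by (auto simp: Hom_iff)
      show ?thesis using p by (auto elim!: GHom_E simp: graded_unit_def k'(2)[OF b] simp del: Let_def)
    qed
    have "is_wcolimit V J E (corep_vfun V C j z) (comp_vfun V F D) (vfo F l) (?k' z D l \<kappa>) \<longleftrightarrow>
      gcolim J C j z E (comp_vfun V F D) (vfo F l) (graded_unit C j z E (comp_vfun V F D) (vfo F l) (?k' z D l \<kappa>))"
      by (rule wcolimit_iff_gcolim[OF j z is_vfunctor_comp[OF D F]]) (use k' in auto)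
    also have "\<dots> \<longleftrightarrow> gcolim J C j z E (comp_vfun V F D) (vfo F l) (\<lambda>b p. gf F (graded_unit C j z C D l \<kappa> b p))"
      by (rule iffI; erule gcolim_cong[OF _ _ j]) (simp_all only: e)
    finally show ?thesis .
  qed
  show ?thesis
  proof
    assume P: "preserves_wcolimits V (arity_weights V J C j) C E F"
    show ?R
    proof (intro ballI allI impI)
      fix z D l K assume z: "z \<in> VOb C" and D: "is_vfunctor V J C D" and G: "gcolim J C j z C D l K"
      note l = gcolimD(1)[OF G]
      obtain \<kappa> where \<kappa>: "\<And>b. b \<in> VOb J \<Longrightarrow> \<kappa> b \<in> Hom V \<I> (ihom V (VHom C (vfo j b) z) (VHom C (vfo D b) l))"
        and K: "\<And>b p. b\<in>VOb J \<Longrightarrow> p\<in>GHom C (vfo j b) z \<Longrightarrow> K b p = graded_unit C j z C D l \<kappa> b p"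
        using graded_unit_ex[OF j z D l gcolimD(2)[OF G]] by blast
      have "gcolim J C j z C D l (graded_unit C j z C D l \<kappa>)" by (rule gcolim_cong[OF G _ j]) (simp add: K)
      then have "is_wcolimit V J C (corep_vfun V C j z) D l \<kappa>" using wcolimit_iff_gcolim[OF j z D l \<kappa>] by simp
      then have "is_wcolimit V J E (corep_vfun V C j z) (comp_vfun V F D) (vfo F l) (?k' z D l \<kappa>)"
        using P z unfolding preserves_wcolimits_def arity_weights_def by blast
      then have "gcolim J C j z E (comp_vfun V F D) (vfo F l) (\<lambda>b p. gf F (graded_unit C j z C D l \<kappa> b p))"
        using key[OF z D l \<kappa>] by blast
      then show "gcolim J C j z E (comp_vfun V F D) (vfo F l) (\<lambda>b p. gf F (K b p))"
        by (rule gcolim_cong[OF _ _ j]) (simp add: K)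
    qed
  next
    assume R: ?R
    show "preserves_wcolimits V (arity_weights V J C j) C E F"
      unfolding preserves_wcolimits_def
    proof (intro ballI allI impI, clarify)
      fix B W D l \<kappa> assume m: "(B, W) \<in> arity_weights V J C j" and w: "is_wcolimit V B C W D l \<kappa>"
      then obtain z where z: "z \<in> VOb C" and [simp]: "B = J" "W = corep_vfun V C j z" by (auto simp: arity_weights_def)
      have D: "is_vfunctor V J C D" and l: "l \<in> VOb C" and n: "is_vnat_trans V (op_vcat V J) (self_vcat V) (corep_vfun V C j z) (corep_vfun V C D l) \<kappa>"
        using w by (auto simp: is_wcolimit_def)
      have \<kappa>: "\<And>b. b \<in> VOb J \<Longrightarrow> \<kappa> b \<in> Hom V \<I> (ihom V (VHom C (vfo j b) z) (VHom C (vfo D b) l))"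
        using n by (simp add: is_vnat_trans_def corep_simps(1)[OF j z] corep_simps(1)[OF D l])
      have "gcolim J C j z C D l (graded_unit C j z C D l \<kappa>)" using wcolimit_iff_gcolim[OF j z D l \<kappa>] w by simp
      then show "is_wcolimit V B E W (comp_vfun V F D) (vfo F l) (\<lambda>b. let x = VHom C (vfo D b) l; y = VHom E (vfo F (vfo D b)) (vfo F l) in
             und_cmp V (self_vcat V) (vfo W b) x y (name_arr V x y (vfa F (vfo D b) l)) (\<kappa> b))"
        using key[OF z D l \<kappa>] R z D by simp
    qed
  qed
qed

text \<open>Density says that the actions of the functors \<open>C(j k,-)\<close> present
  \<open>C(c,x)\<close> as a hom object. By the right unit law in \<open>self_vcat V\<close>, these
  actions are the structure maps of a weighted colimit whose unit consists of identities.\<close>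

lemma dense_gcolim:
  assumes j: "is_vfunctor V J C j" and down: "is_dense V J C j" and c: "c \<in> VOb C"
  shows "gcolim J C j c C j c (\<lambda>b p. p)"
proof -
  note J = vfun_cat(1)[OF j] and C = vfun_cat(2)[OF j]
  note [simp] = vcat_simps[OF C] vfun_simps[OF j] c
  let ?S = "self_vcat V" and ?F = "corep_vfun V C j c"
  let ?k = "\<lambda>b. VIdt ?S (VHom C (vfo j b) c)"
  have F: "is_vfunctor V (op_vcat V J) ?S ?F" by (rule is_vfunctor_corep[OF j c])
  have Fo: "vfo ?F b = VHom C (vfo j b) c" for b by (rule corep_simps(1)[OF j c])
  have "is_vnat_trans V (op_vcat V J) ?S ?F ?F ?k"
    unfolding vnat_trans_iff[OF F F] Fo
  proof (intro conjI ballI allI impI)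
    fix a assume "a \<in> VOb (op_vcat V J)"
    then show "gid ?S (VHom C (vfo j a) c) \<in> GHom ?S (VHom C (vfo j a) c) (VHom C (vfo j a) c)"
      by (intro gid_hom vcategory_self) auto
  next
    fix a b p assume p: "p \<in> GHom (op_vcat V J) a b"
    show "gid ?S (VHom C (vfo j b) c) \<star>\<^bsub>?S\<^esub> gf ?F p = gf ?F p \<star>\<^bsub>?S\<^esub> gid ?S (VHom C (vfo j a) c)"
      using gid_left[OF vcategory_self gf_hom[OF F p]] gid_right[OF vcategory_self gf_hom[OF F p]] by (simp add: Fo)
  qed
  moreover have "is_functor_hom V (op_vcat V J) ?S ?F (corep_vfun V C j x) (VHom C c x)
        (\<lambda>b. VCmp ?S (vfo ?F b) (VHom C (vfo j b) c) (VHom C (vfo j b) x) \<cdot>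
           (vfa (rep_vfun V C (vfo j b)) c x \<odot> ?k b) \<cdot> invV (runit V (VHom C c x)))"
    if [simp]: "x \<in> VOb C" for x
  proof -
    have "VCmp ?S (vfo ?F b) (VHom C (vfo j b) c) (VHom C (vfo j b) x) \<cdot>
           (vfa (rep_vfun V C (vfo j b)) c x \<odot> ?k b) \<cdot> invV (runit V (VHom C c x)) = vfa (rep_vfun V C (vfo j b)) c x" (is "?L = ?r")
      if [simp]: "b \<in> VOb J" for b
    proof -
      note [simp] = rep_simps[OF C, of "vfo j b"]
      have "?L = (VCmp ?S (VHom C (vfo j b) c) (VHom C (vfo j b) c) (VHom C (vfo j b) x) \<cdot>
           (\<iota> (ihom V (VHom C (vfo j b) c) (VHom C (vfo j b) x)) \<odot> ?k b)) \<cdot> (?r \<odot> \<iota> \<I>) \<cdot> invV (runit V (VHom C c x))"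
        by (simp add: Fo)
      also have "\<dots> = (runit V (ihom V (VHom C (vfo j b) c) (VHom C (vfo j b) x)) \<cdot> (?r \<odot> \<iota> \<I>)) \<cdot> invV (runit V (VHom C c x))"
        using vcategory.vidt_right[OF vcategory_self, of "VHom C (vfo j b) c" "VHom C (vfo j b) x"] by simp
      also have "\<dots> = ?r" by (subst runit_nat) auto
      finally show ?thesis .
    qed
    moreover have "is_functor_hom V (op_vcat V J) ?S ?F (corep_vfun V C j x) (VHom C c x) (\<lambda>b. vfa (rep_vfun V C (vfo j b)) c x)"
      using down by (simp add: is_dense_def)
    ultimately show ?thesis unfolding is_functor_hom_def is_vnat_family_def by simp
  qed
  moreover have "is_weight V J ?F" using F J by (simp add: is_weight_def)
  ultimately have "is_wcolimit V J C ?F j c ?k" using j by (simp add: is_wcolimit_def)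
  then have "gcolim J C j c C j c (graded_unit C j c C j c ?k)"
    by (subst (asm) wcolimit_iff_gcolim[OF j c j c]) (auto simp: Hom_iff)
  then show ?thesis
    by (rule gcolim_cong[OF _ _ j]) (auto elim!: GHom_E simp: graded_unit_def den_def unc_self_idt)
qed


subsection \<open>Operators as generalised elements of internal homs\<close>

text \<open>Evaluation of an element \<open>w\<close> of the internal hom from \<open>C(a,b)\<close>
  to \<open>[\<T> ys, E(d,e)]\<close>: first at \<open>p\<close>, then at the generic argument of
  grade \<open>ys\<close>. The grade of \<open>w\<close> leads and the argument of the inner hom
  trails.\<close>

definition app :: "('e, 'o, 'm) vcat \<Rightarrow> 'e \<Rightarrow> 'e \<Rightarrow> 'o list \<Rightarrow> 'o \<times> 'o list \<times> 'm \<times> 'o \<Rightarrow>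
    'c \<times> 'o list \<times> 'm \<times> 'c \<Rightarrow> 'e \<times> 'o list \<times> 'm \<times> 'e" where
  "app E d e ys w p = (d, grd w @ grd p @ ys,
     unc (\<T> ys) (VHom E d e) (unc (fst w) (ihom V (\<T> ys) (VHom E d e)) (el w) \<cdot> (\<iota> (\<T> (grd w)) \<odot> el p) \<cdot> psi (grd w) (grd p)) \<cdot>
     psi (grd w @ grd p) ys, e)"

context
  fixes C :: "('c, 'o, 'm) vcat" and E :: "('e, 'o, 'm) vcat" and d e ys
  assumes C: "vcategory V C" and E: "vcategory V E" and d: "d \<in> VOb E" and e: "e \<in> VOb E" and ys: "set ys \<subseteq> Ob V"
begin

abbreviation "arg_hom \<equiv> ihom V (\<T> ys) (VHom E d e)"

lemma app_oper:
  assumes w: "w \<in> GHom (self_vcat V) (VHom C a b) arg_hom" and ab: "a \<in> VOb C" "b \<in> VOb C"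
  shows "oper C a b E d e (grd w) ys (app E d e ys w)"
  using w
proof (rule GHom_E)
  note [simp] = vcat_simps[OF C] vcat_simps[OF E] d e ys ab
  fix ts W assume "w = (VHom C a b, ts, W, arg_hom)" "VHom C a b \<in> VOb (self_vcat V)" "arg_hom \<in> VOb (self_vcat V)"
    "set ts \<subseteq> Ob V" "W \<in> Arr V" "Dom V W = \<T> ts" "Cod V W = VHom (self_vcat V) (VHom C a b) arg_hom"
  then have [simp]: "w = (VHom C a b, ts, W, arg_hom)" "set ts \<subseteq> Ob V" "W \<in> Arr V" "Dom V W = \<T> ts" "Cod V W = ihom V (VHom C a b) arg_hom" by auto
  show ?thesis unfolding oper_def
  proof (intro conjI ballI allI impI)
    fix p assume p: "p \<in> GHom C a b"
    show "app E d e ys w p \<in> GHom E d e" "grd (app E d e ys w p) = grd w @ grd p @ ys"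
      using p by (auto elim!: GHom_E simp: app_def GHom_iff)
    fix xs u assume xs: "set xs \<subseteq> Ob V" and u: "u \<in> Hom V (\<T> xs) (\<T> (grd p))"
    from p show "app E d e ys w (reix xs u p) = reix (grd w @ xs @ ys) (lwhisker (grd w) (rwhisker xs (grd p) ys u)) (app E d e ys w p)"
    proof (rule GHom_E)
      fix ps f assume [simp]: "p = (a, ps, f, b)" "set ps \<subseteq> Ob V" "f \<in> Arr V" "Dom V f = \<T> ps" "Cod V f = VHom C a b"
      have u': "u \<in> Hom V (\<T> xs) (\<T> ps)" using u by simp
      have [simp]: "u \<in> Arr V" "Dom V u = \<T> xs" "Cod V u = \<T> ps" using u by (auto simp: Hom_iff)
      note [simp] = xs
      have l: "lwhisker ts u \<in> Hom V (\<T> (ts @ xs)) (\<T> (ts @ ps))" using lwhisker_hom[OF u'] by simp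
      then have [simp]: "lwhisker ts u \<in> Arr V" "Dom V (lwhisker ts u) = \<T> (ts @ xs)" "Cod V (lwhisker ts u) = \<T> (ts @ ps)"
        by (auto simp: Hom_iff)
      let ?r = "lwhisker ts (rwhisker xs ps ys u)"
      have r: "?r = rwhisker (ts @ xs) (ts @ ps) ys (lwhisker ts u)" using rwhisker_lwhisker[OF u'] by simp
      have "?r \<in> Hom V (\<T> ((ts @ xs) @ ys)) (\<T> ((ts @ ps) @ ys))" unfolding r by (rule rwhisker_hom[OF l]) auto
      then have [simp]: "?r \<in> Arr V" "Dom V ?r = \<T> (ts @ xs @ ys)" "Cod V ?r = \<T> (ts @ ps @ ys)" by (auto simp: Hom_iff)
      let ?g = "unc (VHom C a b) arg_hom W \<cdot> (\<iota> (\<T> ts) \<odot> f) \<cdot> psi ts ps"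
      have "unc (VHom C a b) arg_hom W \<cdot> (\<iota> (\<T> ts) \<odot> (f \<cdot> u)) \<cdot> psi ts xs = unc (VHom C a b) arg_hom W \<cdot> (\<iota> (\<T> ts) \<odot> f) \<cdot> ((\<iota> (\<T> ts) \<odot> u) \<cdot> psi ts xs)"
        by simp
      also have "\<dots> = ?g \<cdot> lwhisker ts u" using psi_lwhisker[OF u', of ts] by simp
      finally have "unc (\<T> ys) (VHom E d e) (unc (VHom C a b) arg_hom W \<cdot> (\<iota> (\<T> ts) \<odot> (f \<cdot> u)) \<cdot> psi ts xs) \<cdot> psi (ts @ xs) ys =
        unc (\<T> ys) (VHom E d e) (?g \<cdot> lwhisker ts u) \<cdot> psi (ts @ xs) ys" by simp
      also have "\<dots> = (unc (\<T> ys) (VHom E d e) ?g \<cdot> (lwhisker ts u \<odot> \<iota> (\<T> ys))) \<cdot> psi (ts @ xs) ys"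
        by (subst unc_cmp) auto
      also have "\<dots> = unc (\<T> ys) (VHom E d e) ?g \<cdot> ((lwhisker ts u \<odot> \<iota> (\<T> ys)) \<cdot> psi (ts @ xs) ys)" by simp
      also have "\<dots> = unc (\<T> ys) (VHom E d e) ?g \<cdot> (psi (ts @ ps) ys \<cdot> ?r)" unfolding r using psi_rwhisker[OF l] by simp
      also have "\<dots> = (unc (\<T> ys) (VHom E d e) ?g \<cdot> psi (ts @ ps) ys) \<cdot> ?r" by simp
      finally show ?thesis by (simp add: app_def)
    qed
  qed (use ys in auto)
qed

lemma app_inj:
  assumes w: "w \<in> GHom (self_vcat V) (VHom C a b) arg_hom" "w' \<in> GHom (self_vcat V) (VHom C a b) arg_hom" "grd w = grd w'"
    and ab: "a \<in> VOb C" "b \<in> VOb C"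
    and eq: "\<And>p. p \<in> GHom C a b \<Longrightarrow> app E d e ys w p = app E d e ys w' p"
  shows "w = w'"
proof (rule GHom_E[OF w(1)], rule GHom_E[OF w(2)])
  note [simp] = vcat_simps[OF C] vcat_simps[OF E] d e ys ab
  fix ts W ts' W' assume *: "w = (VHom C a b, ts, W, arg_hom)"
    "set ts \<subseteq> Ob V" "W \<in> Arr V" "Dom V W = \<T> ts" "Cod V W = VHom (self_vcat V) (VHom C a b) arg_hom" "w' = (VHom C a b, ts', W', arg_hom)"
    "W' \<in> Arr V" "Dom V W' = \<T> ts'" "Cod V W' = VHom (self_vcat V) (VHom C a b) arg_hom"
  then have [simp]: "w = (VHom C a b, ts, W, arg_hom)" "set ts \<subseteq> Ob V" "W \<in> Arr V" "Dom V W = \<T> ts" "Cod V W = ihom V (VHom C a b) arg_hom" 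
    "w' = (VHom C a b, ts, W', arg_hom)" "W' \<in> Arr V" "Dom V W' = \<T> ts" "Cod V W' = ihom V (VHom C a b) arg_hom" using w(3) by auto
  let ?w = "VHom C a b"
  let ?g = "\<lambda>W. unc ?w arg_hom W \<cdot> (\<iota> (\<T> ts) \<odot> runit V ?w) \<cdot> psi ts [?w]"
  have "unc (\<T> ys) (VHom E d e) (?g W) \<cdot> psi (ts @ [?w]) ys = unc (\<T> ys) (VHom E d e) (?g W') \<cdot> psi (ts @ [?w]) ys"
    using eq[OF univ_hom[OF C ab]] by (simp add: app_def univ_def)
  then have "unc (\<T> ys) (VHom E d e) (?g W) = unc (\<T> ys) (VHom E d e) (?g W')"
    by (rule iso_epi[rotated -1]) auto
  then have "?g W = ?g W'" by (rule unc_inj) auto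
  then have "unc ?w arg_hom W \<cdot> ((\<iota> (\<T> ts) \<odot> runit V ?w) \<cdot> psi ts [?w]) = unc ?w arg_hom W' \<cdot> ((\<iota> (\<T> ts) \<odot> runit V ?w) \<cdot> psi ts [?w])"
    by simp
  then have "unc ?w arg_hom W = unc ?w arg_hom W'" by (rule iso_epi[rotated -1]) (auto intro!: iso_cmp)
  then have "W = W'" by (rule unc_inj) auto
  then show ?thesis by simp
qed

text \<open>Closedness of \<open>V\<close> enters here: one transposition removes the trailing grade
  and a second one removes the variable.\<close>

lemma app_ex:
  assumes A: "oper C a b E d e ts ys A" and ab: "a \<in> VOb C" "b \<in> VOb C"
  shows "\<exists>w. w \<in> GHom (self_vcat V) (VHom C a b) arg_hom \<and> grd w = ts \<and> (\<forall>p\<in>GHom C a b. app E d e ys w p = A p)"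
proof -
  note [simp] = vcat_simps[OF C] vcat_simps[OF E] d e ys ab operD(1)[OF A]
  let ?w = "VHom C a b"
  obtain f where f: "A (univ C a b) = (d, ts @ ?w # ys, f, e)" and
     [simp]: "f \<in> Arr V" "Dom V f = \<T> (ts @ ?w # ys)" "Cod V f = VHom E d e"
    using operD(3,4)[OF A univ_hom[OF C ab(1,2)]] by (auto elim!: GHom_E)
  have eq: "ts @ ?w # ys = (ts @ [?w]) @ ys" by simp
  \<comment> \<open>The arrows \<open>?f\<close>, \<open>?g\<close>, \<open>?h\<close> and
    \<open>?W\<close> undo in turn the steps by which \<open>app\<close> computes its value at the
    universal element: splitting off \<open>ys\<close>, evaluation at it, splitting off
    \<open>[?w]\<close>, evaluation at \<open>?w\<close>.\<close>
  let ?f = "f \<cdot> invV (psi (ts @ [?w]) ys)"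
  let ?g = "curry_arr V (\<T> (ts @ [?w])) (\<T> ys) (VHom E d e) ?f"
  let ?h = "?g \<cdot> invV (psi ts [?w]) \<cdot> (\<iota> (\<T> ts) \<odot> invV (runit V ?w))"
  let ?W = "curry_arr V (\<T> ts) ?w arg_hom ?h"
  let ?o = "(?w, ts, ?W, arg_hom)"
  have o: "?o \<in> GHom (self_vcat V) ?w arg_hom" by (simp add: GHom_iff)
  have "app E d e ys ?o (univ C a b) = A (univ C a b)"
    unfolding f by (simp add: app_def univ_def)
  then have "app E d e ys ?o p = A p" if "p \<in> GHom C a b" for p
    using oper_eqI[OF C _ A _ that] app_oper[OF o ab] by simp
  then show ?thesis using o by (intro exI[of _ ?o]) simp
qed

text \<open>Naturality of evaluation in the grade of \<open>w\<close>. It is set against naturality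
  of an operator in a second variable when a family of such elements \<open>w\<close> has to form an
  operator itself.\<close>

lemma app_reix:
  assumes w: "w \<in> GHom (self_vcat V) (VHom C a b) arg_hom" and ab: "a \<in> VOb C" "b \<in> VOb C"
    and xs: "set xs \<subseteq> Ob V" and u: "u \<in> Hom V (\<T> xs) (\<T> (grd w))" and p: "p \<in> GHom C a b"
  shows "app E d e ys (reix xs u w) p = reix (xs @ grd p @ ys) (rwhisker xs (grd w) (grd p @ ys) u) (app E d e ys w p)"
proof (rule GHom_E[OF w], rule GHom_E[OF p])
  note [simp] = vcat_simps[OF C] vcat_simps[OF E] d e ys ab xs
  fix ts W ps f assume *: "w = (VHom C a b, ts, W, arg_hom)"
    "set ts \<subseteq> Ob V" "W \<in> Arr V" "Dom V W = \<T> ts" "Cod V W = VHom (self_vcat V) (VHom C a b) arg_hom"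
    "p = (a, ps, f, b)" "set ps \<subseteq> Ob V" "f \<in> Arr V" "Dom V f = \<T> ps" "Cod V f = VHom C a b"
  then have [simp]: "w = (VHom C a b, ts, W, arg_hom)" "set ts \<subseteq> Ob V" "W \<in> Arr V" "Dom V W = \<T> ts" "Cod V W = ihom V (VHom C a b) arg_hom" 
    "p = (a, ps, f, b)" "set ps \<subseteq> Ob V" "f \<in> Arr V" "Dom V f = \<T> ps" "Cod V f = VHom C a b" by auto
  have u': "u \<in> Hom V (\<T> xs) (\<T> ts)" using u by simp
  have [simp]: "u \<in> Arr V" "Dom V u = \<T> xs" "Cod V u = \<T> ts" using u by (auto simp: Hom_iff)
  let ?r = "rwhisker xs ts ps u"
  have r: "?r \<in> Hom V (\<T> (xs @ ps)) (\<T> (ts @ ps))" by (rule rwhisker_hom[OF u']) auto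
  then have [simp]: "?r \<in> Arr V" "Dom V ?r = \<T> (xs @ ps)" "Cod V ?r = \<T> (ts @ ps)" by (auto simp: Hom_iff)
  let ?s = "rwhisker xs ts (ps @ ys) u"
  have s: "?s = rwhisker (xs @ ps) (ts @ ps) ys ?r" using rwhisker_rwhisker[OF u'] by simp
  have "?s \<in> Hom V (\<T> (xs @ ps @ ys)) (\<T> (ts @ ps @ ys))" by (rule rwhisker_hom[OF u']) auto
  then have [simp]: "?s \<in> Arr V" "Dom V ?s = \<T> (xs @ ps @ ys)" "Cod V ?s = \<T> (ts @ ps @ ys)" by (auto simp: Hom_iff)
  let ?g = "unc (VHom C a b) arg_hom W \<cdot> (\<iota> (\<T> ts) \<odot> f) \<cdot> psi ts ps"
  have "unc (VHom C a b) arg_hom (W \<cdot> u) \<cdot> (\<iota> (\<T> xs) \<odot> f) \<cdot> psi xs ps = unc (VHom C a b) arg_hom W \<cdot> (\<iota> (\<T> ts) \<odot> f) \<cdot> ((u \<odot> \<iota> (\<T> ps)) \<cdot> psi xs ps)"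
    by (simp add: unc_cmp)
  also have "\<dots> = ?g \<cdot> ?r" using psi_rwhisker[OF u', of ps] by simp
  finally have "unc (\<T> ys) (VHom E d e) (unc (VHom C a b) arg_hom (W \<cdot> u) \<cdot> (\<iota> (\<T> xs) \<odot> f) \<cdot> psi xs ps) \<cdot> psi (xs @ ps) ys =
    unc (\<T> ys) (VHom E d e) (?g \<cdot> ?r) \<cdot> psi (xs @ ps) ys" by simp
  also have "\<dots> = (unc (\<T> ys) (VHom E d e) ?g \<cdot> (?r \<odot> \<iota> (\<T> ys))) \<cdot> psi (xs @ ps) ys"
    by (subst unc_cmp) auto
  also have "\<dots> = unc (\<T> ys) (VHom E d e) ?g \<cdot> ((?r \<odot> \<iota> (\<T> ys)) \<cdot> psi (xs @ ps) ys)" by simp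
  also have "\<dots> = unc (\<T> ys) (VHom E d e) ?g \<cdot> (psi (ts @ ps) ys \<cdot> ?s)" unfolding s using psi_rwhisker[OF r] by simp
  also have "\<dots> = (unc (\<T> ys) (VHom E d e) ?g \<cdot> psi (ts @ ps) ys) \<cdot> ?s" by simp
  finally show ?thesis by (simp add: app_def)
qed

text \<open>The action of \<open>C(k,-)\<close> is the transpose of composition. Hence equations
  between elements of internal homs, as they arise from a colimit preserved by
  \<open>C(k,-)\<close>, turn into equations between operators evaluated at composites.\<close>

lemma app_cmp_rep:
  assumes k: "k \<in> VOb C" and s: "s \<in> GHom C a b" and w: "w \<in> GHom (self_vcat V) (VHom C k b) arg_hom" and p: "p \<in> GHom C k a"
  shows "app E d e ys (w \<star>\<^bsub>self_vcat V\<^esub> gf (rep_vfun V C k) s) p = app E d e ys w (s \<star>\<^bsub>C\<^esub> p)"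
proof (rule GHom_E[OF w], rule GHom_E[OF p], rule GHom_E[OF s])
  fix ts W ps f ss g assume *: "w = (VHom C k b, ts, W, arg_hom)" 
    "set ts \<subseteq> Ob V" "W \<in> Arr V" "Dom V W = \<T> ts" "Cod V W = VHom (self_vcat V) (VHom C k b) arg_hom"
    "p = (k, ps, f, a)" "set ps \<subseteq> Ob V" "f \<in> Arr V" "Dom V f = \<T> ps" "Cod V f = VHom C k a"
    "s = (a, ss, g, b)" "set ss \<subseteq> Ob V" "g \<in> Arr V" "Dom V g = \<T> ss" "Cod V g = VHom C a b" "a \<in> VOb C" "b \<in> VOb C"
  note [simp] = vcat_simps[OF C] vcat_simps[OF E] d e ys k rep_simps[OF C k]
  have [simp]: "w = (VHom C k b, ts, W, arg_hom)" "set ts \<subseteq> Ob V" "W \<in> Arr V" "Dom V W = \<T> ts" "Cod V W = ihom V (VHom C k b) arg_hom"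
    "p = (k, ps, f, a)" "set ps \<subseteq> Ob V" "f \<in> Arr V" "Dom V f = \<T> ps" "Cod V f = VHom C k a"
    "s = (a, ss, g, b)" "set ss \<subseteq> Ob V" "g \<in> Arr V" "Dom V g = \<T> ss" "Cod V g = VHom C a b" "a \<in> VOb C" "b \<in> VOb C"
    using * by auto
  let ?r = "vfa (rep_vfun V C k) a b"
  have "unc (VHom C k a) arg_hom (VCmp (self_vcat V) (VHom C k a) (VHom C k b) arg_hom \<cdot> (W \<odot> (?r \<cdot> g)) \<cdot> psi ts ss) =
     unc (VHom C k a) arg_hom ((VCmp (self_vcat V) (VHom C k a) (VHom C k b) arg_hom \<cdot> (W \<odot> (?r \<cdot> g))) \<cdot> psi ts ss)" by simp
  also have "\<dots> = unc (VHom C k a) arg_hom (VCmp (self_vcat V) (VHom C k a) (VHom C k b) arg_hom \<cdot> (W \<odot> (?r \<cdot> g))) \<cdot> (psi ts ss \<odot> \<iota> (VHom C k a))"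
    by (rule unc_cmp) auto
  also have "\<dots> = unc (VHom C k b) arg_hom W \<cdot> (\<iota> (\<T> ts) \<odot> (VCmp C k a b \<cdot> (g \<odot> \<iota> (VHom C k a)))) \<cdot>
     assc V (\<T> ts) (\<T> ss) (VHom C k a) \<cdot> (psi ts ss \<odot> \<iota> (VHom C k a))"
    by (subst unc_scmp) (auto simp: unc_cmp)
  finally have 1: "unc (VHom C k a) arg_hom (VCmp (self_vcat V) (VHom C k a) (VHom C k b) arg_hom \<cdot> (W \<odot> (?r \<cdot> g)) \<cdot> psi ts ss) =
     unc (VHom C k b) arg_hom W \<cdot> (\<iota> (\<T> ts) \<odot> (VCmp C k a b \<cdot> (g \<odot> \<iota> (VHom C k a)))) \<cdot>
     assc V (\<T> ts) (\<T> ss) (VHom C k a) \<cdot> (psi ts ss \<odot> \<iota> (VHom C k a))" .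
  have "unc (VHom C k a) arg_hom (VCmp (self_vcat V) (VHom C k a) (VHom C k b) arg_hom \<cdot> (W \<odot> (?r \<cdot> g)) \<cdot> psi ts ss) \<cdot>
       (\<iota> (\<T> (ts @ ss)) \<odot> f) \<cdot> psi (ts @ ss) ps =
     unc (VHom C k b) arg_hom W \<cdot> (\<iota> (\<T> ts) \<odot> (VCmp C k a b \<cdot> (g \<odot> \<iota> (VHom C k a)))) \<cdot>
     (assc V (\<T> ts) (\<T> ss) (VHom C k a) \<cdot> ((\<iota> (\<T> ts) \<odot> \<iota> (\<T> ss)) \<odot> f)) \<cdot> (psi ts ss \<odot> \<iota> (\<T> ps)) \<cdot> psi (ts @ ss) ps"
    unfolding 1 by simp
  also have "\<dots> = unc (VHom C k b) arg_hom W \<cdot> (\<iota> (\<T> ts) \<odot> (VCmp C k a b \<cdot> (g \<odot> f))) \<cdot>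
     (assc V (\<T> ts) (\<T> ss) (\<T> ps) \<cdot> (psi ts ss \<odot> \<iota> (\<T> ps)) \<cdot> psi (ts @ ss) ps)"
    by (subst assc_nat) auto
  also have "\<dots> = unc (VHom C k b) arg_hom W \<cdot> (\<iota> (\<T> ts) \<odot> (VCmp C k a b \<cdot> (g \<odot> f) \<cdot> psi ss ps)) \<cdot> psi ts (ss @ ps)"
    by (subst psi_assoc) auto
  finally show ?thesis by (simp add: app_def)
qed

end

end

section \<open>Operators in two variables over a colimit preserved by a representable
  functor\<close>

context symmetric_monoidal_closed
begin

lemma rep_comp_ob [simp]: "vfo (rep_vfun V C k) x = VHom C k x"
  by (simp add: rep_vfun_def)

text \<open>
  The colimit of \<open>D\<close> with weight \<open>C(i-,c)\<close> is preserved by \<open>C(k,-)\<close>.  Since \<open>V\<close> is closed, an operator on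
  \<open>C(k,l)\<close> is then the same as an operator in two variables that is balanced over \<open>B\<close>; the trailing
  grade \<open>ys\<close> is needed to compare operators that are followed by a precomposition.
\<close>

lemma two_variable_extension:
  assumes i: "is_vfunctor V B C i" and D: "is_vfunctor V B C D" and k: "k \<in> VOb C"
    and K: "graded_family B C i c C D l [] K" and l: "l \<in> VOb C"
    and G: "gcolim B C i c (self_vcat V) (comp_vfun V (rep_vfun V C k) D) (VHom C k l) (\<lambda>b p. gf (rep_vfun V C k) (K b p))"
    and d: "d \<in> VOb C" and x: "x \<in> VOb C" and ts: "set ts \<subseteq> Ob V" and ys: "set ys \<subseteq> Ob V"
    and N1: "\<And>b p. b \<in> VOb B \<Longrightarrow> p \<in> GHom C (vfo i b) c \<Longrightarrow> oper C k (vfo D b) C d x (ts @ grd p) ys (N b p)"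
    and N2: "\<And>b r. b \<in> VOb B \<Longrightarrow> r \<in> GHom C k (vfo D b) \<Longrightarrow> oper C (vfo i b) c C d x ts (grd r @ ys) (\<lambda>p. N b p r)"
    and N3: "\<And>b b' p q r. p \<in> GHom C (vfo i b) c \<Longrightarrow> q \<in> GHom B b' b \<Longrightarrow> r \<in> GHom C k (vfo D b') \<Longrightarrow>
       N b' (p \<star>\<^bsub>C\<^esub> gf i q) r = N b p (gf D q \<star>\<^bsub>C\<^esub> r)"
  shows "\<exists>\<Gamma>. oper C k l C d x ts ys \<Gamma> \<and>
    (\<forall>b\<in>VOb B. \<forall>p\<in>GHom C (vfo i b) c. \<forall>r\<in>GHom C k (vfo D b). \<Gamma> (K b p \<star>\<^bsub>C\<^esub> r) = N b p r)"
proof -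
  note C = vfun_cat(2)[OF i] and B = vfun_cat(1)[OF i]
  note ap = C C d x ys
  let ?z = "ihom V (\<T> ys) (VHom C d x)" and ?S = "self_vcat V" and ?R = "rep_vfun V C k"
  have R: "is_vfunctor V C ?S ?R" by (rule is_vfunctor_rep[OF C k])
  \<comment> \<open>With \<open>p\<close> fixed, \<open>N b p\<close> is an operator in
    \<open>r\<close>, hence an element of an internal hom out of \<open>C(k,D b)\<close>.\<close>
  have "\<exists>w. w \<in> GHom ?S (VHom C k (vfo D b)) ?z \<and> grd w = ts @ grd p \<and> (\<forall>r\<in>GHom C k (vfo D b). app C d x ys w r = N b p r)"
    if "b \<in> VOb B" "p \<in> GHom C (vfo i b) c" for b p
    by (rule app_ex[OF ap N1[OF that] k]) (use vfun_simps[OF D] that in auto)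
  then obtain w where w: "\<And>b p. b \<in> VOb B \<Longrightarrow> p \<in> GHom C (vfo i b) c \<Longrightarrow> w b p \<in> GHom ?S (VHom C k (vfo D b)) ?z"
    and gw: "\<And>b p. b \<in> VOb B \<Longrightarrow> p \<in> GHom C (vfo i b) c \<Longrightarrow> grd (w b p) = ts @ grd p"
    and aw: "\<And>b p r. b \<in> VOb B \<Longrightarrow> p \<in> GHom C (vfo i b) c \<Longrightarrow> r \<in> GHom C k (vfo D b) \<Longrightarrow> app C d x ys (w b p) r = N b p r"
    by metis
  \<comment> \<open>As \<open>p\<close> varies, these elements form a family on the weight:
    \<open>N2\<close> gives naturality in the grade of \<open>p\<close> and \<open>N3\<close> gives
    the condition over \<open>B\<close>. The colimit preserved by \<open>C(k,-)\<close> then extends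
    the family to \<open>C(k,l)\<close>.\<close>
  have "graded_family B C i c ?S (comp_vfun V ?R D) ?z ts w"
  proof (rule graded_familyI[OF ts])
    fix b assume b: "b \<in> VOb B"
    have Db: "vfo D b \<in> VOb C" using vfun_simps[OF D] b by auto
    show "oper C (vfo i b) c ?S (vfo (comp_vfun V ?R D) b) ?z ts [] (w b)"
      unfolding oper_def comp_vfun_simps rep_comp_ob
    proof (intro conjI ballI allI impI ts)
      fix p assume p: "p \<in> GHom C (vfo i b) c"
      show "w b p \<in> GHom ?S (VHom C k (vfo D b)) ?z" by (rule w[OF b p])
      show "grd (w b p) = ts @ grd p @ []" using gw[OF b p] by simp
      fix xs u assume xs: "set xs \<subseteq> Ob V" and u: "u \<in> Hom V (\<T> xs) (\<T> (grd p))"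
      have p': "reix xs u p \<in> GHom C (vfo i b) c" by (rule reix_hom[OF p xs u])
      have l: "lwhisker ts u \<in> Hom V (\<T> (ts @ xs)) (\<T> (grd (w b p)))" using lwhisker_hom[OF u ts] gw[OF b p] by simp
      have txs: "set (ts @ xs) \<subseteq> Ob V" using ts xs by simp
      have "w b (reix xs u p) = reix (ts @ xs) (lwhisker ts u) (w b p)"
      proof (rule app_inj[OF ap w[OF b p'] reix_hom[OF w[OF b p] txs l] _ k Db])
        show "grd (w b (reix xs u p)) = grd (reix (ts @ xs) (lwhisker ts u) (w b p))" using gw[OF b p'] by simp
        fix r assume r: "r \<in> GHom C k (vfo D b)"
        have "app C d x ys (w b (reix xs u p)) r = N b (reix xs u p) r" by (rule aw[OF b p' r])
        also have "\<dots> = reix (ts @ xs @ grd r @ ys) (lwhisker ts (rwhisker xs (grd p) (grd r @ ys) u)) (N b p r)"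
          by (rule operD(5)[OF N2[OF b r] p xs u])
        also have "lwhisker ts (rwhisker xs (grd p) (grd r @ ys) u) = rwhisker (ts @ xs) (ts @ grd p) (grd r @ ys) (lwhisker ts u)"
          using grd_ob[OF r] ys by (intro rwhisker_lwhisker[symmetric] u xs grd_ob[OF p] ts) auto
        also have "reix (ts @ xs @ grd r @ ys) (rwhisker (ts @ xs) (ts @ grd p) (grd r @ ys) (lwhisker ts u)) (N b p r) =
          app C d x ys (reix (ts @ xs) (lwhisker ts u) (w b p)) r"
          using app_reix[OF ap w[OF b p] k Db txs l r] aw[OF b p r] gw[OF b p] by simp
        finally show "app C d x ys (w b (reix xs u p)) r = app C d x ys (reix (ts @ xs) (lwhisker ts u) (w b p)) r" .
      qed
      then show "w b (reix xs u p) = reix (ts @ xs @ []) (lwhisker ts (rwhisker xs (grd p) [] u)) (w b p)"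
        using rwhisker_Nil[OF u xs grd_ob[OF p]] by simp
    qed simp
  next
    fix b b' p q assume p: "p \<in> GHom C (vfo i b) c" and q: "q \<in> GHom B b' b"
    note b = GHom_ob(2)[OF q] and b' = GHom_ob(1)[OF q]
    have p': "p \<star>\<^bsub>C\<^esub> gf i q \<in> GHom C (vfo i b') c" by (rule gcmp_hom[OF C gf_hom[OF i q] p])
    have gq: "gf D q \<in> GHom C (vfo D b') (vfo D b)" by (rule gf_hom[OF D q])
    have Rq: "gf ?R (gf D q) \<in> GHom ?S (VHom C k (vfo D b')) (VHom C k (vfo D b))"
      using gf_hom[OF R gq] by simp
    have eq: "gf (comp_vfun V ?R D) q = gf ?R (gf D q)" by (rule gf_comp[OF D R q])
    show "w b' (p \<star>\<^bsub>C\<^esub> gf i q) = w b p \<star>\<^bsub>?S\<^esub> gf (comp_vfun V ?R D) q"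
      unfolding eq
    proof (rule app_inj[OF ap w[OF b' p'] gcmp_hom[OF vcategory_self Rq w[OF b p]] _ k GHom_ob(1)[OF gq]])
      show "grd (w b' (p \<star>\<^bsub>C\<^esub> gf i q)) = grd (w b p \<star>\<^bsub>?S\<^esub> gf ?R (gf D q))"
        using gw[OF b p] gw[OF b' p'] by simp
      fix r assume r: "r \<in> GHom C k (vfo D b')"
      show "app C d x ys (w b' (p \<star>\<^bsub>C\<^esub> gf i q)) r = app C d x ys (w b p \<star>\<^bsub>?S\<^esub> gf ?R (gf D q)) r"
        using aw[OF b' p' r] N3[OF p q r] app_cmp_rep[OF ap k gq w[OF b p] r] aw[OF b p gcmp_hom[OF C r gq]] by simp
    qed
  qed
  then obtain U where U: "U \<in> GHom ?S (VHom C k l) ?z" and gU: "grd U = ts"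
    and UK: "\<And>b p. b \<in> VOb B \<Longrightarrow> p \<in> GHom C (vfo i b) c \<Longrightarrow> U \<star>\<^bsub>?S\<^esub> gf ?R (K b p) = w b p"
    using gcolimD(3)[OF G, of ?z ts w] vcat_simps(1)[OF C d x] ys by auto
  show ?thesis
  proof (intro exI[of _ "app C d x ys U"] conjI ballI)
    show "oper C k l C d x ts ys (app C d x ys U)" using app_oper[OF ap U k l] gU by simp
    fix b p r assume b: "b \<in> VOb B" and p: "p \<in> GHom C (vfo i b) c" and r: "r \<in> GHom C k (vfo D b)"
    show "app C d x ys U (K b p \<star>\<^bsub>C\<^esub> r) = N b p r"
      using app_cmp_rep[OF ap k graded_familyD(4)[OF K b p] U r] UK[OF b p] aw[OF b p r] by simp
  qed
qed

text \<open>Transposed, both operators are arrows out of the colimit \<open>C(k,l)\<close>. So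
  agreement on the composites \<open>K b p \<star> r\<close> suffices, although an element of
  \<open>C(k,l)\<close> need not be such a composite.\<close>

lemma two_variable_unique:
  assumes i: "is_vfunctor V B C i" and D: "is_vfunctor V B C D" and k: "k \<in> VOb C"
    and K: "graded_family B C i c C D l [] K" and l: "l \<in> VOb C"
    and G: "gcolim B C i c (self_vcat V) (comp_vfun V (rep_vfun V C k) D) (VHom C k l) (\<lambda>b p. gf (rep_vfun V C k) (K b p))"
    and d: "d \<in> VOb C" and x: "x \<in> VOb C"
    and M: "oper C k l C d x ts ys M" and N: "oper C k l C d x ts ys N"
    and eq: "\<And>b p r. b \<in> VOb B \<Longrightarrow> p \<in> GHom C (vfo i b) c \<Longrightarrow> r \<in> GHom C k (vfo D b) \<Longrightarrow> M (K b p \<star>\<^bsub>C\<^esub> r) = N (K b p \<star>\<^bsub>C\<^esub> r)"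
    and s: "s \<in> GHom C k l"
  shows "M s = N s"
proof -
  note C = vfun_cat(2)[OF i] and ys = operD(2)[OF M]
  note ap = C C d x ys
  let ?z = "ihom V (\<T> ys) (VHom C d x)" and ?S = "self_vcat V" and ?R = "rep_vfun V C k"
  have R: "is_vfunctor V C ?S ?R" by (rule is_vfunctor_rep[OF C k])
  obtain m where m: "m \<in> GHom ?S (VHom C k l) ?z" "grd m = ts" "\<And>p. p\<in>GHom C k l \<Longrightarrow> app C d x ys m p = M p"
    using app_ex[OF ap M k l] by blast
  obtain n where n: "n \<in> GHom ?S (VHom C k l) ?z" "grd n = ts" "\<And>p. p\<in>GHom C k l \<Longrightarrow> app C d x ys n p = N p"
    using app_ex[OF ap N k l] by blast
  have "m = n"
  proof (rule gcolim_unique[OF G is_vfunctor_comp[OF D R] m(1) n(1)])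
    show "grd m = grd n" using m n by simp
    fix b p assume b: "b \<in> VOb B" and p: "p \<in> GHom C (vfo i b) c"
    have Kp: "K b p \<in> GHom C (vfo D b) l" by (rule graded_familyD(4)[OF K b p])
    have RK: "gf ?R (K b p) \<in> GHom ?S (VHom C k (vfo D b)) (VHom C k l)" using gf_hom[OF R Kp] by simp
    show "m \<star>\<^bsub>?S\<^esub> gf ?R (K b p) = n \<star>\<^bsub>?S\<^esub> gf ?R (K b p)"
    proof (rule app_inj[OF ap gcmp_hom[OF vcategory_self RK m(1)] gcmp_hom[OF vcategory_self RK n(1)] _ k GHom_ob(1)[OF Kp]])
      fix r assume r: "r \<in> GHom C k (vfo D b)"
      show "app C d x ys (m \<star>\<^bsub>?S\<^esub> gf ?R (K b p)) r = app C d x ys (n \<star>\<^bsub>?S\<^esub> gf ?R (K b p)) r"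
        using app_cmp_rep[OF ap k Kp m(1) r] app_cmp_rep[OF ap k Kp n(1) r] m(3) n(3) gcmp_hom[OF C r Kp] eq[OF b p r] by simp
    qed (use m n in simp)
  qed
  then show ?thesis using m(3)[OF s] n(3)[OF s] by simp
qed

lemma gf_simps:
  assumes H: "is_vfunctor V A B H"
  shows "p \<in> Arr (gr A) \<Longrightarrow> gf H p \<in> Arr (gr B)"
    and "p \<in> Arr (gr A) \<Longrightarrow> Dom (gr B) (gf H p) = vfo H (Dom (gr A) p)"
    and "p \<in> Arr (gr A) \<Longrightarrow> Cod (gr B) (gf H p) = vfo H (Cod (gr A) p)"
    and "p \<in> Arr (gr A) \<Longrightarrow> q \<in> Arr (gr A) \<Longrightarrow> Dom (gr A) q = Cod (gr A) p \<Longrightarrow> gf H (q \<star>\<^bsub>A\<^esub> p) = gf H q \<star>\<^bsub>B\<^esub> gf H p"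
  using gf_hom[OF H, of p "Dom (gr A) p" "Cod (gr A) p"] gf_cmp[OF H, of p "Dom (gr A) p" "Cod (gr A) p" q "Cod (gr A) q"]
  by (auto simp: Hom_iff)


section \<open>Pointwise left Kan extensions\<close>

text \<open>By Yoneda the colimit unit at each \<open>c\<close> is determined by values at
  identities, so one family \<open>e\<close> serves all \<open>c\<close>. Empty grade makes
  \<open>e b\<close> an arrow of the underlying category.\<close>

definition pointwise_lan :: "('b, 'o, 'm) vcat \<Rightarrow> ('c, 'o, 'm) vcat \<Rightarrow> ('b, 'c, 'm) vfun \<Rightarrow> ('b, 'c, 'm) vfun \<Rightarrow>
    ('c, 'c, 'm) vfun \<Rightarrow> ('b \<Rightarrow> 'c \<times> 'o list \<times> 'm \<times> 'c) \<Rightarrow> bool" where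
  "pointwise_lan B C i D H e \<longleftrightarrow> is_vfunctor V B C i \<and> is_vfunctor V B C D \<and> is_vfunctor V C C H \<and>
     (\<forall>b\<in>VOb B. e b \<in> GHom C (vfo D b) (vfo H (vfo i b)) \<and> grd (e b) = []) \<and>
     (\<forall>c\<in>VOb C. gcolim B C i c C D (vfo H c) (\<lambda>b p. gf H p \<star>\<^bsub>C\<^esub> e b))"

lemma pointwise_lanD:
  assumes "pointwise_lan B C i D H e"
  shows "is_vfunctor V B C i" "is_vfunctor V B C D" "is_vfunctor V C C H"
    "b \<in> VOb B \<Longrightarrow> e b \<in> GHom C (vfo D b) (vfo H (vfo i b))" "b \<in> VOb B \<Longrightarrow> grd (e b) = []"
    "c \<in> VOb C \<Longrightarrow> gcolim B C i c C D (vfo H c) (\<lambda>b p. gf H p \<star>\<^bsub>C\<^esub> e b)"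
  using assms by (auto simp only: pointwise_lan_def)

text \<open>Read off from the graded condition of the colimit at \<open>i b\<close>, applied to the
  identity of \<open>i b\<close>.\<close>

lemma pointwise_lan_nat:
  assumes P: "pointwise_lan B C i D H e" and q: "q \<in> GHom B b' b"
  shows "e b \<star>\<^bsub>C\<^esub> gf D q = gf H (gf i q) \<star>\<^bsub>C\<^esub> e b'"
proof -
  note i = pointwise_lanD(1)[OF P] and D = pointwise_lanD(2)[OF P] and H = pointwise_lanD(3)[OF P]
  note B = vfun_cat(1)[OF i] and C = vfun_cat(2)[OF i]
  note b = GHom_ob(2)[OF q] and b' = GHom_ob(1)[OF q]
  have ib: "vfo i b \<in> VOb C" using vfun_simps[OF i] b by auto
  have id: "gid C (vfo i b) \<in> GHom C (vfo i b) (vfo i b)" by (rule gid_hom[OF C ib])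
  have "gf H (gid C (vfo i b) \<star>\<^bsub>C\<^esub> gf i q) \<star>\<^bsub>C\<^esub> e b' = (gf H (gid C (vfo i b)) \<star>\<^bsub>C\<^esub> e b) \<star>\<^bsub>C\<^esub> gf D q"
    by (rule graded_familyD(3)[OF gcolimD(2)[OF pointwise_lanD(6)[OF P ib]] id q])
  then show ?thesis
    using gid_left[OF C gf_hom[OF i q]] gid_left[OF C pointwise_lanD(4)[OF P b]] gf_idt[OF H ib] by simp
qed

text \<open>Chosen colimits give the values on objects; an arrow \<open>s\<close> of any grade acts
  by the universal property, and uniqueness yields functoriality. Treating all grades at once
  produces a \<open>V\<close>-functor and not only a functor between underlying categories.\<close>

lemma pointwise_lan_ex:
  assumes i: "is_vfunctor V B C i" and D: "is_vfunctor V B C D"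
    and ex: "\<And>c. c \<in> VOb C \<Longrightarrow> \<exists>l K. gcolim B C i c C D l K"
  shows "\<exists>H e. pointwise_lan B C i D H e \<and> vfo H \<in> extensional (VOb C) \<and> case_prod (vfa H) \<in> extensional (VOb C \<times> VOb C)"
proof -
  note B = vfun_cat(1)[OF i] and C = vfun_cat(2)[OF i]
  obtain L K where G: "\<And>c. c \<in> VOb C \<Longrightarrow> gcolim B C i c C D (L c) (K c)" using ex by metis
  note fam = gcolimD(2)[OF G] and L = gcolimD(1)[OF G]
  have sK: "graded_family B C i c C D (L c') (grd s) (\<lambda>b p. K c' b (s \<star>\<^bsub>C\<^esub> p))" if s: "s \<in> GHom C c c'" for s c c'
  proof (rule graded_familyI)
    note c = GHom_ob(1)[OF s] and c' = GHom_ob(2)[OF s]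
    show "set (grd s) \<subseteq> Ob V" by (rule grd_ob[OF s])
    show "oper C (vfo i b) c C (vfo D b) (L c') (grd s) [] (\<lambda>p. K c' b (s \<star>\<^bsub>C\<^esub> p))" if "b \<in> VOb B" for b
      by (rule oper_comp[OF oper_lcmp[OF C s] graded_familyD(2)[OF fam[OF c'] that]]) simp_all
    fix b b' p q assume p: "p \<in> GHom C (vfo i b) c" and q: "q \<in> GHom B b' b"
    show "K c' b' (s \<star>\<^bsub>C\<^esub> (p \<star>\<^bsub>C\<^esub> gf i q)) = K c' b (s \<star>\<^bsub>C\<^esub> p) \<star>\<^bsub>C\<^esub> gf D q"
      using graded_familyD(3)[OF fam[OF c'] gcmp_hom[OF C p s] q] gcmp_assoc[OF C gf_hom[OF i q] p s] by simp
  qed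
  have "\<exists>u. u \<in> GHom C (L c) (L c') \<and> grd u = grd s \<and> (\<forall>b\<in>VOb B. \<forall>p\<in>GHom C (vfo i b) c. u \<star>\<^bsub>C\<^esub> K c b p = K c' b (s \<star>\<^bsub>C\<^esub> p))"
    if s: "s \<in> GHom C c c'" for s c c'
    by (rule gcolimD(3)[OF G[OF GHom_ob(1)[OF s]] L[OF GHom_ob(2)[OF s]] sK[OF s]])
  note exh = this
  define h where "h c c' s = (SOME u. u \<in> GHom C (L c) (L c') \<and> grd u = grd s \<and>
      (\<forall>b\<in>VOb B. \<forall>p\<in>GHom C (vfo i b) c. u \<star>\<^bsub>C\<^esub> K c b p = K c' b (s \<star>\<^bsub>C\<^esub> p)))" for c c' s
  have "h c c' s \<in> GHom C (L c) (L c') \<and> grd (h c c' s) = grd s \<and>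
      (\<forall>b\<in>VOb B. \<forall>p\<in>GHom C (vfo i b) c. h c c' s \<star>\<^bsub>C\<^esub> K c b p = K c' b (s \<star>\<^bsub>C\<^esub> p))" if s: "s \<in> GHom C c c'" for s c c'
    unfolding h_def by (rule someI_ex[OF exh[OF s]])
  then have h: "\<And>s c c'. s \<in> GHom C c c' \<Longrightarrow> h c c' s \<in> GHom C (L c) (L c')"
    and gh: "\<And>s c c'. s \<in> GHom C c c' \<Longrightarrow> grd (h c c' s) = grd s"
    and hK: "\<And>s c c' b p. s \<in> GHom C c c' \<Longrightarrow> b \<in> VOb B \<Longrightarrow> p \<in> GHom C (vfo i b) c \<Longrightarrow> h c c' s \<star>\<^bsub>C\<^esub> K c b p = K c' b (s \<star>\<^bsub>C\<^esub> p)"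
    by blast+
  have unique: "h c c' s = u" if s: "s \<in> GHom C c c'" and u: "u \<in> GHom C (L c) (L c')" "grd u = grd s"
      "\<And>b p. b \<in> VOb B \<Longrightarrow> p \<in> GHom C (vfo i b) c \<Longrightarrow> u \<star>\<^bsub>C\<^esub> K c b p = K c' b (s \<star>\<^bsub>C\<^esub> p)" for s c c' u
    by (rule gcolim_unique[OF G[OF GHom_ob(1)[OF s]] D h[OF s] u(1)]) (simp_all add: u gh[OF s] hK[OF s])
  \<comment> \<open>Naturality in the grade is again a case of uniqueness: both sides have the same
    composites with the colimit unit.\<close>
  have oper_h: "oper C c c' C (L c) (L c') [] [] (h c c')" if c: "c \<in> VOb C" and c': "c' \<in> VOb C" for c c'
    unfolding oper_def
  proof (intro conjI ballI allI impI)
    fix s xs u assume s: "s \<in> GHom C c c'" and xs: "set xs \<subseteq> Ob V" and u: "u \<in> Hom V (\<T> xs) (\<T> (grd s))"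
    have u': "u \<in> Hom V (\<T> xs) (\<T> (grd (h c c' s)))" using u gh[OF s] by simp
    have "h c c' (reix xs u s) = reix xs u (h c c' s)"
    proof (rule unique[OF reix_hom[OF s xs u] reix_hom[OF h[OF s] xs u']])
      fix b p assume b: "b \<in> VOb B" and p: "p \<in> GHom C (vfo i b) c"
      have gp: "grd (K c b p) = grd p" using graded_familyD(5)[OF fam[OF c] b p] by simp
      have r: "rwhisker xs (grd s) (grd p) u \<in> Hom V (\<T> (xs @ grd p)) (\<T> (grd (s \<star>\<^bsub>C\<^esub> p)))"
        using rwhisker_hom[OF u xs grd_ob[OF s] grd_ob[OF p]] by simp
      have xp: "set (xs @ grd p) \<subseteq> Ob V" using xs grd_ob[OF p] by simp
      have "reix xs u (h c c' s) \<star>\<^bsub>C\<^esub> K c b p = reix (xs @ grd p) (rwhisker xs (grd s) (grd p) u) (K c' b (s \<star>\<^bsub>C\<^esub> p))"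
        using reix_cmp[OF C graded_familyD(4)[OF fam[OF c] b p] h[OF s] xs u'] gp gh[OF s] hK[OF s b p] by simp
      also have "\<dots> = K c' b (reix (xs @ grd p) (rwhisker xs (grd s) (grd p) u) (s \<star>\<^bsub>C\<^esub> p))"
        using operD(5)[OF graded_familyD(2)[OF fam[OF c'] b] gcmp_hom[OF C p s] xp r] rwhisker_Nil[OF r xp] grd_ob[OF s] grd_ob[OF p] by simp
      also have "\<dots> = K c' b (reix xs u s \<star>\<^bsub>C\<^esub> p)" by (subst reix_cmp[OF C p s xs u]) simp
      finally show "reix xs u (h c c' s) \<star>\<^bsub>C\<^esub> K c b p = K c' b (reix xs u s \<star>\<^bsub>C\<^esub> p)" .
    qed simp
    then show "h c c' (reix xs u s) = reix ([] @ xs @ []) (lwhisker [] (rwhisker xs (grd s) [] u)) (h c c' s)"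
      using rwhisker_Nil[OF u xs grd_ob[OF s]] by simp
  qed (use h gh in auto)
  have idt_h: "h c c (gid C c) = gid C (L c)" if c: "c \<in> VOb C" for c
  proof (rule unique[OF gid_hom[OF C c] gid_hom[OF C L[OF c]]])
    fix b p assume b: "b \<in> VOb B" and p: "p \<in> GHom C (vfo i b) c"
    show "gid C (L c) \<star>\<^bsub>C\<^esub> K c b p = K c b (gid C c \<star>\<^bsub>C\<^esub> p)"
      using gid_left[OF C p] gid_left[OF C graded_familyD(4)[OF fam[OF c] b p]] by (simp del: gr_simps)
  qed simp
  have cmp_h: "h a c (q \<star>\<^bsub>C\<^esub> p) = h b c q \<star>\<^bsub>C\<^esub> h a b p" if p: "p \<in> GHom C a b" and q: "q \<in> GHom C b c" for a b c p q
  proof (rule unique[OF gcmp_hom[OF C p q] gcmp_hom[OF C h[OF p] h[OF q]]])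
    fix b' r assume b': "b' \<in> VOb B" and r: "r \<in> GHom C (vfo i b') a"
    have "(h b c q \<star>\<^bsub>C\<^esub> h a b p) \<star>\<^bsub>C\<^esub> K a b' r = h b c q \<star>\<^bsub>C\<^esub> (h a b p \<star>\<^bsub>C\<^esub> K a b' r)"
      by (rule gcmp_assoc[OF C graded_familyD(4)[OF fam[OF GHom_ob(1)[OF p]] b' r] h[OF p] h[OF q]])
    also have "\<dots> = K c b' (q \<star>\<^bsub>C\<^esub> (p \<star>\<^bsub>C\<^esub> r))" using hK[OF p b' r] hK[OF q b' gcmp_hom[OF C r p]] by simp
    also have "\<dots> = K c b' ((q \<star>\<^bsub>C\<^esub> p) \<star>\<^bsub>C\<^esub> r)" using gcmp_assoc[OF C r p q] by simp
    finally show "(h b c q \<star>\<^bsub>C\<^esub> h a b p) \<star>\<^bsub>C\<^esub> K a b' r = K c b' ((q \<star>\<^bsub>C\<^esub> p) \<star>\<^bsub>C\<^esub> r)" .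
  qed (use gh[OF p] gh[OF q] in simp)
  \<comment> \<open>The unit of the Kan extension is the colimit unit at identities.\<close>
  let ?H = "mk_vfun C L h" and ?e = "\<lambda>b. K (vfo i b) b (gid C (vfo i b))"
  have mk1: "is_vfunctor V C C ?H" by (rule mk_vfun(1)[OF C C]) (fact L oper_h idt_h cmp_h)+
  have mk2: "gf ?H p = h a b p" if "p \<in> GHom C a b" for p a b
    by (rule mk_vfun(2)[OF C C _ _ _ _ that]) (fact L oper_h idt_h cmp_h)+
  have Ho: "vfo ?H c = L c" if "c \<in> VOb C" for c using that by (simp add: mk_vfun_def)
  have "pointwise_lan B C i D ?H ?e"
    unfolding pointwise_lan_def
  proof (intro conjI ballI i D)
    show "is_vfunctor V C C ?H" by (rule mk1)
    fix b assume b: "b \<in> VOb B"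
    have ib: "vfo i b \<in> VOb C" using vfun_simps[OF i] b by auto
    note id = gid_hom[OF C ib]
    show "?e b \<in> GHom C (vfo D b) (vfo ?H (vfo i b))" using graded_familyD(4)[OF fam[OF ib] b id] Ho[OF ib] by simp
    show "grd (?e b) = []" using graded_familyD(5)[OF fam[OF ib] b id] by simp
  next
    fix c assume c: "c \<in> VOb C"
    show "gcolim B C i c C D (vfo ?H c) (\<lambda>b p. gf ?H p \<star>\<^bsub>C\<^esub> ?e b)"
      unfolding Ho[OF c]
    proof (rule gcolim_cong[OF G[OF c] _ i])
      fix b p assume b: "b \<in> VOb B" and p: "p \<in> GHom C (vfo i b) c"
      have ib: "vfo i b \<in> VOb C" using vfun_simps[OF i] b by auto
      show "gf ?H p \<star>\<^bsub>C\<^esub> ?e b = K c b p"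
        using mk2[OF p] hK[OF p b gid_hom[OF C ib]] gid_right[OF C p] by (simp del: gr_simps)
    qed
  qed
  then show ?thesis using mk_vfun_ext by blast
qed

text \<open>Interchange of colimits. An arrow out of \<open>H l\<close> is a family on the homs
  \<open>C(i k,l)\<close>. Since \<open>C(i k,-)\<close> preserves the colimit \<open>l\<close>,
  this is a family in two variables, one in the weight \<open>C(j-,z)\<close> and one in
  \<open>C(i k,E b)\<close>. Grouped the other way, it is a family on the weight of arrows out of
  the objects \<open>H (E b)\<close>.\<close>

lemma pointwise_lan_preserves:
  assumes P: "pointwise_lan B C i D H e" and j: "is_vfunctor V J C j" and E: "is_vfunctor V J C E"
    and G: "gcolim J C j z C E l K"
    and R: "\<And>b. b \<in> VOb B \<Longrightarrow> gcolim J C j z (self_vcat V) (comp_vfun V (rep_vfun V C (vfo i b)) E) (VHom C (vfo i b) l)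
       (\<lambda>k p. gf (rep_vfun V C (vfo i b)) (K k p))"
  shows "gcolim J C j z C (comp_vfun V H E) (vfo H l) (\<lambda>b p. gf H (K b p))"
proof -
  note i = pointwise_lanD(1)[OF P] and D = pointwise_lanD(2)[OF P] and H = pointwise_lanD(3)[OF P]
  note B = vfun_cat(1)[OF i] and C = vfun_cat(2)[OF i] and J = vfun_cat(1)[OF j]
  note l = gcolimD(1)[OF G] and K = gcolimD(2)[OF G]
  interpret GC: category "gr C" by (rule category_gr[OF C])
  have HE: "is_vfunctor V J C (comp_vfun V H E)" by (rule is_vfunctor_comp[OF E H])
  note gf = gf_simps[OF H] gf_simps[OF i] gf_simps[OF D] gf_simps[OF E]
  have e: "e b \<in> Arr (gr C)" "Dom (gr C) (e b) = vfo D b" "Cod (gr C) (e b) = vfo H (vfo i b)" if "b \<in> VOb B" for b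
    using pointwise_lanD(4)[OF P that] by (auto simp: Hom_iff)
  have fH: "graded_family J C j z C (comp_vfun V H E) (vfo H l) [] (\<lambda>b p. gf H (K b p))"
  proof (rule graded_familyI)
    show "oper C (vfo j b) z C (vfo (comp_vfun V H E) b) (vfo H l) [] [] (\<lambda>p. gf H (K b p))" if "b \<in> VOb J" for b
      unfolding comp_vfun_simps by (rule oper_comp[OF graded_familyD(2)[OF K that] oper_gf[OF H]]) simp_all
    fix b b' p q assume p: "p \<in> GHom C (vfo j b) z" and q: "q \<in> GHom J b' b"
    show "gf H (K b' (p \<star>\<^bsub>C\<^esub> gf j q)) = gf H (K b p) \<star>\<^bsub>C\<^esub> gf (comp_vfun V H E) q"
      using graded_familyD(3)[OF K p q] gf_cmp[OF H gf_hom[OF E q] graded_familyD(4)[OF K GHom_ob(2)[OF q] p]] gf_comp[OF E H q] by simp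
  qed simp
  have "\<exists>!U. U \<in> GHom C (vfo H l) x \<and> grd U = ts \<and> (\<forall>b\<in>VOb J. \<forall>p\<in>GHom C (vfo j b) z. U \<star>\<^bsub>C\<^esub> gf H (K b p) = A b p)"
    if x: "x \<in> VOb C" and A: "graded_family J C j z C (comp_vfun V H E) x ts A" for x ts A
  proof -
    note ts = graded_familyD(1)[OF A]
    have Aty: "A b p \<in> Arr (gr C)" "Dom (gr C) (A b p) = vfo H (vfo E b)" "Cod (gr C) (A b p) = x"
      if "b \<in> VOb J" "p \<in> GHom C (vfo j b) z" for b p
      using graded_familyD(4)[OF A that] by (auto simp: Hom_iff)
    \<comment> \<open>The test family \<open>A\<close> is spread over two variables,
      \<open>p\<close> in the weight and \<open>r\<close> from \<open>i k\<close> to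
      \<open>E b\<close>, and then collected into one operator on \<open>C(i k,l)\<close>.\<close>
    have "\<exists>\<Gamma>. oper C (vfo i k) l C (vfo D k) x ts [] \<Gamma> \<and>
      (\<forall>b\<in>VOb J. \<forall>p\<in>GHom C (vfo j b) z. \<forall>r\<in>GHom C (vfo i k) (vfo E b). \<Gamma> (K b p \<star>\<^bsub>C\<^esub> r) = A b p \<star>\<^bsub>C\<^esub> (gf H r \<star>\<^bsub>C\<^esub> e k))"
      if k: "k \<in> VOb B" for k
    proof (rule two_variable_extension[OF j E _ K l R[OF k] _ x ts])
      show "vfo i k \<in> VOb C" "vfo D k \<in> VOb C" using k vfun_simps[OF i] vfun_simps[OF D] by auto
      fix b p assume b: "b \<in> VOb J" and p: "p \<in> GHom C (vfo j b) z"
      show "oper C (vfo i k) (vfo E b) C (vfo D k) x (ts @ grd p) [] (\<lambda>r. A b p \<star>\<^bsub>C\<^esub> (gf H r \<star>\<^bsub>C\<^esub> e k))"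
        by (rule oper_post[OF C _ oper_pre[OF C pointwise_lanD(4)[OF P k] oper_gf[OF H]]])
          (use graded_familyD(4,5)[OF A b p] pointwise_lanD(5)[OF P k] in auto)
    next
      fix b r assume b: "b \<in> VOb J" and r: "r \<in> GHom C (vfo i k) (vfo E b)"
      have "oper C (vfo j b) z C (vfo H (vfo E b)) x ts [] (A b)" using graded_familyD(2)[OF A b] by simp
      then show "oper C (vfo j b) z C (vfo D k) x ts (grd r @ []) (\<lambda>p. A b p \<star>\<^bsub>C\<^esub> (gf H r \<star>\<^bsub>C\<^esub> e k))"
        by (rule oper_pre[OF C gcmp_hom[OF C pointwise_lanD(4)[OF P k] gf_hom[OF H r]]]) (simp add: pointwise_lanD(5)[OF P k])
    next
      fix b b' p q r assume p: "p \<in> GHom C (vfo j b) z" and q: "q \<in> GHom J b' b" and r: "r \<in> GHom C (vfo i k) (vfo E b')"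
      have "A b' (p \<star>\<^bsub>C\<^esub> gf j q) = A b p \<star>\<^bsub>C\<^esub> gf H (gf E q)"
        using graded_familyD(3)[OF A p q] gf_comp[OF E H q] by simp
      then show "A b' (p \<star>\<^bsub>C\<^esub> gf j q) \<star>\<^bsub>C\<^esub> (gf H r \<star>\<^bsub>C\<^esub> e k) = A b p \<star>\<^bsub>C\<^esub> (gf H (gf E q \<star>\<^bsub>C\<^esub> r) \<star>\<^bsub>C\<^esub> e k)"
        using Aty[OF GHom_ob(2)[OF q] p] q r e[OF k] by (simp add: Hom_iff gf)
    qed (use ts in auto)
    then obtain \<Gamma> where \<Gamma>: "\<And>k. k \<in> VOb B \<Longrightarrow> oper C (vfo i k) l C (vfo D k) x ts [] (\<Gamma> k)"
      and \<Gamma>K: "\<And>k b p r. k \<in> VOb B \<Longrightarrow> b \<in> VOb J \<Longrightarrow> p \<in> GHom C (vfo j b) z \<Longrightarrow> r \<in> GHom C (vfo i k) (vfo E b) \<Longrightarrow>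
         \<Gamma> k (K b p \<star>\<^bsub>C\<^esub> r) = A b p \<star>\<^bsub>C\<^esub> (gf H r \<star>\<^bsub>C\<^esub> e k)"
      by metis
    have Kty: "K b p \<in> Arr (gr C)" "Dom (gr C) (K b p) = vfo E b" "Cod (gr C) (K b p) = l"
      if "b \<in> VOb J" "p \<in> GHom C (vfo j b) z" for b p
      using graded_familyD(4)[OF K that] by (auto simp: Hom_iff)
    \<comment> \<open>The operators \<open>\<Gamma> k\<close> fit together over \<open>B\<close>.
      This is checked on the composites \<open>K b p \<star> r\<close>, where it reduces to
      naturality of \<open>e\<close>.\<close>
    have "graded_family B C i l C D x ts \<Gamma>"
    proof (rule graded_familyI[OF ts \<Gamma>])
      fix k k' s q assume s: "s \<in> GHom C (vfo i k) l" and q: "q \<in> GHom B k' k"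
      note k = GHom_ob(2)[OF q] and k' = GHom_ob(1)[OF q]
      have ob: "vfo i k \<in> VOb C" "vfo D k' \<in> VOb C" using k k' vfun_simps[OF i] vfun_simps[OF D] by auto
      show "\<Gamma> k' (s \<star>\<^bsub>C\<^esub> gf i q) = \<Gamma> k s \<star>\<^bsub>C\<^esub> gf D q"
      proof (rule two_variable_unique[OF j E ob(1) K l R[OF k] ob(2) x _ _ _ s])
        show "oper C (vfo i k) l C (vfo D k') x ts (grd q) (\<lambda>s. \<Gamma> k' (s \<star>\<^bsub>C\<^esub> gf i q))"
          by (rule oper_comp[OF oper_rcmp[OF C gf_hom[OF i q]] \<Gamma>[OF k']]) simp_all
        show "oper C (vfo i k) l C (vfo D k') x ts (grd q) (\<lambda>s. \<Gamma> k s \<star>\<^bsub>C\<^esub> gf D q)"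
          by (rule oper_pre[OF C gf_hom[OF D q] \<Gamma>[OF k]]) simp
        fix b p r assume b: "b \<in> VOb J" and p: "p \<in> GHom C (vfo j b) z" and r: "r \<in> GHom C (vfo i k) (vfo E b)"
        have "\<Gamma> k' ((K b p \<star>\<^bsub>C\<^esub> r) \<star>\<^bsub>C\<^esub> gf i q) = \<Gamma> k' (K b p \<star>\<^bsub>C\<^esub> (r \<star>\<^bsub>C\<^esub> gf i q))"
          using gcmp_assoc[OF C gf_hom[OF i q] r graded_familyD(4)[OF K b p]] by simp
        also have "\<dots> = A b p \<star>\<^bsub>C\<^esub> (gf H (r \<star>\<^bsub>C\<^esub> gf i q) \<star>\<^bsub>C\<^esub> e k')"
          by (rule \<Gamma>K[OF k' b p gcmp_hom[OF C gf_hom[OF i q] r]])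
        also have "\<dots> = A b p \<star>\<^bsub>C\<^esub> (gf H r \<star>\<^bsub>C\<^esub> (gf H (gf i q) \<star>\<^bsub>C\<^esub> e k'))"
          using q r e[OF k'] by (simp add: Hom_iff gf)
        also have "\<dots> = (A b p \<star>\<^bsub>C\<^esub> (gf H r \<star>\<^bsub>C\<^esub> e k)) \<star>\<^bsub>C\<^esub> gf D q"
          unfolding pointwise_lan_nat[OF P q, symmetric] using q r e[OF k] Aty[OF b p] by (simp add: Hom_iff gf)
        also have "\<dots> = \<Gamma> k (K b p \<star>\<^bsub>C\<^esub> r) \<star>\<^bsub>C\<^esub> gf D q" using \<Gamma>K[OF k b p r] by simp
        finally show "\<Gamma> k' ((K b p \<star>\<^bsub>C\<^esub> r) \<star>\<^bsub>C\<^esub> gf i q) = \<Gamma> k (K b p \<star>\<^bsub>C\<^esub> r) \<star>\<^bsub>C\<^esub> gf D q" .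
      qed
    qed
    then obtain U where U: "U \<in> GHom C (vfo H l) x" "grd U = ts"
      and U\<Gamma>: "\<And>k s. k \<in> VOb B \<Longrightarrow> s \<in> GHom C (vfo i k) l \<Longrightarrow> U \<star>\<^bsub>C\<^esub> (gf H s \<star>\<^bsub>C\<^esub> e k) = \<Gamma> k s"
      using gcolimD(3)[OF pointwise_lanD(6)[OF P l] x] by blast
    \<comment> \<open>Two arrows out of \<open>H (E b)\<close> are compared through the colimit
      presentation of that object.\<close>
    have UK: "U \<star>\<^bsub>C\<^esub> gf H (K b p) = A b p" if b: "b \<in> VOb J" and p: "p \<in> GHom C (vfo j b) z" for b p
    proof -
      have Eb: "vfo E b \<in> VOb C" using b vfun_simps[OF E] by auto
      have HK: "gf H (K b p) \<in> GHom C (vfo H (vfo E b)) (vfo H l)" by (rule gf_hom[OF H graded_familyD(4)[OF K b p]])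
      have Ap: "A b p \<in> GHom C (vfo H (vfo E b)) x" using graded_familyD(4)[OF A b p] by simp
      show ?thesis
      proof (rule gcolim_unique[OF pointwise_lanD(6)[OF P Eb] D gcmp_hom[OF C HK U(1)] Ap])
        show "grd (U \<star>\<^bsub>C\<^esub> gf H (K b p)) = grd (A b p)"
          using U(2) graded_familyD(5)[OF K b p] graded_familyD(5)[OF A b p] by simp
        fix k r assume k: "k \<in> VOb B" and r: "r \<in> GHom C (vfo i k) (vfo E b)"
        have "(U \<star>\<^bsub>C\<^esub> gf H (K b p)) \<star>\<^bsub>C\<^esub> (gf H r \<star>\<^bsub>C\<^esub> e k) = U \<star>\<^bsub>C\<^esub> (gf H (K b p \<star>\<^bsub>C\<^esub> r) \<star>\<^bsub>C\<^esub> e k)"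
          using U(1) Kty[OF b p] r e[OF k] by (simp add: Hom_iff gf)
        then show "(U \<star>\<^bsub>C\<^esub> gf H (K b p)) \<star>\<^bsub>C\<^esub> (gf H r \<star>\<^bsub>C\<^esub> e k) = A b p \<star>\<^bsub>C\<^esub> (gf H r \<star>\<^bsub>C\<^esub> e k)"
          using U\<Gamma>[OF k gcmp_hom[OF C r graded_familyD(4)[OF K b p]]] \<Gamma>K[OF k b p r] by simp
      qed
    qed
    show ?thesis
    proof (rule ex1I[of _ U])
      show "U \<in> GHom C (vfo H l) x \<and> grd U = ts \<and> (\<forall>b\<in>VOb J. \<forall>p\<in>GHom C (vfo j b) z. U \<star>\<^bsub>C\<^esub> gf H (K b p) = A b p)"
        using U UK by blast
      fix U' assume "U' \<in> GHom C (vfo H l) x \<and> grd U' = ts \<and> (\<forall>b\<in>VOb J. \<forall>p\<in>GHom C (vfo j b) z. U' \<star>\<^bsub>C\<^esub> gf H (K b p) = A b p)"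
      then have U': "U' \<in> GHom C (vfo H l) x" "grd U' = ts"
        and U'K: "\<And>b p. b\<in>VOb J \<Longrightarrow> p\<in>GHom C (vfo j b) z \<Longrightarrow> U' \<star>\<^bsub>C\<^esub> gf H (K b p) = A b p" by blast+
      \<comment> \<open>A competitor induces the same operators \<open>\<Gamma> k\<close>, by
        uniqueness in two variables.\<close>
      show "U' = U"
      proof (rule gcolim_unique[OF pointwise_lanD(6)[OF P l] D U'(1) U(1)])
        show "grd U' = grd U" using U U' by simp
        fix k s assume k: "k \<in> VOb B" and s: "s \<in> GHom C (vfo i k) l"
        have ob: "vfo i k \<in> VOb C" "vfo D k \<in> VOb C" using k vfun_simps[OF i] vfun_simps[OF D] by auto
        have "U' \<star>\<^bsub>C\<^esub> (gf H s \<star>\<^bsub>C\<^esub> e k) = \<Gamma> k s"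
        proof (rule two_variable_unique[OF j E ob(1) K l R[OF k] ob(2) x _ \<Gamma>[OF k] _ s])
          show "oper C (vfo i k) l C (vfo D k) x ts [] (\<lambda>s. U' \<star>\<^bsub>C\<^esub> (gf H s \<star>\<^bsub>C\<^esub> e k))"
            by (rule oper_post[OF C U'(1) oper_pre[OF C pointwise_lanD(4)[OF P k] oper_gf[OF H]]])
              (use U'(2) pointwise_lanD(5)[OF P k] in auto)
          fix b p r assume b: "b \<in> VOb J" and p: "p \<in> GHom C (vfo j b) z" and r: "r \<in> GHom C (vfo i k) (vfo E b)"
          have "U' \<star>\<^bsub>C\<^esub> (gf H (K b p \<star>\<^bsub>C\<^esub> r) \<star>\<^bsub>C\<^esub> e k) = (U' \<star>\<^bsub>C\<^esub> gf H (K b p)) \<star>\<^bsub>C\<^esub> (gf H r \<star>\<^bsub>C\<^esub> e k)"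
            using U'(1) Kty[OF b p] r e[OF k] by (simp add: Hom_iff gf)
          then show "U' \<star>\<^bsub>C\<^esub> (gf H (K b p \<star>\<^bsub>C\<^esub> r) \<star>\<^bsub>C\<^esub> e k) = \<Gamma> k (K b p \<star>\<^bsub>C\<^esub> r)"
            using U'K[OF b p] \<Gamma>K[OF k b p r] by simp
        qed
        then show "U' \<star>\<^bsub>C\<^esub> (gf H s \<star>\<^bsub>C\<^esub> e k) = U \<star>\<^bsub>C\<^esub> (gf H s \<star>\<^bsub>C\<^esub> e k)" using U\<Gamma>[OF k s] by simp
      qed
    qed
  qed
  then show ?thesis unfolding gcolim_def using fH vfun_simps(1)[OF H l] by blast
qed

section \<open>Transformations out of a Kan extension\<close>

abbreviation tr :: "('a, 'b, 'm) vfun \<Rightarrow> ('a \<Rightarrow> 'm) \<Rightarrow> ('a, 'b, 'm) vfun \<Rightarrow> 'a \<Rightarrow> 'b \<times> 'o list \<times> 'm \<times> 'b" where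
  "tr F \<alpha> G a \<equiv> (vfo F a, [], \<alpha> a, vfo G a)"

lemma trD:
  assumes "is_vnat_trans V A B F G \<alpha>"
  shows "is_vfunctor V A B F" "is_vfunctor V A B G"
    "a \<in> VOb A \<Longrightarrow> tr F \<alpha> G a \<in> GHom B (vfo F a) (vfo G a)"
    "p \<in> GHom A a b \<Longrightarrow> tr F \<alpha> G b \<star>\<^bsub>B\<^esub> gf F p = gf G p \<star>\<^bsub>B\<^esub> tr F \<alpha> G a"
proof -
  show F: "is_vfunctor V A B F" and G: "is_vfunctor V A B G" using assms by (auto simp: is_vnat_trans_def)
  show "a \<in> VOb A \<Longrightarrow> tr F \<alpha> G a \<in> GHom B (vfo F a) (vfo G a)"
    "p \<in> GHom A a b \<Longrightarrow> tr F \<alpha> G b \<star>\<^bsub>B\<^esub> gf F p = gf G p \<star>\<^bsub>B\<^esub> tr F \<alpha> G a"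
    using assms unfolding vnat_trans_iff[OF F G] by blast+
qed

text \<open>The components come from the universal property at each \<open>c\<close> in the empty
  grade; naturality against an arrow \<open>s\<close> is uniqueness in the grade of
  \<open>s\<close>.\<close>

lemma pointwise_lan_extend:
  assumes P: "pointwise_lan B C i D H e" and G: "is_vfunctor V C C G"
    and g: "\<And>b. b \<in> VOb B \<Longrightarrow> g b \<in> GHom C (vfo D b) (vfo G (vfo i b))" "\<And>b. b \<in> VOb B \<Longrightarrow> grd (g b) = []"
    and nat: "\<And>b b' q. q \<in> GHom B b' b \<Longrightarrow> g b \<star>\<^bsub>C\<^esub> gf D q = gf G (gf i q) \<star>\<^bsub>C\<^esub> g b'"
  shows "\<exists>\<beta>. is_vnat_trans V C C H G \<beta> \<and> \<beta> \<in> extensional (VOb C) \<and> (\<forall>b\<in>VOb B. tr H \<beta> G (vfo i b) \<star>\<^bsub>C\<^esub> e b = g b)"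
proof -
  note i = pointwise_lanD(1)[OF P] and D = pointwise_lanD(2)[OF P] and H = pointwise_lanD(3)[OF P]
  note B = vfun_cat(1)[OF i] and C = vfun_cat(2)[OF i]
  interpret GC: category "gr C" by (rule category_gr[OF C])
  note gf = gf_simps[OF H] gf_simps[OF i] gf_simps[OF D] gf_simps[OF G]
  have e: "e b \<in> Arr (gr C)" "Dom (gr C) (e b) = vfo D b" "Cod (gr C) (e b) = vfo H (vfo i b)" if "b \<in> VOb B" for b
    using pointwise_lanD(4)[OF P that] by (auto simp: Hom_iff)
  have gty: "g b \<in> Arr (gr C)" "Dom (gr C) (g b) = vfo D b" "Cod (gr C) (g b) = vfo G (vfo i b)" if "b \<in> VOb B" for b
    using g(1)[OF that] by (auto simp: Hom_iff)
  have fam: "graded_family B C i c C D (vfo G c) [] (\<lambda>b p. gf G p \<star>\<^bsub>C\<^esub> g b)" if c: "c \<in> VOb C" for c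
  proof (rule graded_familyI)
    fix b assume b: "b \<in> VOb B"
    show "oper C (vfo i b) c C (vfo D b) (vfo G c) [] [] (\<lambda>p. gf G p \<star>\<^bsub>C\<^esub> g b)"
      by (rule oper_pre[OF C g(1)[OF b] oper_gf[OF G]]) (simp add: g(2)[OF b])
  next
    fix b b' p q assume p: "p \<in> GHom C (vfo i b) c" and q: "q \<in> GHom B b' b"
    have "gf G (p \<star>\<^bsub>C\<^esub> gf i q) \<star>\<^bsub>C\<^esub> g b' = gf G p \<star>\<^bsub>C\<^esub> (gf G (gf i q) \<star>\<^bsub>C\<^esub> g b')"
      using p q gty[OF GHom_ob(1)[OF q]] by (simp add: Hom_iff gf)
    also have "\<dots> = (gf G p \<star>\<^bsub>C\<^esub> g b) \<star>\<^bsub>C\<^esub> gf D q"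
      unfolding nat[OF q, symmetric] using p q gty[OF GHom_ob(2)[OF q]] by (simp add: Hom_iff gf)
    finally show "gf G (p \<star>\<^bsub>C\<^esub> gf i q) \<star>\<^bsub>C\<^esub> g b' = (gf G p \<star>\<^bsub>C\<^esub> g b) \<star>\<^bsub>C\<^esub> gf D q" .
  qed simp
  have "\<exists>u. u \<in> GHom C (vfo H c) (vfo G c) \<and> grd u = [] \<and> (\<forall>b\<in>VOb B. \<forall>p\<in>GHom C (vfo i b) c. u \<star>\<^bsub>C\<^esub> (gf H p \<star>\<^bsub>C\<^esub> e b) = gf G p \<star>\<^bsub>C\<^esub> g b)"
    if c: "c \<in> VOb C" for c
    by (rule gcolimD(3)[OF pointwise_lanD(6)[OF P c] vfun_simps(1)[OF G c] fam[OF c]])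
  then obtain u where u: "\<And>c. c \<in> VOb C \<Longrightarrow> u c \<in> GHom C (vfo H c) (vfo G c)" "\<And>c. c \<in> VOb C \<Longrightarrow> grd (u c) = []"
    and ue: "\<And>c b p. c \<in> VOb C \<Longrightarrow> b\<in>VOb B \<Longrightarrow> p\<in>GHom C (vfo i b) c \<Longrightarrow> u c \<star>\<^bsub>C\<^esub> (gf H p \<star>\<^bsub>C\<^esub> e b) = gf G p \<star>\<^bsub>C\<^esub> g b"
    by metis
  let ?\<beta> = "\<lambda>c\<in>VOb C. el (u c)"
  have tr: "tr H ?\<beta> G c = u c" if c: "c \<in> VOb C" for c
    using u[OF c] c by (auto elim!: GHom_E)
  have uty: "u b \<in> Arr (gr C)" "Dom (gr C) (u b) = vfo H b" "Cod (gr C) (u b) = vfo G b" if "b \<in> VOb C" for b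
    using u(1)[OF that] by (auto simp: Hom_iff)
  have "is_vnat_trans V C C H G ?\<beta>"
    unfolding vnat_trans_iff[OF H G]
  proof (intro conjI ballI allI impI)
    fix c assume c: "c \<in> VOb C"
    show "tr H ?\<beta> G c \<in> GHom C (vfo H c) (vfo G c)" unfolding tr[OF c] by (rule u(1)[OF c])
  next
    fix c c' s assume s: "s \<in> GHom C c c'"
    note c = GHom_ob(1)[OF s] and c' = GHom_ob(2)[OF s]
    have "u c' \<star>\<^bsub>C\<^esub> gf H s = gf G s \<star>\<^bsub>C\<^esub> u c"
    proof (rule gcolim_unique[OF pointwise_lanD(6)[OF P c] D gcmp_hom[OF C gf_hom[OF H s] u(1)[OF c']] gcmp_hom[OF C u(1)[OF c] gf_hom[OF G s]]])
      fix b p assume b: "b \<in> VOb B" and p: "p \<in> GHom C (vfo i b) c"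
      have "(u c' \<star>\<^bsub>C\<^esub> gf H s) \<star>\<^bsub>C\<^esub> (gf H p \<star>\<^bsub>C\<^esub> e b) = u c' \<star>\<^bsub>C\<^esub> (gf H (s \<star>\<^bsub>C\<^esub> p) \<star>\<^bsub>C\<^esub> e b)"
        using s p uty[OF c'] e[OF b] by (simp add: Hom_iff gf)
      also have "\<dots> = gf G (s \<star>\<^bsub>C\<^esub> p) \<star>\<^bsub>C\<^esub> g b" by (rule ue[OF c' b gcmp_hom[OF C p s]])
      also have "\<dots> = gf G s \<star>\<^bsub>C\<^esub> (gf G p \<star>\<^bsub>C\<^esub> g b)" using s p gty[OF b] by (simp add: Hom_iff gf)
      also have "\<dots> = (gf G s \<star>\<^bsub>C\<^esub> u c) \<star>\<^bsub>C\<^esub> (gf H p \<star>\<^bsub>C\<^esub> e b)"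
        unfolding ue[OF c b p, symmetric] using s p uty[OF c] e[OF b] by (simp add: Hom_iff gf)
      finally show "(u c' \<star>\<^bsub>C\<^esub> gf H s) \<star>\<^bsub>C\<^esub> (gf H p \<star>\<^bsub>C\<^esub> e b) = (gf G s \<star>\<^bsub>C\<^esub> u c) \<star>\<^bsub>C\<^esub> (gf H p \<star>\<^bsub>C\<^esub> e b)" .
    qed (use u(2)[OF c] u(2)[OF c'] in simp)
    then show "tr H ?\<beta> G c' \<star>\<^bsub>C\<^esub> gf H s = gf G s \<star>\<^bsub>C\<^esub> tr H ?\<beta> G c" unfolding tr[OF c] tr[OF c'] .
  qed
  moreover have "tr H ?\<beta> G (vfo i b) \<star>\<^bsub>C\<^esub> e b = g b" if b: "b \<in> VOb B" for b
  proof -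
    have ib: "vfo i b \<in> VOb C" using b vfun_simps[OF i] by auto
    show ?thesis unfolding tr[OF ib]
      using ue[OF ib b gid_hom[OF C ib]] gf_idt[OF H ib] gf_idt[OF G ib] gid_left[OF C pointwise_lanD(4)[OF P b]] gid_left[OF C g(1)[OF b]]
      by (simp del: gr_simps)
  qed
  ultimately show ?thesis by (intro exI[of _ ?\<beta>]) auto
qed

text \<open>Naturality carries \<open>gf H p\<close> across a component, so on the colimit unit the
  component at \<open>c\<close> is determined by the components at the objects
  \<open>i k\<close>.\<close>

lemma pointwise_lan_extend_unique:
  assumes P: "pointwise_lan B C i D H e" and a: "is_vnat_trans V C C H G \<alpha>" and b: "is_vnat_trans V C C H G \<beta>"
    and eq: "\<And>k. k \<in> VOb B \<Longrightarrow> tr H \<alpha> G (vfo i k) \<star>\<^bsub>C\<^esub> e k = tr H \<beta> G (vfo i k) \<star>\<^bsub>C\<^esub> e k" and c: "c \<in> VOb C"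
  shows "\<alpha> c = \<beta> c"
proof -
  note i = pointwise_lanD(1)[OF P] and D = pointwise_lanD(2)[OF P] and H = pointwise_lanD(3)[OF P] and G = trD(2)[OF a]
  note C = vfun_cat(2)[OF i]
  have "tr H \<alpha> G c = tr H \<beta> G c"
  proof (rule gcolim_unique[OF pointwise_lanD(6)[OF P c] D trD(3)[OF a c] trD(3)[OF b c]])
    fix k p assume k: "k \<in> VOb B" and p: "p \<in> GHom C (vfo i k) c"
    have ik: "vfo i k \<in> VOb C" using k vfun_simps[OF i] by auto
    have e: "e k \<in> GHom C (vfo D k) (vfo H (vfo i k))" by (rule pointwise_lanD(4)[OF P k])
    have *: "tr H \<gamma> G c \<star>\<^bsub>C\<^esub> (gf H p \<star>\<^bsub>C\<^esub> e k) = gf G p \<star>\<^bsub>C\<^esub> (tr H \<gamma> G (vfo i k) \<star>\<^bsub>C\<^esub> e k)"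
      if g: "is_vnat_trans V C C H G \<gamma>" for \<gamma>
    proof -
      have "tr H \<gamma> G c \<star>\<^bsub>C\<^esub> (gf H p \<star>\<^bsub>C\<^esub> e k) = (tr H \<gamma> G c \<star>\<^bsub>C\<^esub> gf H p) \<star>\<^bsub>C\<^esub> e k"
        by (rule gcmp_assoc[OF C e gf_hom[OF H p] trD(3)[OF g c], symmetric])
      also have "\<dots> = (gf G p \<star>\<^bsub>C\<^esub> tr H \<gamma> G (vfo i k)) \<star>\<^bsub>C\<^esub> e k" using trD(4)[OF g p] by simp
      also have "\<dots> = gf G p \<star>\<^bsub>C\<^esub> (tr H \<gamma> G (vfo i k) \<star>\<^bsub>C\<^esub> e k)"
        by (rule gcmp_assoc[OF C e trD(3)[OF g ik] gf_hom[OF G p]])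
      finally show ?thesis .
    qed
    show "tr H \<alpha> G c \<star>\<^bsub>C\<^esub> (gf H p \<star>\<^bsub>C\<^esub> e k) = tr H \<beta> G c \<star>\<^bsub>C\<^esub> (gf H p \<star>\<^bsub>C\<^esub> e k)"
      unfolding *[OF a] *[OF b] eq[OF k] ..
  qed simp
  then show ?thesis by simp
qed

section \<open>Kan extension along a fully faithful functor\<close>

lemma ff_inverse:
  assumes j: "is_vfunctor V J C j" and ff: "fully_faithful V J j"
  obtains g where "\<And>k l. k \<in> VOb J \<Longrightarrow> l \<in> VOb J \<Longrightarrow> oper C (vfo j k) (vfo j l) J k l [] [] (g k l)"
    and "\<And>k l p. k \<in> VOb J \<Longrightarrow> l \<in> VOb J \<Longrightarrow> p \<in> GHom C (vfo j k) (vfo j l) \<Longrightarrow> gf j (g k l p) = p"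
    and "\<And>k l p. p \<in> GHom J k l \<Longrightarrow> g k l (gf j p) = p"
proof
  note J = vfun_cat(1)[OF j] and C = vfun_cat(2)[OF j]
  note [simp] = vcat_simps[OF J] vcat_simps[OF C] vfun_simps[OF j]
  let ?g = "\<lambda>k l p. (k, grd p, invV (vfa j k l) \<cdot> el p, l)"
  have iso [simp]: "is_iso V (vfa j k l)" if "k \<in> VOb J" "l \<in> VOb J" for k l
    using ff that by (simp add: fully_faithful_def)
  show "oper C (vfo j k) (vfo j l) J k l [] [] (?g k l)" if [simp]: "k \<in> VOb J" "l \<in> VOb J" for k l
    unfolding oper_def
  proof (intro conjI ballI allI impI)
    fix p assume p: "p \<in> GHom C (vfo j k) (vfo j l)"
    show "?g k l p \<in> GHom J k l" "grd (?g k l p) = [] @ grd p @ []" using p by (auto elim!: GHom_E simp: GHom_iff)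
    fix xs u assume xs: "set xs \<subseteq> Ob V" and u: "u \<in> Hom V (\<T> xs) (\<T> (grd p))"
    have "?g k l (reix xs u p) = reix xs u (?g k l p)" using p u by (auto elim!: GHom_E simp: HomV_iff)
    then show "?g k l (reix xs u p) = reix ([] @ xs @ []) (lwhisker [] (rwhisker xs (grd p) [] u)) (?g k l p)"
      using rwhisker_Nil[OF u xs grd_ob[OF p]] by simp
  qed simp_all
  show "gf j (?g k l p) = p" if "k \<in> VOb J" "l \<in> VOb J" "p \<in> GHom C (vfo j k) (vfo j l)" for k l p
    using that by (auto elim!: GHom_E)
  show "?g k l (gf j p) = p" if "p \<in> GHom J k l" for k l p
    using that by (auto elim!: GHom_E)
qed

text \<open>For fully faithful \<open>j\<close> the weight \<open>C(j-,j k)\<close> is the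
  representable \<open>J(-,k)\<close>, and the colimit of \<open>D\<close> weighted by it is
  \<open>D k\<close>. The inverse \<open>v\<close> is induced by the family that pulls
  \<open>p\<close> back to \<open>J\<close> and applies \<open>D\<close>.\<close>

lemma pointwise_lan_ff_iso:
  assumes P: "pointwise_lan J C j D H e" and ff: "fully_faithful V J j" and k: "k \<in> VOb J"
  shows "\<exists>v. v \<in> GHom C (vfo H (vfo j k)) (vfo D k) \<and> grd v = [] \<and> v \<star>\<^bsub>C\<^esub> e k = gid C (vfo D k) \<and> e k \<star>\<^bsub>C\<^esub> v = gid C (vfo H (vfo j k))"
proof -
  note j = pointwise_lanD(1)[OF P] and D = pointwise_lanD(2)[OF P] and H = pointwise_lanD(3)[OF P]
  note J = vfun_cat(1)[OF j] and C = vfun_cat(2)[OF j]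
  note e = pointwise_lanD(4)[OF P]
  have jk: "vfo j k \<in> VOb C" and Dk: "vfo D k \<in> VOb C" using k vfun_simps[OF j] vfun_simps[OF D] by auto
  obtain g where g: "\<And>k l. k \<in> VOb J \<Longrightarrow> l \<in> VOb J \<Longrightarrow> oper C (vfo j k) (vfo j l) J k l [] [] (g k l)"
    and jg: "\<And>k l p. k \<in> VOb J \<Longrightarrow> l \<in> VOb J \<Longrightarrow> p \<in> GHom C (vfo j k) (vfo j l) \<Longrightarrow> gf j (g k l p) = p"
    and gj: "\<And>k l p. p \<in> GHom J k l \<Longrightarrow> g k l (gf j p) = p"
    using ff_inverse[OF j ff] by blast
  have fam: "graded_family J C j (vfo j k) C D (vfo D k) [] (\<lambda>b p. gf D (g b k p))"
  proof (rule graded_familyI)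
    show "oper C (vfo j b) (vfo j k) C (vfo D b) (vfo D k) [] [] (\<lambda>p. gf D (g b k p))" if "b \<in> VOb J" for b
      by (rule oper_comp[OF g[OF that k] oper_gf[OF D]]) simp_all
    fix b b' p q assume p: "p \<in> GHom C (vfo j b) (vfo j k)" and q: "q \<in> GHom J b' b"
    have gp: "g b k p \<in> GHom J b k" by (rule operD(3)[OF g[OF GHom_ob(2)[OF q] k] p])
    have "p \<star>\<^bsub>C\<^esub> gf j q = gf j (g b k p \<star>\<^bsub>J\<^esub> q)"
      using gf_cmp[OF j q gp] jg[OF GHom_ob(2)[OF q] k p] by simp
    then have "g b' k (p \<star>\<^bsub>C\<^esub> gf j q) = g b k p \<star>\<^bsub>J\<^esub> q" using gj[OF gcmp_hom[OF J q gp]] by simp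
    then show "gf D (g b' k (p \<star>\<^bsub>C\<^esub> gf j q)) = gf D (g b k p) \<star>\<^bsub>C\<^esub> gf D q" using gf_cmp[OF D q gp] by simp
  qed simp
  obtain v where v: "v \<in> GHom C (vfo H (vfo j k)) (vfo D k)" "grd v = []"
    and ve: "\<And>b p. b \<in> VOb J \<Longrightarrow> p \<in> GHom C (vfo j b) (vfo j k) \<Longrightarrow> v \<star>\<^bsub>C\<^esub> (gf H p \<star>\<^bsub>C\<^esub> e b) = gf D (g b k p)"
    using gcolimD(3)[OF pointwise_lanD(6)[OF P jk] Dk fam] by blast
  have "v \<star>\<^bsub>C\<^esub> e k = gid C (vfo D k)"
    using ve[OF k gid_hom[OF C jk]] gf_idt[OF H jk] gid_left[OF C e[OF k]] gj[OF gid_hom[OF J k]] gf_idt[OF j k] gf_idt[OF D k]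
    by (simp del: gr_simps tuple_simps)
  moreover have "e k \<star>\<^bsub>C\<^esub> v = gid C (vfo H (vfo j k))"
  proof (rule gcolim_unique[OF pointwise_lanD(6)[OF P jk] D gcmp_hom[OF C v(1) e[OF k]] gid_hom[OF C vfun_simps(1)[OF H jk]]])
    show "grd (e k \<star>\<^bsub>C\<^esub> v) = grd (gid C (vfo H (vfo j k)))" using v(2) pointwise_lanD(5)[OF P k] by simp
    fix b p assume b: "b \<in> VOb J" and p: "p \<in> GHom C (vfo j b) (vfo j k)"
    have gp: "g b k p \<in> GHom J b k" by (rule operD(3)[OF g[OF b k] p])
    have He: "gf H p \<star>\<^bsub>C\<^esub> e b \<in> GHom C (vfo D b) (vfo H (vfo j k))" by (rule gcmp_hom[OF C e[OF b] gf_hom[OF H p]])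
    have "(e k \<star>\<^bsub>C\<^esub> v) \<star>\<^bsub>C\<^esub> (gf H p \<star>\<^bsub>C\<^esub> e b) = e k \<star>\<^bsub>C\<^esub> gf D (g b k p)"
      using gcmp_assoc[OF C He v(1) e[OF k]] ve[OF b p] by simp
    also have "\<dots> = gf H p \<star>\<^bsub>C\<^esub> e b" using pointwise_lan_nat[OF P gp] jg[OF b k p] by simp
    also have "\<dots> = gid C (vfo H (vfo j k)) \<star>\<^bsub>C\<^esub> (gf H p \<star>\<^bsub>C\<^esub> e b)" using gid_left[OF C He] by simp
    finally show "(e k \<star>\<^bsub>C\<^esub> v) \<star>\<^bsub>C\<^esub> (gf H p \<star>\<^bsub>C\<^esub> e b) = gid C (vfo H (vfo j k)) \<star>\<^bsub>C\<^esub> (gf H p \<star>\<^bsub>C\<^esub> e b)" .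
  qed
  ultimately show ?thesis using v by blast
qed

end

section \<open>Adjunctions and equivalences of ordinary categories\<close>

lemma functorD:
  assumes "is_functor A B F"
  shows "category A" "category B" "a \<in> Ob A \<Longrightarrow> fo F a \<in> Ob B"
    "f \<in> Arr A \<Longrightarrow> fa F f \<in> Arr B" "f \<in> Arr A \<Longrightarrow> Dom B (fa F f) = fo F (Dom A f)"
    "f \<in> Arr A \<Longrightarrow> Cod B (fa F f) = fo F (Cod A f)"
    "a \<in> Ob A \<Longrightarrow> fa F (Idt A a) = Idt B (fo F a)"
    "f \<in> Arr A \<Longrightarrow> g \<in> Arr A \<Longrightarrow> Dom A g = Cod A f \<Longrightarrow> fa F (g \<cdot>\<^bsub>A\<^esub> f) = fa F g \<cdot>\<^bsub>B\<^esub> fa F f"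
  using assms by (auto simp: is_functor_def Hom_iff)

lemma functorI:
  assumes "category A" "category B" "\<And>a. a \<in> Ob A \<Longrightarrow> fo F a \<in> Ob B"
    "\<And>f. f \<in> Arr A \<Longrightarrow> fa F f \<in> Hom B (fo F (Dom A f)) (fo F (Cod A f))"
    "\<And>a. a \<in> Ob A \<Longrightarrow> fa F (Idt A a) = Idt B (fo F a)"
    "\<And>f g. f \<in> Arr A \<Longrightarrow> g \<in> Arr A \<Longrightarrow> Dom A g = Cod A f \<Longrightarrow> fa F (g \<cdot>\<^bsub>A\<^esub> f) = fa F g \<cdot>\<^bsub>B\<^esub> fa F f"
  shows "is_functor A B F"
  using assms by (simp add: is_functor_def)

lemma id_func_simps [simp]: "fo id_func a = a" "fa id_func f = f"
  by (simp_all add: id_func_def)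

lemma comp_func_simps [simp]: "fo (comp_func G F) a = fo G (fo F a)" "fa (comp_func G F) f = fa G (fa F f)"
  by (simp_all add: comp_func_def)

lemma functor_id: "category A \<Longrightarrow> is_functor A A id_func"
  by (rule functorI) (auto simp: Hom_iff category.cod_ob category.dom_ob)

lemma functor_comp:
  assumes F: "is_functor A B F" and G: "is_functor B E G"
  shows "is_functor A E (comp_func G F)"
  using functorD[OF F] functorD[OF G] by (intro functorI) (auto simp: Hom_iff)

text \<open>The values \<open>L\<close> and the unit \<open>\<eta>\<close> are prescribed, so that
  the resulting monad can be computed from chosen free objects.\<close>

lemma adjunction_of_universal_arrows:
  assumes A: "category A" and B: "category B" and G: "is_functor A B G"
    and L: "\<And>b. b \<in> Ob B \<Longrightarrow> L b \<in> Ob A" and \<eta>: "\<And>b. b \<in> Ob B \<Longrightarrow> \<eta> b \<in> Hom B b (fo G (L b))"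
    and univ: "\<And>a b f. a \<in> Ob A \<Longrightarrow> f \<in> Hom B b (fo G a) \<Longrightarrow> \<exists>!g. g \<in> Hom A (L b) a \<and> fa G g \<cdot>\<^bsub>B\<^esub> \<eta> b = f"
  shows "\<exists>F \<epsilon>. is_adjunction A B F G \<eta> \<epsilon> \<and> fo F = L"
proof -
  interpret A: category A by (rule A)
  interpret B: category B by (rule B)
  note Gd = functorD(3-)[OF G]
  note [simp] = Gd L
  have \<eta>' [simp]: "\<eta> b \<in> Arr B" "Dom B (\<eta> b) = b" "Cod B (\<eta> b) = fo G (L b)" if "b \<in> Ob B" for b
    using \<eta>[OF that] by (auto simp: Hom_iff)
  define t where "t b a f = (THE g. g \<in> Hom A (L b) a \<and> fa G g \<cdot>\<^bsub>B\<^esub> \<eta> b = f)" for b a f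
  have t: "t b a f \<in> Hom A (L b) a \<and> fa G (t b a f) \<cdot>\<^bsub>B\<^esub> \<eta> b = f" if "a \<in> Ob A" "f \<in> Hom B b (fo G a)" for a b f
    unfolding t_def by (rule theI'[OF univ[OF that]])
  have t' [simp]: "t b a f \<in> Arr A" "Dom A (t b a f) = L b" "Cod A (t b a f) = a" "fa G (t b a f) \<cdot>\<^bsub>B\<^esub> \<eta> b = f"
    if "a \<in> Ob A" "f \<in> Arr B" "Dom B f = b" "Cod B f = fo G a" for a b f
    using t[of a f b] that by (auto simp: Hom_iff)
  have eqI: "g = h" if "b \<in> Ob B" "g \<in> Arr A" "h \<in> Arr A" "Dom A g = L b" "Dom A h = L b" "Cod A g = Cod A h"
      "fa G g \<cdot>\<^bsub>B\<^esub> \<eta> b = fa G h \<cdot>\<^bsub>B\<^esub> \<eta> b" for b g h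
  proof -
    have "fa G h \<cdot>\<^bsub>B\<^esub> \<eta> b \<in> Hom B b (fo G (Cod A h))" using that by (auto simp: Hom_iff)
    from univ[OF _ this] show ?thesis using that by (auto simp: Hom_iff)
  qed
  let ?F = "\<lparr>fo = L, fa = (\<lambda>f. t (Dom B f) (L (Cod B f)) (\<eta> (Cod B f) \<cdot>\<^bsub>B\<^esub> f))\<rparr>"
  let ?\<epsilon> = "\<lambda>a. t (fo G a) a (Idt B (fo G a))"
  have F: "is_functor B A ?F"
  proof (rule functorI[OF B A])
    fix f assume f: "f \<in> Arr B"
    then show "fa ?F f \<in> Hom A (fo ?F (Dom B f)) (fo ?F (Cod B f))" by (simp add: Hom_iff)
  next
    fix b assume b: "b \<in> Ob B"
    show "fa ?F (Idt B b) = Idt A (fo ?F b)" by (rule eqI[of b]) (simp_all add: b)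
  next
    fix f g assume fg: "f \<in> Arr B" "g \<in> Arr B" "Dom B g = Cod B f"
    let ?tf = "t (Dom B f) (L (Cod B f)) (\<eta> (Cod B f) \<cdot>\<^bsub>B\<^esub> f)" and ?tg = "t (Cod B f) (L (Cod B g)) (\<eta> (Cod B g) \<cdot>\<^bsub>B\<^esub> g)"
    have "(fa G ?tg \<cdot>\<^bsub>B\<^esub> fa G ?tf) \<cdot>\<^bsub>B\<^esub> \<eta> (Dom B f) = fa G ?tg \<cdot>\<^bsub>B\<^esub> (\<eta> (Cod B f) \<cdot>\<^bsub>B\<^esub> f)" using fg by simp
    also have "\<dots> = (fa G ?tg \<cdot>\<^bsub>B\<^esub> \<eta> (Cod B f)) \<cdot>\<^bsub>B\<^esub> f" using fg by (simp del: t'(4))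
    also have "\<dots> = \<eta> (Cod B g) \<cdot>\<^bsub>B\<^esub> (g \<cdot>\<^bsub>B\<^esub> f)" using fg by simp
    finally have 1: "(fa G ?tg \<cdot>\<^bsub>B\<^esub> fa G ?tf) \<cdot>\<^bsub>B\<^esub> \<eta> (Dom B f) = \<eta> (Cod B g) \<cdot>\<^bsub>B\<^esub> (g \<cdot>\<^bsub>B\<^esub> f)" .
    show "fa ?F (g \<cdot>\<^bsub>B\<^esub> f) = fa ?F g \<cdot>\<^bsub>A\<^esub> fa ?F f"
    proof (rule eqI[of "Dom B f"])
      show "fa G (fa ?F (g \<cdot>\<^bsub>B\<^esub> f)) \<cdot>\<^bsub>B\<^esub> \<eta> (Dom B f) = fa G (fa ?F g \<cdot>\<^bsub>A\<^esub> fa ?F f) \<cdot>\<^bsub>B\<^esub> \<eta> (Dom B f)"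
        using fg 1 by simp
    qed (use fg in simp_all)
  qed simp
  have n\<eta>: "is_nat_trans B B id_func (comp_func G ?F) \<eta>"
    unfolding is_nat_trans_def using functor_id[OF B] functor_comp[OF F G] by (simp add: Hom_iff)
  have n\<epsilon>: "is_nat_trans A A (comp_func ?F G) id_func ?\<epsilon>"
    unfolding is_nat_trans_def
  proof (intro conjI ballI functor_id[OF A] functor_comp[OF G F])
    fix a assume a: "a \<in> Ob A"
    then show "?\<epsilon> a \<in> Hom A (fo (comp_func ?F G) a) (fo id_func a)" by (simp add: Hom_iff)
  next
    fix f assume f: "f \<in> Arr A"
    let ?a = "Dom A f" and ?b = "Cod A f"
    let ?s = "t (fo G ?a) (L (fo G ?b)) (\<eta> (fo G ?b) \<cdot>\<^bsub>B\<^esub> fa G f)"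
    have "(fa G (?\<epsilon> ?b) \<cdot>\<^bsub>B\<^esub> fa G ?s) \<cdot>\<^bsub>B\<^esub> \<eta> (fo G ?a) = fa G (?\<epsilon> ?b) \<cdot>\<^bsub>B\<^esub> (\<eta> (fo G ?b) \<cdot>\<^bsub>B\<^esub> fa G f)"
      using f by simp
    also have "\<dots> = (fa G (?\<epsilon> ?b) \<cdot>\<^bsub>B\<^esub> \<eta> (fo G ?b)) \<cdot>\<^bsub>B\<^esub> fa G f" using f by (simp del: t'(4))
    finally have 1: "(fa G (?\<epsilon> ?b) \<cdot>\<^bsub>B\<^esub> fa G ?s) \<cdot>\<^bsub>B\<^esub> \<eta> (fo G ?a) = fa G f" using f by simp
    show "?\<epsilon> ?b \<cdot>\<^bsub>A\<^esub> fa (comp_func ?F G) f = fa id_func f \<cdot>\<^bsub>A\<^esub> ?\<epsilon> ?a"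
    proof (rule eqI[of "fo G ?a"])
      show "fa G (?\<epsilon> ?b \<cdot>\<^bsub>A\<^esub> fa (comp_func ?F G) f) \<cdot>\<^bsub>B\<^esub> \<eta> (fo G ?a) = fa G (fa id_func f \<cdot>\<^bsub>A\<^esub> ?\<epsilon> ?a) \<cdot>\<^bsub>B\<^esub> \<eta> (fo G ?a)"
        using f 1 by simp
    qed (use f in simp_all)
  qed
  have tri: "?\<epsilon> (L b) \<cdot>\<^bsub>A\<^esub> fa ?F (\<eta> b) = Idt A (L b)" if b: "b \<in> Ob B" for b
  proof (rule eqI[OF b])
    let ?s = "t b (L (fo G (L b))) (\<eta> (fo G (L b)) \<cdot>\<^bsub>B\<^esub> \<eta> b)"
    have "(fa G (?\<epsilon> (L b)) \<cdot>\<^bsub>B\<^esub> fa G ?s) \<cdot>\<^bsub>B\<^esub> \<eta> b = fa G (?\<epsilon> (L b)) \<cdot>\<^bsub>B\<^esub> (\<eta> (fo G (L b)) \<cdot>\<^bsub>B\<^esub> \<eta> b)"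
      using b by simp
    also have "\<dots> = (fa G (?\<epsilon> (L b)) \<cdot>\<^bsub>B\<^esub> \<eta> (fo G (L b))) \<cdot>\<^bsub>B\<^esub> \<eta> b" using b by (simp del: t'(4))
    finally have 1: "(fa G (?\<epsilon> (L b)) \<cdot>\<^bsub>B\<^esub> fa G ?s) \<cdot>\<^bsub>B\<^esub> \<eta> b = \<eta> b" using b by simp
    show "fa G (?\<epsilon> (L b) \<cdot>\<^bsub>A\<^esub> fa ?F (\<eta> b)) \<cdot>\<^bsub>B\<^esub> \<eta> b = fa G (Idt A (L b)) \<cdot>\<^bsub>B\<^esub> \<eta> b"
      using b 1 by simp
  qed (use b in simp_all)
  have "is_adjunction A B ?F G \<eta> ?\<epsilon>"
    unfolding is_adjunction_def using F G n\<eta> n\<epsilon> tri by simp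
  then show ?thesis by (intro exI[of _ ?F] exI[of _ ?\<epsilon>]) simp
qed

lemma equivalence_of_fully_faithful:
  assumes F: "is_functor A B F"
    and full: "\<And>a a' f. a \<in> Ob A \<Longrightarrow> a' \<in> Ob A \<Longrightarrow> f \<in> Hom B (fo F a) (fo F a') \<Longrightarrow> \<exists>g\<in>Hom A a a'. fa F g = f"
    and faithful: "\<And>a a' g h. g \<in> Hom A a a' \<Longrightarrow> h \<in> Hom A a a' \<Longrightarrow> fa F g = fa F h \<Longrightarrow> g = h"
    and surj: "\<And>b. b \<in> Ob B \<Longrightarrow> \<exists>a\<in>Ob A. \<exists>t\<in>Hom B (fo F a) b. is_iso B t"
  shows "is_equivalence A B F"
proof -
  note A = functorD(1)[OF F] and B = functorD(2)[OF F]
  interpret A: category A by (rule A)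
  interpret B: category B by (rule B)
  note [simp] = functorD(3-)[OF F]
  obtain w t where w [simp]: "\<And>b. b \<in> Ob B \<Longrightarrow> w b \<in> Ob A" and t: "\<And>b. b \<in> Ob B \<Longrightarrow> t b \<in> Hom B (fo F (w b)) b"
    and iso [simp]: "\<And>b. b \<in> Ob B \<Longrightarrow> is_iso B (t b)"
    using surj by metis
  have t' [simp]: "t b \<in> Arr B" "Dom B (t b) = fo F (w b)" "Cod B (t b) = b" if "b \<in> Ob B" for b
    using t[OF that] by (auto simp: Hom_iff)
  define l where "l a a' f = (SOME g. g \<in> Hom A a a' \<and> fa F g = f)" for a a' f
  have l: "l a a' f \<in> Hom A a a' \<and> fa F (l a a' f) = f" if "a \<in> Ob A" "a' \<in> Ob A" "f \<in> Hom B (fo F a) (fo F a')" for a a' f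
    unfolding l_def by (rule someI_ex) (use full[OF that] in blast)
  have l' [simp]: "l a a' f \<in> Arr A" "Dom A (l a a' f) = a" "Cod A (l a a' f) = a'" "fa F (l a a' f) = f"
    if "a \<in> Ob A" "a' \<in> Ob A" "f \<in> Arr B" "Dom B f = fo F a" "Cod B f = fo F a'" for a a' f
    using l[of a a' f] that by (auto simp: Hom_iff)
  have eqI: "g = h" if "g \<in> Arr A" "h \<in> Arr A" "Dom A g = Dom A h" "Cod A g = Cod A h" "fa F g = fa F h" for g h
    using faithful[of g "Dom A g" "Cod A g" h] that by (auto simp: Hom_iff)
  let ?G = "\<lparr>fo = w, fa = (\<lambda>f. l (w (Dom B f)) (w (Cod B f)) (inverse_arr B (t (Cod B f)) \<cdot>\<^bsub>B\<^esub> (f \<cdot>\<^bsub>B\<^esub> t (Dom B f))))\<rparr>"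
  have G: "is_functor B A ?G"
  proof (rule functorI[OF B A])
    fix f assume f: "f \<in> Arr B"
    then show "fa ?G f \<in> Hom A (fo ?G (Dom B f)) (fo ?G (Cod B f))" by (simp add: Hom_iff)
  next
    fix b assume b: "b \<in> Ob B"
    show "fa ?G (Idt B b) = Idt A (fo ?G b)" by (rule eqI) (simp_all add: b)
  next
    fix f g assume fg: "f \<in> Arr B" "g \<in> Arr B" "Dom B g = Cod B f"
    show "fa ?G (g \<cdot>\<^bsub>B\<^esub> f) = fa ?G g \<cdot>\<^bsub>A\<^esub> fa ?G f"
      by (rule eqI) (use fg in simp_all)
  qed simp
  let ?\<sigma> = "\<lambda>a. l a (w (fo F a)) (inverse_arr B (t (fo F a)))"
  have \<sigma>iso: "is_iso A (?\<sigma> a)" if a: "a \<in> Ob A" for a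
  proof (rule A.is_isoI)
    show "?\<sigma> a \<in> Hom A a (w (fo F a))" "l (w (fo F a)) a (t (fo F a)) \<in> Hom A (w (fo F a)) a"
      using a by (simp_all add: Hom_iff)
    show "l (w (fo F a)) a (t (fo F a)) \<cdot>\<^bsub>A\<^esub> ?\<sigma> a = Idt A a" by (rule eqI) (use a in simp_all)
    show "?\<sigma> a \<cdot>\<^bsub>A\<^esub> l (w (fo F a)) a (t (fo F a)) = Idt A (w (fo F a))" by (rule eqI) (use a in simp_all)
  qed
  have s: "is_nat_iso A A id_func (comp_func ?G F) ?\<sigma>"
    unfolding is_nat_iso_def is_nat_trans_def
  proof (intro conjI ballI functor_id[OF A] functor_comp[OF F G])
    fix a assume a: "a \<in> Ob A"
    then show "?\<sigma> a \<in> Hom A (fo id_func a) (fo (comp_func ?G F) a)" by (simp add: Hom_iff)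
    show "is_iso A (?\<sigma> a)" by (rule \<sigma>iso[OF a])
  next
    fix f assume f: "f \<in> Arr A"
    show "?\<sigma> (Cod A f) \<cdot>\<^bsub>A\<^esub> fa id_func f = fa (comp_func ?G F) f \<cdot>\<^bsub>A\<^esub> ?\<sigma> (Dom A f)"
      by (rule eqI) (use f in simp_all)
  qed
  have "is_nat_iso B B (comp_func F ?G) id_func t"
    unfolding is_nat_iso_def is_nat_trans_def
    using functor_id[OF B] functor_comp[OF G F] by (auto simp: Hom_iff)
  then show ?thesis unfolding is_equivalence_def using F G s by blast
qed

section \<open>The Eilenberg-Moore category and a criterion for monadicity\<close>

locale monad_data =
  fixes A :: "('o, 'm, 'x) cat_scheme" and B :: "('p, 'n, 'y) cat_scheme" and F G \<eta> \<epsilon>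
  assumes adj: "is_adjunction A B F G \<eta> \<epsilon>"
begin

lemma functors: "is_functor B A F" "is_functor A B G"
  using adj by (simp_all add: is_adjunction_def)

sublocale A: category A by (rule functorD(1)[OF functors(2)])
sublocale B: category B by (rule functorD(2)[OF functors(2)])

lemmas [simp] = functorD(3-)[OF functors(1)] functorD(3-)[OF functors(2)]

lemma unit [simp]: "b \<in> Ob B \<Longrightarrow> \<eta> b \<in> Arr B" "b \<in> Ob B \<Longrightarrow> Dom B (\<eta> b) = b" "b \<in> Ob B \<Longrightarrow> Cod B (\<eta> b) = fo G (fo F b)"
  using adj by (auto simp: is_adjunction_def is_nat_trans_def Hom_iff)

lemma counit [simp]: "a \<in> Ob A \<Longrightarrow> \<epsilon> a \<in> Arr A" "a \<in> Ob A \<Longrightarrow> Dom A (\<epsilon> a) = fo F (fo G a)" "a \<in> Ob A \<Longrightarrow> Cod A (\<epsilon> a) = a"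
  using adj by (auto simp: is_adjunction_def is_nat_trans_def Hom_iff)

lemma unit_nat: "f \<in> Arr B \<Longrightarrow> \<eta> (Cod B f) \<cdot>\<^bsub>B\<^esub> f = fa G (fa F f) \<cdot>\<^bsub>B\<^esub> \<eta> (Dom B f)"
  and counit_nat: "g \<in> Arr A \<Longrightarrow> \<epsilon> (Cod A g) \<cdot>\<^bsub>A\<^esub> fa F (fa G g) = g \<cdot>\<^bsub>A\<^esub> \<epsilon> (Dom A g)"
  and triangle: "a \<in> Ob A \<Longrightarrow> fa G (\<epsilon> a) \<cdot>\<^bsub>B\<^esub> \<eta> (fo G a) = Idt B (fo G a)"
  using adj by (auto simp: is_adjunction_def is_nat_trans_def)

abbreviation "T \<equiv> comp_func G F"
abbreviation "\<mu> \<equiv> (\<lambda>b. fa G (\<epsilon> (fo F b)))"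
abbreviation "Alg \<equiv> algebra_cat B T \<eta> \<mu>"

lemma alg_simps [simp]: "Ob Alg = {x. is_algebra B T \<eta> \<mu> x}" "Dom Alg (x, f, y) = x" "Cod Alg (x, f, y) = y"
  "Idt Alg x = (x, Idt B (fst x), x)" "(y, g, z) \<cdot>\<^bsub>Alg\<^esub> (x, f, y') = (x, g \<cdot>\<^bsub>B\<^esub> f, z)"
  "(x, f, y) \<in> Arr Alg \<longleftrightarrow> is_algebra B T \<eta> \<mu> x \<and> is_algebra B T \<eta> \<mu> y \<and>
              f \<in> Hom B (fst x) (fst y) \<and> f \<cdot>\<^bsub>B\<^esub> snd x = snd y \<cdot>\<^bsub>B\<^esub> fa T f"
  by (simp_all add: algebra_cat_def)

lemma algebraD:
  assumes "is_algebra B T \<eta> \<mu> x"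
  shows "fst x \<in> Ob B" "snd x \<in> Arr B" "Dom B (snd x) = fo G (fo F (fst x))" "Cod B (snd x) = fst x"
    "snd x \<cdot>\<^bsub>B\<^esub> \<eta> (fst x) = Idt B (fst x)" "snd x \<cdot>\<^bsub>B\<^esub> \<mu> (fst x) = snd x \<cdot>\<^bsub>B\<^esub> fa G (fa F (snd x))"
  using assms by (auto simp: is_algebra_def Hom_iff split: prod.splits)

lemma category_alg: "category Alg"
proof
  fix f g h x y z w
  show "Dom Alg f \<in> Ob Alg" "Cod Alg f \<in> Ob Alg" if "f \<in> Arr Alg"
    using that by (cases f; simp)+
  show "Idt Alg x \<in> Hom Alg x x" if "x \<in> Ob Alg"
    using that algebraD[of x] by (auto simp: Hom_iff)
  show c: "g \<cdot>\<^bsub>Alg\<^esub> f \<in> Hom Alg x z" if f: "f \<in> Hom Alg x y" and g: "g \<in> Hom Alg y z"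
  proof -
    obtain f' where f': "f = (x, f', y)" using f by (cases f) (auto simp: Hom_iff)
    obtain g' where g': "g = (y, g', z)" using g by (cases g) (auto simp: Hom_iff)
    have al: "is_algebra B T \<eta> \<mu> x" "is_algebra B T \<eta> \<mu> y" "is_algebra B T \<eta> \<mu> z"
      and [simp]: "f' \<in> Arr B" "Dom B f' = fst x" "Cod B f' = fst y" "g' \<in> Arr B" "Dom B g' = fst y" "Cod B g' = fst z"
      and ef: "f' \<cdot>\<^bsub>B\<^esub> snd x = snd y \<cdot>\<^bsub>B\<^esub> fa G (fa F f')" and eg: "g' \<cdot>\<^bsub>B\<^esub> snd y = snd z \<cdot>\<^bsub>B\<^esub> fa G (fa F g')"
      using f g unfolding f' g' by (auto simp: Hom_iff)
    note [simp] = algebraD(1-4)[OF al(1)] algebraD(1-4)[OF al(2)] algebraD(1-4)[OF al(3)]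
    have "(g' \<cdot>\<^bsub>B\<^esub> f') \<cdot>\<^bsub>B\<^esub> snd x = (g' \<cdot>\<^bsub>B\<^esub> snd y) \<cdot>\<^bsub>B\<^esub> fa G (fa F f')" using ef by simp
    also have "\<dots> = snd z \<cdot>\<^bsub>B\<^esub> fa G (fa F (g' \<cdot>\<^bsub>B\<^esub> f'))" unfolding eg by simp
    finally show ?thesis using al by (simp add: f' g' Hom_iff)
  qed
  show "Idt Alg y \<cdot>\<^bsub>Alg\<^esub> f = f" "f \<cdot>\<^bsub>Alg\<^esub> Idt Alg x = f" if "f \<in> Hom Alg x y"
    using that by (cases f; auto simp: Hom_iff)+
  show "(h \<cdot>\<^bsub>Alg\<^esub> g) \<cdot>\<^bsub>Alg\<^esub> f = h \<cdot>\<^bsub>Alg\<^esub> (g \<cdot>\<^bsub>Alg\<^esub> f)" if "f \<in> Hom Alg x y" "g \<in> Hom Alg y z" "h \<in> Hom Alg z w"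
    using that by (cases f; cases g; cases h) (auto simp: Hom_iff)
qed

abbreviation "K \<equiv> comparison_func A G \<epsilon>"

lemma K_simps [simp]: "fo K a = (fo G a, fa G (\<epsilon> a))" "fa K f = (fo K (Dom A f), fa G f, fo K (Cod A f))"
  by (simp_all add: comparison_func_def Let_def)

lemma K_algebra: "a \<in> Ob A \<Longrightarrow> is_algebra B T \<eta> \<mu> (fo K a)"
  using triangle[of a] arg_cong[OF counit_nat[of "\<epsilon> a"], of "fa G"]
  by (auto simp: is_algebra_def Hom_iff)

lemma functor_K: "is_functor A Alg K"
proof (rule functorI[OF A.category_axioms category_alg])
  show "fo K a \<in> Ob Alg" if "a \<in> Ob A" for a using K_algebra[OF that] by simp
  show "fa K f \<in> Hom Alg (fo K (Dom A f)) (fo K (Cod A f))" if "f \<in> Arr A" for f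
    using that K_algebra[of "Dom A f"] K_algebra[of "Cod A f"] arg_cong[OF counit_nat[of f], of "fa G"]
    by (simp add: Hom_iff)
qed simp_all

text \<open>The inverse in \<open>B\<close> is automatically compatible with the algebra structures,
  as one sees by composing the homomorphism equation with it on both sides.\<close>

lemma alg_iso:
  assumes f: "f \<in> Hom Alg x y" and i: "is_iso B (fst (snd f))"
  shows "is_iso Alg f"
proof -
  obtain f' where f': "f = (x, f', y)" using f by (cases f) (auto simp: Hom_iff)
  have al: "is_algebra B T \<eta> \<mu> x" "is_algebra B T \<eta> \<mu> y"
    and [simp]: "f' \<in> Arr B" "Dom B f' = fst x" "Cod B f' = fst y" 
    and ef: "f' \<cdot>\<^bsub>B\<^esub> snd x = snd y \<cdot>\<^bsub>B\<^esub> fa G (fa F f')" and [simp]: "is_iso B f'"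
    using f i unfolding f' by (auto simp: Hom_iff)
  note [simp] = algebraD(1-4)[OF al(1)] algebraD(1-4)[OF al(2)]
  let ?g = "inverse_arr B f'"
  have 1: "fa G (fa F f') \<cdot>\<^bsub>B\<^esub> fa G (fa F ?g) = Idt B (fo G (fo F (fst y)))"
  proof -
    have "fa G (fa F f') \<cdot>\<^bsub>B\<^esub> fa G (fa F ?g) = fa G (fa F (f' \<cdot>\<^bsub>B\<^esub> ?g))" by (simp del: B.cmp_inv)
    then show ?thesis by simp
  qed
  have "?g \<cdot>\<^bsub>B\<^esub> snd y = ?g \<cdot>\<^bsub>B\<^esub> (snd y \<cdot>\<^bsub>B\<^esub> (fa G (fa F f') \<cdot>\<^bsub>B\<^esub> fa G (fa F ?g)))" unfolding 1 by simp
  also have "\<dots> = ?g \<cdot>\<^bsub>B\<^esub> ((f' \<cdot>\<^bsub>B\<^esub> snd x) \<cdot>\<^bsub>B\<^esub> fa G (fa F ?g))" unfolding ef by simp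
  also have "\<dots> = snd x \<cdot>\<^bsub>B\<^esub> fa G (fa F ?g)" by simp
  finally have "(y, ?g, x) \<in> Hom Alg y x" using al by (simp add: Hom_iff)
  then show ?thesis by (intro category.is_isoI[OF category_alg f]) (auto simp: f')
qed

text \<open>The assumptions spell out in \<open>B\<close> that the comparison functor is full,
  faithful and essentially surjective. The isomorphism in \<open>surj\<close> starts at the given
  algebra, the direction in which the unit of a Kan extension points.\<close>

lemma monadicI:
  assumes full: "\<And>a a' f. a \<in> Ob A \<Longrightarrow> a' \<in> Ob A \<Longrightarrow> f \<in> Hom B (fo G a) (fo G a') \<Longrightarrow>
      f \<cdot>\<^bsub>B\<^esub> fa G (\<epsilon> a) = fa G (\<epsilon> a') \<cdot>\<^bsub>B\<^esub> fa G (fa F f) \<Longrightarrow> \<exists>g\<in>Hom A a a'. fa G g = f"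
    and faithful: "\<And>a a' g h. g \<in> Hom A a a' \<Longrightarrow> h \<in> Hom A a a' \<Longrightarrow> fa G g = fa G h \<Longrightarrow> g = h"
    and surj: "\<And>b h. b \<in> Ob B \<Longrightarrow> h \<in> Hom B (fo G (fo F b)) b \<Longrightarrow> h \<cdot>\<^bsub>B\<^esub> \<eta> b = Idt B b \<Longrightarrow>
      h \<cdot>\<^bsub>B\<^esub> \<mu> b = h \<cdot>\<^bsub>B\<^esub> fa G (fa F h) \<Longrightarrow>
      \<exists>a\<in>Ob A. \<exists>f\<in>Hom B b (fo G a). is_iso B f \<and> f \<cdot>\<^bsub>B\<^esub> h = fa G (\<epsilon> a) \<cdot>\<^bsub>B\<^esub> fa G (fa F f)"
  shows "is_monadic A B G"
proof -
  have "is_equivalence A Alg K"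
  proof (rule equivalence_of_fully_faithful[OF functor_K])
    fix a a' f assume a: "a \<in> Ob A" "a' \<in> Ob A" and f: "f \<in> Hom Alg (fo K a) (fo K a')"
    obtain f' where f': "f = (fo K a, f', fo K a')" using f by (cases f) (auto simp: Hom_iff)
    have "f' \<in> Hom B (fo G a) (fo G a')" "f' \<cdot>\<^bsub>B\<^esub> fa G (\<epsilon> a) = fa G (\<epsilon> a') \<cdot>\<^bsub>B\<^esub> fa G (fa F f')"
      using f unfolding f' by (auto simp: Hom_iff)
    then obtain g where "g \<in> Hom A a a'" "fa G g = f'" using full[OF a] by blast
    then show "\<exists>g\<in>Hom A a a'. fa K g = f" by (intro bexI[of _ g]) (auto simp: f' Hom_iff)
  next
    fix a a' g h assume "g \<in> Hom A a a'" "h \<in> Hom A a a'" "fa K g = fa K h"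
    then show "g = h" by (intro faithful) simp_all
  next
    fix y assume "y \<in> Ob Alg"
    then have y: "is_algebra B T \<eta> \<mu> y" by simp
    obtain b h where bh: "y = (b, h)" by (cases y)
    note al = algebraD[OF y, unfolded bh, simplified]
    obtain a f where a: "a \<in> Ob A" and f: "f \<in> Hom B b (fo G a)" and i: "is_iso B f"
      and e: "f \<cdot>\<^bsub>B\<^esub> h = fa G (\<epsilon> a) \<cdot>\<^bsub>B\<^esub> fa G (fa F f)"
      using surj[of b h] al by (auto simp: Hom_iff)
    have g: "(y, f, fo K a) \<in> Hom Alg y (fo K a)" using y f e K_algebra[OF a] by (simp add: Hom_iff bh)
    have gi: "is_iso Alg (y, f, fo K a)" by (rule alg_iso[OF g]) (simp add: i)
    interpret Alg: category Alg by (rule category_alg)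
    have "inverse_arr Alg (y, f, fo K a) \<in> Hom Alg (fo K a) y"
      using Alg.inv_arr[OF gi] Alg.dom_inv[OF gi] Alg.cod_inv[OF gi] by (simp add: Hom_iff del: K_simps)
    then show "\<exists>a\<in>Ob A. \<exists>t\<in>Hom Alg (fo K a) y. is_iso Alg t" using a Alg.inv_iso[OF gi] by blast
  qed
  then show ?thesis unfolding is_monadic_def using functors(2) adj by blast
qed

end

section \<open>Categories of families\<close>

lemma restrict_eq_iff: "restrict h S = a \<longleftrightarrow> a \<in> extensional S \<and> (\<forall>s\<in>S. h s = a s)"
  by (auto simp: fun_eq_iff extensional_def restrict_def)

lemma family_hom: "f \<in> Hom (family_cat S C) a b \<longleftrightarrow>
    f \<in> extensional S \<and> a \<in> extensional S \<and> b \<in> extensional S \<and> (\<forall>s\<in>S. f s \<in> Hom C (a s) (b s))"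
  by (auto simp: Hom_iff family_cat_def PiE_iff restrict_eq_iff)

lemma family_simps [simp]: "Idt (family_cat S C) a = (\<lambda>s\<in>S. Idt C (a s))"
  "g \<cdot>\<^bsub>family_cat S C\<^esub> f = (\<lambda>s\<in>S. g s \<cdot>\<^bsub>C\<^esub> f s)" "a \<in> Ob (family_cat S C) \<longleftrightarrow> a \<in> S \<rightarrow>\<^sub>E Ob C"
  by (simp_all add: family_cat_def)

lemma category_family:
  assumes "category C"
  shows "category (family_cat S C)"
proof -
  interpret C: category C by (rule assms)
  show ?thesis
  proof
    fix f g h a b c d
    show "Dom (family_cat S C) f \<in> Ob (family_cat S C)" "Cod (family_cat S C) f \<in> Ob (family_cat S C)"
      if "f \<in> Arr (family_cat S C)"
      using that by (auto simp: PiE_iff family_cat_def)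
    show "Idt (family_cat S C) a \<in> Hom (family_cat S C) a a" if "a \<in> Ob (family_cat S C)"
      using that by (auto simp: family_hom PiE_iff C.idt_hom)
    show "g \<cdot>\<^bsub>family_cat S C\<^esub> f \<in> Hom (family_cat S C) a c"
      if "f \<in> Hom (family_cat S C) a b" "g \<in> Hom (family_cat S C) b c"
      using that by (auto simp: family_hom intro: C.cmp_hom)
    show "Idt (family_cat S C) b \<cdot>\<^bsub>family_cat S C\<^esub> f = f" "f \<cdot>\<^bsub>family_cat S C\<^esub> Idt (family_cat S C) a = f"
      if "f \<in> Hom (family_cat S C) a b"
      using that by (auto simp: family_hom restrict_eq_iff C.idt_left C.idt_right)
    show "(h \<cdot>\<^bsub>family_cat S C\<^esub> g) \<cdot>\<^bsub>family_cat S C\<^esub> f = h \<cdot>\<^bsub>family_cat S C\<^esub> (g \<cdot>\<^bsub>family_cat S C\<^esub> f)"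
      if "f \<in> Hom (family_cat S C) a b" "g \<in> Hom (family_cat S C) b c" "h \<in> Hom (family_cat S C) c d"
      using that by (auto simp: family_hom intro!: restrict_ext C.cmp_assoc)
  qed
qed

section \<open>Discrete enriched categories\<close>

text \<open>
  Distinct objects of a discrete enriched category have an initial object \<open>z\<close> as hom object; the
  choices made by \<open>SOME\<close> below are of arrows out of an initial object, hence unique.
\<close>

context symmetric_monoidal_closed
begin

definition initial :: "'o \<Rightarrow> bool" where
  "initial z \<longleftrightarrow> z \<in> Ob V \<and> (\<forall>w\<in>Ob V. \<exists>!f. f \<in> Hom V z w)"

lemma initial_ob: "initial z \<Longrightarrow> z \<in> Ob V"
  by (simp add: initial_def)

lemma initial_ex: "initial z \<Longrightarrow> w \<in> Ob V \<Longrightarrow> \<exists>f. f \<in> Hom V z w"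
  by (auto simp: initial_def)

lemma initial_eq: "initial z \<Longrightarrow> f \<in> Arr V \<Longrightarrow> g \<in> Arr V \<Longrightarrow> Dom V f = z \<Longrightarrow> Dom V g = z \<Longrightarrow> Cod V f = Cod V g \<Longrightarrow> f = g"
proof -
  assume a: "initial z" "f \<in> Arr V" "g \<in> Arr V" "Dom V f = z" "Dom V g = z" "Cod V f = Cod V g"
  then have "\<exists>!h. h \<in> Hom V z (Cod V g)" using cod_ob'[OF a(3)] unfolding initial_def by blast
  moreover have "f \<in> Hom V z (Cod V g)" "g \<in> Hom V z (Cod V g)" using a by (auto simp: Hom_iff)
  ultimately show "f = g" by blast
qed

text \<open>The functor \<open>- \<otimes> x\<close> has a right adjoint, hence preserves initial
  objects.\<close>

lemma initial_tens_left:
  assumes z: "initial z" and [simp]: "x \<in> Ob V"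
  shows "initial (z \<otimes> x)"
  unfolding initial_def
proof (intro conjI ballI)
  note [simp] = initial_ob[OF z]
  show "z \<otimes> x \<in> Ob V" by simp
  fix w assume [simp]: "w \<in> Ob V"
  obtain f where f: "f \<in> Hom V z (ihom V x w)" using initial_ex[OF z, of "ihom V x w"] by auto
  show "\<exists>!f. f \<in> Hom V (z \<otimes> x) w"
  proof (rule ex1I)
    show "unc x w f \<in> Hom V (z \<otimes> x) w" using f by (auto simp: Hom_iff)
    fix g assume g: "g \<in> Hom V (z \<otimes> x) w"
    then have "curry_arr V z x w g = f" using f by (intro initial_eq[OF z]) (auto simp: Hom_iff)
    then show "g = unc x w f" using unc_curry[of z x w g] g by (auto simp: Hom_iff)
  qed
qed

lemma initial_tens_right:
  assumes z: "initial z" and x [simp]: "x \<in> Ob V"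
  shows "initial (x \<otimes> z)"
  unfolding initial_def
proof (intro conjI ballI)
  note [simp] = initial_ob[OF z]
  note i = initial_tens_left[OF z x]
  show "x \<otimes> z \<in> Ob V" by simp
  fix w assume "w \<in> Ob V"
  then obtain f where f: "f \<in> Hom V (z \<otimes> x) w" using initial_ex[OF i] by blast
  show "\<exists>!f. f \<in> Hom V (x \<otimes> z) w"
  proof (rule ex1I)
    show "f \<cdot> symm V x z \<in> Hom V (x \<otimes> z) w" using f by (auto simp: Hom_iff)
    fix g assume g: "g \<in> Hom V (x \<otimes> z) w"
    then have "g \<cdot> symm V z x = f" using f by (intro initial_eq[OF i]) (auto simp: Hom_iff)
    then have "(g \<cdot> symm V z x) \<cdot> symm V x z = f \<cdot> symm V x z" by simp
    then show "g = f \<cdot> symm V x z" using g by (auto simp: Hom_iff symm_symm)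
  qed
qed

lemma initial_exists:
  fixes U :: "'u set"
  assumes U: "infinite U" and col: "has_small_colimits U V"
  shows "\<exists>z. initial z"
proof -
  \<comment> \<open>An initial object is a colimit of the empty diagram; the empty shape is small
    because \<open>U\<close> is infinite.\<close>
  let ?S = "\<lparr>Ob = {}, Arr = {}, Dom = \<lambda>_. undefined, Cod = \<lambda>_. undefined, Idt = \<lambda>_. undefined, Cmp = \<lambda>_ _. undefined\<rparr> :: ('u, 'u) cat"
  let ?D = "\<lparr>fo = \<lambda>_. undefined, fa = \<lambda>_. undefined\<rparr> :: ('u, 'u, 'o, 'm) func"
  have "category ?S" by unfold_locales (auto simp: Hom_def)
  then have "is_functor ?S V ?D" using category_axioms by (simp add: is_functor_def)
  moreover have "small U ({} :: 'u set)" using U by (auto simp: small_def lesspoll_def dest: eqpoll_finite_iff)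
  ultimately obtain l p where "is_colimit ?S V ?D l p" using col unfolding has_small_colimits_def by fastforce
  then have "initial l" by (auto simp: is_colimit_def is_cocone_def initial_def)
  then show ?thesis ..
qed

definition disc :: "'s set \<Rightarrow> 'o \<Rightarrow> ('s, 'o, 'm) vcat" where
  "disc S z = (let h = (\<lambda>a b. if a = b then \<I> else z) in
    \<lparr>VOb = S, VHom = h,
     VCmp = (\<lambda>a b c. if a = b \<and> b = c then lunit V \<I> else (SOME f. f \<in> Hom V (h b c \<otimes> h a b) (h a c))),
     VIdt = (\<lambda>a. \<iota> \<I>)\<rparr>)"

definition disc_fun :: "'o \<Rightarrow> ('c, 'o, 'm) vcat \<Rightarrow> ('s \<Rightarrow> 'c) \<Rightarrow> ('s, 'c, 'm) vfun" where
  "disc_fun z C h = \<lparr>vfo = h, vfa = (\<lambda>a b. if a = b then VIdt C (h a) else (SOME f. f \<in> Hom V z (VHom C (h a) (h b))))\<rparr>"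

lemma disc_simps [simp]: "VOb (disc S z) = S" "VHom (disc S z) a b = (if a = b then \<I> else z)" "VIdt (disc S z) a = \<iota> \<I>"
  "VCmp (disc S z) a a a = lunit V \<I>"
  by (simp_all add: disc_def)

text \<open>Unless all objects involved coincide, both sides of an axiom start from an initial
  object, since tensoring preserves initial objects. On the diagonal the axioms are those of the
  monoid \<open>\<I>\<close>, which rest on \<open>runit_unit\<close>.\<close>

lemma vcategory_disc:
  assumes z: "initial z"
  shows "vcategory V (disc S z)"
proof -
  note [simp] = initial_ob[OF z]
  note i = initial_tens_left initial_tens_right z
  let ?h = "VHom (disc S z)" and ?m = "VCmp (disc S z)"
  have "?m a b c \<in> Hom V (?h b c \<otimes> ?h a b) (?h a c)" for a b c
  proof (cases "a = b \<and> b = c")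
    case True then show ?thesis by (auto simp: Hom_iff)
  next
    case False
    then have "initial (?h b c \<otimes> ?h a b)" using i by auto
    from someI_ex[OF initial_ex[OF this, of "?h a c"]] show ?thesis using False by (auto simp: disc_def Let_def)
  qed
  then have m: "?m a b c \<in> Arr V" "Dom V (?m a b c) = ?h b c \<otimes> ?h a b" "Cod V (?m a b c) = ?h a c" for a b c
    by (auto simp only: Hom_iff)
  have h [simp]: "?h a b \<in> Ob V" for a b by simp
  note ds = disc_simps(2)
  show ?thesis
  proof (intro vcategory.intro vcategory_axioms.intro, rule symmetric_monoidal_closed_axioms)
    fix a b c d
    show "?h a b \<in> Ob V" by (rule h)
    show "?m a b c \<in> Hom V (?h b c \<otimes> ?h a b) (?h a c)" by (simp only: Hom_iff m)
    show "VIdt (disc S z) a \<in> Hom V \<I> (?h a a)" by (simp add: Hom_iff)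
    show "?m a b d \<cdot> (?m b c d \<odot> \<iota> (?h a b)) = ?m a c d \<cdot> (\<iota> (?h c d) \<odot> ?m a b c) \<cdot> assc V (?h c d) (?h b c) (?h a b)"
    proof (cases "a = b \<and> b = c \<and> c = d")
      case True then show ?thesis using triangle[of \<I> \<I>] by (simp add: runit_unit)
    next
      case False
      then have "initial ((?h c d \<otimes> ?h b c) \<otimes> ?h a b)" using i by auto
      then show ?thesis by (rule initial_eq) (simp_all add: m del: ds)
    qed
    show "?m a b b \<cdot> (VIdt (disc S z) b \<odot> \<iota> (?h a b)) = lunit V (?h a b)"
    proof (cases "a = b")
      case False
      then have "initial (\<I> \<otimes> ?h a b)" using i by auto
      then show ?thesis by (rule initial_eq) (use False in \<open>auto simp: m\<close>)
    qed simp
    show "?m a a b \<cdot> (\<iota> (?h a b) \<odot> VIdt (disc S z) a) = runit V (?h a b)"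
    proof (cases "a = b")
      case False
      then have "initial (?h a b \<otimes> \<I>)" using i by auto
      then show ?thesis by (rule initial_eq) (use False in \<open>auto simp: m\<close>)
    qed (simp add: runit_unit)
  qed
qed

lemma is_vfunctor_disc:
  assumes z: "initial z" and C: "vcategory V C" and h: "\<And>s. s \<in> S \<Longrightarrow> h s \<in> VOb C"
  shows "is_vfunctor V (disc S z) C (disc_fun z C h)"
proof -
  note [simp] = initial_ob[OF z] h vcat_simps[OF C]
  note m = vcat_simps[OF vcategory_disc[OF z, of S]]
  let ?F = "disc_fun z C h" and ?h = "VHom (disc S z)"
  have o [simp]: "vfo ?F a = h a" for a by (simp add: disc_fun_def)
  have "vfa ?F a b \<in> Hom V (?h a b) (VHom C (h a) (h b))" if [simp]: "a \<in> S" "b \<in> S" for a b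
    using someI_ex[OF initial_ex[OF z, of "VHom C (h a) (h b)"]] by (auto simp: disc_fun_def Hom_iff)
  then have F: "vfa ?F a b \<in> Arr V" "Dom V (vfa ?F a b) = ?h a b" "Cod V (vfa ?F a b) = VHom C (h a) (h b)"
    if "a \<in> S" "b \<in> S" for a b
    using that by (auto simp only: Hom_iff)
  have "vfa ?F a c \<cdot> VCmp (disc S z) a b c = VCmp C (h a) (h b) (h c) \<cdot> (vfa ?F b c \<odot> vfa ?F a b)"
    if [simp]: "a \<in> S" "b \<in> S" "c \<in> S" for a b c
  proof (cases "a = b \<and> b = c")
    case True
    have "VCmp C (h a) (h a) (h a) \<cdot> (VIdt C (h a) \<odot> VIdt C (h a)) =
       (VCmp C (h a) (h a) (h a) \<cdot> (VIdt C (h a) \<odot> \<iota> (VHom C (h a) (h a)))) \<cdot> (\<iota> \<I> \<odot> VIdt C (h a))" by simp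
    also have "\<dots> = VIdt C (h a) \<cdot> lunit V \<I>" by (subst vcategory.vidt_left[OF C]) (simp_all add: lunit_nat)
    finally show ?thesis using True by (auto simp: disc_fun_def)
  next
    case False
    then have "initial (?h b c \<otimes> ?h a b)" using initial_tens_left initial_tens_right z by auto
    then show ?thesis by (rule initial_eq) (simp_all add: m F del: disc_simps(2))
  qed
  then show ?thesis using F C vcategory_disc[OF z, of S]
    by (auto simp: is_vfunctor_def Hom_iff disc_fun_def)
qed

lemma GHom_el:
  assumes "p \<in> GHom E a b"
  shows "el p \<in> Arr V" "Dom V (el p) = \<T> (grd p)" "Cod V (el p) = VHom E a b"
  using assms by (auto elim!: GHom_E)

text \<open>Over a discrete category naturality holds automatically: at the universal element of an
  off-diagonal hom both sides start from an initial object, and on the diagonal the condition says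
  that identities act trivially.\<close>

lemma graded_family_disc:
  assumes z: "initial z" and i: "is_vfunctor V (disc S z) C i" and D: "is_vfunctor V (disc S z) E D" and ts: "set ts \<subseteq> Ob V"
    and A: "\<And>b. b \<in> S \<Longrightarrow> oper C (vfo i b) c E (vfo D b) x ts [] (A b)"
  shows "graded_family (disc S z) C i c E D x ts A"
proof (rule graded_familyI[OF ts])
  note B = vfun_cat(1)[OF i] and C = vfun_cat(2)[OF i] and E = vfun_cat(2)[OF D]
  note [simp] = vfun_simps[OF i] vfun_simps[OF D] initial_ob[OF z]
  show "\<And>b. b \<in> VOb (disc S z) \<Longrightarrow> oper C (vfo i b) c E (vfo D b) x ts [] (A b)" using A by simp
  fix b b' p q assume p: "p \<in> GHom C (vfo i b) c" and q: "q \<in> GHom (disc S z) b' b"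
  have [simp]: "b \<in> S" "b' \<in> S" using GHom_ob[OF q] by auto
  have Ap: "A b p \<in> GHom E (vfo D b) x" "grd (A b p) = ts @ grd p" using operD(3,4)[OF A p] by auto
  have op: "oper (disc S z) b' b E (vfo D b') x (ts @ grd p) [] (\<lambda>q. A b' (p \<star>\<^bsub>C\<^esub> gf i q))"
    by (rule oper_comp[OF oper_comp[OF oper_gf[OF i] oper_lcmp[OF C p]] A]) simp_all
  have op': "oper (disc S z) b' b E (vfo D b') x (ts @ grd p) [] (\<lambda>q. A b p \<star>\<^bsub>E\<^esub> gf D q)"
    by (rule oper_comp[OF oper_gf[OF D] oper_lcmp[OF E Ap(1)]]) (simp_all add: Ap)
  have "A b' (p \<star>\<^bsub>C\<^esub> gf i (univ (disc S z) b' b)) = A b p \<star>\<^bsub>E\<^esub> gf D (univ (disc S z) b' b)" (is "?l = ?r")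
  proof (cases "b = b'")
    case True
    let ?u = "runit V \<I>"
    have u: "?u \<in> Hom V (\<T> [\<I>]) (\<T> [])" by (simp add: Hom_iff)
    \<comment> \<open>On the diagonal the universal element is an identity restricted along the
      unitor, so both sides become restrictions of \<open>A b p\<close>.\<close>
    have un: "univ (disc S z) b b = reix [\<I>] ?u (gid (disc S z) b)" by (simp add: univ_def)
    have b: "b \<in> VOb (disc S z)" by simp
    have ib: "vfo i b \<in> VOb C" and Db: "vfo D b \<in> VOb E" by auto
    have r: "gf F (reix [\<I>] ?u (gid (disc S z) b)) = reix [\<I>] ?u (gid E' (vfo F b))"
      if F: "is_vfunctor V (disc S z) E' F" for E' :: "('x, 'o, 'm) vcat" and F
      using vfun_idt[OF F, of b] vfun_simps[OF F, of b] by (simp add: univ_def)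
    have l: "lwhisker (grd p) ?u \<in> Hom V (\<T> (grd p @ [\<I>])) (\<T> (grd p))" using lwhisker_hom[OF u grd_ob[OF p]] by simp
    have P: "p \<star>\<^bsub>C\<^esub> reix [\<I>] ?u (gid C (vfo i b)) = reix (grd p @ [\<I>]) (lwhisker (grd p) ?u) p"
      using cmp_reix[OF C gid_hom[OF C ib] p _ , of "[\<I>]" ?u] u gid_right[OF C p] by (simp del: gr_simps)
    have "?l = A b (reix (grd p @ [\<I>]) (lwhisker (grd p) ?u) p)"
      unfolding True[symmetric] un r[OF i] P ..
    also have "\<dots> = reix (ts @ grd p @ [\<I>]) (lwhisker ts (lwhisker (grd p) ?u)) (A b p)"
      using operD(5)[OF A p _ l] grd_ob[OF p] rwhisker_Nil[OF l] by simp
    also have "\<dots> = ?r"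
      unfolding True[symmetric] un r[OF D]
      using cmp_reix[OF E gid_hom[OF E Db] Ap(1) _ , of "[\<I>]" ?u] u gid_right[OF E Ap(1)] Ap(2)
      by (simp add: lwhisker_append del: gr_simps)
    finally show ?thesis .
  next
    case False
    have uq: "univ (disc S z) b' b \<in> GHom (disc S z) b' b" by (rule univ_hom[OF B]) auto
    let ?T = "ts @ grd p"
    have T: "set ?T \<subseteq> Ob V" using ts grd_ob[OF p] by simp
    have in_: "initial (\<T> ?T \<otimes> (z \<otimes> \<I>))"
      using T by (intro initial_tens_right initial_tens_left z) auto
    have l: "?l \<in> GHom E (vfo D b') x" "grd ?l = ?T @ [z]" using operD(3,4)[OF op uq] False by auto
    have r: "?r \<in> GHom E (vfo D b') x" "grd ?r = ?T @ [z]" using operD(3,4)[OF op' uq] False by auto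
    show ?thesis
    proof (rule GHom_eqI[OF l(1) r(1)])
      show "grd ?l = grd ?r" using l r by simp
      have ps: "is_iso V (psi ?T [z])" "psi ?T [z] \<in> Arr V" "Dom V (psi ?T [z]) = \<T> (?T @ [z])" "Cod V (psi ?T [z]) = \<T> ?T \<otimes> (z \<otimes> \<I>)"
        using T by auto
      note L = GHom_el[OF l(1), unfolded l(2)] and R = GHom_el[OF r(1), unfolded r(2)]
      have "el ?l \<cdot> invV (psi ?T [z]) = el ?r \<cdot> invV (psi ?T [z])"
        by (rule initial_eq[OF in_]) (use L R ps in simp_all)
      then show "el ?l = el ?r" by (rule iso_epi[rotated -1]) (use L R ps in simp_all)
    qed
  qed
  then show "A b' (p \<star>\<^bsub>C\<^esub> gf i q) = A b p \<star>\<^bsub>E\<^esub> gf D q"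
    by (rule oper_eqI[OF B op op' _ q])
qed

end

section \<open>Ary endofunctors\<close>

locale eleutheric_arities = symmetric_monoidal_closed V for V :: "('o, 'm) smcc" (structure) +
  fixes U :: "'u set" and C :: "('c, 'o, 'm) vcat" and J :: "('j, 'o, 'm) vcat" and j :: "('j, 'c, 'm) vfun"
  assumes infinite_U: "infinite U" and colimits: "has_small_colimits U V" and cocomplete: "cocomplete U V C"
    and arity_subcategory: "subcategory_of_arities V J C j" and small_J: "small U (VOb J)" and eleutheric: "eleutheric V J C j"
begin

lemma j: "is_vfunctor V J C j" and ff: "fully_faithful V J j" and dense: "is_dense V J C j"
  using arity_subcategory by (auto simp: subcategory_of_arities_def)

lemmas C = vfun_cat(2)[OF j] and J = vfun_cat(1)[OF j]

lemma jo: "k \<in> VOb J \<Longrightarrow> vfo j k \<in> VOb C"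
  by (rule vfun_simps(1)[OF j])

lemma rep_preserves:
  assumes k: "k \<in> VOb J" and D: "is_vfunctor V J C D" and G: "gcolim J C j z C D l K" and z: "z \<in> VOb C"
  shows "gcolim J C j z (self_vcat V) (comp_vfun V (rep_vfun V C (vfo j k)) D) (VHom C (vfo j k) l) (\<lambda>b p. gf (rep_vfun V C (vfo j k)) (K b p))"
proof -
  have "preserves_wcolimits V (arity_weights V J C j) C (self_vcat V) (rep_vfun V C (vfo j k))"
    using eleutheric k by (simp add: eleutheric_def)
  then show ?thesis
    using preserves_iff_gcolim[OF j is_vfunctor_rep[OF C jo[OF k]]] D G z by simp
qed

text \<open>The values of \<open>i\<close> are arities, so eleuthericity supplies the preservation
  by representables that the interchange of colimits requires.\<close>

lemma aryI:
  assumes P: "pointwise_lan B C i D H e" and ext: "vfo H \<in> extensional (VOb C)" "case_prod (vfa H) \<in> extensional (VOb C \<times> VOb C)"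
    and i: "\<And>b. b \<in> VOb B \<Longrightarrow> \<exists>k\<in>VOb J. vfo i b = vfo j k"
  shows "H \<in> ary_endofunctors V J C j"
proof -
  have "preserves_wcolimits V (arity_weights V J C j) C C H"
    unfolding preserves_iff_gcolim[OF j pointwise_lanD(3)[OF P]]
  proof (intro ballI allI impI)
    fix z E l K assume z: "z \<in> VOb C" and E: "is_vfunctor V J C E" and G: "gcolim J C j z C E l K"
    show "gcolim J C j z C (comp_vfun V H E) (vfo H l) (\<lambda>b p. gf H (K b p))"
    proof (rule pointwise_lan_preserves[OF P j E G])
      fix b assume "b \<in> VOb B"
      then obtain k where "k \<in> VOb J" "vfo i b = vfo j k" using i by blast
      then show "gcolim J C j z (self_vcat V) (comp_vfun V (rep_vfun V C (vfo i b)) E) (VHom C (vfo i b) l)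
         (\<lambda>k p. gf (rep_vfun V C (vfo i b)) (K k p))"
        using rep_preserves[OF _ E G z] by simp
    qed
  qed
  then show ?thesis using pointwise_lanD(3)[OF P] ext by (simp add: ary_endofunctors_def is_ary_def)
qed

lemma ary_functor: "H \<in> ary_endofunctors V J C j \<Longrightarrow> is_vfunctor V C C H"
  by (simp add: ary_endofunctors_def is_ary_def)

text \<open>\<open>H\<close> preserves the presentation of \<open>c\<close> given by
  \<open>dense_gcolim\<close>. As the unit of that presentation is trivial, the unit of the Kan
  extension consists of identities.\<close>

lemma ary_pointwise_lan:
  assumes H: "H \<in> ary_endofunctors V J C j"
  shows "pointwise_lan J C j (comp_vfun V H j) H (\<lambda>k. gid C (vfo H (vfo j k)))"
  unfolding pointwise_lan_def
proof (intro conjI ballI)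
  note HF = ary_functor[OF H]
  show "is_vfunctor V J C j" by (rule j)
  show "is_vfunctor V J C (comp_vfun V H j)" by (rule is_vfunctor_comp[OF j HF])
  show "is_vfunctor V C C H" by (rule HF)
  show "gid C (vfo H (vfo j k)) \<in> GHom C (vfo (comp_vfun V H j) k) (vfo H (vfo j k))" if "k \<in> VOb J" for k
    using gid_hom[OF C vfun_simps(1)[OF HF jo[OF that]]] by simp
  show "grd (gid C (vfo H (vfo j k))) = []" for k by simp
  fix c assume c: "c \<in> VOb C"
  have "preserves_wcolimits V (arity_weights V J C j) C C H" using H by (simp add: ary_endofunctors_def is_ary_def)
  then have "gcolim J C j c C (comp_vfun V H j) (vfo H c) (\<lambda>b p. gf H p)"
    using preserves_iff_gcolim[OF j HF] c j dense_gcolim[OF j dense c] by blast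
  then show "gcolim J C j c C (comp_vfun V H j) (vfo H c) (\<lambda>b p. gf H p \<star>\<^bsub>C\<^esub> gid C (vfo H (vfo j b)))"
    by (rule gcolim_cong[OF _ _ j]) (rule gid_right[OF C gf_hom[OF HF]])
qed

lemma lan_ex:
  assumes D: "is_vfunctor V J C D"
  obtains H e where "pointwise_lan J C j D H e" "H \<in> ary_endofunctors V J C j"
proof -
  have "\<exists>l K. gcolim J C j c C D l K" if "c \<in> VOb C" for c
    by (rule gcolim_has[OF _ _ j that D, of "arity_weights V J C j"])
      (use eleutheric that in \<open>auto simp: eleutheric_def arity_weights_def\<close>)
  then obtain H e where P: "pointwise_lan J C j D H e" and ext: "vfo H \<in> extensional (VOb C)" "case_prod (vfa H) \<in> extensional (VOb C \<times> VOb C)"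
    using pointwise_lan_ex[OF j D] by blast
  show thesis by (rule that[OF P aryI[OF P ext]]) auto
qed

text \<open>
  The last clause is the pointwise part of the universal property: it concerns arrows of arbitrary grade out
  of each single value of \<open>H\<close>, not transformations out of \<open>H\<close>.
\<close>

definition is_free :: "('j \<Rightarrow> 'c) \<Rightarrow> ('c, 'c, 'm) vfun \<Rightarrow> ('j \<Rightarrow> 'c \<times> 'o list \<times> 'm \<times> 'c) \<Rightarrow> bool" where
  "is_free X H \<eta> \<longleftrightarrow> H \<in> ary_endofunctors V J C j \<and>
     (\<forall>k\<in>VOb J. \<eta> k \<in> GHom C (X k) (vfo H (vfo j k)) \<and> grd (\<eta> k) = []) \<and>
     (\<forall>G g. is_vfunctor V C C G \<longrightarrow> (\<forall>k\<in>VOb J. g k \<in> GHom C (X k) (vfo G (vfo j k)) \<and> grd (g k) = []) \<longrightarrow>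
        (\<exists>\<beta>. is_vnat_trans V C C H G \<beta> \<and> \<beta> \<in> extensional (VOb C) \<and> (\<forall>k\<in>VOb J. tr H \<beta> G (vfo j k) \<star>\<^bsub>C\<^esub> \<eta> k = g k))) \<and>
     (\<forall>G \<alpha> \<beta>. is_vnat_trans V C C H G \<alpha> \<longrightarrow> is_vnat_trans V C C H G \<beta> \<longrightarrow>
        (\<forall>k\<in>VOb J. tr H \<alpha> G (vfo j k) \<star>\<^bsub>C\<^esub> \<eta> k = tr H \<beta> G (vfo j k) \<star>\<^bsub>C\<^esub> \<eta> k) \<longrightarrow> (\<forall>c\<in>VOb C. \<alpha> c = \<beta> c)) \<and>
     (\<forall>c x u v. u \<in> GHom C (vfo H c) x \<longrightarrow> v \<in> GHom C (vfo H c) x \<longrightarrow> c \<in> VOb C \<longrightarrow> grd u = grd v \<longrightarrow>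
        (\<forall>k\<in>VOb J. \<forall>p\<in>GHom C (vfo j k) c. u \<star>\<^bsub>C\<^esub> (gf H p \<star>\<^bsub>C\<^esub> \<eta> k) = v \<star>\<^bsub>C\<^esub> (gf H p \<star>\<^bsub>C\<^esub> \<eta> k)) \<longrightarrow> u = v)"

lemma free_ex:
  assumes X: "\<And>k. k \<in> VOb J \<Longrightarrow> X k \<in> VOb C"
  shows "\<exists>H \<eta>. is_free X H \<eta>"
proof -
  obtain z where z: "initial z" using initial_exists[OF infinite_U colimits] by blast
  \<comment> \<open>\<open>cocomplete\<close> speaks of weights whose objects have type
    \<open>'u\<close>, so the objects of \<open>J\<close> are copied into that type along an
    injection; \<open>?g\<close> undoes the copying.\<close>
  obtain f :: "'j \<Rightarrow> 'u" where f: "inj_on f (VOb J)"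
    using small_J unfolding small_def lesspoll_def lepoll_def by blast
  let ?S = "f ` VOb J" and ?g = "inv_into (VOb J) f"
  have g: "?g s \<in> VOb J" if "s \<in> ?S" for s using that by (rule inv_into_into)
  have gf': "?g (f k) = k" if "k \<in> VOb J" for k using inv_into_f_f[OF f that] .
  have fg: "f (?g s) = s" if "s \<in> ?S" for s using that by (rule f_inv_into_f)
  let ?B = "disc ?S z" and ?i = "disc_fun z C (\<lambda>s. vfo j (?g s))" and ?D = "disc_fun z C (\<lambda>s. X (?g s))"
  have i: "is_vfunctor V ?B C ?i" by (rule is_vfunctor_disc[OF z C]) (use g jo in auto)
  have D: "is_vfunctor V ?B C ?D" by (rule is_vfunctor_disc[OF z C]) (use g X in auto)
  have io: "vfo ?i s = vfo j (?g s)" and Do: "vfo ?D s = X (?g s)" for s by (simp_all add: disc_fun_def)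
  have "?S \<prec> U" using small_J f unfolding small_def by (metis inj_on_image_eqpoll_self eq_lesspoll_trans)
  then have "(?B, corep_vfun V C ?i c) \<in> small_weights U V" if "c \<in> VOb C" for c
    using is_vfunctor_corep[OF i that] vfun_cat(1)[OF i] by (simp add: small_weights_def is_weight_def small_def)
  then have "\<exists>l K. gcolim ?B C ?i c C ?D l K" if "c \<in> VOb C" for c
    using gcolim_has[OF _ _ i that D] cocomplete that unfolding cocomplete_def by blast
  then obtain H e where P: "pointwise_lan ?B C ?i ?D H e" and ext: "vfo H \<in> extensional (VOb C)" "case_prod (vfa H) \<in> extensional (VOb C \<times> VOb C)"
    using pointwise_lan_ex[OF i D] by blast
  note HF = pointwise_lanD(3)[OF P]
  have ary: "H \<in> ary_endofunctors V J C j" by (rule aryI[OF P ext]) (use g io in auto)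
  let ?e = "\<lambda>k. e (f k)"
  have ee: "e s = ?e (?g s)" if "s \<in> ?S" for s using fg[OF that] by simp
  have "is_free X H ?e"
    unfolding is_free_def
  proof (intro conjI ballI allI impI)
    show "H \<in> ary_endofunctors V J C j" by (rule ary)
    show "?e k \<in> GHom C (X k) (vfo H (vfo j k))" "grd (?e k) = []" if k: "k \<in> VOb J" for k
      using pointwise_lanD(4,5)[OF P, of "f k"] k gf'[OF k] by (auto simp: io Do)
  next
    fix G h assume G: "is_vfunctor V C C G" and h: "\<forall>k\<in>VOb J. h k \<in> GHom C (X k) (vfo G (vfo j k)) \<and> grd (h k) = []"
    let ?h = "\<lambda>s. h (?g s)"
    have h1: "?h s \<in> GHom C (vfo ?D s) (vfo G (vfo ?i s))" and h2: "grd (?h s) = []" if "s \<in> VOb ?B" for s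
      using h g[of s] that by (auto simp: io Do)
    have fam: "graded_family ?B C ?i c C ?D (vfo G c) [] (\<lambda>b p. gf G p \<star>\<^bsub>C\<^esub> ?h b)" if "c \<in> VOb C" for c
    proof (rule graded_family_disc[OF z i D])
      fix s assume s: "s \<in> ?S"
      then have s': "s \<in> VOb ?B" by simp
      show "oper C (vfo ?i s) c C (vfo ?D s) (vfo G c) [] [] (\<lambda>p. gf G p \<star>\<^bsub>C\<^esub> ?h s)"
        by (rule oper_pre[OF C h1[OF s'] oper_gf[OF G]]) (use h2[OF s'] in simp)
    qed simp
    \<comment> \<open>Naturality over the discrete category is the graded condition of
      \<open>fam\<close> at an identity.\<close>
    have nat: "?h b \<star>\<^bsub>C\<^esub> gf ?D q = gf G (gf ?i q) \<star>\<^bsub>C\<^esub> ?h b'" if q: "q \<in> GHom ?B b' b" for b b' q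
    proof -
      note b = GHom_ob(2)[OF q]
      have ib: "vfo ?i b \<in> VOb C" by (rule vfun_simps(1)[OF i b])
      have "gf G (gid C (vfo ?i b) \<star>\<^bsub>C\<^esub> gf ?i q) \<star>\<^bsub>C\<^esub> ?h b' = (gf G (gid C (vfo ?i b)) \<star>\<^bsub>C\<^esub> ?h b) \<star>\<^bsub>C\<^esub> gf ?D q"
        by (rule graded_familyD(3)[OF fam[OF ib] gid_hom[OF C ib] q])
      then show ?thesis
        using gid_left[OF C gf_hom[OF i q]] gid_left[OF C h1[OF b]] gf_idt[OF G ib] by (simp del: gr_simps tuple_simps)
    qed
    obtain \<beta> where \<beta>: "is_vnat_trans V C C H G \<beta>" "\<beta> \<in> extensional (VOb C)" and
       \<beta>e: "\<And>s. s \<in> VOb ?B \<Longrightarrow> tr H \<beta> G (vfo ?i s) \<star>\<^bsub>C\<^esub> e s = ?h s"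
      using pointwise_lan_extend[OF P G h1 h2 nat] by blast
    show "\<exists>\<beta>. is_vnat_trans V C C H G \<beta> \<and> \<beta> \<in> extensional (VOb C) \<and> (\<forall>k\<in>VOb J. tr H \<beta> G (vfo j k) \<star>\<^bsub>C\<^esub> ?e k = h k)"
    proof (intro exI[of _ \<beta>] conjI \<beta> ballI)
      fix k assume k: "k \<in> VOb J"
      show "tr H \<beta> G (vfo j k) \<star>\<^bsub>C\<^esub> ?e k = h k" using \<beta>e[of "f k"] k gf'[OF k] by (simp add: io del: gr_simps)
    qed
  next
    fix G \<alpha> \<beta> c assume ab: "is_vnat_trans V C C H G \<alpha>" "is_vnat_trans V C C H G \<beta>"
      and eq: "\<forall>k\<in>VOb J. tr H \<alpha> G (vfo j k) \<star>\<^bsub>C\<^esub> ?e k = tr H \<beta> G (vfo j k) \<star>\<^bsub>C\<^esub> ?e k" and c: "c \<in> VOb C"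
    show "\<alpha> c = \<beta> c"
    proof (rule pointwise_lan_extend_unique[OF P ab _ c])
      fix s assume "s \<in> VOb ?B"
      then have s: "s \<in> ?S" by simp
      show "tr H \<alpha> G (vfo ?i s) \<star>\<^bsub>C\<^esub> e s = tr H \<beta> G (vfo ?i s) \<star>\<^bsub>C\<^esub> e s"
        unfolding io ee[OF s] using eq g[OF s] by blast
    qed
  next
    fix c x u v assume uv: "u \<in> GHom C (vfo H c) x" "v \<in> GHom C (vfo H c) x" and c: "c \<in> VOb C" and gr: "grd u = grd v"
      and eq: "\<forall>k\<in>VOb J. \<forall>p\<in>GHom C (vfo j k) c. u \<star>\<^bsub>C\<^esub> (gf H p \<star>\<^bsub>C\<^esub> ?e k) = v \<star>\<^bsub>C\<^esub> (gf H p \<star>\<^bsub>C\<^esub> ?e k)"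
    show "u = v"
    proof (rule gcolim_unique[OF pointwise_lanD(6)[OF P c] D uv gr])
      fix s p assume "s \<in> VOb ?B" and p: "p \<in> GHom C (vfo ?i s) c"
      then have s: "s \<in> ?S" by simp
      have "p \<in> GHom C (vfo j (?g s)) c" using p unfolding io .
      then show "u \<star>\<^bsub>C\<^esub> (gf H p \<star>\<^bsub>C\<^esub> e s) = v \<star>\<^bsub>C\<^esub> (gf H p \<star>\<^bsub>C\<^esub> e s)"
        unfolding ee[OF s] using eq g[OF s] by blast
    qed
  qed
  then show ?thesis by blast
qed

end

section \<open>Underlying ordinary categories in terms of graded arrows\<close>

context symmetric_monoidal_closed
begin

text \<open>Since \<open>\<T> []\<close> is \<open>\<I>\<close>, the arrows of the underlying
  category are the graded arrows of empty grade; \<open>up\<close> and \<open>down\<close> insert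
  and drop the empty list.\<close>

definition up :: "'c \<times> 'm \<times> 'c \<Rightarrow> 'c \<times> 'o list \<times> 'm \<times> 'c" where
  "up f = (fst f, [], snd f)"

definition down :: "'c \<times> 'o list \<times> 'm \<times> 'c \<Rightarrow> 'c \<times> 'm \<times> 'c" where
  "down p = (fst p, snd (snd p))"

lemma up_simp [simp]: "up (a, f, b) = (a, [], f, b)"
  by (simp add: up_def)

lemma up_inject [simp]: "up f = up g \<longleftrightarrow> f = g"
  by (cases f; cases g) simp

lemma grd_up [simp]: "grd (up f) = []"
  by (cases f) simp

lemma up_down: "grd p = [] \<Longrightarrow> up (down p) = p"
  by (cases p) (simp add: down_def)

lemma und_simps [simp]: "Ob (underlying_cat V E) = VOb E" "up (Idt (underlying_cat V E) a) = gid E a"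
  "up (g \<cdot>\<^bsub>underlying_cat V E\<^esub> f) = up g \<star>\<^bsub>E\<^esub> up f"
  by (cases f; cases g; simp add: underlying_cat_def und_cmp_def)+

lemma und_hom: "f \<in> Hom (underlying_cat V E) a b \<longleftrightarrow> up f \<in> GHom E a b"
  by (cases f) (auto simp: underlying_cat_def GHom_iff Hom_def)

lemma category_underlying:
  assumes E: "vcategory V E"
  shows "category (underlying_cat V E)"
proof
  fix f g h a b c d
  show "Dom (underlying_cat V E) f \<in> Ob (underlying_cat V E)" "Cod (underlying_cat V E) f \<in> Ob (underlying_cat V E)"
    if "f \<in> Arr (underlying_cat V E)" using that by (auto simp: underlying_cat_def)
  show "Idt (underlying_cat V E) a \<in> Hom (underlying_cat V E) a a" if "a \<in> Ob (underlying_cat V E)"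
    using gid_hom[OF E] that by (simp add: und_hom)
  show "g \<cdot>\<^bsub>underlying_cat V E\<^esub> f \<in> Hom (underlying_cat V E) a c"
    if "f \<in> Hom (underlying_cat V E) a b" "g \<in> Hom (underlying_cat V E) b c"
    using that gcmp_hom[OF E] by (simp add: und_hom)
  show "Idt (underlying_cat V E) b \<cdot>\<^bsub>underlying_cat V E\<^esub> f = f" "f \<cdot>\<^bsub>underlying_cat V E\<^esub> Idt (underlying_cat V E) a = f"
    if "f \<in> Hom (underlying_cat V E) a b"
    unfolding up_inject[symmetric] und_simps using that gid_left[OF E] gid_right[OF E] by (auto simp only: und_hom)
  show "(h \<cdot>\<^bsub>underlying_cat V E\<^esub> g) \<cdot>\<^bsub>underlying_cat V E\<^esub> f = h \<cdot>\<^bsub>underlying_cat V E\<^esub> (g \<cdot>\<^bsub>underlying_cat V E\<^esub> f)"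
    if "f \<in> Hom (underlying_cat V E) a b" "g \<in> Hom (underlying_cat V E) b c" "h \<in> Hom (underlying_cat V E) c d"
    unfolding up_inject[symmetric] und_simps using that gcmp_assoc[OF E] by (auto simp only: und_hom)
qed

end

section \<open>The categories of endofunctors and of signatures, and the forgetful functor\<close>

context eleutheric_arities
begin

abbreviation "En \<equiv> end_cat V J C j"
abbreviation "Sg \<equiv> sig_cat V J C"
abbreviation "Fg \<equiv> forgetful J j"

lemma sig_simps [simp]: "X \<in> Ob Sg \<longleftrightarrow> X \<in> VOb J \<rightarrow>\<^sub>E VOb C"
  "k \<in> VOb J \<Longrightarrow> up ((\<psi> \<cdot>\<^bsub>Sg\<^esub> \<phi>) k) = up (\<psi> k) \<star>\<^bsub>C\<^esub> up (\<phi> k)"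
  "k \<in> VOb J \<Longrightarrow> up (Idt Sg X k) = gid C (X k)"
  by (simp_all add: sig_cat_def)

lemma sig_hom: "\<phi> \<in> Hom Sg X Y \<longleftrightarrow> \<phi> \<in> extensional (VOb J) \<and> X \<in> extensional (VOb J) \<and> Y \<in> extensional (VOb J) \<and>
    (\<forall>k\<in>VOb J. up (\<phi> k) \<in> GHom C (X k) (Y k))"
  by (simp add: sig_cat_def family_hom und_hom)

lemma category_sig: "category Sg"
  unfolding sig_cat_def by (intro category_family category_underlying C)

lemma sig_eqI: "\<phi> \<in> Hom Sg X Y \<Longrightarrow> \<psi> \<in> Hom Sg X Y \<Longrightarrow> (\<And>k. k \<in> VOb J \<Longrightarrow> up (\<phi> k) = up (\<psi> k)) \<Longrightarrow> \<phi> = \<psi>"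
  unfolding sig_hom up_inject by (blast intro: extensionalityI)

text \<open>Allows equations in \<open>En\<close> to be computed componentwise in
  \<open>gr C\<close>, where composition is strict.\<close>

definition cmpt :: "('c, 'c, 'm) vfun \<times> ('c \<Rightarrow> 'm) \<times> ('c, 'c, 'm) vfun \<Rightarrow> 'c \<Rightarrow> 'c \<times> 'o list \<times> 'm \<times> 'c" where
  "cmpt g c = tr (fst g) (fst (snd g)) (snd (snd g)) c"

lemma cmpt_simp: "cmpt (F, \<alpha>, G) c = tr F \<alpha> G c"
  by (simp add: cmpt_def)

lemma grd_cmpt [simp]: "grd (cmpt g c) = []"
  by (simp add: cmpt_def)

lemma end_ob [simp]: "Ob En = ary_endofunctors V J C j"
  by (simp add: end_cat_def)

lemma end_hom: "g \<in> Hom En F G \<longleftrightarrow> (\<exists>\<alpha>. g = (F, \<alpha>, G) \<and> F \<in> ary_endofunctors V J C j \<and> G \<in> ary_endofunctors V J C j \<and>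
    is_vnat_trans V C C F G \<alpha> \<and> \<alpha> \<in> extensional (VOb C))"
  by (cases g) (auto simp: end_cat_def Hom_iff)

lemma cmpt_hom: "g \<in> Hom En F G \<Longrightarrow> c \<in> VOb C \<Longrightarrow> cmpt g c \<in> GHom C (vfo F c) (vfo G c)"
  using trD(3) by (auto simp only: end_hom cmpt_simp)

lemma cmpt_nat: "g \<in> Hom En F G \<Longrightarrow> p \<in> GHom C c c' \<Longrightarrow> cmpt g c' \<star>\<^bsub>C\<^esub> gf F p = gf G p \<star>\<^bsub>C\<^esub> cmpt g c"
  unfolding end_hom by (elim exE conjE) (simp only: cmpt_simp trD(4))

lemma cmpt_cmp: "c \<in> VOb C \<Longrightarrow> cmpt (h \<cdot>\<^bsub>En\<^esub> g) c = cmpt h c \<star>\<^bsub>C\<^esub> cmpt g c"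
  by (cases h; cases g) (simp add: end_cat_def cmpt_def und_cmp_def)

lemma cmpt_idt: "c \<in> VOb C \<Longrightarrow> cmpt (Idt En F) c = gid C (vfo F c)"
  by (simp add: end_cat_def cmpt_def)

lemma cmpt_eqI: "g \<in> Hom En F G \<Longrightarrow> h \<in> Hom En F G \<Longrightarrow> (\<And>c. c \<in> VOb C \<Longrightarrow> cmpt g c = cmpt h c) \<Longrightarrow> g = h"
  by (auto simp: end_hom cmpt_simp intro: extensionalityI)

lemma end_homI:
  assumes F: "F \<in> ary_endofunctors V J C j" and G: "G \<in> ary_endofunctors V J C j"
    and g: "g = (F, \<alpha>, G)" and \<alpha>: "\<alpha> \<in> extensional (VOb C)"
    and c: "\<And>c. c \<in> VOb C \<Longrightarrow> cmpt g c \<in> GHom C (vfo F c) (vfo G c)"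
    and n: "\<And>c c' p. p \<in> GHom C c c' \<Longrightarrow> cmpt g c' \<star>\<^bsub>C\<^esub> gf F p = gf G p \<star>\<^bsub>C\<^esub> cmpt g c"
  shows "g \<in> Hom En F G"
proof -
  have "is_vnat_trans V C C F G \<alpha>"
    unfolding vnat_trans_iff[OF ary_functor[OF F] ary_functor[OF G]]
    using c n unfolding g cmpt_simp by blast
  then show ?thesis using F G g \<alpha> by (auto simp: end_hom)
qed

lemma category_end: "category En"
proof
  fix f g h a b c d
  show "Dom En f \<in> Ob En" "Cod En f \<in> Ob En" if "f \<in> Arr En" using that by (auto simp: end_cat_def)
  show id: "Idt En a \<in> Hom En a a" if a: "a \<in> Ob En" for a
  proof -
    have A: "a \<in> ary_endofunctors V J C j" using a by simp
    note F = ary_functor[OF A]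
    show ?thesis
    proof (rule end_homI[OF A A])
      show "Idt En a = (a, \<lambda>c\<in>VOb C. VIdt C (vfo a c), a)" by (simp add: end_cat_def)
      show "cmpt (Idt En a) c \<in> GHom C (vfo a c) (vfo a c)" if "c \<in> VOb C" for c
        unfolding cmpt_idt[OF that] by (rule gid_hom[OF C vfun_simps(1)[OF F that]])
      show "cmpt (Idt En a) c' \<star>\<^bsub>C\<^esub> gf a p = gf a p \<star>\<^bsub>C\<^esub> cmpt (Idt En a) c" if p: "p \<in> GHom C c c'" for c c' p
        using gid_left[OF C gf_hom[OF F p]] gid_right[OF C gf_hom[OF F p]] by (simp only: cmpt_idt GHom_ob[OF p])
    qed simp
  qed
  show cm: "g \<cdot>\<^bsub>En\<^esub> f \<in> Hom En a c" if f: "f \<in> Hom En a b" and g: "g \<in> Hom En b c" for f g a b c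
  proof -
    obtain \<alpha> where f': "f = (a, \<alpha>, b)" and ab: "a \<in> ary_endofunctors V J C j" using f by (auto simp: end_hom)
    obtain \<beta> where g': "g = (b, \<beta>, c)" and bc: "c \<in> ary_endofunctors V J C j" "b \<in> ary_endofunctors V J C j" using g by (auto simp: end_hom)
    show ?thesis
    proof (rule end_homI[OF ab bc(1)])
      show "g \<cdot>\<^bsub>En\<^esub> f = (a, \<lambda>x\<in>VOb C. und_cmp V C (vfo a x) (vfo b x) (vfo c x) (\<beta> x) (\<alpha> x), c)"
        by (simp add: f' g' end_cat_def)
      show "cmpt (g \<cdot>\<^bsub>En\<^esub> f) x \<in> GHom C (vfo a x) (vfo c x)" if "x \<in> VOb C" for x
        unfolding cmpt_cmp[OF that] by (rule gcmp_hom[OF C cmpt_hom[OF f that] cmpt_hom[OF g that]])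
      show "cmpt (g \<cdot>\<^bsub>En\<^esub> f) y \<star>\<^bsub>C\<^esub> gf a p = gf c p \<star>\<^bsub>C\<^esub> cmpt (g \<cdot>\<^bsub>En\<^esub> f) x" if p: "p \<in> GHom C x y" for x y p
      proof -
        note x = GHom_ob(1)[OF p] and y = GHom_ob(2)[OF p]
        note ap = gf_hom[OF ary_functor[OF ab] p] and bp = gf_hom[OF ary_functor[OF bc(2)] p] and cp = gf_hom[OF ary_functor[OF bc(1)] p]
        have "(cmpt g y \<star>\<^bsub>C\<^esub> cmpt f y) \<star>\<^bsub>C\<^esub> gf a p = cmpt g y \<star>\<^bsub>C\<^esub> (gf b p \<star>\<^bsub>C\<^esub> cmpt f x)"
          using gcmp_assoc[OF C ap cmpt_hom[OF f y] cmpt_hom[OF g y]] cmpt_nat[OF f p] by simp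
        also have "\<dots> = (gf c p \<star>\<^bsub>C\<^esub> cmpt g x) \<star>\<^bsub>C\<^esub> cmpt f x"
          using gcmp_assoc[OF C cmpt_hom[OF f x] bp cmpt_hom[OF g y]] cmpt_nat[OF g p] by simp
        also have "\<dots> = gf c p \<star>\<^bsub>C\<^esub> (cmpt g x \<star>\<^bsub>C\<^esub> cmpt f x)"
          by (rule gcmp_assoc[OF C cmpt_hom[OF f x] cmpt_hom[OF g x] cp])
        finally show ?thesis by (simp only: cmpt_cmp x y)
      qed
    qed simp
  qed
  show "Idt En b \<cdot>\<^bsub>En\<^esub> f = f" if f: "f \<in> Hom En a b"
  proof (rule cmpt_eqI[OF cm[OF f id] f])
    show "b \<in> Ob En" using f by (auto simp: end_hom)
    show "cmpt (Idt En b \<cdot>\<^bsub>En\<^esub> f) c = cmpt f c" if "c \<in> VOb C" for c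
      unfolding cmpt_cmp[OF that] cmpt_idt[OF that] by (rule gid_left[OF C cmpt_hom[OF f that]])
  qed
  show "f \<cdot>\<^bsub>En\<^esub> Idt En a = f" if f: "f \<in> Hom En a b"
  proof (rule cmpt_eqI[OF cm[OF id f] f])
    show "a \<in> Ob En" using f by (auto simp: end_hom)
    show "cmpt (f \<cdot>\<^bsub>En\<^esub> Idt En a) c = cmpt f c" if "c \<in> VOb C" for c
      unfolding cmpt_cmp[OF that] cmpt_idt[OF that] by (rule gid_right[OF C cmpt_hom[OF f that]])
  qed
  show "(h \<cdot>\<^bsub>En\<^esub> g) \<cdot>\<^bsub>En\<^esub> f = h \<cdot>\<^bsub>En\<^esub> (g \<cdot>\<^bsub>En\<^esub> f)" if f: "f \<in> Hom En a b" and g: "g \<in> Hom En b c" and h: "h \<in> Hom En c d"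
  proof (rule cmpt_eqI[OF cm[OF f cm[OF g h]] cm[OF cm[OF f g] h]])
    show "cmpt ((h \<cdot>\<^bsub>En\<^esub> g) \<cdot>\<^bsub>En\<^esub> f) x = cmpt (h \<cdot>\<^bsub>En\<^esub> (g \<cdot>\<^bsub>En\<^esub> f)) x" if x: "x \<in> VOb C" for x
      unfolding cmpt_cmp[OF x] by (rule gcmp_assoc[OF C cmpt_hom[OF f x] cmpt_hom[OF g x] cmpt_hom[OF h x]])
  qed
qed

lemma Fg_ob: "k \<in> VOb J \<Longrightarrow> fo Fg H k = vfo H (vfo j k)" "fo Fg H \<in> extensional (VOb J)"
  by (simp_all add: forgetful_def)

lemma Fg_arr: "k \<in> VOb J \<Longrightarrow> up (fa Fg g k) = cmpt g (vfo j k)" "fa Fg g \<in> extensional (VOb J)"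
  by (cases g; simp add: forgetful_def cmpt_def)+

lemma Fg_hom: "g \<in> Hom En F G \<Longrightarrow> fa Fg g \<in> Hom Sg (fo Fg F) (fo Fg G)"
  unfolding sig_hom using cmpt_hom jo by (auto simp: Fg_arr Fg_ob)

lemma end_arr: "g \<in> Arr En \<Longrightarrow> g \<in> Hom En (Dom En g) (Cod En g)"
  by (simp add: Hom_iff)

lemma functor_forgetful: "is_functor En Sg Fg"
proof (rule functorI[OF category_end category_sig])
  interpret S: category Sg by (rule category_sig)
  interpret E: category En by (rule category_end)
  show ob: "fo Fg F \<in> Ob Sg" if "F \<in> Ob En" for F
    using that vfun_simps(1)[OF ary_functor] jo by (auto simp: PiE_iff Fg_ob)
  show hom: "fa Fg g \<in> Hom Sg (fo Fg (Dom En g)) (fo Fg (Cod En g))" if "g \<in> Arr En" for g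
    by (rule Fg_hom[OF end_arr[OF that]])
  show "fa Fg (Idt En F) = Idt Sg (fo Fg F)" if F: "F \<in> Ob En" for F
  proof (rule sig_eqI)
    show "fa Fg (Idt En F) \<in> Hom Sg (fo Fg F) (fo Fg F)" by (rule Fg_hom[OF E.idt_hom[OF F]])
    show "Idt Sg (fo Fg F) \<in> Hom Sg (fo Fg F) (fo Fg F)" by (rule S.idt_hom[OF ob[OF F]])
    show "up (fa Fg (Idt En F) k) = up (Idt Sg (fo Fg F) k)" if "k \<in> VOb J" for k
      using that jo[OF that] by (simp add: Fg_arr Fg_ob cmpt_idt)
  qed
  show "fa Fg (g \<cdot>\<^bsub>En\<^esub> f) = fa Fg g \<cdot>\<^bsub>Sg\<^esub> fa Fg f" if f: "f \<in> Arr En" and g: "g \<in> Arr En" and e: "Dom En g = Cod En f" for f g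
  proof (rule sig_eqI)
    have g': "g \<in> Hom En (Cod En f) (Cod En g)" using g e by (simp add: Hom_iff)
    show "fa Fg (g \<cdot>\<^bsub>En\<^esub> f) \<in> Hom Sg (fo Fg (Dom En f)) (fo Fg (Cod En g))"
      by (rule Fg_hom[OF E.cmp_hom[OF end_arr[OF f] g']])
    show "fa Fg g \<cdot>\<^bsub>Sg\<^esub> fa Fg f \<in> Hom Sg (fo Fg (Dom En f)) (fo Fg (Cod En g))"
      by (rule S.cmp_hom[OF Fg_hom[OF end_arr[OF f]] Fg_hom[OF g']])
    show "up (fa Fg (g \<cdot>\<^bsub>En\<^esub> f) k) = up ((fa Fg g \<cdot>\<^bsub>Sg\<^esub> fa Fg f) k)" if "k \<in> VOb J" for k
      using that jo[OF that] by (simp add: Fg_arr cmpt_cmp)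
  qed
qed


section \<open>Monadicity\<close>

lemma freeD:
  assumes "is_free X H \<eta>"
  shows "H \<in> ary_endofunctors V J C j"
    "k \<in> VOb J \<Longrightarrow> \<eta> k \<in> GHom C (X k) (vfo H (vfo j k))" "k \<in> VOb J \<Longrightarrow> grd (\<eta> k) = []"
    "is_vfunctor V C C G \<Longrightarrow> (\<And>k. k\<in>VOb J \<Longrightarrow> g k \<in> GHom C (X k) (vfo G (vfo j k))) \<Longrightarrow> (\<And>k. k\<in>VOb J \<Longrightarrow> grd (g k) = []) \<Longrightarrow>
      \<exists>\<beta>. is_vnat_trans V C C H G \<beta> \<and> \<beta> \<in> extensional (VOb C) \<and> (\<forall>k\<in>VOb J. tr H \<beta> G (vfo j k) \<star>\<^bsub>C\<^esub> \<eta> k = g k)"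
    "is_vnat_trans V C C H G \<alpha> \<Longrightarrow> is_vnat_trans V C C H G \<beta> \<Longrightarrow>
      (\<And>k. k\<in>VOb J \<Longrightarrow> tr H \<alpha> G (vfo j k) \<star>\<^bsub>C\<^esub> \<eta> k = tr H \<beta> G (vfo j k) \<star>\<^bsub>C\<^esub> \<eta> k) \<Longrightarrow> c \<in> VOb C \<Longrightarrow> \<alpha> c = \<beta> c"
    "u \<in> GHom C (vfo H c) x \<Longrightarrow> v \<in> GHom C (vfo H c) x \<Longrightarrow> c \<in> VOb C \<Longrightarrow> grd u = grd v \<Longrightarrow>
      (\<And>k p. k\<in>VOb J \<Longrightarrow> p\<in>GHom C (vfo j k) c \<Longrightarrow> u \<star>\<^bsub>C\<^esub> (gf H p \<star>\<^bsub>C\<^esub> \<eta> k) = v \<star>\<^bsub>C\<^esub> (gf H p \<star>\<^bsub>C\<^esub> \<eta> k)) \<Longrightarrow> u = v"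
proof -
  note * = assms[unfolded is_free_def]
  show "H \<in> ary_endofunctors V J C j" by (rule *[THEN conjunct1])
  show "k \<in> VOb J \<Longrightarrow> \<eta> k \<in> GHom C (X k) (vfo H (vfo j k))" "k \<in> VOb J \<Longrightarrow> grd (\<eta> k) = []"
    using *[THEN conjunct2, THEN conjunct1] by blast+
  show "is_vfunctor V C C G \<Longrightarrow> (\<And>k. k\<in>VOb J \<Longrightarrow> g k \<in> GHom C (X k) (vfo G (vfo j k))) \<Longrightarrow> (\<And>k. k\<in>VOb J \<Longrightarrow> grd (g k) = []) \<Longrightarrow>
      \<exists>\<beta>. is_vnat_trans V C C H G \<beta> \<and> \<beta> \<in> extensional (VOb C) \<and> (\<forall>k\<in>VOb J. tr H \<beta> G (vfo j k) \<star>\<^bsub>C\<^esub> \<eta> k = g k)"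
    by (rule *[THEN conjunct2, THEN conjunct2, THEN conjunct1, THEN spec, THEN spec, THEN mp, THEN mp]) simp_all
  show "is_vnat_trans V C C H G \<alpha> \<Longrightarrow> is_vnat_trans V C C H G \<beta> \<Longrightarrow>
      (\<And>k. k\<in>VOb J \<Longrightarrow> tr H \<alpha> G (vfo j k) \<star>\<^bsub>C\<^esub> \<eta> k = tr H \<beta> G (vfo j k) \<star>\<^bsub>C\<^esub> \<eta> k) \<Longrightarrow> c \<in> VOb C \<Longrightarrow> \<alpha> c = \<beta> c"
    by (rule *[THEN conjunct2, THEN conjunct2, THEN conjunct2, THEN conjunct1, THEN spec, THEN spec, THEN spec, THEN mp, THEN mp, THEN mp, THEN bspec])
      (assumption | rule ballI | simp only:)+
  show "u \<in> GHom C (vfo H c) x \<Longrightarrow> v \<in> GHom C (vfo H c) x \<Longrightarrow> c \<in> VOb C \<Longrightarrow> grd u = grd v \<Longrightarrow>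
      (\<And>k p. k\<in>VOb J \<Longrightarrow> p\<in>GHom C (vfo j k) c \<Longrightarrow> u \<star>\<^bsub>C\<^esub> (gf H p \<star>\<^bsub>C\<^esub> \<eta> k) = v \<star>\<^bsub>C\<^esub> (gf H p \<star>\<^bsub>C\<^esub> \<eta> k)) \<Longrightarrow> u = v"
    by (rule *[THEN conjunct2, THEN conjunct2, THEN conjunct2, THEN conjunct2, THEN spec, THEN spec, THEN spec, THEN spec,
          THEN mp, THEN mp, THEN mp, THEN mp, THEN mp]) (assumption | rule ballI | simp only:)+
qed

theorem monadic_forgetful: "is_monadic En Sg Fg"
proof -
  interpret S: category Sg by (rule category_sig)
  interpret E: category En by (rule category_end)
  interpret GC: category "gr C" by (rule category_gr[OF C])
  have "\<exists>H \<eta>. is_free X H \<eta>" if "X \<in> Ob Sg" for X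
    using that by (intro free_ex) auto
  then obtain L e where free: "\<And>X. X \<in> Ob Sg \<Longrightarrow> is_free X (L X) (e X)" by metis
  have L: "L X \<in> ary_endofunctors V J C j"
    and e: "k \<in> VOb J \<Longrightarrow> e X k \<in> GHom C (X k) (vfo (L X) (vfo j k))" "k \<in> VOb J \<Longrightarrow> grd (e X k) = []"
    if "X \<in> Ob Sg" for X k
    by (rule freeD(1)[OF free[OF that]], rule freeD(2)[OF free[OF that]], assumption, rule freeD(3)[OF free[OF that]], assumption)
  note free_ex = freeD(4)[OF free] and free_uniq = freeD(5)[OF free] and free_sep = freeD(6)[OF free]
  define \<eta> where "\<eta> X = (\<lambda>k\<in>VOb J. down (e X k))" for X
  have up_\<eta>: "up (\<eta> X k) = e X k" if "X \<in> Ob Sg" "k \<in> VOb J" for X k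
    using that e(2) by (simp add: \<eta>_def up_down)
  have \<eta>: "\<eta> X \<in> Hom Sg X (fo Fg (L X))" if X: "X \<in> Ob Sg" for X
    unfolding sig_hom using X e(1)[OF X] up_\<eta>[OF X] by (auto simp: \<eta>_def Fg_ob PiE_iff simp del: sig_simps(1))
      (auto simp: PiE_iff)
  have sig_ob: "X \<in> Ob Sg" "Y \<in> Ob Sg" if "\<phi> \<in> Hom Sg X Y" for \<phi> X Y
    using that S.dom_ob' S.cod_ob' by (auto simp only: Hom_iff)
  \<comment> \<open>An arrow from \<open>X\<close> to the signature of \<open>G\<close> is a family
    as in the third clause of \<open>is_free\<close>; that clause and the next give existence and
    uniqueness of its transpose.\<close>
  have "\<exists>F \<epsilon>. is_adjunction En Sg F Fg \<eta> \<epsilon> \<and> fo F = L"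
  proof (rule adjunction_of_universal_arrows[OF category_end category_sig functor_forgetful _ \<eta>])
    show "L X \<in> Ob En" if "X \<in> Ob Sg" for X using L[OF that] by simp
    fix G X \<phi> assume "G \<in> Ob En" and \<phi>: "\<phi> \<in> Hom Sg X (fo Fg G)"
    then have G: "G \<in> ary_endofunctors V J C j" by simp
    note X = sig_ob(1)[OF \<phi>]
    have p: "up (\<phi> k) \<in> GHom C (X k) (vfo G (vfo j k))" if "k \<in> VOb J" for k
      using \<phi> that by (simp add: sig_hom Fg_ob)
    obtain \<beta> where \<beta>: "is_vnat_trans V C C (L X) G \<beta>" "\<beta> \<in> extensional (VOb C)"
      and \<beta>e: "\<And>k. k\<in>VOb J \<Longrightarrow> tr (L X) \<beta> G (vfo j k) \<star>\<^bsub>C\<^esub> e X k = up (\<phi> k)"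
      using free_ex[OF X ary_functor[OF G] p grd_up] by blast
    show "\<exists>!g. g \<in> Hom En (L X) G \<and> fa Fg g \<cdot>\<^bsub>Sg\<^esub> \<eta> X = \<phi>"
    proof (rule ex1I)
      let ?g = "(L X, \<beta>, G)"
      have g: "?g \<in> Hom En (L X) G" using L[OF X] G \<beta> by (simp add: end_hom)
      have "fa Fg ?g \<cdot>\<^bsub>Sg\<^esub> \<eta> X = \<phi>"
      proof (rule sig_eqI[OF S.cmp_hom[OF \<eta>[OF X] Fg_hom[OF g]] \<phi>])
        show "up ((fa Fg ?g \<cdot>\<^bsub>Sg\<^esub> \<eta> X) k) = up (\<phi> k)" if "k \<in> VOb J" for k
          using \<beta>e[OF that] that by (simp only: sig_simps(2) Fg_arr(1) up_\<eta>[OF X] cmpt_simp)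
      qed
      then show "?g \<in> Hom En (L X) G \<and> fa Fg ?g \<cdot>\<^bsub>Sg\<^esub> \<eta> X = \<phi>" using g by blast
      fix h assume h: "h \<in> Hom En (L X) G \<and> fa Fg h \<cdot>\<^bsub>Sg\<^esub> \<eta> X = \<phi>"
      then obtain \<alpha> where h': "h = (L X, \<alpha>, G)" and \<alpha>: "is_vnat_trans V C C (L X) G \<alpha>" "\<alpha> \<in> extensional (VOb C)"
        by (auto simp: end_hom)
      have "tr (L X) \<alpha> G (vfo j k) \<star>\<^bsub>C\<^esub> e X k = up (\<phi> k)" if k: "k \<in> VOb J" for k
        using sig_simps(2)[OF k, of "fa Fg h" "\<eta> X"] h unfolding Fg_arr(1)[OF k] up_\<eta>[OF X k] by (simp only: h' cmpt_simp)
      then have "\<alpha> c = \<beta> c" if "c \<in> VOb C" for c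
        by (intro free_uniq[OF X \<alpha>(1) \<beta>(1) _ that]) (simp only: \<beta>e)
      then have "\<alpha> = \<beta>" using \<alpha>(2) \<beta>(2) by (blast intro: extensionalityI)
      then show "h = ?g" using h' by simp
    qed
  qed
  then obtain F \<epsilon> where adj: "is_adjunction En Sg F Fg \<eta> \<epsilon>" and FL: "fo F = L" by blast
  interpret M: monad_data En Sg F Fg \<eta> \<epsilon> by unfold_locales (rule adj)
  have \<epsilon>: "\<epsilon> a \<in> Hom En (L (fo Fg a)) a" if "a \<in> Ob En" for a
    using M.counit[OF that] FL by (simp add: Hom_iff)
  have Fhom: "fa F \<phi> \<in> Hom En (L X) (L Y)" if "\<phi> \<in> Hom Sg X Y" for \<phi> X Y
    using that functorD(4-6)[OF M.functors(1), of \<phi>] FL by (simp only: Hom_iff)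
  have FgO: "fo Fg a \<in> Ob Sg" if "a \<in> Ob En" for a
    by (rule functorD(3)[OF M.functors(2) that])
  \<comment> \<open>The triangle identity at one arity. Together with \<open>nat\<close>, which is
    naturality of the adjunction unit at one arity, it carries the calculations below.\<close>
  have tri: "cmpt (\<epsilon> a) (vfo j k) \<star>\<^bsub>C\<^esub> e (fo Fg a) k = gid C (vfo a (vfo j k))" if a: "a \<in> Ob En" and k: "k \<in> VOb J" for a k
  proof -
    have "up ((fa Fg (\<epsilon> a) \<cdot>\<^bsub>Sg\<^esub> \<eta> (fo Fg a)) k) = up (Idt Sg (fo Fg a) k)" using M.triangle[OF a] by (simp only:)
    then show ?thesis using k by (simp only: sig_simps(2,3) Fg_arr(1) up_\<eta>[OF FgO[OF a]] Fg_ob(1))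
  qed
  have nat: "cmpt (fa F \<phi>) (vfo j k) \<star>\<^bsub>C\<^esub> e X k = e Y k \<star>\<^bsub>C\<^esub> up (\<phi> k)" if \<phi>: "\<phi> \<in> Hom Sg X Y" and k: "k \<in> VOb J" for \<phi> X Y k
  proof -
    have "\<eta> Y \<cdot>\<^bsub>Sg\<^esub> \<phi> = fa Fg (fa F \<phi>) \<cdot>\<^bsub>Sg\<^esub> \<eta> X" using M.unit_nat[of \<phi>] \<phi> by (simp only: Hom_iff)
    then have "up ((\<eta> Y \<cdot>\<^bsub>Sg\<^esub> \<phi>) k) = up ((fa Fg (fa F \<phi>) \<cdot>\<^bsub>Sg\<^esub> \<eta> X) k)" by (simp only:)
    then show ?thesis using k by (simp only: sig_simps(2) Fg_arr(1) up_\<eta>[OF sig_ob(1)[OF \<phi>]] up_\<eta>[OF sig_ob(2)[OF \<phi>]])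
  qed
  note arr = Hom_iff[of _ "gr C"]
  show ?thesis
  proof (rule M.monadicI)
    fix a a' \<phi> assume a: "a \<in> Ob En" and a': "a' \<in> Ob En" and \<phi>: "\<phi> \<in> Hom Sg (fo Fg a) (fo Fg a')"
      and eq: "\<phi> \<cdot>\<^bsub>Sg\<^esub> fa Fg (\<epsilon> a) = fa Fg (\<epsilon> a') \<cdot>\<^bsub>Sg\<^esub> fa Fg (fa F \<phi>)"
    have aa: "a \<in> ary_endofunctors V J C j" "a' \<in> ary_endofunctors V J C j" using a a' by simp_all
    note X = FgO[OF a] and X' = FgO[OF a']
    note gfs = gf_simps[OF ary_functor[OF aa(1)]] gf_simps[OF ary_functor[OF aa(2)]]
      gf_simps[OF ary_functor[OF L[OF X]]] gf_simps[OF ary_functor[OF L[OF X']]]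
    have eqk: "up (\<phi> k) \<star>\<^bsub>C\<^esub> cmpt (\<epsilon> a) (vfo j k) = cmpt (\<epsilon> a') (vfo j k) \<star>\<^bsub>C\<^esub> cmpt (fa F \<phi>) (vfo j k)" if k: "k \<in> VOb J" for k
      using arg_cong[OF eq, of "\<lambda>f. up (f k)"] k by (simp only: sig_simps(2) Fg_arr(1))
    have p: "up (\<phi> k) \<in> GHom C (vfo a (vfo j k)) (vfo a' (vfo j k))" if "k \<in> VOb J" for k
      using \<phi> that by (simp add: sig_hom Fg_ob)
    \<comment> \<open>A homomorphism of algebras is natural in all arrows between arities. An
      identity is inserted as \<open>?E l \<star> e (fo Fg a) l\<close>; the counit slides past
      \<open>p\<close>, is exchanged for \<open>?E'\<close> and \<open>?F\<close> by the
      homomorphism equation, and these slide back until the triangle identity removes the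
      counit.\<close>
    have nat\<phi>: "up (\<phi> k) \<star>\<^bsub>C\<^esub> gf a p = gf a' p \<star>\<^bsub>C\<^esub> up (\<phi> l)"
      if k: "k \<in> VOb J" and l: "l \<in> VOb J" and pp: "p \<in> GHom C (vfo j l) (vfo j k)" for k l p
    proof -
      note ty = p[OF k] p[OF l] pp cmpt_hom[OF \<epsilon>[OF a] jo[OF k]] cmpt_hom[OF \<epsilon>[OF a] jo[OF l]]
        cmpt_hom[OF \<epsilon>[OF a'] jo[OF k]] cmpt_hom[OF \<epsilon>[OF a'] jo[OF l]] cmpt_hom[OF Fhom[OF \<phi>] jo[OF k]] cmpt_hom[OF Fhom[OF \<phi>] jo[OF l]]
        e(1)[OF X k] e(1)[OF X l] e(1)[OF X' k] e(1)[OF X' l]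
      let ?E = "\<lambda>k. cmpt (\<epsilon> a) (vfo j k)" and ?E' = "\<lambda>k. cmpt (\<epsilon> a') (vfo j k)" and ?F = "\<lambda>k. cmpt (fa F \<phi>) (vfo j k)"
      let ?L = "gf (L (fo Fg a)) p" and ?L' = "gf (L (fo Fg a')) p"
      have "up (\<phi> k) \<star>\<^bsub>C\<^esub> gf a p = up (\<phi> k) \<star>\<^bsub>C\<^esub> (gf a p \<star>\<^bsub>C\<^esub> (?E l \<star>\<^bsub>C\<^esub> e (fo Fg a) l))"
        using gid_right[OF C gf_hom[OF ary_functor[OF aa(1)] pp]] by (simp only: tri[OF a l])
      also have "\<dots> = up (\<phi> k) \<star>\<^bsub>C\<^esub> ((gf a p \<star>\<^bsub>C\<^esub> ?E l) \<star>\<^bsub>C\<^esub> e (fo Fg a) l)"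
        using ty k l by (simp add: arr gfs Fg_ob)
      also have "\<dots> = (up (\<phi> k) \<star>\<^bsub>C\<^esub> ?E k) \<star>\<^bsub>C\<^esub> (?L \<star>\<^bsub>C\<^esub> e (fo Fg a) l)"
        unfolding cmpt_nat[OF \<epsilon>[OF a] pp, symmetric] using ty k l by (simp add: arr gfs Fg_ob)
      also have "\<dots> = ?E' k \<star>\<^bsub>C\<^esub> ((?F k \<star>\<^bsub>C\<^esub> ?L) \<star>\<^bsub>C\<^esub> e (fo Fg a) l)"
        unfolding eqk[OF k] using ty k l by (simp add: arr gfs Fg_ob)
      also have "\<dots> = (?E' k \<star>\<^bsub>C\<^esub> ?L') \<star>\<^bsub>C\<^esub> (?F l \<star>\<^bsub>C\<^esub> e (fo Fg a) l)"
        unfolding cmpt_nat[OF Fhom[OF \<phi>] pp] using ty k l by (simp add: arr gfs Fg_ob)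
      also have "\<dots> = gf a' p \<star>\<^bsub>C\<^esub> ((?E' l \<star>\<^bsub>C\<^esub> e (fo Fg a') l) \<star>\<^bsub>C\<^esub> up (\<phi> l))"
        unfolding cmpt_nat[OF \<epsilon>[OF a'] pp] nat[OF \<phi> l] using ty k l by (simp add: arr gfs Fg_ob)
      also have "\<dots> = gf a' p \<star>\<^bsub>C\<^esub> up (\<phi> l)" unfolding tri[OF a' l] gid_left[OF C p[OF l]] ..
      finally show ?thesis .
    qed
    \<comment> \<open>Since \<open>a\<close> is the Kan extension of its restriction, the family
      just shown natural extends to a transformation.\<close>
    note P = ary_pointwise_lan[OF aa(1)]
    obtain \<beta> where \<beta>: "is_vnat_trans V C C a a' \<beta>" "\<beta> \<in> extensional (VOb C)"
      and \<beta>\<phi>: "\<And>k. k \<in> VOb J \<Longrightarrow> tr a \<beta> a' (vfo j k) \<star>\<^bsub>C\<^esub> gid C (vfo a (vfo j k)) = up (\<phi> k)"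
    proof -
      have "\<exists>\<beta>. is_vnat_trans V C C a a' \<beta> \<and> \<beta> \<in> extensional (VOb C) \<and> (\<forall>b\<in>VOb J. tr a \<beta> a' (vfo j b) \<star>\<^bsub>C\<^esub> gid C (vfo a (vfo j b)) = up (\<phi> b))"
      proof (rule pointwise_lan_extend[OF P ary_functor[OF aa(2)]])
        show "up (\<phi> b) \<in> GHom C (vfo (comp_vfun V a j) b) (vfo a' (vfo j b))" if "b \<in> VOb J" for b using p[OF that] by simp
        show "up (\<phi> b) \<star>\<^bsub>C\<^esub> gf (comp_vfun V a j) q = gf a' (gf j q) \<star>\<^bsub>C\<^esub> up (\<phi> b')" if q: "q \<in> GHom J b' b" for b b' q
          using nat\<phi>[OF GHom_ob(2)[OF q] GHom_ob(1)[OF q] gf_hom[OF j q]] gf_comp[OF j ary_functor[OF aa(1)] q] by simp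
      qed simp
      then show thesis using that by blast
    qed
    let ?g = "(a, \<beta>, a')"
    have g: "?g \<in> Hom En a a'" using aa \<beta> by (simp add: end_hom)
    have "fa Fg ?g = \<phi>"
    proof (rule sig_eqI[OF Fg_hom[OF g] \<phi>])
      fix k assume k: "k \<in> VOb J"
      show "up (fa Fg ?g k) = up (\<phi> k)"
        using \<beta>\<phi>[OF k] gid_right[OF C cmpt_hom[OF g jo[OF k]]] unfolding Fg_arr(1)[OF k] by (simp only: cmpt_simp)
    qed
    then show "\<exists>g\<in>Hom En a a'. fa Fg g = \<phi>" using g by blast
  next
    fix a a' g h assume g: "g \<in> Hom En a a'" and h: "h \<in> Hom En a a'" and eq: "fa Fg g = fa Fg h"
    obtain \<alpha> where g': "g = (a, \<alpha>, a')" and a: "a \<in> ary_endofunctors V J C j" and \<alpha>: "is_vnat_trans V C C a a' \<alpha>" "\<alpha> \<in> extensional (VOb C)"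
      using g by (auto simp: end_hom)
    obtain \<beta> where h': "h = (a, \<beta>, a')" and \<beta>: "is_vnat_trans V C C a a' \<beta>" "\<beta> \<in> extensional (VOb C)"
      using h by (auto simp: end_hom)
    have "\<alpha> c = \<beta> c" if c: "c \<in> VOb C" for c
    proof (rule pointwise_lan_extend_unique[OF ary_pointwise_lan[OF a] \<alpha>(1) \<beta>(1) _ c])
      fix k assume k: "k \<in> VOb J"
      have "cmpt g (vfo j k) = cmpt h (vfo j k)" using Fg_arr(1)[OF k, of g] Fg_arr(1)[OF k, of h] eq by simp
      then show "tr a \<alpha> a' (vfo j k) \<star>\<^bsub>C\<^esub> gid C (vfo a (vfo j k)) = tr a \<beta> a' (vfo j k) \<star>\<^bsub>C\<^esub> gid C (vfo a (vfo j k))"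
        by (simp only: g' h' cmpt_simp)
    qed
    then have "\<alpha> = \<beta>" using \<alpha>(2) \<beta>(2) by (blast intro: extensionalityI)
    then show "g = h" by (simp only: g' h')
  next
    fix X h assume X: "X \<in> Ob Sg" and "h \<in> Hom Sg (fo Fg (fo F X)) X" and unit: "h \<cdot>\<^bsub>Sg\<^esub> \<eta> X = Idt Sg X"
      and mult: "h \<cdot>\<^bsub>Sg\<^esub> fa Fg (\<epsilon> (fo F X)) = h \<cdot>\<^bsub>Sg\<^esub> fa Fg (fa F h)"
    then have h: "h \<in> Hom Sg (fo Fg (L X)) X" by (simp only: FL)
    note LX = L[OF X]
    have LXo: "L X \<in> Ob En" using LX by simp
    let ?TX = "fo Fg (L X)"
    note TX = FgO[OF LXo]
    note gfs = gf_simps[OF ary_functor[OF LX]] gf_simps[OF ary_functor[OF L[OF TX]]]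
    have hk: "up (h k) \<in> GHom C (vfo (L X) (vfo j k)) (X k)" if "k \<in> VOb J" for k
      using h that by (simp add: sig_hom Fg_ob)
    have unitk: "up (h k) \<star>\<^bsub>C\<^esub> e X k = gid C (X k)" if k: "k \<in> VOb J" for k
      using arg_cong[OF unit, of "\<lambda>f. up (f k)"] k by (simp only: sig_simps(2,3) up_\<eta>[OF X])
    have multk: "up (h k) \<star>\<^bsub>C\<^esub> cmpt (\<epsilon> (L X)) (vfo j k) = up (h k) \<star>\<^bsub>C\<^esub> cmpt (fa F h) (vfo j k)" if k: "k \<in> VOb J" for k
      using arg_cong[OF mult, of "\<lambda>f. up (f k)"] k by (simp only: sig_simps(2) Fg_arr(1) FL)
    \<comment> \<open>The algebra structure \<open>h\<close> is an action of \<open>J\<close> on the family \<open>X\<close>, which makes \<open>X\<close> a \<open>V\<close>-functor.\<close>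
    have act: "up (h k) \<star>\<^bsub>C\<^esub> (gf (L X) (p \<star>\<^bsub>C\<^esub> q) \<star>\<^bsub>C\<^esub> e X m) =
        (up (h k) \<star>\<^bsub>C\<^esub> (gf (L X) p \<star>\<^bsub>C\<^esub> e X l)) \<star>\<^bsub>C\<^esub> (up (h l) \<star>\<^bsub>C\<^esub> (gf (L X) q \<star>\<^bsub>C\<^esub> e X m))"
      if k: "k \<in> VOb J" and l: "l \<in> VOb J" and m: "m \<in> VOb J" and p: "p \<in> GHom C (vfo j l) (vfo j k)" and q: "q \<in> GHom C (vfo j m) (vfo j l)"
      for k l m p q
    proof -
      let ?E = "\<lambda>k. cmpt (\<epsilon> (L X)) (vfo j k)" and ?F = "\<lambda>k. cmpt (fa F h) (vfo j k)"
      let ?p = "gf (L X) p" and ?q = "gf (L X) q" and ?p' = "gf (L ?TX) p"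
      note ty = hk[OF k] hk[OF l] hk[OF m] p q cmpt_hom[OF \<epsilon>[OF LXo] jo[OF k]] cmpt_hom[OF \<epsilon>[OF LXo] jo[OF l]]
        cmpt_hom[OF Fhom[OF h] jo[OF k]] cmpt_hom[OF Fhom[OF h] jo[OF l]] e(1)[OF X k] e(1)[OF X l] e(1)[OF X m] e(1)[OF TX l]
      \<comment> \<open>Naturality of the adjunction unit turns
        \<open>e X l \<star> up (h l)\<close> into \<open>?F l \<star> e ?TX l\<close>. Then
        \<open>?F\<close> slides past \<open>p\<close> to meet \<open>up (h k)\<close>, where the
        multiplication law exchanges it for the counit \<open>?E\<close>; this slides back and
        cancels against \<open>e ?TX l\<close>.\<close>
      have "(up (h k) \<star>\<^bsub>C\<^esub> (?p \<star>\<^bsub>C\<^esub> e X l)) \<star>\<^bsub>C\<^esub> (up (h l) \<star>\<^bsub>C\<^esub> (?q \<star>\<^bsub>C\<^esub> e X m)) =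
         up (h k) \<star>\<^bsub>C\<^esub> (?p \<star>\<^bsub>C\<^esub> ((e X l \<star>\<^bsub>C\<^esub> up (h l)) \<star>\<^bsub>C\<^esub> (?q \<star>\<^bsub>C\<^esub> e X m)))"
        using ty k l m by (simp add: arr gfs Fg_ob)
      also have "\<dots> = up (h k) \<star>\<^bsub>C\<^esub> ((?p \<star>\<^bsub>C\<^esub> ?F l) \<star>\<^bsub>C\<^esub> (e ?TX l \<star>\<^bsub>C\<^esub> (?q \<star>\<^bsub>C\<^esub> e X m)))"
        unfolding nat[OF h l, symmetric] using ty k l m by (simp add: arr gfs Fg_ob)
      also have "\<dots> = (up (h k) \<star>\<^bsub>C\<^esub> ?F k) \<star>\<^bsub>C\<^esub> (?p' \<star>\<^bsub>C\<^esub> (e ?TX l \<star>\<^bsub>C\<^esub> (?q \<star>\<^bsub>C\<^esub> e X m)))"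
        unfolding cmpt_nat[OF Fhom[OF h] p, symmetric] using ty k l m by (simp add: arr gfs Fg_ob)
      also have "\<dots> = up (h k) \<star>\<^bsub>C\<^esub> ((?E k \<star>\<^bsub>C\<^esub> ?p') \<star>\<^bsub>C\<^esub> (e ?TX l \<star>\<^bsub>C\<^esub> (?q \<star>\<^bsub>C\<^esub> e X m)))"
        unfolding multk[OF k, symmetric] using ty k l m by (simp add: arr gfs Fg_ob)
      also have "\<dots> = up (h k) \<star>\<^bsub>C\<^esub> (?p \<star>\<^bsub>C\<^esub> ((?E l \<star>\<^bsub>C\<^esub> e ?TX l) \<star>\<^bsub>C\<^esub> (?q \<star>\<^bsub>C\<^esub> e X m)))"
        unfolding cmpt_nat[OF \<epsilon>[OF LXo] p] using ty k l m by (simp add: arr gfs Fg_ob)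
      also have "\<dots> = up (h k) \<star>\<^bsub>C\<^esub> (?p \<star>\<^bsub>C\<^esub> (?q \<star>\<^bsub>C\<^esub> e X m))"
        unfolding tri[OF LXo l] gid_left[OF C gcmp_hom[OF C e(1)[OF X m] gf_hom[OF ary_functor[OF LX] q]]] ..
      also have "\<dots> = up (h k) \<star>\<^bsub>C\<^esub> (gf (L X) (p \<star>\<^bsub>C\<^esub> q) \<star>\<^bsub>C\<^esub> e X m)"
        using ty k l m by (simp add: arr gfs Fg_ob)
      finally show ?thesis by simp
    qed
    \<comment> \<open>For \<open>q\<close> in \<open>J(l,k)\<close>, the arrow
      \<open>gf (L X) (gf j q) \<star> e X l\<close> is the coprojection of \<open>X l\<close> into
      the free endofunctor at \<open>j k\<close> that \<open>q\<close> indexes; followed by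
      \<open>h\<close> it is the action of \<open>q\<close>. The unit law of the algebra makes
      identities act as identities, and \<open>act\<close> takes care of composites.\<close>
    let ?d = "\<lambda>l k q. up (h k) \<star>\<^bsub>C\<^esub> (gf (L X) (gf j q) \<star>\<^bsub>C\<^esub> e X l)"
    let ?D = "mk_vfun J X ?d"
    have Xo: "X k \<in> VOb C" if "k \<in> VOb J" for k using X that by auto
    have oper_d: "oper J l k C (X l) (X k) [] [] (?d l k)" if "l \<in> VOb J" "k \<in> VOb J" for l k
      by (rule oper_post[OF C hk[OF that(2)] oper_pre[OF C e(1)[OF X that(1)] oper_comp[OF oper_gf[OF j] oper_gf[OF ary_functor[OF LX]]]]])
        (simp_all add: e(2)[OF X that(1)])
    have idt_d: "?d k k (gid J k) = gid C (X k)" if k: "k \<in> VOb J" for k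
      using unitk[OF k] gid_left[OF C e(1)[OF X k]]
      by (simp only: gf_idt[OF j k] gf_idt[OF ary_functor[OF LX] jo[OF k]])
    have cmp_d: "?d m k (p \<star>\<^bsub>J\<^esub> q) = ?d l k p \<star>\<^bsub>C\<^esub> ?d m l q" if q: "q \<in> GHom J m l" and p: "p \<in> GHom J l k" for m l k p q
      using act[OF GHom_ob(2)[OF p] GHom_ob(1)[OF p] GHom_ob(1)[OF q] gf_hom[OF j p] gf_hom[OF j q]]
      by (simp only: gf_cmp[OF j q p])
    have D: "is_vfunctor V J C ?D" by (rule mk_vfun(1)[OF J C]) (fact Xo oper_d idt_d cmp_d)+
    have Dgf: "gf ?D q = ?d l k q" if "q \<in> GHom J l k" for l k q
      by (rule mk_vfun(2)[OF J C _ _ _ _ that]) (fact Xo oper_d idt_d cmp_d)+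
    have Do: "vfo ?D k = X k" if "k \<in> VOb J" for k using that by (simp add: mk_vfun_def)
    \<comment> \<open>The endofunctor sought is the Kan extension of the \<open>V\<close>-functor
      just built. As \<open>j\<close> is fully faithful, its unit \<open>\<theta>\<close> is
      invertible and identifies \<open>X\<close> with the signature of \<open>H\<close>.\<close>
    obtain H \<theta> where P: "pointwise_lan J C j ?D H \<theta>" and H: "H \<in> ary_endofunctors V J C j" using lan_ex[OF D] by blast
    have Ho: "H \<in> Ob En" using H by simp
    note HX = FgO[OF Ho]
    have \<theta>: "\<theta> k \<in> GHom C (X k) (vfo H (vfo j k))" "grd (\<theta> k) = []" if "k \<in> VOb J" for k
      using pointwise_lanD(4,5)[OF P that] Do[OF that] by simp_all
    have "\<exists>v. v \<in> GHom C (vfo H (vfo j k)) (X k) \<and> grd v = [] \<and> v \<star>\<^bsub>C\<^esub> \<theta> k = gid C (X k) \<and> \<theta> k \<star>\<^bsub>C\<^esub> v = gid C (vfo H (vfo j k))"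
      if "k \<in> VOb J" for k
      using pointwise_lan_ff_iso[OF P ff that] unfolding Do[OF that] .
    then obtain v where v: "\<And>k. k \<in> VOb J \<Longrightarrow> v k \<in> GHom C (vfo H (vfo j k)) (X k)" "\<And>k. k \<in> VOb J \<Longrightarrow> grd (v k) = []"
      and v\<theta>: "\<And>k. k \<in> VOb J \<Longrightarrow> v k \<star>\<^bsub>C\<^esub> \<theta> k = gid C (X k)" and \<theta>v: "\<And>k. k \<in> VOb J \<Longrightarrow> \<theta> k \<star>\<^bsub>C\<^esub> v k = gid C (vfo H (vfo j k))"
      by metis
    define \<phi> \<psi> where "\<phi> = (\<lambda>k\<in>VOb J. down (\<theta> k))" and "\<psi> = (\<lambda>k\<in>VOb J. down (v k))"
    note defs = this
    have up\<phi>: "up (\<phi> k) = \<theta> k" and up\<psi>: "up (\<psi> k) = v k" if "k \<in> VOb J" for k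
      using that \<theta>(2) v(2) by (simp_all add: up_down defs)
    have Xe: "X \<in> extensional (VOb J)" using X by (simp add: PiE_iff)
    have ext: "\<phi> \<in> extensional (VOb J)" "\<psi> \<in> extensional (VOb J)" by (simp_all add: defs)
    have \<phi>: "\<phi> \<in> Hom Sg X (fo Fg H)"
      unfolding sig_hom by (intro conjI ballI ext Xe Fg_ob(2)) (simp only: up\<phi> Fg_ob(1) \<theta>(1))
    have \<psi>: "\<psi> \<in> Hom Sg (fo Fg H) X"
      unfolding sig_hom by (intro conjI ballI ext Xe Fg_ob(2)) (simp only: up\<psi> Fg_ob(1) v(1))
    have iso: "is_iso Sg \<phi>"
    proof (rule S.is_isoI[OF \<phi> \<psi>])
      show "\<psi> \<cdot>\<^bsub>Sg\<^esub> \<phi> = Idt Sg X"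
        by (rule sig_eqI[OF S.cmp_hom[OF \<phi> \<psi>] S.idt_hom[OF X]]) (simp only: sig_simps(2,3) up\<phi> up\<psi> v\<theta>)
      show "\<phi> \<cdot>\<^bsub>Sg\<^esub> \<psi> = Idt Sg (fo Fg H)"
        by (rule sig_eqI[OF S.cmp_hom[OF \<psi> \<phi>] S.idt_hom[OF HX]]) (simp only: sig_simps(2,3) up\<phi> up\<psi> \<theta>v Fg_ob(1))
    qed
    note gfh = gf_simps[OF ary_functor[OF H]] gf_simps[OF ary_functor[OF L[OF HX]]]
    have "\<phi> \<cdot>\<^bsub>Sg\<^esub> h = fa Fg (\<epsilon> H) \<cdot>\<^bsub>Sg\<^esub> fa Fg (fa F \<phi>)"
    proof (rule sig_eqI[OF S.cmp_hom[OF h \<phi>] S.cmp_hom[OF Fg_hom[OF Fhom[OF \<phi>]] Fg_hom[OF \<epsilon>[OF Ho]]]])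
      fix k assume k: "k \<in> VOb J"
      let ?E = "\<lambda>k. cmpt (\<epsilon> H) (vfo j k)" and ?F = "\<lambda>k. cmpt (fa F \<phi>) (vfo j k)"
      \<comment> \<open>A comparison of two single arrows out of the value of \<open>L X\<close> at
        \<open>j k\<close>, with no naturality in \<open>k\<close> available for \<open>h\<close>;
        the pointwise clause of freeness reduces it to the coprojections.\<close>
      have "\<theta> k \<star>\<^bsub>C\<^esub> up (h k) = ?E k \<star>\<^bsub>C\<^esub> ?F k"
      proof (rule free_sep[OF X gcmp_hom[OF C hk[OF k] \<theta>(1)[OF k]]
          gcmp_hom[OF C cmpt_hom[OF Fhom[OF \<phi>] jo[OF k]] cmpt_hom[OF \<epsilon>[OF Ho] jo[OF k]]] jo[OF k]])
        show "grd (\<theta> k \<star>\<^bsub>C\<^esub> up (h k)) = grd (?E k \<star>\<^bsub>C\<^esub> ?F k)"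
          by (simp only: grd_cmp grd_up grd_cmpt \<theta>(2)[OF k] append_Nil)
        fix l p assume l: "l \<in> VOb J" and p: "p \<in> GHom C (vfo j l) (vfo j k)"
        obtain g where g: "\<And>k l. k \<in> VOb J \<Longrightarrow> l \<in> VOb J \<Longrightarrow> oper C (vfo j k) (vfo j l) J k l [] [] (g k l)"
          and jg: "\<And>k l p. k \<in> VOb J \<Longrightarrow> l \<in> VOb J \<Longrightarrow> p \<in> GHom C (vfo j k) (vfo j l) \<Longrightarrow> gf j (g k l p) = p"
          and "\<And>k l p. p \<in> GHom J k l \<Longrightarrow> g k l (gf j p) = p"
          using ff_inverse[OF j ff] by blast
        \<comment> \<open>The functor \<open>?D\<close> acts on elements of \<open>J\<close>, so
          \<open>p\<close> is first pulled back along the fully faithful \<open>j\<close>.\<close>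
        define q where "q = g l k p"
        have q: "q \<in> GHom J l k" unfolding q_def by (rule operD(3)[OF g[OF l k] p])
        have pq: "p = gf j q" unfolding q_def by (rule jg[OF l k p, symmetric])
        note ty = hk[OF k] p \<theta>(1)[OF k] \<theta>(1)[OF l] cmpt_hom[OF \<epsilon>[OF Ho] jo[OF k]] cmpt_hom[OF \<epsilon>[OF Ho] jo[OF l]]
          cmpt_hom[OF Fhom[OF \<phi>] jo[OF k]] cmpt_hom[OF Fhom[OF \<phi>] jo[OF l]] e(1)[OF X l] e(1)[OF HX l]
        have "(\<theta> k \<star>\<^bsub>C\<^esub> up (h k)) \<star>\<^bsub>C\<^esub> (gf (L X) p \<star>\<^bsub>C\<^esub> e X l) = \<theta> k \<star>\<^bsub>C\<^esub> gf ?D q"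
          unfolding Dgf[OF q] pq[symmetric] using ty k l by (simp add: arr gfs gfh Fg_ob)
        also have "\<dots> = gf H p \<star>\<^bsub>C\<^esub> \<theta> l" using pointwise_lan_nat[OF P q] pq by simp
        finally have 1: "(\<theta> k \<star>\<^bsub>C\<^esub> up (h k)) \<star>\<^bsub>C\<^esub> (gf (L X) p \<star>\<^bsub>C\<^esub> e X l) = gf H p \<star>\<^bsub>C\<^esub> \<theta> l" .
        let ?p' = "gf (L (fo Fg H)) p"
        have "(?E k \<star>\<^bsub>C\<^esub> ?F k) \<star>\<^bsub>C\<^esub> (gf (L X) p \<star>\<^bsub>C\<^esub> e X l) = ?E k \<star>\<^bsub>C\<^esub> ((?F k \<star>\<^bsub>C\<^esub> gf (L X) p) \<star>\<^bsub>C\<^esub> e X l)"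
          using ty k l by (simp add: arr gfs gfh Fg_ob)
        also have "\<dots> = (?E k \<star>\<^bsub>C\<^esub> ?p') \<star>\<^bsub>C\<^esub> (?F l \<star>\<^bsub>C\<^esub> e X l)"
          unfolding cmpt_nat[OF Fhom[OF \<phi>] p] using ty k l by (simp add: arr gfs gfh Fg_ob)
        also have "\<dots> = gf H p \<star>\<^bsub>C\<^esub> ((?E l \<star>\<^bsub>C\<^esub> e (fo Fg H) l) \<star>\<^bsub>C\<^esub> \<theta> l)"
          unfolding cmpt_nat[OF \<epsilon>[OF Ho] p] nat[OF \<phi> l] up\<phi>[OF l] using ty k l by (simp add: arr gfs gfh Fg_ob)
        also have "\<dots> = gf H p \<star>\<^bsub>C\<^esub> \<theta> l" unfolding tri[OF Ho l] gid_left[OF C \<theta>(1)[OF l]] ..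
        finally show "(\<theta> k \<star>\<^bsub>C\<^esub> up (h k)) \<star>\<^bsub>C\<^esub> (gf (L X) p \<star>\<^bsub>C\<^esub> e X l) = (?E k \<star>\<^bsub>C\<^esub> ?F k) \<star>\<^bsub>C\<^esub> (gf (L X) p \<star>\<^bsub>C\<^esub> e X l)"
          using 1 by simp
      qed
      then show "up ((\<phi> \<cdot>\<^bsub>Sg\<^esub> h) k) = up ((fa Fg (\<epsilon> H) \<cdot>\<^bsub>Sg\<^esub> fa Fg (fa F \<phi>)) k)"
        using k by (simp only: sig_simps(2) Fg_arr(1) up\<phi>)
    qed
    then show "\<exists>a\<in>Ob En. \<exists>f\<in>Hom Sg X (fo Fg a). is_iso Sg f \<and> f \<cdot>\<^bsub>Sg\<^esub> h = fa Fg (\<epsilon> a) \<cdot>\<^bsub>Sg\<^esub> fa Fg (fa F f)"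
      using Ho \<phi> iso by blast
  qed
qed

end

theorem proposition7p7:
  fixes U :: "'u set"
    and V :: "('o, 'm) smcc"
    and C :: "('c, 'o, 'm) vcat"
    and J :: "('j, 'o, 'm) vcat"
    and j :: "('j, 'c, 'm) vfun"
  assumes "universe U"
    and "symmetric_monoidal_closed V"
    and "locally_small U V"
    and "has_small_limits U V"
    and "has_small_colimits U V"
    and "vcategory V C"
    and "cocomplete U V C"
    and "subcategory_of_arities V J C j"
    and "small U (VOb J)"
    and "eleutheric V J C j"
  shows "is_monadic (end_cat V J C j) (sig_cat V J C) (forgetful J j)"
proof -
  have "infinite U" using assms(1) by (simp add: universe_def)
  then interpret eleutheric_arities V U C J j
    using assms by (intro eleutheric_arities.intro eleutheric_arities_axioms.intro)
  show ?thesis by (rule monadic_forgetful)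
qed

end
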